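(* Let $T>0$, let $b:[0,T]\times\mathbb{R}^d\to\mathbb{R}^d$ be measurable, and suppose there are nonnegative $C_0,C_1\in L^1([0,T])$ such that for all $t\in[0,T]$ and $x,y\in\mathbb{R}^d$, $|b(t,x)|\le C_0(t)(1+|x|)$ and $(b(t,x)-b(t,y))\cdot(x-y)\ge -C_1(t)|x-y|^2$. Let $\alpha,\beta\in(0,1]$ satisfy $\alpha+\beta>1$, and suppose $\sup_{t\in[0,T]}[b(t,\cdot)]_{C^\alpha}<\infty$. Let $u$ be a (continuous) distributional solution of $$-\partial_tu+b(t,x)\cdot\nabla u=0\quad\text{in }(0,T)\times\mathbb{R}^d$$ with terminal value $u_T=u(T,\cdot)$ such that $\sup_{t\in[0,T]}[u(t,\cdot)]_{C^\beta}<\infty$. Then $u$ is the unique viscosity solution of this equation (among those of at most linear growth in $x$, uniformly in $t$) with terminal value $u_T$.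
   Context: $[\cdot]_{C^\gamma}$ denotes the $\gamma$-Hölder seminorm on $\mathbb{R}^d$ (Lipschitz seminorm for $\gamma=1$). Distributional solution: $u\in C([0,T]\times\mathbb{R}^d)$, with $b\cdot\nabla u$ understood as the distribution $\operatorname{div}(bu)-(\operatorname{div}b)u$ ($\operatorname{div}b$ is a locally finite signed measure). For $(t,x,p)$ set $\underline b(t,x,p)=\liminf_{z\to x}b(t,z)\cdot p$ and $\overline b(t,x,p)=\limsup_{z\to x}b(t,z)\cdot p$. Definition. An upper semicontinuous function $u:[0,T]\times\mathbb{R}^d\to\mathbb{R}$ is a viscosity subsolution if, for every $\psi:[0,T]\times\mathbb{R}^d\to\mathbb{R}$ that is $C^1$ in $t$ and $C^2$ in $x$ (and such that $u(t,x)-\psi(t,x)\to-\infty$ as $|x|\to\infty$ uniformly in $t$), $$-\frac{d}{dt}\max_{x}\{u(t,x)-\psi(t,x)\}\le\inf\Big\{\partial_t\psi(t,y)-\underline b(t,y,\nabla\psi(t,y)):\ y\in\arg\max\{u(t,\cdot)-\psi(t,\cdot)\}\Big\}.$$ A lower semicontinuous function $v$ is a viscosity supersolution if, for every such $\psi$ (now with $v(t,x)-\psi(t,x)\to+\infty$ as $|x|\to\infty$ uniformly in $t$), $$-\frac{d}{dt}\min_{x}\{v(t,x)-\psi(t,x)\}\ge\sup\Big\{\partial_t\psi(t,y)-\overline b(t,y,\nabla\psi(t,y)):\ y\in\arg\min\{v(t,\cdot)-\psi(t,\cdot)\}\Big\}.$$ These inequalities are understood in integrated form: with $M(t)$ the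 max (resp. min) and $R(t)$ the right-hand side, $M(t_1)-M(t_2)\le\int_{t_1}^{t_2}R(t)\,dt$ (resp. $\ge$) for all $0\le t_1<t_2\le T$. A continuous function that is both is a viscosity solution. *)

theory Defs
  imports "HOL-Analysis.Analysis"
begin

text \<open>
  Time-dependent scalar and vector fields on \<open>[0,T] \<times> \<real>\<^sup>d\<close> are curried functions \<open>real \<Rightarrow> 'a \<Rightarrow> _\<close> with
  \<open>'a :: euclidean_space\<close>; their values at times outside \<open>[0,T]\<close> are never used.
\<close>

definition holder_seminorm :: "real \<Rightarrow> ('a::real_normed_vector \<Rightarrow> 'b::real_normed_vector) \<Rightarrow> ereal" where
  "holder_seminorm \<gamma> f =
     (SUP (x, y) \<in> {(x, y). x \<noteq> y}. ereal (norm (f x - f y) / norm (x - y) powr \<gamma>))"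


subsection \<open>Distributional solutions\<close>

definition grad :: "('a::real_inner \<Rightarrow> real) \<Rightarrow> 'a \<Rightarrow> 'a" where
  "grad f x = (THE D. GDERIV f x :> D)"

primrec continuously_differentiable :: "nat \<Rightarrow> ('a::euclidean_space \<Rightarrow> real) \<Rightarrow> bool" where
  "continuously_differentiable 0 f \<longleftrightarrow> continuous_on UNIV f"
| "continuously_differentiable (Suc k) f \<longleftrightarrow>
     (\<forall>x. f differentiable (at x)) \<and>
     (\<forall>i\<in>Basis. continuously_differentiable k (\<lambda>x. frechet_derivative f (at x) i))"

text \<open>\<open>C\<^sub>c\<^sup>\<infinity>((0,T) \<times> \<real>\<^sup>d)\<close>, its members being extended by zero to \<open>\<real> \<times> \<real>\<^sup>d\<close>.\<close>

definition test_function :: "real \<Rightarrow> (real \<times> 'a::euclidean_space \<Rightarrow> real) \<Rightarrow> bool" where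
  "test_function T \<phi> \<longleftrightarrow>
     (\<forall>k. continuously_differentiable k \<phi>) \<and>
     compact (closure {z. \<phi> z \<noteq> 0}) \<and> closure {z. \<phi> z \<noteq> 0} \<subseteq> {0<..<T} \<times> UNIV"

text \<open>
  The spatial divergence of \<open>b\<close>, as a distribution on \<open>(0,T) \<times> \<real>\<^sup>d\<close>, is the locally finite signed
  measure \<open>\<mu> - \<nu>\<close>. A locally finite signed measure need not be a set function on all Borel sets, so
  it is represented by a pair of nonnegative locally finite measures. The spatial part of the
  gradient on \<open>\<real> \<times> \<real>\<^sup>d\<close> is its second component.
\<close>

definition has_divergence_measure ::
  "real \<Rightarrow> (real \<Rightarrow> 'a \<Rightarrow> 'a::euclidean_space) \<Rightarrow> (real \<times> 'a) measure \<Rightarrow> (real \<times> 'a) measure \<Rightarrow> bool" where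
  "has_divergence_measure T b \<mu> \<nu> \<longleftrightarrow>
     sets \<mu> = sets borel \<and> sets \<nu> = sets borel \<and>
     (\<forall>K. compact K \<and> K \<subseteq> {0<..<T} \<times> UNIV \<longrightarrow> emeasure \<mu> K < \<infinity> \<and> emeasure \<nu> K < \<infinity>) \<and>
     (\<forall>\<phi>. test_function T \<phi> \<longrightarrow>
        - (LINT z:{0<..<T} \<times> UNIV|lebesgue. b (fst z) (snd z) \<bullet> snd (grad \<phi> z)) =
        (LINT z:{0<..<T} \<times> UNIV|\<mu>. \<phi> z) - (LINT z:{0<..<T} \<times> UNIV|\<nu>. \<phi> z))"

text \<open>
  \<open>- \<partial>\<^sub>t u + b \<cdot> \<nabla>u = 0\<close> with \<open>b \<cdot> \<nabla>u = div (b u) - (div b) u\<close>, tested against \<open>\<phi>\<close>: the three terms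
  below are those of \<open>- \<partial>\<^sub>t u\<close>, \<open>div (b u)\<close> and \<open>- (div b) u\<close>.
\<close>

definition distributional_solution ::
  "real \<Rightarrow> (real \<Rightarrow> 'a \<Rightarrow> 'a::euclidean_space) \<Rightarrow> (real \<Rightarrow> 'a \<Rightarrow> real) \<Rightarrow> bool" where
  "distributional_solution T b u \<longleftrightarrow>
     continuous_on ({0..T} \<times> UNIV) (\<lambda>(t, x). u t x) \<and>
     (\<exists>\<mu> \<nu>. has_divergence_measure T b \<mu> \<nu> \<and>
       (\<forall>\<phi>. test_function T \<phi> \<longrightarrow>
          (LINT z:{0<..<T} \<times> UNIV|lebesgue. u (fst z) (snd z) * fst (grad \<phi> z))
          - (LINT z:{0<..<T} \<times> UNIV|lebesgue.
               u (fst z) (snd z) * (b (fst z) (snd z) \<bullet> snd (grad \<phi> z)))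
          - ((LINT z:{0<..<T} \<times> UNIV|\<mu>. u (fst z) (snd z) * \<phi> z)
             - (LINT z:{0<..<T} \<times> UNIV|\<nu>. u (fst z) (snd z) * \<phi> z)) = 0))"


subsection \<open>Viscosity solutions\<close>

definition usc_on :: "'a::topological_space set \<Rightarrow> ('a \<Rightarrow> real) \<Rightarrow> bool" where
  "usc_on S f \<longleftrightarrow> (\<forall>z\<in>S. \<forall>c. f z < c \<longrightarrow> (\<forall>\<^sub>F w in at z within S. f w < c))"

definition lsc_on :: "'a::topological_space set \<Rightarrow> ('a \<Rightarrow> real) \<Rightarrow> bool" where
  "lsc_on S f \<longleftrightarrow> (\<forall>z\<in>S. \<forall>c. c < f z \<longrightarrow> (\<forall>\<^sub>F w in at z within S. c < f w))"

text \<open>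
  Semicontinuous envelopes: as usual for these, the value at \<open>x\<close> itself takes part in the limit,
  hence \<open>nhds x\<close> and not \<open>at x\<close>.
\<close>

definition lower_b :: "(real \<Rightarrow> 'a \<Rightarrow> 'a::euclidean_space) \<Rightarrow> real \<Rightarrow> 'a \<Rightarrow> 'a \<Rightarrow> ereal" where
  "lower_b b t x p = Liminf (nhds x) (\<lambda>z. ereal (b t z \<bullet> p))"

definition upper_b :: "(real \<Rightarrow> 'a \<Rightarrow> 'a::euclidean_space) \<Rightarrow> real \<Rightarrow> 'a \<Rightarrow> 'a \<Rightarrow> ereal" where
  "upper_b b t x p = Limsup (nhds x) (\<lambda>z. ereal (b t z \<bullet> p))"

text \<open>
  \<open>\<psi>\<close> is \<open>C\<^sup>1\<close> in \<open>t\<close> and \<open>C\<^sup>2\<close> in \<open>x\<close> on \<open>[0,T] \<times> \<real>\<^sup>d\<close>, i.e. \<open>\<psi>\<close> and the derivatives \<open>\<partial>\<^sub>t \<psi> = \<psi>t\<close>,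
  \<open>\<nabla>\<psi> = D\<psi>\<close>, \<open>D\<^sup>2\<psi>\<close> are jointly continuous; \<open>\<partial>\<^sub>t\<close> is one-sided at \<open>t = 0\<close> and \<open>t = T\<close>.
\<close>

definition C12 ::
  "real \<Rightarrow> (real \<Rightarrow> 'a::euclidean_space \<Rightarrow> real) \<Rightarrow> (real \<Rightarrow> 'a \<Rightarrow> real) \<Rightarrow> (real \<Rightarrow> 'a \<Rightarrow> 'a) \<Rightarrow> bool" where
  "C12 T \<psi> \<psi>t D\<psi> \<longleftrightarrow>
     (\<exists>D2\<psi> :: real \<Rightarrow> 'a \<Rightarrow> 'a \<Rightarrow>\<^sub>L 'a.
       (\<forall>t\<in>{0..T}. \<forall>x.
          ((\<lambda>s. \<psi> s x) has_real_derivative \<psi>t t x) (at t within {0..T}) \<and>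
          GDERIV (\<psi> t) x :> D\<psi> t x \<and>
          (D\<psi> t has_derivative blinfun_apply (D2\<psi> t x)) (at x)) \<and>
       continuous_on ({0..T} \<times> UNIV) (\<lambda>(t, x). \<psi> t x) \<and>
       continuous_on ({0..T} \<times> UNIV) (\<lambda>(t, x). \<psi>t t x) \<and>
       continuous_on ({0..T} \<times> UNIV) (\<lambda>(t, x). D\<psi> t x) \<and>
       continuous_on ({0..T} \<times> UNIV) (\<lambda>(t, x). D2\<psi> t x))"

definition tends_to_minus_infinity :: "real \<Rightarrow> (real \<Rightarrow> 'a::euclidean_space \<Rightarrow> real) \<Rightarrow> bool" where
  "tends_to_minus_infinity T w \<longleftrightarrow> (\<forall>K. \<forall>\<^sub>F x in at_infinity. \<forall>t\<in>{0..T}. w t x \<le> K)"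

definition tends_to_plus_infinity :: "real \<Rightarrow> (real \<Rightarrow> 'a::euclidean_space \<Rightarrow> real) \<Rightarrow> bool" where
  "tends_to_plus_infinity T w \<longleftrightarrow> (\<forall>K. \<forall>\<^sub>F x in at_infinity. \<forall>t\<in>{0..T}. K \<le> w t x)"

definition sub_rhs ::
  "(real \<Rightarrow> 'a \<Rightarrow> 'a::euclidean_space) \<Rightarrow> (real \<Rightarrow> 'a \<Rightarrow> real) \<Rightarrow> (real \<Rightarrow> 'a \<Rightarrow> real) \<Rightarrow>
   (real \<Rightarrow> 'a \<Rightarrow> real) \<Rightarrow> (real \<Rightarrow> 'a \<Rightarrow> 'a) \<Rightarrow> real \<Rightarrow> ereal" where
  "sub_rhs b u \<psi> \<psi>t D\<psi> t =
     (INF y \<in> {y. is_arg_max (\<lambda>x. u t x - \<psi> t x) (\<lambda>_. True) y}.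
        ereal (\<psi>t t y) - lower_b b t y (D\<psi> t y))"

definition super_rhs ::
  "(real \<Rightarrow> 'a \<Rightarrow> 'a::euclidean_space) \<Rightarrow> (real \<Rightarrow> 'a \<Rightarrow> real) \<Rightarrow> (real \<Rightarrow> 'a \<Rightarrow> real) \<Rightarrow>
   (real \<Rightarrow> 'a \<Rightarrow> real) \<Rightarrow> (real \<Rightarrow> 'a \<Rightarrow> 'a) \<Rightarrow> real \<Rightarrow> ereal" where
  "super_rhs b v \<psi> \<psi>t D\<psi> t =
     (SUP y \<in> {y. is_arg_min (\<lambda>x. v t x - \<psi> t x) (\<lambda>_. True) y}.
        ereal (\<psi>t t y) - upper_b b t y (D\<psi> t y))"

text \<open>
  The right-hand sides are extended-real valued a priori. Their time integrals are meant as genuine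
  Lebesgue integrals, so integrability is asked for, rather than relying on the value 0 which the
  library gives to the integral of a non-integrable function.
\<close>

definition ereal_integrable_on :: "(real \<Rightarrow> ereal) \<Rightarrow> real set \<Rightarrow> bool" where
  "ereal_integrable_on R S \<longleftrightarrow>
     (AE t in lebesgue_on S. \<bar>R t\<bar> \<noteq> \<infinity>) \<and> (\<lambda>t. real_of_ereal (R t)) absolutely_integrable_on S"

text \<open>
  Under semicontinuity and the growth condition on \<open>u - \<psi>\<close> (resp. \<open>v - \<psi>\<close>) the supremum
  (resp. infimum) over \<open>x\<close> is attained, i.e. it is the maximum (resp. minimum).
\<close>

definition viscosity_subsolution ::
  "real \<Rightarrow> (real \<Rightarrow> 'a \<Rightarrow> 'a::euclidean_space) \<Rightarrow> (real \<Rightarrow> 'a \<Rightarrow> real) \<Rightarrow> bool" where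
  "viscosity_subsolution T b u \<longleftrightarrow>
     usc_on ({0..T} \<times> UNIV) (\<lambda>(t, x). u t x) \<and>
     (\<forall>\<psi> \<psi>t D\<psi>.
        C12 T \<psi> \<psi>t D\<psi> \<and> tends_to_minus_infinity T (\<lambda>t x. u t x - \<psi> t x) \<longrightarrow>
        ereal_integrable_on (sub_rhs b u \<psi> \<psi>t D\<psi>) {0..T} \<and>
        (\<forall>t1 t2. 0 \<le> t1 \<and> t1 < t2 \<and> t2 \<le> T \<longrightarrow>
           (SUP x. u t1 x - \<psi> t1 x) - (SUP x. u t2 x - \<psi> t2 x)
           \<le> (LINT t:{t1..t2}|lebesgue. real_of_ereal (sub_rhs b u \<psi> \<psi>t D\<psi> t))))"

definition viscosity_supersolution ::
  "real \<Rightarrow> (real \<Rightarrow> 'a \<Rightarrow> 'a::euclidean_space) \<Rightarrow> (real \<Rightarrow> 'a \<Rightarrow> real) \<Rightarrow> bool" where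
  "viscosity_supersolution T b v \<longleftrightarrow>
     lsc_on ({0..T} \<times> UNIV) (\<lambda>(t, x). v t x) \<and>
     (\<forall>\<psi> \<psi>t D\<psi>.
        C12 T \<psi> \<psi>t D\<psi> \<and> tends_to_plus_infinity T (\<lambda>t x. v t x - \<psi> t x) \<longrightarrow>
        ereal_integrable_on (super_rhs b v \<psi> \<psi>t D\<psi>) {0..T} \<and>
        (\<forall>t1 t2. 0 \<le> t1 \<and> t1 < t2 \<and> t2 \<le> T \<longrightarrow>
           (INF x. v t1 x - \<psi> t1 x) - (INF x. v t2 x - \<psi> t2 x)
           \<ge> (LINT t:{t1..t2}|lebesgue. real_of_ereal (super_rhs b v \<psi> \<psi>t D\<psi> t))))"

definition viscosity_solution ::
  "real \<Rightarrow> (real \<Rightarrow> 'a \<Rightarrow> 'a::euclidean_space) \<Rightarrow> (real \<Rightarrow> 'a \<Rightarrow> real) \<Rightarrow> bool" where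
  "viscosity_solution T b u \<longleftrightarrow>
     continuous_on ({0..T} \<times> UNIV) (\<lambda>(t, x). u t x) \<and>
     viscosity_subsolution T b u \<and> viscosity_supersolution T b u"

definition linear_growth :: "real \<Rightarrow> (real \<Rightarrow> 'a::euclidean_space \<Rightarrow> real) \<Rightarrow> bool" where
  "linear_growth T u \<longleftrightarrow> (\<exists>C. \<forall>t\<in>{0..T}. \<forall>x. \<bar>u t x\<bar> \<le> C * (1 + norm x))"

end

theory Submission
  imports Defs
begin

text \<open>
  Let \<open>X\<close> be a curve with \<open>X' = - b(t, X)\<close>. Testing the distributional equation with a bump of radius
  \<open>\<epsilon>\<close> that moves along \<open>X\<close>, and using \<open>u = u(t, X) + O(\<epsilon>\<^sup>\<beta>)\<close> and \<open>b = - X' + O(\<epsilon>\<^sup>\<alpha>)\<close> on its support, one finds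
  that the variation of \<open>u\<close> along \<open>X\<close> is \<open>O(\<epsilon>\<^sup>\<alpha>\<^sup>+\<^sup>\<beta>\<^sup>-\<^sup>1 + \<epsilon>\<^sup>\<beta>)\<close>; the term with \<open>div b\<close> is harmless because
  \<open>div b + d C\<^sub>1 \<ge> 0\<close>. Hence \<open>u\<close> is constant along characteristics. It suffices to use polynomial curves for
  which \<open>X' + b(t, X)\<close> is small in \<open>L\<^sup>1\<close>.

  Let \<open>M(t) = max (u(t, \<cdot>) - \<psi>(t, \<cdot>))\<close>. If it is attained at \<open>y\<close> for \<open>t = s\<close>, comparing with the point to
  which the flow carries \<open>y\<close> at time \<open>s + \<delta>\<close> bounds \<open>M(s) - M(s + \<delta>)\<close> from above; averaging over \<open>s\<close> and
  letting \<open>\<delta> \<rightarrow> 0\<close> gives the integrated subsolution inequality, and the same argument for \<open>- u\<close> gives the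
  supersolution inequality.

  Conversely, test a subsolution \<open>v\<close> of linear growth with \<open>f(t) |z - X(t)|\<^sup>2\<close>, where \<open>f\<close> is a large multiple of
  a smooth approximation of \<open>exp(- 2 \<integral> C\<^sub>1)\<close>. By the one-sided Lipschitz condition the right-hand side is then
  essentially nonpositive, so \<open>v(s, X(s)) \<le> v(T, X(T))\<close> up to small errors. The same for \<open>- v\<close> shows that \<open>v\<close>
  is determined by its terminal value.
\<close>

subsection \<open>Smooth functions\<close>

text \<open>\<open>div b\<close> is only a measure and \<open>u\<close> only continuous, so
  \<open>u\<close> times a bump is not a test function: the one available control of
  \<open>(div b) u\<close> is positivity, which passes from smooth to continuous integrands by
  density. Each bump costs a factor 1/\<epsilon> per derivative, so the defect of the curve has to
  be small compared with a power of \<epsilon> and is chosen after \<epsilon>. The bump must be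
  smooth in time too, whereas a characteristic of a field that is merely integrable in time is not;
  polynomial curves arise from an Euler scheme whose velocity is approximated in L^1. The quadratic
  test function in the comparison argument is smoothed in the same way. For the subsolution
  inequality the difficulty is that the maximizer moves with the time s, while short time averages
  of \<open>b\<close> converge in L^1 only at fixed points of space. A finite net in the ball
  containing all maximizers reconciles the two, at the price of the Hoelder oscillation of
  \<open>b\<close>. All this is carried out for Borel data defined at all times; the given Lebesgue
  measurable data differ from such data by a null set of times, which the integrated inequalities do
  not see.\<close>

lemma continuously_differentiable_SucI:
  assumes "\<And>x. (f has_derivative f' x) (at x)"
    and "\<And>i. i \<in> Basis \<Longrightarrow> continuously_differentiable k (\<lambda>x. f' x i)"
  shows "continuously_differentiable (Suc k) f"
proof -
  have "frechet_derivative f (at x) = f' x" for x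
    using frechet_derivative_at[OF assms(1)] by simp
  then show ?thesis
    using assms by (auto simp: differentiable_def)
qed

lemma continuously_differentiable_SucE:
  assumes "continuously_differentiable (Suc k) f"
  shows "(f has_derivative frechet_derivative f (at x)) (at x)"
    and "i \<in> Basis \<Longrightarrow> continuously_differentiable k (\<lambda>x. frechet_derivative f (at x) i)"
  using assms by (auto simp: frechet_derivative_works)

text \<open>Serves the product and chain rules, where the factor left undifferentiated is needed at
  order \<open>k\<close> but is assumed at order \<open>Suc k\<close>.\<close>

lemma continuously_differentiable_lower:
  "continuously_differentiable (Suc k) f \<Longrightarrow> continuously_differentiable k f"
proof (induction k arbitrary: f)
  case 0
  then show ?case
    by (auto simp: continuous_on_eq_continuous_at intro!: differentiable_imp_continuous_within)
next
  case (Suc k)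
  from Suc(2) show ?case
    unfolding continuously_differentiable.simps(2)[of "Suc k"] continuously_differentiable.simps(2)[of k f]
    using Suc(1) by blast
qed

lemma continuously_differentiable_const: "continuously_differentiable k (\<lambda>x. c)"
proof (induction k arbitrary: c)
  case (Suc k)
  show ?case by (rule continuously_differentiable_SucI[where f' = "\<lambda>_ _. 0"]) (auto intro: Suc)
qed auto

lemma continuously_differentiable_linear:
  "bounded_linear f \<Longrightarrow> continuously_differentiable k f"
  by (cases k)
    (auto intro!: linear_continuous_on continuously_differentiable_SucI[where f' = "\<lambda>_. f"]
      bounded_linear_imp_has_derivative continuously_differentiable_const simp del: continuously_differentiable.simps(2))

lemma continuously_differentiable_add:
  "continuously_differentiable k f \<Longrightarrow> continuously_differentiable k g \<Longrightarrow>
   continuously_differentiable k (\<lambda>x. f x + g x)"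
proof (induction k arbitrary: f g)
  case (Suc k)
  show ?case
    by (rule continuously_differentiable_SucI,
        rule has_derivative_add[OF continuously_differentiable_SucE(1)[OF Suc(2)] continuously_differentiable_SucE(1)[OF Suc(3)]])
       (intro Suc(1) continuously_differentiable_SucE(2)[OF Suc(2)] continuously_differentiable_SucE(2)[OF Suc(3)])
qed (auto intro: continuous_intros)

lemma continuously_differentiable_mult:
  "continuously_differentiable k f \<Longrightarrow> continuously_differentiable k g \<Longrightarrow>
   continuously_differentiable k (\<lambda>x. f x * g x)"
proof (induction k arbitrary: f g)
  case (Suc k)
  show ?case
    by (rule continuously_differentiable_SucI,
        rule has_derivative_mult[OF continuously_differentiable_SucE(1)[OF Suc(2)] continuously_differentiable_SucE(1)[OF Suc(3)]])
       (intro continuously_differentiable_add Suc(1) continuously_differentiable_SucE(2)[OF Suc(2)] continuously_differentiable_SucE(2)[OF Suc(3)]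
         continuously_differentiable_lower[OF Suc(2)] continuously_differentiable_lower[OF Suc(3)])
qed (auto intro: continuous_intros)

lemma continuously_differentiable_compose:
  fixes h :: "real \<Rightarrow> real"
  shows "continuously_differentiable k h \<Longrightarrow> continuously_differentiable k f \<Longrightarrow>
   continuously_differentiable k (\<lambda>x. h (f x))"
proof (induction k arbitrary: h f)
  case 0
  then show ?case by (auto intro: continuous_on_compose2)
next
  case (Suc k)
  define h' where "h' x = frechet_derivative h (at x) 1" for x
  have h': "(h has_derivative (\<lambda>y. h' x * y)) (at x)" for x
  proof -
    have "linear (frechet_derivative h (at x))"
      using continuously_differentiable_SucE(1)[OF Suc(2)] has_derivative_linear by blast
    then have "frechet_derivative h (at x) y = h' x * y" for y
      using linear_cmul[of "frechet_derivative h (at x)" y 1] by (simp add: h'_def)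
    then show ?thesis
      by (intro has_derivative_eq_rhs[OF continuously_differentiable_SucE(1)[OF Suc(2)]] ext) simp
  qed
  have k: "continuously_differentiable k h'"
    using continuously_differentiable_SucE(2)[OF Suc(2), of 1] by (simp add: h'_def[abs_def])
  show ?case
    by (rule continuously_differentiable_SucI,
        rule has_derivative_compose[OF continuously_differentiable_SucE(1)[OF Suc(3)] h'])
       (rule continuously_differentiable_mult[OF Suc(1)[OF k continuously_differentiable_lower[OF Suc(3)]]
          continuously_differentiable_SucE(2)[OF Suc(3)]])
qed

lemma continuously_differentiable_uminus:
  "continuously_differentiable k f \<Longrightarrow> continuously_differentiable k (\<lambda>x. - f x)"
  using continuously_differentiable_mult[OF continuously_differentiable_const[of k "-1"], of f] by simp

lemma continuously_differentiable_diff: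
  "continuously_differentiable k f \<Longrightarrow> continuously_differentiable k g \<Longrightarrow>
   continuously_differentiable k (\<lambda>x. f x - g x)"
  using continuously_differentiable_add[OF _ continuously_differentiable_uminus, of k f g] by simp

lemma continuously_differentiable_inverse:
  fixes f :: "'a::euclidean_space \<Rightarrow> real"
  assumes "\<And>x. f x \<noteq> 0"
  shows "continuously_differentiable k f \<Longrightarrow> continuously_differentiable k (\<lambda>x. inverse (f x))"
proof (induction k)
  case 0
  then show ?case using assms by (auto intro: continuous_intros)
next
  case (Suc k)
  show ?case
    by (rule continuously_differentiable_SucI,
        rule Deriv.has_derivative_inverse[OF _ continuously_differentiable_SucE(1)[OF Suc(2)]])
       (intro assms Suc(1) continuously_differentiable_mult continuously_differentiable_uminus continuously_differentiable_lower[OF Suc(2)]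
        continuously_differentiable_SucE(2)[OF Suc(2)])+
qed

lemma continuously_differentiable_polynomial:
  "real_polynomial_function p \<Longrightarrow> continuously_differentiable k p"
  by (induction rule: real_polynomial_function.induct)
    (auto intro: continuously_differentiable_linear continuously_differentiable_const
      continuously_differentiable_add continuously_differentiable_mult)

text \<open>Having the whole chain of derivatives at hand lets the induction on \<open>k\<close> run
  for all \<open>n\<close> at once.\<close>

lemma has_real_derivative_imp_continuously_differentiable:
  fixes D :: "nat \<Rightarrow> real \<Rightarrow> real"
  assumes "\<And>n x. (D n has_real_derivative D (Suc n) x) (at x)"
  shows "continuously_differentiable k (D n)"
proof (induction k arbitrary: n)
  case 0
  have "isCont (D n) x" for x
    using DERIV_isCont assms by blast
  then show ?case by (simp add: continuous_at_imp_continuous_on)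
next
  case (Suc k)
  show ?case
    by (rule continuously_differentiable_SucI[where f' = "\<lambda>x y. D (Suc n) x * y"])
       (use assms Suc in \<open>auto simp: has_field_derivative_def\<close>)
qed

subsection \<open>Bump functions\<close>

definition bump0 :: "real \<Rightarrow> real" where
  "bump0 x = (if x > 0 then exp (- inverse x) else 0)"

text \<open>A family that contains \<open>bump0\<close> (for \<open>p = 1\<close>) and is closed
  under differentiation, which sends p to X^2 (p - p').\<close>

definition bump_deriv :: "real poly \<Rightarrow> real \<Rightarrow> real" where
  "bump_deriv p x = (if x > 0 then poly p (inverse x) * exp (- inverse x) else 0)"

lemma poly_exp_tendsto_0: "((\<lambda>y. poly p y * exp (- y)) \<longlongrightarrow> (0::real)) at_top"
proof -
  have "((\<lambda>y. \<Sum>i\<le>degree p. coeff p i * (y ^ i / exp y)) \<longlongrightarrow> (\<Sum>i\<le>degree p. coeff p i * 0)) at_top"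
    by (intro tendsto_sum tendsto_mult tendsto_const tendsto_power_div_exp_0)
  then show ?thesis
    by (simp add: poly_altdef exp_minus sum_distrib_right divide_inverse mult.assoc)
qed

lemma bump_deriv_tendsto_0: "((\<lambda>x. bump_deriv p x) \<longlongrightarrow> 0) (at 0)"
proof -
  have "((\<lambda>x. poly p (inverse x) * exp (- inverse x)) \<longlongrightarrow> (0::real)) (at_right 0)"
    by (rule filterlim_compose[OF poly_exp_tendsto_0 filterlim_inverse_at_top_right])
  moreover have "\<forall>\<^sub>F x in at_right 0. poly p (inverse x) * exp (- inverse x) = bump_deriv p x"
    by (rule eventually_mono[OF eventually_at_right_less]) (auto simp: bump_deriv_def)
  ultimately have r: "((\<lambda>x. bump_deriv p x) \<longlongrightarrow> 0) (at_right 0)"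
    by (rule Lim_transform_eventually)
  have "\<forall>\<^sub>F x in at_left (0::real). x < 0" by (simp add: eventually_at_filter)
  then have "\<forall>\<^sub>F x in at_left 0. 0 = bump_deriv p x"
    by eventually_elim (auto simp: bump_deriv_def)
  then have "((\<lambda>x. bump_deriv p x) \<longlongrightarrow> 0) (at_left 0)"
    by (rule Lim_transform_eventually[OF tendsto_const])
  with r show ?thesis by (simp add: filterlim_split_at)
qed

lemma bump_deriv_has_derivative:
  "(bump_deriv p has_real_derivative bump_deriv ([:0, 0, 1:] * (p - pderiv p)) x) (at x)"
proof -
  consider "x > 0" | "x < 0" | "x = 0" by linarith
  then show ?thesis
  proof cases
    case 1
    have "((\<lambda>x. poly p (inverse x) * exp (- inverse x)) has_real_derivative
       bump_deriv ([:0, 0, 1:] * (p - pderiv p)) x) (at x)"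
      using 1 by (auto intro!: derivative_eq_intros DERIV_chain2[OF poly_DERIV] simp: bump_deriv_def algebra_simps power2_eq_square)
    note d = this
    have "\<forall>\<^sub>F x in nhds x. poly p (inverse x) * exp (- inverse x) = bump_deriv p x"
      by (rule eventually_mono[OF eventually_nhds_in_open[of "{0<..}" x]]) (use 1 in \<open>auto simp: bump_deriv_def\<close>)
    from DERIV_cong_ev[OF refl this refl] d show ?thesis
      by blast
  next
    case 2
    have "((\<lambda>x. 0::real) has_real_derivative bump_deriv ([:0, 0, 1:] * (p - pderiv p)) x) (at x)"
      using 2 by (auto simp: bump_deriv_def)
    note d = this
    have "\<forall>\<^sub>F x in nhds x. 0 = bump_deriv p x"
      by (rule eventually_mono[OF eventually_nhds_in_open[of "{..<0}" x]]) (use 2 in \<open>auto simp: bump_deriv_def\<close>)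
    from DERIV_cong_ev[OF refl this refl] d show ?thesis
      by blast
  next
    case 3
    \<comment> \<open>Dividing by \<open>y\<close> multiplies the polynomial by its variable, so the
      difference quotient at 0 stays in the family and tends to 0.\<close>
    have "bump_deriv p y / y = bump_deriv ([:0,1:] * p) y" for y
      by (auto simp: bump_deriv_def field_simps)
    then have "((\<lambda>y. (bump_deriv p y - bump_deriv p 0) / (y - 0)) \<longlongrightarrow> 0) (at 0)"
      using bump_deriv_tendsto_0[of "[:0,1:] * p"] by (simp add: bump_deriv_def[of _ 0])
    then show ?thesis using 3 by (simp add: has_field_derivative_iff bump_deriv_def[of _ 0])
  qed
qed

lemma bump0_smooth: "continuously_differentiable k bump0"
proof -
  define P where "P n = ((\<lambda>p. [:0, 0, 1:] * (p - pderiv p)) ^^ n) (1::real poly)" for n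
  have "continuously_differentiable k (bump_deriv (P 0))"
    by (rule has_real_derivative_imp_continuously_differentiable[where D = "\<lambda>n. bump_deriv (P n)"])
       (use bump_deriv_has_derivative in \<open>simp add: P_def\<close>)
  also have "bump_deriv (P 0) = bump0"
    by (auto simp: P_def bump_deriv_def bump0_def)
  finally show ?thesis .
qed

lemma bump0_pos: "0 < x \<Longrightarrow> 0 < bump0 x" and bump0_eq_0: "x \<le> 0 \<Longrightarrow> bump0 x = 0" and bump0_nonneg: "0 \<le> bump0 x"
  by (auto simp: bump0_def)

lemma bump0_mono: "x \<le> y \<Longrightarrow> bump0 x \<le> bump0 y"
  by (auto simp: bump0_def)

lemma obtain_smooth_real_derivative:
  fixes f :: "real \<Rightarrow> real"
  assumes "\<And>k. continuously_differentiable k f"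
  obtains f' where "\<And>x. (f has_real_derivative f' x) (at x)" "\<And>k. continuously_differentiable k f'"
    "continuous_on UNIV f'"
proof -
  define f' where "f' x = frechet_derivative f (at x) 1" for x
  have f: "(f has_real_derivative f' x) (at x)" for x
  proof -
    have D: "(f has_derivative frechet_derivative f (at x)) (at x)"
      by (rule continuously_differentiable_SucE(1)[OF assms[of "Suc 0"]])
    then have "linear (frechet_derivative f (at x))"
      using has_derivative_linear by blast
    then have "frechet_derivative f (at x) y = f' x * y" for y
      using linear_cmul[of "frechet_derivative f (at x)" y 1] by (simp add: f'_def)
    then show ?thesis
      using has_derivative_eq_rhs[OF D, of "(*) (f' x)"] by (auto simp: has_field_derivative_def)
  qed
  have k: "continuously_differentiable k f'" for k
    using continuously_differentiable_SucE(2)[OF assms[of "Suc k"], of 1] by (simp add: f'_def[abs_def])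
  show ?thesis using that[OF f k] k[of 0] by simp
qed

text \<open>The denominator never vanishes, because \<open>x\<close> and \<open>1 - x\<close> are
  not both nonpositive. Rescaled copies switch the time cutoffs on and off.\<close>

definition smooth_step :: "real \<Rightarrow> real" where
  "smooth_step x = bump0 x * inverse (bump0 x + bump0 (1 - x))"

lemma smooth_step_smooth: "continuously_differentiable k smooth_step"
proof -
  have "bump0 x + bump0 (1 - x) \<noteq> 0" for x
    using bump0_pos[of x] bump0_pos[of "1 - x"] bump0_nonneg[of x] bump0_nonneg[of "1 - x"]
    by (cases "x > 0") linarith+
  moreover have "continuously_differentiable k (\<lambda>x. bump0 (1 - x))"
    by (rule continuously_differentiable_compose[OF bump0_smooth])
       (intro continuously_differentiable_diff continuously_differentiable_const continuously_differentiable_linear bounded_linear_ident)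
  ultimately have "continuously_differentiable k (\<lambda>x. bump0 x * inverse (bump0 x + bump0 (1 - x)))"
    by (intro continuously_differentiable_mult continuously_differentiable_inverse continuously_differentiable_add bump0_smooth) auto
  then show ?thesis by (simp add: smooth_step_def[abs_def])
qed

lemma smooth_step_0: "x \<le> 0 \<Longrightarrow> smooth_step x = 0" and smooth_step_1: "1 \<le> x \<Longrightarrow> smooth_step x = 1"
  using bump0_pos[of x] by (auto simp: smooth_step_def bump0_eq_0)

lemma smooth_step_bounds: "0 \<le> smooth_step x" "smooth_step x \<le> 1"
proof -
  have *: "0 \<le> bump0 x" "0 \<le> bump0 (1 - x)" by (simp_all add: bump0_nonneg)
  then show "0 \<le> smooth_step x" by (simp add: smooth_step_def)
  show "smooth_step x \<le> 1"
    unfolding smooth_step_def divide_inverse[symmetric]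
    by (rule divide_le_eq_1[THEN iffD2]) (use * in linarith)
qed

subsection \<open>The divergence of one-sided Lipschitz fields\<close>

lemma compact_continuous_norm_bound:
  fixes g :: "'a::topological_space \<Rightarrow> 'b::real_normed_vector"
  assumes "continuous_on S g" "compact S"
  obtains L where "0 \<le> L" "\<And>x. x \<in> S \<Longrightarrow> norm (g x) \<le> L"
proof -
  obtain L where "\<forall>x\<in>S. norm (g x) \<le> L"
    using compact_imp_bounded[OF compact_continuous_image[OF assms]] by (auto simp: bounded_iff)
  then show ?thesis using that[of "max L 0"] by fastforce
qed

lemma integrable_continuous_compact_support:
  fixes g :: "'a::euclidean_space \<Rightarrow> 'b::{banach, second_countable_topology}"
  assumes "continuous_on UNIV g" and "\<And>x. r < norm x \<Longrightarrow> g x = 0"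
  shows "integrable lborel g"
proof -
  have "integrable lborel (\<lambda>x. indicator (cball 0 r) x *\<^sub>R g x)"
    by (rule borel_integrable_compact) (auto intro: continuous_on_subset[OF assms(1)])
  also have "(\<lambda>x. indicator (cball 0 r) x *\<^sub>R g x) = g"
    using assms(2) by (auto simp: indicator_def fun_eq_iff not_le)
  finally show ?thesis .
qed

lemma integral_translation_lborel:
  fixes g :: "'a::euclidean_space \<Rightarrow> 'b::{banach, second_countable_topology}"
  assumes [measurable]: "g \<in> borel_measurable borel"
  shows "(LINT z|lborel. g (c + z)) = (LINT z|lborel. g z)"
  using integral_distr[of "(+) c" lborel borel g] by (simp add: lborel_distr_plus)

lemma GDERIV_lipschitz:
  fixes f :: "'a::euclidean_space \<Rightarrow> real"
  assumes "\<And>x. GDERIV f x :> Df x" "convex S" "\<And>x. x \<in> S \<Longrightarrow> norm (Df x) \<le> L" "x \<in> S" "y \<in> S"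
  shows "\<bar>f x - f y\<bar> \<le> L * norm (x - y)"
proof -
  have "norm (f x - f y) \<le> L * norm (x - y)"
  proof (rule differentiable_bound[OF \<open>convex S\<close>])
    show "(f has_derivative (\<lambda>h. h \<bullet> Df z)) (at z within S)" for z
      using assms(1) by (auto simp: gderiv_def has_derivative_at_withinI)
    show "onorm (\<lambda>h. h \<bullet> Df z) \<le> L" if "z \<in> S" for z
      by (rule onorm_le)
         (use Cauchy_Schwarz_ineq2[of _ "Df z"] mult_right_mono[OF assms(3)[OF that] norm_ge_zero]
          in \<open>fastforce simp: mult.commute intro: order_trans\<close>)
  qed (use assms in auto)
  then show ?thesis by simp
qed

text \<open>The difference quotients of \<open>f\<close> are moved onto \<open>B\<close> by a translation; this is the distributional
  inequality \<open>div B \<ge> - d K\<close> for a one-sided Lipschitz field.\<close>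

lemma one_sided_divergence_le:
  fixes B :: "'a::euclidean_space \<Rightarrow> 'a" and f :: "'a \<Rightarrow> real" and K :: real
  assumes contB: "continuous_on UNIV B"
    and os: "\<And>x y. (B x - B y) \<bullet> (x - y) \<ge> - K * (norm (x - y))\<^sup>2"
    and GD: "\<And>x. GDERIV f x :> Df x" and contD: "continuous_on UNIV Df"
    and nn: "\<And>x. 0 \<le> f x" and supp: "\<And>x. r < norm x \<Longrightarrow> f x = 0"
  shows "(LINT z|lborel. B z \<bullet> Df z) \<le> DIM('a) * K * (LINT z|lborel. f z)"
proof -
  define h where "h n = inverse (real (Suc n))" for n
  have h: "0 < h n" "h n \<le> 1" for n
    by (auto simp: h_def field_simps)
  have h0: "h \<longlonglongrightarrow> 0" unfolding h_def by (rule LIMSEQ_inverse_real_of_nat)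
  have contf: "continuous_on UNIV f"
    using GD by (auto simp: gderiv_def continuous_on_eq_continuous_at intro: has_derivative_continuous)
  have intf: "integrable lborel f"
    by (rule integrable_continuous_compact_support[OF contf supp])
  have Df0: "Df x = 0" if "r < norm x" for x
  proof -
    have "open {y. r < norm (y::'a)}" by (intro open_Collect_less continuous_intros)
    then have "(f has_derivative (\<lambda>h. 0)) (at x)"
      using has_derivative_transform_within_open[of "\<lambda>_. 0" "\<lambda>_. 0" x UNIV "{y. r < norm y}" f] that supp by auto
    then have "(\<lambda>h. h \<bullet> Df x) = (\<lambda>h. 0)"
      using GD[of x] has_derivative_unique unfolding gderiv_def by blast
    then show ?thesis by (metis inner_eq_zero_iff)
  qed
  obtain L where L: "\<And>x. x \<in> cball 0 (r + 2) \<Longrightarrow> norm (Df x) \<le> L"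
    using compact_continuous_norm_bound[OF continuous_on_subset[OF contD subset_UNIV] compact_cball] by metis
  have B_int: "integrable lborel (\<lambda>z. (B z \<bullet> i) * f (z + c))" for i c
  proof (rule integrable_continuous_compact_support[where r = "r + norm c"])
    show "continuous_on UNIV (\<lambda>z. (B z \<bullet> i) * f (z + c))"
      by (intro continuous_intros continuous_on_compose2[OF contf] contB) auto
    show "(B x \<bullet> i) * f (x + c) = 0" if "r + norm c < norm x" for x
      using supp[of "x + c"] norm_triangle_ineq4[of "x + c" c] that by simp
  qed
  have main: "(LINT z|lborel. (B z \<bullet> i) * (Df z \<bullet> i)) \<le> K * (LINT z|lborel. f z)" if i: "i \<in> Basis" for i
  proof -
    define q where "q n z = (B z \<bullet> i) * ((f (z + h n *\<^sub>R i) - f z) / h n)" for n z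
    have le: "(LINT z|lborel. q n z) \<le> K * (LINT z|lborel. f z)" for n
    proof -
      have "(LINT z|lborel. q n z) = ((LINT z|lborel. (B z \<bullet> i) * f (z + h n *\<^sub>R i)) - (LINT z|lborel. (B z \<bullet> i) * f z)) / h n"
        using B_int[of i "h n *\<^sub>R i"] B_int[of i 0] by (simp add: q_def field_simps flip: diff_divide_distrib)
      also have "(LINT z|lborel. (B z \<bullet> i) * f (z + h n *\<^sub>R i)) = (LINT z|lborel. (B (z - h n *\<^sub>R i) \<bullet> i) * f z)"
      proof -
        have "(\<lambda>z. (B (z - h n *\<^sub>R i) \<bullet> i) * f z) \<in> borel_measurable borel"
          by (intro borel_measurable_continuous_onI continuous_intros continuous_on_compose2[OF contB] contf) auto
        from integral_translation_lborel[OF this, of "h n *\<^sub>R i"] show ?thesis by (simp add: add.commute)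
      qed
      also have "\<dots> \<le> (LINT z|lborel. (B z \<bullet> i) * f z + (K * h n) * f z)"
      proof (rule integral_mono)
        show "integrable lborel (\<lambda>z. (B (z - h n *\<^sub>R i) \<bullet> i) * f z)"
          by (rule integrable_continuous_compact_support[where r = r])
             (auto intro!: continuous_intros continuous_on_compose2[OF contB] contf simp: supp)
        show "integrable lborel (\<lambda>z. (B z \<bullet> i) * f z + (K * h n) * f z)"
          using B_int[of i 0] intf by simp
        show "B (z - h n *\<^sub>R i) \<bullet> i * f z \<le> (B z \<bullet> i) * f z + (K * h n) * f z" for z
        proof -
          \<comment> \<open>For an increment along a basis vector the condition is quadratic in
            \<open>h n\<close>; one factor cancels here, the other one makes up for the division by
            \<open>h n\<close> in the quotient. Each basis direction contributes \<open>K\<close>,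
            whence the dimension in the result.\<close>
          have "- K * (h n)\<^sup>2 \<le> h n * ((B z - B (z - h n *\<^sub>R i)) \<bullet> i)"
            using os[of z "z - h n *\<^sub>R i"] i h[of n] by (simp add: norm_Basis power2_eq_square)
          then have "h n * (- K * h n) \<le> h n * ((B z - B (z - h n *\<^sub>R i)) \<bullet> i)"
            by (simp add: power2_eq_square algebra_simps)
          then have "- K * h n \<le> (B z - B (z - h n *\<^sub>R i)) \<bullet> i"
            using h[of n] mult_le_cancel_left_pos by blast
          then have "B (z - h n *\<^sub>R i) \<bullet> i \<le> B z \<bullet> i + K * h n"
            by (simp add: inner_diff_left)
          then show ?thesis using nn[of z] mult_right_mono by (fastforce simp: distrib_right)
        qed
      qed
      also have "\<dots> = (LINT z|lborel. (B z \<bullet> i) * f z) + (K * h n) * (LINT z|lborel. f z)"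
        using B_int[of i 0] intf by simp
      finally show ?thesis using h[of n] by (simp add: divide_right_mono field_simps)
    qed
    obtain Bb where Bb: "\<And>x. x \<in> cball 0 (r + 1) \<Longrightarrow> norm (B x) \<le> Bb"
      using compact_continuous_norm_bound[OF continuous_on_subset[OF contB subset_UNIV] compact_cball] by metis
    \<comment> \<open>As \<open>h n\<close> is at most 1, all quotients live on the ball of radius r
      + 1, and the Lipschitz constant of \<open>f\<close> is taken on the ball of radius r +
      2.\<close>
    have "(\<lambda>n. LINT z|lborel. q n z) \<longlonglongrightarrow> (LINT z|lborel. (B z \<bullet> i) * (Df z \<bullet> i))"
    proof (rule integral_dominated_convergence[where w = "\<lambda>z. (Bb * L) * indicator (cball 0 (r + 1)) z"])
      show "(\<lambda>z. B z \<bullet> i * (Df z \<bullet> i)) \<in> borel_measurable lborel"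
        by (simp, intro borel_measurable_continuous_onI continuous_intros contB contD)
      show "q n \<in> borel_measurable lborel" for n
        unfolding q_def using h[of n]
        by (simp, intro borel_measurable_continuous_onI continuous_intros contB contf continuous_on_compose2[OF contf]) auto
      show "integrable lborel (\<lambda>z::'a. (Bb * L) * indicator (cball 0 (r + 1)) z)"
        by (intro integrable_mult_right integrable_real_indicator) (use emeasure_bounded_finite[OF bounded_cball[of 0 "r + 1"]] in \<open>auto simp: top.not_eq_extremum\<close>)
      show "AE z in lborel. (\<lambda>n. q n z) \<longlonglongrightarrow> B z \<bullet> i * (Df z \<bullet> i)"
      proof (rule AE_I2)
        fix z
        have "((\<lambda>t. f (z + t *\<^sub>R i)) has_derivative (\<lambda>t. (t *\<^sub>R i) \<bullet> Df z)) (at 0)"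
          by (rule has_derivative_compose[of "\<lambda>t. z + t *\<^sub>R i" "\<lambda>t. t *\<^sub>R i" 0 UNIV f])
             (use GD[of z] in \<open>auto simp: gderiv_def intro!: derivative_eq_intros\<close>)
        then have "((\<lambda>t. f (z + t *\<^sub>R i)) has_real_derivative (i \<bullet> Df z)) (at 0)"
          by (simp add: has_field_derivative_def mult_commute_abs)
        then have lim: "((\<lambda>t. (f (z + t *\<^sub>R i) - f z) / t) \<longlongrightarrow> i \<bullet> Df z) (at 0)"
          by (simp add: has_field_derivative_iff)
        have "filterlim h (at 0) sequentially"
          using h0 h by (auto simp: filterlim_at less_imp_neq[symmetric] intro!: always_eventually)
        from filterlim_compose[OF lim this] show "(\<lambda>n. q n z) \<longlonglongrightarrow> B z \<bullet> i * (Df z \<bullet> i)"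
          unfolding q_def by (intro tendsto_mult tendsto_const) (simp add: inner_commute)
      qed
      show "AE z in lborel. norm (q n z) \<le> (Bb * L) * indicator (cball 0 (r + 1)) z" for n
      proof (rule AE_I2)
        fix z
        show "norm (q n z) \<le> (Bb * L) * indicator (cball 0 (r + 1)) z"
        proof (cases "norm z \<le> r + 1")
          case True
          have i1: "norm (h n *\<^sub>R i) \<le> 1" using i h[of n] by simp
          have "norm (z + h n *\<^sub>R i) \<le> r + 2" using True i1 norm_triangle_ineq[of z "h n *\<^sub>R i"] by linarith
          then have "\<bar>f (z + h n *\<^sub>R i) - f z\<bar> \<le> L * norm (z + h n *\<^sub>R i - z)"
            by (intro GDERIV_lipschitz[OF GD convex_cball L, of 0 "r + 2"]) (use True in auto)
          then have 1: "\<bar>(f (z + h n *\<^sub>R i) - f z) / h n\<bar> \<le> L"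
            using h[of n] i by (simp add: field_simps)
          have 2: "\<bar>B z \<bullet> i\<bar> \<le> Bb"
            using Bb[of z] True Basis_le_norm[OF i, of "B z"] by simp
          show ?thesis
            unfolding q_def using True mult_mono[OF 2 1] 2 by (simp add: abs_mult)
        next
          case False
          have "norm (h n *\<^sub>R i) \<le> 1" using i h[of n] by simp
          then have "r < norm (z + h n *\<^sub>R i)" using False norm_triangle_ineq4[of "z + h n *\<^sub>R i" "h n *\<^sub>R i"] by simp
          then show ?thesis using False supp[of "z + h n *\<^sub>R i"] supp[of z] by (simp add: q_def)
        qed
      qed
    qed
    then show ?thesis by (rule LIMSEQ_le_const2) (use le in blast)
  qed
  have "(LINT z|lborel. B z \<bullet> Df z) = (LINT z|lborel. (\<Sum>i\<in>Basis. (B z \<bullet> i) * (Df z \<bullet> i)))"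
    by (rule Bochner_Integration.integral_cong[OF refl euclidean_inner])
  also have "\<dots> = (\<Sum>i\<in>Basis. LINT z|lborel. (B z \<bullet> i) * (Df z \<bullet> i))"
    by (rule Bochner_Integration.integral_sum, rule integrable_continuous_compact_support[where r = r])
       (auto intro!: continuous_intros contB contD simp: Df0)
  also have "\<dots> \<le> (\<Sum>i\<in>(Basis::'a set). K * (LINT z|lborel. f z))"
    by (rule sum_mono[OF main])
  finally show ?thesis by simp
qed

text \<open>The field is locally bounded in space but only with an integrable bound in time, so the
  natural majorants are products of an L^1 function of time and the indicator of a ball.\<close>

lemma integrable_pair_bound:
  fixes f :: "real \<times> 'a::euclidean_space \<Rightarrow> 'b::{banach, second_countable_topology}"
  assumes f: "f \<in> borel_measurable borel" and g: "integrable lborel g"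
    and le: "\<And>t x. norm (f (t, x)) \<le> g t * indicator (cball 0 r) x"
  shows "integrable lborel f"
proof -
  have [measurable]: "g \<in> borel_measurable borel" using g by auto
  have [measurable]: "cball (0::'a) r \<in> sets borel" by simp
  have fin: "emeasure lborel (cball (0::'a) r) \<noteq> \<infinity>"
    using emeasure_bounded_finite[OF bounded_cball[of "0::'a" r]] by simp
  have "integrable (lborel \<Otimes>\<^sub>M lborel) (\<lambda>(t, x). g t * indicator (cball (0::'a) r) x)"
  proof (rule lborel_pair.Fubini_integrable)
    show "(\<lambda>(t, x). g t * indicator (cball (0::'a) r) x) \<in> borel_measurable (lborel \<Otimes>\<^sub>M lborel)"
      by measurable
    have "(\<lambda>t. LINT x|lborel. norm (case (t, x) of (t, x) \<Rightarrow> g t * indicator (cball (0::'a) r) x))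
      = (\<lambda>t. \<bar>g t\<bar> * measure lborel (cball (0::'a) r))"
      by (simp add: abs_mult)
    then show "integrable lborel (\<lambda>t. LINT x|lborel. norm (case (t, x) of (t, x) \<Rightarrow> g t * indicator (cball (0::'a) r) x))"
      using g by simp
    show "AE t in lborel. integrable lborel (\<lambda>x. case (t, x) of (t, x) \<Rightarrow> g t * indicator (cball (0::'a) r) x)"
      using fin by (auto intro!: AE_I2 integrable_mult_right integrable_real_indicator simp: top.not_eq_extremum)
  qed
  then have "integrable lborel (\<lambda>(t, x). g t * indicator (cball (0::'a) r) x)"
    by (simp add: lborel_prod)
  then show ?thesis
    by (rule Bochner_Integration.integrable_bound)
       (use f le in \<open>auto intro!: AE_I2 order_trans[OF _ abs_ge_self]\<close>)
qed

lemma integral_lborel_pair: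
  fixes f :: "real \<times> 'a::euclidean_space \<Rightarrow> 'b::{banach, second_countable_topology}"
  assumes "integrable lborel f"
  shows "(LINT z|lborel. f z) = (LINT t|lborel. LINT x|lborel. f (t, x))"
    and "integrable lborel (\<lambda>t. LINT x|lborel. f (t, x))"
proof -
  have f: "integrable (lborel \<Otimes>\<^sub>M lborel) f" using assms by (simp add: lborel_prod)
  show "(LINT z|lborel. f z) = (LINT t|lborel. LINT x|lborel. f (t, x))"
    using lborel_pair.integral_fst'[OF f] by (simp add: lborel_prod)
  show "integrable lborel (\<lambda>t. LINT x|lborel. f (t, x))"
    using lborel_pair.integrable_fst'[OF f] .
qed

subsection \<open>Test functions\<close>

lemma grad_eqI: "GDERIV f x :> D \<Longrightarrow> grad f x = D"
  unfolding grad_def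
proof (rule the_equality)
  fix E assume "GDERIV f x :> D" "GDERIV f x :> E"
  then have "(\<lambda>h. h \<bullet> D) = (\<lambda>h. h \<bullet> E)"
    using has_derivative_unique unfolding gderiv_def by blast
  then have "(D - E) \<bullet> (D - E) = 0"
    by (metis (no_types) inner_diff_right diff_self)
  then show "E = D" by simp
qed

lemma GDERIV_continuous: "GDERIV f x :> D \<Longrightarrow> isCont f x"
  by (simp add: gderiv_def has_derivative_continuous)

lemma GDERIV_slice:
  assumes "GDERIV f (t, x) :> (pt, px)"
  shows "GDERIV (\<lambda>x. f (t, x)) x :> px"
  unfolding gderiv_def
  by (rule has_derivative_eq_rhs[OF has_derivative_compose[of "\<lambda>x. (t, x)" "\<lambda>h. (0, h)"]])
     (use assms in \<open>auto simp: gderiv_def inner_prod_def intro!: derivative_eq_intros\<close>)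

text \<open>A test function packaged with its two partial gradients and with a box carrying its
  support. This keeps the description operator in \<open>grad\<close> and the closure in
  \<open>test_function\<close> out of the estimates.\<close>

definition smooth_supported ::
  "real \<Rightarrow> real \<Rightarrow> real \<Rightarrow> (real \<times> 'a::euclidean_space \<Rightarrow> real) \<Rightarrow> (real \<times> 'a \<Rightarrow> real) \<Rightarrow> (real \<times> 'a \<Rightarrow> 'a) \<Rightarrow> bool" where
  "smooth_supported a c r \<phi> pt px \<longleftrightarrow>
     (\<forall>k. continuously_differentiable k \<phi>) \<and> (\<forall>z. GDERIV \<phi> z :> (pt z, px z)) \<and>
     continuous_on UNIV pt \<and> continuous_on UNIV px \<and> (\<forall>z. z \<notin> {a..c} \<times> cball 0 r \<longrightarrow> \<phi> z = 0)"

lemma smooth_supportedD: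
  assumes "smooth_supported a c r \<phi> pt px"
  shows "continuously_differentiable k \<phi>" "GDERIV \<phi> z :> (pt z, px z)"
    "continuous_on UNIV pt" "continuous_on UNIV px" "z \<notin> {a..c} \<times> cball 0 r \<Longrightarrow> \<phi> z = 0"
  using assms unfolding smooth_supported_def by blast+

lemma smooth_supported_test_function:
  assumes "smooth_supported a c r \<phi> pt px" "0 < a" "c < T"
  shows "test_function T \<phi>"
proof -
  have K: "compact ({a..c} \<times> cball (0::'a) r)" by (intro compact_Times) auto
  have "{z. \<phi> z \<noteq> 0} \<subseteq> {a..c} \<times> cball 0 r"
    using smooth_supportedD(5)[OF assms(1)] by blast
  then have sub: "closure {z. \<phi> z \<noteq> 0} \<subseteq> {a..c} \<times> cball 0 r"
    by (rule closure_minimal) (rule compact_imp_closed[OF K])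
  moreover have "compact (closure {z. \<phi> z \<noteq> 0})"
    using sub by (metis K closed_closure closed_Int_compact inf.absorb_iff1)
  ultimately show ?thesis
    using smooth_supportedD(1)[OF assms(1)] assms(2,3) by (fastforce simp: test_function_def)
qed

lemma smooth_supported_gradient_zero:
  assumes "smooth_supported a c r \<phi> pt px" "z \<notin> {a..c} \<times> cball 0 r"
  shows "pt z = 0" "px z = 0"
proof -
  have "closed ({a..c} \<times> cball (0::'a) r)" by (intro closed_Times) auto
  then have "open (- ({a..c} \<times> cball (0::'a) r))" by auto
  then have "(\<phi> has_derivative (\<lambda>h. 0)) (at z)"
    using has_derivative_transform_within_open[of "\<lambda>_. 0" "\<lambda>_. 0" z UNIV "- ({a..c} \<times> cball 0 r)" \<phi>]
      assms(2) smooth_supportedD(5)[OF assms(1)] by auto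
  then have "grad \<phi> z = 0" by (intro grad_eqI) (simp add: gderiv_def)
  moreover have "grad \<phi> z = (pt z, px z)"
    by (rule grad_eqI[OF smooth_supportedD(2)[OF assms(1)]])
  ultimately show "pt z = 0" "px z = 0" by (auto simp: zero_prod_def)
qed

lemma smooth_supported_continuous: "smooth_supported a c r \<phi> pt px \<Longrightarrow> continuous_on UNIV \<phi>"
  by (auto simp: continuous_on_eq_continuous_at intro: GDERIV_continuous smooth_supportedD(2))

lemma GDERIV_polynomial:
  fixes p :: "'a::euclidean_space \<Rightarrow> real"
  assumes "real_polynomial_function p"
  shows "\<exists>p'. (\<forall>x. GDERIV p x :> p' x) \<and> continuous_on UNIV p'"
  using assms
proof (induction rule: real_polynomial_function.induct)
  case (linear f)
  have "f h = h \<bullet> (\<Sum>i\<in>Basis. f i *\<^sub>R i)" for h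
  proof -
    have "f h = f (\<Sum>i\<in>Basis. (h \<bullet> i) *\<^sub>R i)" by (simp add: euclidean_representation)
    also have "\<dots> = (\<Sum>i\<in>Basis. (h \<bullet> i) * f i)"
      using bounded_linear.linear[OF linear] by (simp add: linear_sum linear_cmul)
    also have "\<dots> = h \<bullet> (\<Sum>i\<in>Basis. f i *\<^sub>R i)"
      by (simp add: inner_sum_right mult.commute)
    finally show ?thesis .
  qed
  then have "f = (\<lambda>h. h \<bullet> (\<Sum>i\<in>Basis. f i *\<^sub>R i))" by blast
  moreover have "(f has_derivative f) (at x)" for x
    using linear by (rule bounded_linear_imp_has_derivative)
  ultimately show ?case
    by (intro exI[of _ "\<lambda>_. \<Sum>i\<in>Basis. f i *\<^sub>R i"]) (auto simp: gderiv_def)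
next
  case (const c)
  show ?case by (intro exI[of _ "\<lambda>_. 0"]) (auto intro: GDERIV_const)
next
  case (add f g)
  then obtain f' g' where "\<forall>x. GDERIV f x :> f' x" "continuous_on UNIV f'" "\<forall>x. GDERIV g x :> g' x" "continuous_on UNIV g'"
    by blast
  then show ?case by (intro exI[of _ "\<lambda>x. f' x + g' x"]) (auto intro: GDERIV_add continuous_intros)
next
  case (mult f g)
  then obtain f' g' where *: "\<forall>x. GDERIV f x :> f' x" "continuous_on UNIV f'" "\<forall>x. GDERIV g x :> g' x" "continuous_on UNIV g'"
    by blast
  have "continuous_on UNIV f" "continuous_on UNIV g"
    using * by (auto simp: continuous_on_eq_continuous_at intro: GDERIV_continuous)
  with * show ?case
    by (intro exI[of _ "\<lambda>x. f x *\<^sub>R g' x + g x *\<^sub>R f' x"]) (auto intro!: GDERIV_mult continuous_intros)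
qed

text \<open>Polynomials in (t, x) serve as smooth multipliers; by Stone-Weierstrass they stand in
  for arbitrary continuous ones on compact sets.\<close>

lemma smooth_supported_polynomial_mult:
  fixes \<phi> :: "real \<times> 'a::euclidean_space \<Rightarrow> real"
  assumes \<phi>: "smooth_supported a c r \<phi> pt px" and p: "real_polynomial_function p"
  obtains qt qx where "smooth_supported a c r (\<lambda>z. p z * \<phi> z) qt qx"
proof -
  obtain p' where p': "\<And>x. GDERIV p x :> p' x" "continuous_on UNIV p'"
    using GDERIV_polynomial[OF p] by blast
  have cp: "continuous_on UNIV p"
    using p' by (auto simp: continuous_on_eq_continuous_at intro: GDERIV_continuous)
  have "GDERIV (\<lambda>z. p z * \<phi> z) z :> p z *\<^sub>R (pt z, px z) + \<phi> z *\<^sub>R p' z" for z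
    by (intro GDERIV_mult p' smooth_supportedD(2)[OF \<phi>])
  then have "GDERIV (\<lambda>z. p z * \<phi> z) z :> (p z * pt z + \<phi> z * fst (p' z), p z *\<^sub>R px z + \<phi> z *\<^sub>R snd (p' z))" for z
    by (rule GDERIV_subst) (auto simp: prod_eq_iff)
  then have "smooth_supported a c r (\<lambda>z. p z * \<phi> z)
      (\<lambda>z. p z * pt z + \<phi> z * fst (p' z)) (\<lambda>z. p z *\<^sub>R px z + \<phi> z *\<^sub>R snd (p' z))"
    using smooth_supported_continuous[OF \<phi>] smooth_supportedD(1,3-5)[OF \<phi>] cp p'(2) unfolding smooth_supported_def
    by (intro conjI allI impI continuous_intros continuously_differentiable_mult continuously_differentiable_polynomial[OF p])
       auto
  then show ?thesis by (rule that)
qed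

subsection \<open>The distributional equation\<close>

text \<open>The bounds hold at all times: the given \<open>b\<close> is extended by \<open>0\<close> outside \<open>[0, T]\<close> and off a null set of
  times, and \<open>u\<close> by its values at \<open>0\<close> and \<open>T\<close>.\<close>

locale transport_field =
  fixes b :: "real \<Rightarrow> 'a::euclidean_space \<Rightarrow> 'a" and C0 C1 :: "real \<Rightarrow> real" and H \<alpha> :: real
  assumes b_borel: "(\<lambda>z. b (fst z) (snd z)) \<in> borel_measurable borel"
    and C0_integrable: "integrable lborel C0" and C0_nonneg: "0 \<le> C0 t"
    and C1_integrable: "integrable lborel C1" and C1_nonneg: "0 \<le> C1 t"
    and b_growth: "norm (b t x) \<le> C0 t * (1 + norm x)"
    and b_one_sided: "(b t x - b t y) \<bullet> (x - y) \<ge> - C1 t * (norm (x - y))\<^sup>2"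
    and H_nonneg: "0 \<le> H" and \<alpha>_pos: "0 < \<alpha>"
    and b_holder: "norm (b t x - b t y) \<le> H * norm (x - y) powr \<alpha>"
begin

lemma b_continuous: "continuous_on UNIV (b t)"
  unfolding continuous_on_eq_continuous_at[OF open_UNIV]
proof (intro ballI)
  fix x :: 'a
  have "((\<lambda>y. norm (y - x)) \<longlongrightarrow> 0) (at x)"
    by (rule tendsto_norm_zero[OF LIM_zero[OF tendsto_ident_at]])
  then have "((\<lambda>y. norm (y - x) powr \<alpha>) \<longlongrightarrow> 0) (at x)"
    by (rule tendsto_zero_powrI[OF _ tendsto_const always_eventually \<alpha>_pos]) simp
  from tendsto_mult_left[OF this, of H] have "((\<lambda>y. H * norm (y - x) powr \<alpha>) \<longlongrightarrow> 0) (at x)"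
    by simp
  then have "((\<lambda>y. b t y - b t x) \<longlongrightarrow> 0) (at x)"
    by (rule Lim_null_comparison[OF always_eventually[OF allI[OF b_holder]]])
  then show "isCont (b t) x"
    unfolding isCont_def by (rule LIM_zero_cancel)
qed

lemma b_compose_borel:
  assumes "f \<in> borel_measurable borel" "g \<in> borel_measurable borel"
  shows "(\<lambda>z. b (f z) (g z)) \<in> borel_measurable borel"
proof -
  have "(\<lambda>z. (f z, g z)) \<in> borel_measurable borel"
    using assms by (rule borel_measurable_Pair)
  from measurable_compose[OF this b_borel] show ?thesis by simp
qed

end

locale distributional_transport = transport_field b C0 C1 H \<alpha>
  for b :: "real \<Rightarrow> 'a::euclidean_space \<Rightarrow> 'a" and C0 C1 H \<alpha> +
  fixes T :: real and u :: "real \<Rightarrow> 'a \<Rightarrow> real" and \<mu> \<nu> :: "(real \<times> 'a) measure" and B \<beta> :: real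
  assumes T_pos: "0 < T"
    and u_continuous: "continuous_on UNIV (\<lambda>z. u (fst z) (snd z))"
    and B_nonneg: "0 \<le> B" and \<beta>_pos: "0 < \<beta>"
    and u_holder: "t \<in> {0..T} \<Longrightarrow> \<bar>u t x - u t y\<bar> \<le> B * norm (x - y) powr \<beta>"
    and divergence: "has_divergence_measure T b \<mu> \<nu>"
    and equation: "test_function T \<phi> \<Longrightarrow>
          (LINT z:{0<..<T} \<times> UNIV|lebesgue. u (fst z) (snd z) * fst (grad \<phi> z))
          - (LINT z:{0<..<T} \<times> UNIV|lebesgue.
               u (fst z) (snd z) * (b (fst z) (snd z) \<bullet> snd (grad \<phi> z)))
          - ((LINT z:{0<..<T} \<times> UNIV|\<mu>. u (fst z) (snd z) * \<phi> z)
             - (LINT z:{0<..<T} \<times> UNIV|\<nu>. u (fst z) (snd z) * \<phi> z)) = 0"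
begin

text \<open>The integrals extend over the whole space-time; for functions vanishing outside (0, T) x
  R^d this agrees with the restricted integrals in the hypotheses.\<close>

definition div_b :: "(real \<times> 'a \<Rightarrow> real) \<Rightarrow> real" where
  "div_b f = (LINT z|\<mu>. f z) - (LINT z|\<nu>. f z)"

lemma integral_lebesgue_vanishing:
  fixes f :: "real \<times> 'a \<Rightarrow> real"
  assumes "f \<in> borel_measurable borel" "\<And>z. z \<notin> {0<..<T} \<times> UNIV \<Longrightarrow> f z = 0"
  shows "(LINT z:{0<..<T} \<times> UNIV|lebesgue. f z) = (LINT z|lborel. f z)"
proof -
  have "(\<lambda>z. indicator ({0<..<T} \<times> UNIV) z *\<^sub>R f z) = f"
  proof
    fix z show "indicator ({0<..<T} \<times> UNIV) z *\<^sub>R f z = f z"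
      by (cases "z \<in> {0<..<T} \<times> UNIV") (simp_all add: assms(2))
  qed
  then show ?thesis
    unfolding set_lebesgue_integral_def using assms(1) by (simp add: integral_completion)
qed

lemma set_integral_vanishing:
  fixes f :: "real \<times> 'a \<Rightarrow> real"
  assumes "\<And>z. z \<notin> {0<..<T} \<times> UNIV \<Longrightarrow> f z = 0"
  shows "(LINT z:{0<..<T} \<times> UNIV|M. f z) = (LINT z|M. f z)"
  unfolding set_lebesgue_integral_def
  by (rule Bochner_Integration.integral_cong[OF refl]) (metis assms indicator_simps scaleR_one scaleR_zero_right)

context
  fixes a c r :: real and \<phi> :: "real \<times> 'a \<Rightarrow> real" and pt px
  assumes \<phi>: "smooth_supported a c r \<phi> pt px" and ac: "0 < a" "c < T"
begin

lemma support_in_domain: "z \<in> {a..c} \<times> cball 0 r \<Longrightarrow> z \<in> {0<..<T} \<times> UNIV"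
  using ac by auto

lemma gradient_eq: "grad \<phi> z = (pt z, px z)"
  by (rule grad_eqI[OF smooth_supportedD(2)[OF \<phi>]])

lemma zero_outside: "z \<notin> {0<..<T} \<times> UNIV \<Longrightarrow> \<phi> z = 0 \<and> pt z = 0 \<and> px z = 0"
  using smooth_supported_gradient_zero[OF \<phi>, of z] support_in_domain[of z] smooth_supportedD(5)[OF \<phi>, of z]
  by blast

lemma measurable_gradient [measurable]:
  "\<phi> \<in> borel_measurable borel" "pt \<in> borel_measurable borel" "px \<in> borel_measurable borel"
  using smooth_supported_continuous[OF \<phi>] smooth_supportedD(3,4)[OF \<phi>] by (auto intro: borel_measurable_continuous_onI)

lemma measurable_coefficients [measurable]:
  "(\<lambda>z. u (fst z) (snd z)) \<in> borel_measurable borel" "(\<lambda>z. b (fst z) (snd z)) \<in> borel_measurable borel"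
  using u_continuous b_borel by (auto intro: borel_measurable_continuous_onI)

lemma div_b_eq: "div_b \<phi> = - (LINT z|lborel. b (fst z) (snd z) \<bullet> px z)"
proof -
  have "- (LINT z:{0<..<T} \<times> UNIV|lebesgue. b (fst z) (snd z) \<bullet> snd (grad \<phi> z)) =
        (LINT z:{0<..<T} \<times> UNIV|\<mu>. \<phi> z) - (LINT z:{0<..<T} \<times> UNIV|\<nu>. \<phi> z)"
    using divergence smooth_supported_test_function[OF \<phi> ac] unfolding has_divergence_measure_def by blast
  moreover have "(LINT z:{0<..<T} \<times> UNIV|lebesgue. b (fst z) (snd z) \<bullet> px z) = (LINT z|lborel. b (fst z) (snd z) \<bullet> px z)"
    by (rule integral_lebesgue_vanishing) (use zero_outside in auto)
  ultimately show ?thesis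
    using zero_outside by (simp add: gradient_eq set_integral_vanishing div_b_def)
qed

lemma equation_lborel:
  "(LINT z|lborel. u (fst z) (snd z) * pt z) - (LINT z|lborel. u (fst z) (snd z) * (b (fst z) (snd z) \<bullet> px z))
    = div_b (\<lambda>z. u (fst z) (snd z) * \<phi> z)"
proof -
  have "(LINT z:{0<..<T} \<times> UNIV|lebesgue. u (fst z) (snd z) * pt z) = (LINT z|lborel. u (fst z) (snd z) * pt z)"
    by (rule integral_lebesgue_vanishing) (use zero_outside in auto)
  moreover have "(LINT z:{0<..<T} \<times> UNIV|lebesgue. u (fst z) (snd z) * (b (fst z) (snd z) \<bullet> px z))
      = (LINT z|lborel. u (fst z) (snd z) * (b (fst z) (snd z) \<bullet> px z))"
    by (rule integral_lebesgue_vanishing) (use zero_outside in auto)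
  ultimately show ?thesis
    using equation[OF smooth_supported_test_function[OF \<phi> ac]] zero_outside
    by (simp add: gradient_eq set_integral_vanishing div_b_def)
qed

lemma gradient_bound: obtains L where "0 \<le> L" "\<And>z. norm (\<phi> z) \<le> L" "\<And>z. norm (pt z) \<le> L" "\<And>z. norm (px z) \<le> L"
proof -
  have K: "compact ({a..c} \<times> cball (0::'a) r)" by (intro compact_Times) auto
  have cont: "continuous_on ({a..c} \<times> cball 0 r) \<phi>" "continuous_on ({a..c} \<times> cball 0 r) pt" "continuous_on ({a..c} \<times> cball 0 r) px"
    using smooth_supported_continuous[OF \<phi>] smooth_supportedD(3,4)[OF \<phi>] by (auto intro: continuous_on_subset)
  obtain L1 where L1: "0 \<le> L1" "\<And>z. z \<in> {a..c} \<times> cball 0 r \<Longrightarrow> norm (\<phi> z) \<le> L1"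
    using compact_continuous_norm_bound[OF cont(1) K] by metis
  obtain L2 where L2: "0 \<le> L2" "\<And>z. z \<in> {a..c} \<times> cball 0 r \<Longrightarrow> norm (pt z) \<le> L2"
    using compact_continuous_norm_bound[OF cont(2) K] by metis
  obtain L3 where L3: "0 \<le> L3" "\<And>z. z \<in> {a..c} \<times> cball 0 r \<Longrightarrow> norm (px z) \<le> L3"
    using compact_continuous_norm_bound[OF cont(3) K] by metis
  have "norm (\<phi> z) \<le> L1 + L2 + L3 \<and> norm (pt z) \<le> L1 + L2 + L3 \<and> norm (px z) \<le> L1 + L2 + L3" for z
  proof (cases "z \<in> {a..c} \<times> cball 0 r")
    case True
    then show ?thesis using L1(1) L2(1) L3(1) L1(2)[OF True] L2(2)[OF True] L3(2)[OF True] by linarith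
  next
    case False
    then have "\<phi> z = 0" "pt z = 0" "px z = 0" using smooth_supportedD(5)[OF \<phi> False] smooth_supported_gradient_zero[OF \<phi> False] by auto
    then show ?thesis using L1 L2 L3 by simp
  qed
  then show ?thesis using that[of "L1 + L2 + L3"] L1 L2 L3 by auto
qed

lemma integrable_supported:
  fixes f :: "real \<times> 'a \<Rightarrow> real"
  assumes "f \<in> borel_measurable borel" and g: "integrable lborel g" and le: "\<And>t x. t \<in> {a..c} \<Longrightarrow> norm x \<le> r \<Longrightarrow> \<bar>f (t, x)\<bar> \<le> g t"
    and 0: "\<And>z. \<phi> z = 0 \<Longrightarrow> px z = 0 \<Longrightarrow> pt z = 0 \<Longrightarrow> f z = 0"
  shows "integrable lborel f"
proof (rule integrable_pair_bound[where r = r and g = "\<lambda>t. \<bar>g t\<bar>"])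
  show "norm (f (t, x)) \<le> \<bar>g t\<bar> * indicator (cball 0 r) x" for t x
  proof (cases "(t, x) \<in> {a..c} \<times> cball 0 r")
    case True
    then show ?thesis using le[of t x] by auto
  next
    case False
    then have "f (t, x) = 0"
      using smooth_supportedD(5)[OF \<phi> False] smooth_supported_gradient_zero[OF \<phi> False] by (intro 0)
    then show ?thesis by simp
  qed
qed (use assms in auto)

lemma integrable_b_px:
  assumes g: "g \<in> borel_measurable borel" and gle: "\<And>z. z \<in> {a..c} \<times> cball 0 r \<Longrightarrow> \<bar>g z\<bar> \<le> G"
  shows "integrable lborel (\<lambda>z. g z * (b (fst z) (snd z) \<bullet> px z))"
proof -
  obtain L where L: "0 \<le> L" "\<And>z. norm (px z) \<le> L" using gradient_bound by metis
  show ?thesis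
  proof (rule integrable_supported)
    show "integrable lborel (\<lambda>t. \<bar>G\<bar> * (C0 t * (1 + \<bar>r\<bar>) * L))" using C0_integrable by simp
    show "\<bar>g (t, x) * (b (fst (t, x)) (snd (t, x)) \<bullet> px (t, x))\<bar> \<le> \<bar>G\<bar> * (C0 t * (1 + \<bar>r\<bar>) * L)"
      if "t \<in> {a..c}" "norm x \<le> r" for t x
    proof -
      have "norm (b t x) \<le> C0 t * (1 + \<bar>r\<bar>)"
        by (rule order_trans[OF b_growth]) (use that C0_nonneg in \<open>auto intro!: mult_left_mono\<close>)
      then have "norm (b t x) * norm (px (t, x)) \<le> C0 t * (1 + \<bar>r\<bar>) * L"
        by (intro mult_mono L) (auto intro!: mult_nonneg_nonneg C0_nonneg)
      then have "\<bar>b t x \<bullet> px (t, x)\<bar> \<le> C0 t * (1 + \<bar>r\<bar>) * L"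
        using Cauchy_Schwarz_ineq2 order_trans by blast
      moreover have "\<bar>g (t, x)\<bar> \<le> \<bar>G\<bar>" using gle[of "(t, x)"] that by force
      ultimately show ?thesis by (auto simp: abs_mult intro!: mult_mono)
    qed
  qed (use g in auto)
qed

lemma integrable_C1: "integrable lborel (\<lambda>z. C1 (fst z) * \<phi> z)"
proof -
  obtain L where L: "0 \<le> L" "\<And>z. norm (\<phi> z) \<le> L" using gradient_bound by metis
  have "C1 \<in> borel_measurable borel" using C1_integrable by auto
  then have "(\<lambda>z::real \<times> 'a. C1 (fst z)) \<in> borel_measurable borel"
    by (rule measurable_compose[rotated]) (intro borel_measurable_continuous_onI continuous_intros)
  then have "(\<lambda>z. C1 (fst z) * \<phi> z) \<in> borel_measurable borel"
    using measurable_gradient(1) by (rule borel_measurable_times)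
  then show ?thesis
    by (rule integrable_supported[where g = "\<lambda>t. C1 t * L"])
       (use C1_integrable L in \<open>auto simp: abs_mult C1_nonneg intro!: mult_mono\<close>)
qed

text \<open>On each time slice \<open>b t\<close> is a continuous one-sided Lipschitz field with
  constant \<open>C1 t\<close>; the inequality for such fields is integrated in time.\<close>

lemma div_b_one_sided:
  assumes nn: "\<And>z. 0 \<le> \<phi> z"
  shows "0 \<le> div_b \<phi> + DIM('a) * (LINT z|lborel. C1 (fst z) * \<phi> z)"
proof -
  have i1: "integrable lborel (\<lambda>z. b (fst z) (snd z) \<bullet> px z)"
    using integrable_b_px[of "\<lambda>_. 1" 1] by simp
  have "(LINT z|lborel. b (fst z) (snd z) \<bullet> px z) = (LINT t|lborel. LINT x|lborel. b t x \<bullet> px (t, x))"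
    using integral_lborel_pair(1)[OF i1] by simp
  also have "\<dots> \<le> (LINT t|lborel. DIM('a) * (LINT x|lborel. C1 t * \<phi> (t, x)))"
  proof (rule integral_mono)
    show "integrable lborel (\<lambda>t. LINT x|lborel. b t x \<bullet> px (t, x))"
      using integral_lborel_pair(2)[OF i1] by simp
    show "integrable lborel (\<lambda>t. real DIM('a) * (LINT x|lborel. C1 t * \<phi> (t, x)))"
      using integral_lborel_pair(2)[OF integrable_C1] by simp
    fix t
    have "(LINT x|lborel. b t x \<bullet> px (t, x)) \<le> DIM('a) * C1 t * (LINT x|lborel. \<phi> (t, x))"
    proof (rule one_sided_divergence_le[OF b_continuous b_one_sided, where r = r])
      show "GDERIV (\<lambda>x. \<phi> (t, x)) x :> px (t, x)" for x
        by (rule GDERIV_slice[OF smooth_supportedD(2)[OF \<phi>]])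
      show "continuous_on UNIV (\<lambda>x. px (t, x))"
        using smooth_supportedD(4)[OF \<phi>] by (auto intro!: continuous_on_compose2[of UNIV px] continuous_intros)
      show "\<phi> (t, x) = 0" if "r < norm x" for x
        using smooth_supportedD(5)[OF \<phi>, of "(t, x)"] that by auto
    qed (use nn in auto)
    then show "(LINT x|lborel. b t x \<bullet> px (t, x)) \<le> DIM('a) * (LINT x|lborel. C1 t * \<phi> (t, x))"
      by simp
  qed
  also have "\<dots> = DIM('a) * (LINT z|lborel. C1 (fst z) * \<phi> z)"
    using integral_lborel_pair(1)[OF integrable_C1] by simp
  finally show ?thesis by (simp add: div_b_eq)
qed

end

lemma integrable_measure:
  assumes K: "compact K" "K \<subseteq> {0<..<T} \<times> UNIV" and f: "continuous_on UNIV f" and 0: "\<And>z. z \<notin> K \<Longrightarrow> f z = (0::real)"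
  shows "integrable \<mu> f" "integrable \<nu> f"
proof -
  obtain L where L: "0 \<le> L" "\<And>z. z \<in> K \<Longrightarrow> norm (f z) \<le> L"
    using compact_continuous_norm_bound[OF continuous_on_subset[OF f subset_UNIV] K(1)] by metis
  have *: "integrable M f" if "sets M = sets borel" "emeasure M K < \<infinity>" for M
  proof (rule Bochner_Integration.integrable_bound)
    have "K \<in> sets M" using K that by (simp add: compact_imp_closed)
    then show "integrable M (\<lambda>z. L * indicator K z)"
      using that by (intro integrable_mult_right integrable_real_indicator) (auto simp: top.not_eq_extremum)
    have "f \<in> borel_measurable borel" using f by (rule borel_measurable_continuous_onI)
    then show "f \<in> borel_measurable M" using measurable_cong_sets[OF that(1) refl] by blast
    show "AE z in M. norm (f z) \<le> norm (L * indicator K z)"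
      using L 0 by (intro AE_I2) (auto simp: indicator_def)
  qed
  then show "integrable \<mu> f" "integrable \<nu> f"
    using divergence K by (auto simp: has_divergence_measure_def)
qed

end

context distributional_transport
begin

text \<open>\<open>div b + d C\<^sub>1\<close> is a nonnegative functional on smooth functions. Since continuous \<open>g\<close> are uniform limits
  of polynomials on the compact \<open>K\<close>, it may also be tested with \<open>G \<plusminus> g\<close> times a smooth bump.\<close>

lemma div_b_bound:
  fixes G :: real and g :: "real \<times> 'a \<Rightarrow> real"
  assumes \<phi>: "smooth_supported a c r \<phi> pt px" and ac: "0 < a" "c < T" and nn: "\<And>z. 0 \<le> \<phi> z"
    and K: "compact K" "K \<subseteq> {0<..<T} \<times> UNIV" and 0: "\<And>z. z \<notin> K \<Longrightarrow> \<phi> z = 0"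
    and g: "continuous_on UNIV g" and gle: "\<And>z. z \<in> K \<Longrightarrow> \<bar>g z\<bar> \<le> G"
  shows "\<bar>div_b (\<lambda>z. g z * \<phi> z)\<bar> \<le> G * div_b \<phi> + 2 * DIM('a) * G * (LINT z|lborel. C1 (fst z) * \<phi> z)"
proof -
  define J where "J = (LINT z|lborel. C1 (fst z) * \<phi> z)"
  \<comment> \<open>The mass of \<open>\<phi>\<close> under \<mu> + \<nu>. It multiplies only the
    approximation error \<zeta>, so that being finite is enough: it disappears when \<zeta> tends to
    0.\<close>
  define Q where "Q = (LINT z|\<mu>. \<phi> z) + (LINT z|\<nu>. \<phi> z)"
  have J: "0 \<le> J" unfolding J_def by (intro Bochner_Integration.integral_nonneg) (use C1_nonneg nn in auto)
  have Q: "0 \<le> Q" unfolding Q_def by (intro add_nonneg_nonneg Bochner_Integration.integral_nonneg) (use nn in auto)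
  have cont\<phi>: "continuous_on UNIV \<phi>" by (rule smooth_supported_continuous[OF \<phi>])
  have int: "integrable \<mu> (\<lambda>z. f z * \<phi> z)" "integrable \<nu> (\<lambda>z. f z * \<phi> z)" if "continuous_on UNIV f" for f
    by (rule integrable_measure[OF K], intro continuous_intros that cont\<phi>, use 0 in simp)+
  have int\<phi>: "integrable \<mu> \<phi>" "integrable \<nu> \<phi>"
    using int[of "\<lambda>_. 1"] by auto
  have approx: "\<bar>div_b (\<lambda>z. g z * \<phi> z)\<bar> \<le> (G + \<zeta>) * div_b \<phi> + 2 * DIM('a) * (G + \<zeta>) * J + \<zeta> * Q" if \<zeta>: "0 < \<zeta>" for \<zeta> :: real
  proof -
    obtain p where p: "real_polynomial_function p" and pg: "\<And>z. z \<in> K \<Longrightarrow> \<bar>g z - p z\<bar> < \<zeta>"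
      using Stone_Weierstrass_real_polynomial_function[of K g \<zeta>] K(1) continuous_on_subset[OF g subset_UNIV, of K] \<zeta> by metis
    have contp: "continuous_on UNIV p"
      using continuously_differentiable_polynomial[OF p, of 0] by simp
    have one: "0 \<le> s * div_b (\<lambda>z. p z * \<phi> z) + (G + \<zeta>) * div_b \<phi> + 2 * DIM('a) * (G + \<zeta>) * J"
      if s: "s = 1 \<or> s = -1" for s :: real
    proof -
      \<comment> \<open>On \<open>K\<close> the polynomial satisfies |p| \<le> G + \<zeta>, so
        \<open>f\<close> lies between 0 and 2 (G + \<zeta>) there and \<open>f\<close> times the
        bump is a nonnegative test function. The two signs of \<open>s\<close> give the two halves
        of the bound on the absolute value.\<close>
      define f where "f z = s * p z + (G + \<zeta>)" for z
      have f: "real_polynomial_function f"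
        unfolding f_def by (intro real_polynomial_function.intros(2-4) p)
      have fK: "0 \<le> f z \<and> f z \<le> 2 * (G + \<zeta>)" if "z \<in> K" for z
        using pg[OF that] gle[OF that] s unfolding f_def by auto
      obtain qt qx where q: "smooth_supported a c r (\<lambda>z. f z * \<phi> z) qt qx"
        using smooth_supported_polynomial_mult[OF \<phi> f] by metis
      have fnn: "0 \<le> f z * \<phi> z" for z
        using fK[of z] nn[of z] 0[of z] by (cases "z \<in> K") auto
      have "0 \<le> div_b (\<lambda>z. f z * \<phi> z) + DIM('a) * (LINT z|lborel. C1 (fst z) * (f z * \<phi> z))"
        by (rule div_b_one_sided[OF q ac fnn])
      also have "(LINT z|lborel. C1 (fst z) * (f z * \<phi> z)) \<le> (LINT z|lborel. 2 * (G + \<zeta>) * (C1 (fst z) * \<phi> z))"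
      proof (rule integral_mono[OF integrable_C1[OF q ac]])
        show "integrable lborel (\<lambda>z. 2 * (G + \<zeta>) * (C1 (fst z) * \<phi> z))"
          using integrable_C1[OF \<phi> ac] by simp
        show "C1 (fst z) * (f z * \<phi> z) \<le> 2 * (G + \<zeta>) * (C1 (fst z) * \<phi> z)" for z
        proof (cases "z \<in> K")
          case True
          have "f z * (C1 (fst z) * \<phi> z) \<le> 2 * (G + \<zeta>) * (C1 (fst z) * \<phi> z)"
            using fK[OF True] nn C1_nonneg by (intro mult_right_mono) auto
          then show ?thesis by (simp add: mult_ac)
        qed (simp add: 0)
      qed
      also have "\<dots> = 2 * (G + \<zeta>) * J" by (simp add: J_def)
      also have "div_b (\<lambda>z. f z * \<phi> z) = s * div_b (\<lambda>z. p z * \<phi> z) + (G + \<zeta>) * div_b \<phi>"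
        using int[OF contp] int\<phi> by (simp add: div_b_def f_def distrib_right mult.assoc) (simp add: algebra_simps)
      finally show ?thesis by (simp add: algebra_simps)
    qed
    have "\<bar>div_b (\<lambda>z. p z * \<phi> z)\<bar> \<le> (G + \<zeta>) * div_b \<phi> + 2 * DIM('a) * (G + \<zeta>) * J"
      using one[of 1] one[of "-1"] by auto
    moreover have "\<bar>div_b (\<lambda>z. g z * \<phi> z) - div_b (\<lambda>z. p z * \<phi> z)\<bar> \<le> \<zeta> * Q"
    proof -
      have *: "\<bar>(LINT z|M. g z * \<phi> z) - (LINT z|M. p z * \<phi> z)\<bar> \<le> \<zeta> * (LINT z|M. \<phi> z)"
        if i: "integrable M (\<lambda>z. g z * \<phi> z)" "integrable M (\<lambda>z. p z * \<phi> z)" "integrable M \<phi>" for M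
      proof -
        have "\<bar>(LINT z|M. g z * \<phi> z) - (LINT z|M. p z * \<phi> z)\<bar> = \<bar>LINT z|M. g z * \<phi> z - p z * \<phi> z\<bar>"
          using i by simp
        also have "\<dots> \<le> (LINT z|M. \<bar>g z * \<phi> z - p z * \<phi> z\<bar>)" by (rule integral_abs_bound)
        also have "\<dots> \<le> (LINT z|M. \<zeta> * \<phi> z)"
        proof (rule integral_mono)
          show "\<bar>g z * \<phi> z - p z * \<phi> z\<bar> \<le> \<zeta> * \<phi> z" for z
          proof (cases "z \<in> K")
            case True
            have "\<bar>g z - p z\<bar> * \<phi> z \<le> \<zeta> * \<phi> z" using pg[OF True] nn[of z] by (intro mult_right_mono) auto
            moreover have "\<bar>g z * \<phi> z - p z * \<phi> z\<bar> = \<bar>g z - p z\<bar> * \<phi> z"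
              using nn[of z] by (simp flip: left_diff_distrib add: abs_mult)
            ultimately show ?thesis by simp
          qed (simp add: 0)
        qed (use i in auto)
        finally show ?thesis by simp
      qed
      show ?thesis
        using *[OF int(1)[OF g] int(1)[OF contp] int\<phi>(1)] *[OF int(2)[OF g] int(2)[OF contp] int\<phi>(2)]
        unfolding div_b_def Q_def distrib_left by linarith
    qed
    ultimately show ?thesis by linarith
  qed
  show ?thesis
  proof (rule field_le_epsilon)
    fix e :: real assume e: "0 < e"
    define D where "D = \<bar>div_b \<phi>\<bar> + 2 * DIM('a) * J + Q + 1"
    have D: "0 < D" using J Q by (auto simp: D_def intro!: add_nonneg_pos)
    define \<zeta> where "\<zeta> = e / D"
    have \<zeta>: "0 < \<zeta>" using e D by (simp add: \<zeta>_def)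
    have "\<zeta> * (div_b \<phi> + 2 * DIM('a) * J + Q) \<le> \<zeta> * D" using \<zeta> by (intro mult_left_mono) (auto simp: D_def)
    also have "\<dots> = e" using D by (simp add: \<zeta>_def)
    finally show "\<bar>div_b (\<lambda>z. g z * \<phi> z)\<bar> \<le> G * div_b \<phi> + 2 * DIM('a) * G * (LINT z|lborel. C1 (fst z) * \<phi> z) + e"
      using approx[OF \<zeta>] unfolding J_def[symmetric] by (simp add: algebra_simps)
  qed
qed

end

subsection \<open>The commutator estimate\<close>

text \<open>The usual mollifier profile of radius \<epsilon>, left unnormalized: its mass is carried
  along, and only the ratio of the integral of |\<open>Drho\<close>| to that mass matters in the
  end.\<close>

definition rho :: "real \<Rightarrow> 'a::euclidean_space \<Rightarrow> real" where
  "rho \<epsilon> w = bump0 (1 - (w \<bullet> w) / \<epsilon>\<^sup>2)"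

definition Drho :: "real \<Rightarrow> 'a::euclidean_space \<Rightarrow> 'a" where
  "Drho \<epsilon> w = (deriv bump0 (1 - (w \<bullet> w) / \<epsilon>\<^sup>2) * (- 2 / \<epsilon>\<^sup>2)) *\<^sub>R w"

lemma bump0_deriv:
  "(bump0 has_real_derivative deriv bump0 x) (at x)" "continuous_on UNIV (deriv bump0)"
proof -
  obtain f' where f': "\<And>x. (bump0 has_real_derivative f' x) (at x)" "continuous_on UNIV f'"
    using obtain_smooth_real_derivative[OF bump0_smooth] by metis
  then have "deriv bump0 = f'" by (auto simp: DERIV_imp_deriv)
  with f' show "(bump0 has_real_derivative deriv bump0 x) (at x)" "continuous_on UNIV (deriv bump0)"
    by auto
qed

lemma bump0_deriv_neg: "x < 0 \<Longrightarrow> deriv bump0 x = 0"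
proof (rule DERIV_imp_deriv)
  assume "x < 0"
  have "\<forall>\<^sub>F y in nhds x. bump0 y = 0"
    by (rule eventually_mono[OF eventually_nhds_in_open[of "{..<0}" x]]) (use \<open>x < 0\<close> in \<open>auto simp: bump0_def\<close>)
  from DERIV_cong_ev[OF refl this refl, of 0] show "(bump0 has_real_derivative 0) (at x)" by simp
qed

lemma rho_continuous: "continuous_on S (rho \<epsilon>)"
  unfolding rho_def[abs_def] divide_inverse
  using bump0_smooth[of 0] by (auto intro!: continuous_intros continuous_on_compose2[of UNIV bump0])

lemma Drho_continuous: "continuous_on S (Drho \<epsilon>)"
  unfolding Drho_def[abs_def] divide_inverse
  by (auto intro!: continuous_intros continuous_on_compose2[OF bump0_deriv(2)])

lemma rho_nonneg: "0 \<le> rho \<epsilon> w"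
  by (simp add: rho_def bump0_nonneg)

lemma rho_outside: "0 < \<epsilon> \<Longrightarrow> \<epsilon> < norm w \<Longrightarrow> rho \<epsilon> w = 0"
  and Drho_outside: "0 < \<epsilon> \<Longrightarrow> \<epsilon> < norm w \<Longrightarrow> Drho \<epsilon> w = 0"
proof -
  assume "0 < \<epsilon>" "\<epsilon> < norm w"
  then have "\<epsilon>\<^sup>2 < (norm w)\<^sup>2" by (intro power_strict_mono) auto
  then have "1 - (w \<bullet> w) / \<epsilon>\<^sup>2 < 0" using \<open>0 < \<epsilon>\<close> by (simp add: field_simps power2_norm_eq_inner)
  then show "rho \<epsilon> w = 0" "Drho \<epsilon> w = 0"
    by (simp_all add: rho_def Drho_def bump0_eq_0 bump0_deriv_neg)
qed

lemma rho_has_derivative: "(rho \<epsilon> has_derivative (\<lambda>h. h \<bullet> Drho \<epsilon> w)) (at w)"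
proof -
  have "((\<lambda>w. 1 - (w \<bullet> w) / \<epsilon>\<^sup>2) has_derivative (\<lambda>h. - (2 * (h \<bullet> w)) / \<epsilon>\<^sup>2)) (at w)"
    by (auto intro!: derivative_eq_intros simp: inner_commute divide_inverse algebra_simps)
  from has_derivative_compose[OF this bump0_deriv(1)[unfolded has_field_derivative_def]]
  show ?thesis
    unfolding rho_def[abs_def] Drho_def by (rule has_derivative_eq_rhs) (auto simp: fun_eq_iff)
qed

lemma rho_GDERIV: "GDERIV (\<lambda>z. rho \<epsilon> (z - x)) z :> Drho \<epsilon> (z - x)"
  unfolding gderiv_def
  by (rule has_derivative_eq_rhs[OF has_derivative_compose[OF _ rho_has_derivative]])
     (auto intro!: derivative_eq_intros)

lemma rho_integrable: "0 < \<epsilon> \<Longrightarrow> integrable lborel (rho \<epsilon>)"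
  and norm_Drho_integrable: "0 < \<epsilon> \<Longrightarrow> integrable lborel (\<lambda>w. norm (Drho \<epsilon> w))"
  by (auto intro!: integrable_continuous_compact_support[where r = \<epsilon>] rho_continuous Drho_continuous continuous_intros
      simp: rho_outside Drho_outside)

lemma integrable_indicator_cball [simp]: "integrable lborel (indicator (cball (c::'a::euclidean_space) r) :: 'a \<Rightarrow> real)"
  using emeasure_bounded_finite[OF bounded_cball[of c r]] by (intro integrable_real_indicator) (auto simp: top.not_eq_extremum)

text \<open>\<open>Drho\<close> has size at most 2 m / \<epsilon> on the ball of radius \<epsilon>,
  while \<open>rho\<close> is bounded below on the ball of radius \<epsilon> / 2; the two volumes
  differ by a factor depending on the dimension only.\<close>

lemma rho_integral_bounds:
  obtains Cb where "0 \<le> Cb" "\<And>\<epsilon>. 0 < \<epsilon> \<Longrightarrow> (LINT w|lborel. norm (Drho \<epsilon> (w::'a::euclidean_space))) \<le> Cb / \<epsilon> * (LINT w|lborel. rho \<epsilon> (w::'a))"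
    "\<And>\<epsilon>. 0 < \<epsilon> \<Longrightarrow> 0 < (LINT w|lborel. rho \<epsilon> (w::'a))"
proof -
  obtain m where m: "0 \<le> m" "\<And>x. x \<in> {0..1} \<Longrightarrow> norm (deriv bump0 x) \<le> m"
    using compact_continuous_norm_bound[OF continuous_on_subset[OF bump0_deriv(2) subset_UNIV] compact_Icc] by metis
  define v where "v = unit_ball_vol (DIM('a))"
  define d where "d = DIM('a)"
  \<comment> \<open>The value of the profile on the sphere of radius \<epsilon> / 2, where |w|^2 /
    \<epsilon>^2 = 1/4.\<close>
  define \<kappa> where "\<kappa> = bump0 (3/4)"
  have \<kappa>: "0 < \<kappa>" by (simp add: \<kappa>_def bump0_pos)
  have v: "0 < v" by (simp add: v_def)
  have 1: "(LINT w|lborel. norm (Drho \<epsilon> (w::'a))) \<le> 2 * m / \<epsilon> * (v * \<epsilon> ^ d)" if \<epsilon>: "0 < \<epsilon>" for \<epsilon>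
  proof -
    have "norm (Drho \<epsilon> w) \<le> 2 * m / \<epsilon> * indicator (cball (0::'a) \<epsilon>) w" for w :: 'a
    proof (cases "norm w \<le> \<epsilon>")
      case True
      have "(norm w)\<^sup>2 \<le> \<epsilon>\<^sup>2" using True by (intro power_mono) auto
      then have "1 - (w \<bullet> w) / \<epsilon>\<^sup>2 \<in> {0..1}" using \<epsilon> by (simp add: field_simps power2_norm_eq_inner)
      from m(2)[OF this] have "\<bar>deriv bump0 (1 - (w \<bullet> w) / \<epsilon>\<^sup>2)\<bar> * norm w \<le> m * \<epsilon>"
        using True m(1) by (intro mult_mono) auto
      then have "2 / \<epsilon>\<^sup>2 * (\<bar>deriv bump0 (1 - (w \<bullet> w) / \<epsilon>\<^sup>2)\<bar> * norm w) \<le> 2 / \<epsilon>\<^sup>2 * (m * \<epsilon>)"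
        by (intro mult_left_mono) auto
      also have "\<dots> = 2 * m / \<epsilon>" using \<epsilon> by (simp add: power2_eq_square)
      finally show ?thesis using True by (simp add: Drho_def abs_mult mult_ac)
    qed (use \<epsilon> in \<open>simp add: Drho_outside\<close>)
    then have "(LINT w|lborel. norm (Drho \<epsilon> (w::'a))) \<le> (LINT w|lborel. 2 * m / \<epsilon> * indicator (cball (0::'a) \<epsilon>) w)"
      by (intro integral_mono norm_Drho_integrable \<epsilon> integrable_mult_right integrable_indicator_cball)
    also have "\<dots> = 2 * m / \<epsilon> * (v * \<epsilon> ^ d)" using \<epsilon> content_cball[of \<epsilon> "0::'a"] by (simp add: v_def d_def)
    finally show ?thesis .
  qed
  have 2: "\<kappa> * (v * (\<epsilon> / 2) ^ d) \<le> (LINT w|lborel. rho \<epsilon> (w::'a))" if \<epsilon>: "0 < \<epsilon>" for \<epsilon>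
  proof -
    have "\<kappa> * indicator (cball (0::'a) (\<epsilon> / 2)) w \<le> rho \<epsilon> w" for w :: 'a
    proof (cases "norm w \<le> \<epsilon> / 2")
      case True
      have "(norm w)\<^sup>2 \<le> (\<epsilon> / 2)\<^sup>2" using True by (intro power_mono) auto
      then have "3/4 \<le> 1 - (w \<bullet> w) / \<epsilon>\<^sup>2" using \<epsilon> by (simp add: field_simps power2_norm_eq_inner)
      then show ?thesis using True by (simp add: rho_def \<kappa>_def bump0_mono)
    qed (simp add: rho_nonneg)
    then have "(LINT w|lborel. \<kappa> * indicator (cball (0::'a) (\<epsilon> / 2)) w) \<le> (LINT w|lborel. rho \<epsilon> (w::'a))"
      by (intro integral_mono rho_integrable \<epsilon> integrable_mult_right integrable_indicator_cball)
    then show ?thesis using \<epsilon> content_cball[of "\<epsilon> / 2" "0::'a"] by (simp add: v_def d_def)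
  qed
  show ?thesis
  proof (rule that[of "2 * m * 2 ^ d / \<kappa>"])
    show "0 \<le> 2 * m * 2 ^ d / \<kappa>" using m \<kappa> by simp
    fix \<epsilon> :: real assume \<epsilon>: "0 < \<epsilon>"
    have "2 * m / \<epsilon> * (v * \<epsilon> ^ d) = 2 * m * 2 ^ d / \<kappa> / \<epsilon> * (\<kappa> * (v * (\<epsilon> / 2) ^ d))"
      using \<kappa> \<epsilon> by (simp add: power_divide)
    also have "\<dots> \<le> 2 * m * 2 ^ d / \<kappa> / \<epsilon> * (LINT w|lborel. rho \<epsilon> (w::'a))"
      using \<kappa> \<epsilon> m by (intro mult_left_mono 2) auto
    finally show "(LINT w|lborel. norm (Drho \<epsilon> (w::'a))) \<le> 2 * m * 2 ^ d / \<kappa> / \<epsilon> * (LINT w|lborel. rho \<epsilon> (w::'a))"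
      using 1[OF \<epsilon>] by linarith
    have "0 < \<kappa> * (v * (\<epsilon> / 2) ^ d)" using \<kappa> v \<epsilon> by simp
    then show "0 < (LINT w|lborel. rho \<epsilon> (w::'a))" using 2[OF \<epsilon>] by linarith
  qed
qed

text \<open>A constant field satisfies the one-sided condition with constant 0; applying the
  divergence inequality to \<open>v\<close> and to \<open>- v\<close> gives equality.\<close>

lemma integral_inner_Drho: 
  assumes "0 < \<epsilon>" shows "(LINT z|lborel. v \<bullet> Drho \<epsilon> (z - x)) = 0"
proof -
  have out: "rho \<epsilon> (z - x) = 0" if "\<epsilon> + norm x < norm z" for z
    using that norm_triangle_ineq[of "z - x" x] assms by (intro rho_outside) auto
  have cont: "continuous_on UNIV (\<lambda>z. Drho \<epsilon> (z - x))"
    by (intro continuous_on_compose2[OF Drho_continuous[of UNIV]] continuous_intros) auto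
  have *: "(LINT z|lborel. v \<bullet> Drho \<epsilon> (z - x)) \<le> 0" for v
    using one_sided_divergence_le[of "\<lambda>_. v" 0 "\<lambda>z. rho \<epsilon> (z - x)" "\<lambda>z. Drho \<epsilon> (z - x)" "\<epsilon> + norm x",
        OF _ _ rho_GDERIV cont rho_nonneg out]
    by (auto intro!: continuous_intros)
  show ?thesis using *[of v] *[of "- v"] by simp
qed

text \<open>For a polynomial curve the argument of \<open>bump0\<close> is a polynomial in (t, x),
  so the moving bump is smooth to every order without further work.\<close>

lemma real_polynomial_function_norm_path:
  fixes X :: "real \<Rightarrow> 'a::euclidean_space"
  assumes "polynomial_function X"
  shows "real_polynomial_function (\<lambda>z. 1 - ((snd z - X (fst z)) \<bullet> (snd z - X (fst z))) / \<epsilon>\<^sup>2)"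
proof -
  have *: "real_polynomial_function (\<lambda>z::real \<times> 'a. (snd z - X (fst z)) \<bullet> i)" if "i \<in> Basis" for i
  proof -
    have "real_polynomial_function (\<lambda>t. X t \<bullet> i)"
      using assms that by (simp add: polynomial_function_iff_Basis_inner)
    then have "real_polynomial_function ((\<lambda>t. X t \<bullet> i) \<circ> (fst :: real \<times> 'a \<Rightarrow> real))"
      by (intro real_polynomial_function_compose) (auto simp: polynomial_function_bounded_linear bounded_linear_fst)
    moreover have "real_polynomial_function (\<lambda>z::real \<times> 'a. snd z \<bullet> i)"
      by (intro real_polynomial_function.intros(1) bounded_linear_compose[OF bounded_linear_inner_left bounded_linear_snd])
    ultimately show ?thesis
      by (simp add: inner_diff_left o_def real_polynomial_function_diff)
  qed
  have "real_polynomial_function (\<lambda>z::real \<times> 'a. 1 - (\<Sum>i\<in>Basis. ((snd z - X (fst z)) \<bullet> i) * ((snd z - X (fst z)) \<bullet> i)) * inverse (\<epsilon>\<^sup>2))"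
    by (intro real_polynomial_function_diff real_polynomial_function.intros(2,4) real_polynomial_function_sum *) auto
  then show ?thesis
    by (simp only: euclidean_inner[symmetric] divide_inverse)
qed

text \<open>The time derivative falls on the cutoff and on the moving centre. The second
  contribution carries X' paired with \<open>Drho\<close>; in the equation it joins the term with b
  to form the defect X' + b.\<close>

lemma moving_bump_smooth:
  fixes X :: "real \<Rightarrow> 'a::euclidean_space"
  assumes X: "polynomial_function X" "\<And>t. (X has_vector_derivative X' t) (at t)" and contX': "continuous_on UNIV X'"
    and \<eta>: "\<And>k. continuously_differentiable k \<eta>" "\<And>t. (\<eta> has_real_derivative \<eta>' t) (at t)" and cont\<eta>': "continuous_on UNIV \<eta>'"
    and supp: "\<And>t. t \<notin> {a..c} \<Longrightarrow> \<eta> t = 0" and r: "\<And>t. t \<in> {a..c} \<Longrightarrow> norm (X t) + \<epsilon> \<le> r" and \<epsilon>: "0 < \<epsilon>"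
  shows "smooth_supported a c r (\<lambda>z. \<eta> (fst z) * rho \<epsilon> (snd z - X (fst z)))
     (\<lambda>z. \<eta>' (fst z) * rho \<epsilon> (snd z - X (fst z)) - \<eta> (fst z) * (X' (fst z) \<bullet> Drho \<epsilon> (snd z - X (fst z))))
     (\<lambda>z. \<eta> (fst z) *\<^sub>R Drho \<epsilon> (snd z - X (fst z)))"
proof -
  have contX: "continuous_on UNIV X"
    using X(2) by (auto simp: continuous_on_eq_continuous_at intro: has_vector_derivative_continuous)
  have cont\<eta>: "continuous_on UNIV \<eta>" using \<eta>(1)[of 0] by simp
  have 1: "continuously_differentiable k (\<lambda>z::real \<times> 'a. \<eta> (fst z) * rho \<epsilon> (snd z - X (fst z)))" for k
  proof (rule continuously_differentiable_mult)
    show "continuously_differentiable k (\<lambda>z::real \<times> 'a. \<eta> (fst z))"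
      by (intro continuously_differentiable_compose[OF \<eta>(1)] continuously_differentiable_linear bounded_linear_fst)
    show "continuously_differentiable k (\<lambda>z::real \<times> 'a. rho \<epsilon> (snd z - X (fst z)))"
      unfolding rho_def
      by (intro continuously_differentiable_compose[OF bump0_smooth] continuously_differentiable_polynomial
          real_polynomial_function_norm_path[OF X(1)])
  qed
  have 2: "GDERIV (\<lambda>z. \<eta> (fst z) * rho \<epsilon> (snd z - X (fst z))) z :>
     (\<eta>' (fst z) * rho \<epsilon> (snd z - X (fst z)) - \<eta> (fst z) * (X' (fst z) \<bullet> Drho \<epsilon> (snd z - X (fst z))),
      \<eta> (fst z) *\<^sub>R Drho \<epsilon> (snd z - X (fst z)))" for z
  proof -
    have d1: "((\<lambda>z::real \<times> 'a. \<eta> (fst z)) has_derivative (\<lambda>h. \<eta>' (fst z) * fst h)) (at z)"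
      by (rule has_derivative_compose[OF _ \<eta>(2)[unfolded has_field_derivative_def]]) (auto intro!: derivative_eq_intros)
    have "((\<lambda>z::real \<times> 'a. X (fst z)) has_derivative (\<lambda>h. fst h *\<^sub>R X' (fst z))) (at z)"
      by (rule has_derivative_compose[OF _ X(2)[unfolded has_vector_derivative_def]]) (auto intro!: derivative_eq_intros)
    then have "((\<lambda>z::real \<times> 'a. snd z - X (fst z)) has_derivative (\<lambda>h. snd h - fst h *\<^sub>R X' (fst z))) (at z)"
      by (auto intro!: derivative_eq_intros)
    from has_derivative_compose[OF this rho_has_derivative]
    have d2: "((\<lambda>z::real \<times> 'a. rho \<epsilon> (snd z - X (fst z))) has_derivative
       (\<lambda>h. (snd h - fst h *\<^sub>R X' (fst z)) \<bullet> Drho \<epsilon> (snd z - X (fst z)))) (at z)" .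
    show ?thesis
      unfolding gderiv_def
      by (rule has_derivative_eq_rhs[OF has_derivative_mult[OF d1 d2]])
         (auto simp: fun_eq_iff inner_prod_def inner_diff_left algebra_simps)
  qed
  have [continuous_intros]: "continuous_on S (\<lambda>z. f (fst z))" if "continuous_on UNIV f" for f :: "real \<Rightarrow> 'b::topological_space" and S :: "(real \<times> 'a) set"
    using that by (auto intro!: continuous_on_compose2[of UNIV f] continuous_intros)
  have [continuous_intros]: "continuous_on UNIV (\<lambda>z::real \<times> 'a. rho \<epsilon> (snd z - X (fst z)))"
    by (rule continuous_on_compose2[OF rho_continuous[of UNIV]]) (auto intro!: continuous_intros contX)
  have [continuous_intros]: "continuous_on UNIV (\<lambda>z::real \<times> 'a. Drho \<epsilon> (snd z - X (fst z)))"
    by (rule continuous_on_compose2[OF Drho_continuous[of UNIV]]) (auto intro!: continuous_intros contX)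
  have 3: "\<eta> (fst z) * rho \<epsilon> (snd z - X (fst z)) = 0" if "z \<notin> {a..c} \<times> cball 0 r" for z
  proof (cases "fst z \<in> {a..c}")
    case True
    then have "r < norm (snd z)" using that by (cases z) auto
    then have "\<epsilon> < norm (snd z - X (fst z))" using r[OF True] norm_triangle_ineq[of "snd z - X (fst z)" "X (fst z)"] by simp
    then show ?thesis using \<epsilon> by (simp add: rho_outside)
  qed (simp add: supp)
  show ?thesis
    unfolding smooth_supported_def
    using 1 2 3 by (intro conjI allI impI continuous_intros contX' cont\<eta> cont\<eta>') auto
qed

context distributional_transport
begin

context
  fixes X X' :: "real \<Rightarrow> 'a" and \<epsilon> a c :: real and \<eta> \<eta>' :: "real \<Rightarrow> real"
  assumes X: "polynomial_function X" "\<And>t. (X has_vector_derivative X' t) (at t)" and contX': "continuous_on UNIV X'"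
    and \<eta>: "\<And>k. continuously_differentiable k \<eta>" "\<And>t. (\<eta> has_real_derivative \<eta>' t) (at t)" and cont\<eta>': "continuous_on UNIV \<eta>'"
    and supp: "\<And>t. t \<notin> {a..c} \<Longrightarrow> \<eta> t = 0" and nn: "\<And>t. 0 \<le> \<eta> t"
    and ac: "0 < a" "c < T" and \<epsilon>: "0 < \<epsilon>"
begin

lemma path_continuous: "continuous_on UNIV X"
  using X(2) by (auto simp: continuous_on_eq_continuous_at intro: has_vector_derivative_continuous)

lemma cutoff_deriv_zero: "t \<notin> {a..c} \<Longrightarrow> \<eta>' t = 0"
proof -
  assume t: "t \<notin> {a..c}"
  have "\<forall>\<^sub>F y in nhds t. \<eta> y = 0"
    by (rule eventually_mono[OF eventually_nhds_in_open[of "- {a..c}" t]]) (use t supp in auto)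
  from DERIV_cong_ev[OF refl this refl, of 0] have "(\<eta> has_real_derivative 0) (at t)" by simp
  then show ?thesis using \<eta>(2) DERIV_unique by blast
qed

lemma cutoff_integrable:
  assumes "f \<in> borel_measurable borel" "integrable lborel w" "\<And>t. t \<in> {a..c} \<Longrightarrow> \<bar>f t\<bar> \<le> w t"
  shows "integrable lborel (\<lambda>t. \<eta> t * f t)"
proof -
  have cont\<eta>: "continuous_on UNIV \<eta>" using \<eta>(1)[of 0] by simp
  obtain L where L: "0 \<le> L" "\<And>t. t \<in> {a..c} \<Longrightarrow> norm (\<eta> t) \<le> L"
    using compact_continuous_norm_bound[OF continuous_on_subset[OF cont\<eta> subset_UNIV] compact_Icc] by metis
  have [measurable]: "\<eta> \<in> borel_measurable borel" "f \<in> borel_measurable borel"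
    using cont\<eta> assms by (auto intro: borel_measurable_continuous_onI)
  show ?thesis
  proof (rule Bochner_Integration.integrable_bound)
    show "integrable lborel (\<lambda>t. L * w t)" using assms by simp
    show "AE t in lborel. norm (\<eta> t * f t) \<le> norm (L * w t)"
    proof (rule AE_I2)
      fix t show "norm (\<eta> t * f t) \<le> norm (L * w t)"
      proof (cases "t \<in> {a..c}")
        case True
        have "norm (\<eta> t * f t) \<le> L * w t" using L(2)[OF True] L(1) assms(3)[OF True] by (auto simp: abs_mult intro!: mult_mono)
        then show ?thesis by simp
      qed (simp add: supp)
    qed
  qed auto
qed

lemma defect_measurable: "(\<lambda>t. norm (X' t + b t (X t))) \<in> borel_measurable borel"
proof -
  have "(\<lambda>t. b t (X t)) \<in> borel_measurable borel"
    using path_continuous by (intro b_compose_borel borel_measurable_continuous_onI) auto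
  from measurable_compose[OF borel_measurable_add[OF borel_measurable_continuous_onI[OF contX'] this] borel_measurable_norm] show ?thesis .
qed

lemma cutoff_integrables:
  "integrable lborel (\<lambda>t. \<eta> t)" "integrable lborel (\<lambda>t. \<eta> t * C1 t)" "integrable lborel (\<lambda>t. \<eta> t * norm (X' t + b t (X t)))"
  "integrable lborel (\<lambda>t. \<eta>' t)" "integrable lborel (\<lambda>t. f t * \<eta>' t)" if "continuous_on UNIV f" for f :: "real \<Rightarrow> real"
proof -
  have "\<eta>' t = 0" if "max \<bar>a\<bar> \<bar>c\<bar> < norm t" for t using that by (intro cutoff_deriv_zero) auto
  then show "integrable lborel (\<lambda>t. \<eta>' t)" "integrable lborel (\<lambda>t. f t * \<eta>' t)"
    using \<open>continuous_on UNIV f\<close> cont\<eta>' by (auto intro!: integrable_continuous_compact_support[where r = "max \<bar>a\<bar> \<bar>c\<bar>"] continuous_intros)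
  have "\<eta> t = 0" if "max \<bar>a\<bar> \<bar>c\<bar> < norm t" for t using that by (intro supp) auto
  then show "integrable lborel (\<lambda>t. \<eta> t)"
    using \<eta>(1)[of 0] by (intro integrable_continuous_compact_support[where r = "max \<bar>a\<bar> \<bar>c\<bar>"]) auto
  show "integrable lborel (\<lambda>t. \<eta> t * C1 t)"
    by (rule cutoff_integrable[where w = C1]) (use C1_integrable C1_nonneg in auto)
  obtain L1 where L1: "0 \<le> L1" "\<And>t. t \<in> {a..c} \<Longrightarrow> norm (X t) \<le> L1"
    using compact_continuous_norm_bound[OF continuous_on_subset[OF path_continuous subset_UNIV] compact_Icc] by metis
  obtain L2 where L2: "0 \<le> L2" "\<And>t. t \<in> {a..c} \<Longrightarrow> norm (X' t) \<le> L2"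
    using compact_continuous_norm_bound[OF continuous_on_subset[OF contX' subset_UNIV] compact_Icc] by metis
  show "integrable lborel (\<lambda>t. \<eta> t * norm (X' t + b t (X t)))"
  proof (rule cutoff_integrable[OF defect_measurable])
    show "integrable lborel (\<lambda>t. L2 * indicator {a..c} t + C0 t * (1 + L1))"
      using C0_integrable by (intro Bochner_Integration.integrable_add integrable_mult_right integrable_mult_left integrable_real_indicator)
         (auto simp: emeasure_lborel_Icc_eq)
    show "\<bar>norm (X' t + b t (X t))\<bar> \<le> L2 * indicator {a..c} t + C0 t * (1 + L1)" if "t \<in> {a..c}" for t
    proof -
      have "norm (b t (X t)) \<le> C0 t * (1 + L1)"
        by (rule order_trans[OF b_growth]) (use L1(2)[OF that] C0_nonneg in \<open>auto intro!: mult_left_mono\<close>)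
      then show ?thesis using L2(2)[OF that] norm_triangle_ineq[of "X' t" "b t (X t)"] that by simp
    qed
  qed
qed

lemma slice_integrables:
  "integrable lborel (\<lambda>z. rho \<epsilon> (z - X t))" "integrable lborel (\<lambda>z. norm (Drho \<epsilon> (z - X t)))"
  "continuous_on UNIV f \<Longrightarrow> integrable lborel (\<lambda>z. f z * rho \<epsilon> (z - X t))"
  "continuous_on UNIV g \<Longrightarrow> integrable lborel (\<lambda>z. g z \<bullet> Drho \<epsilon> (z - X t))"
  "(LINT z|lborel. rho \<epsilon> (z - X t)) = (LINT z|lborel. rho \<epsilon> (z::'a))"
  "(LINT z|lborel. norm (Drho \<epsilon> (z - X t))) = (LINT z|lborel. norm (Drho \<epsilon> (z::'a)))"
proof -
  have far: "\<epsilon> < norm (z - X t)" if "\<epsilon> + norm (X t) < norm z" for z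
    using that norm_triangle_ineq[of "z - X t" "X t"] by simp
  have [continuous_intros]: "continuous_on UNIV (\<lambda>z. rho \<epsilon> (z - X t))" "continuous_on UNIV (\<lambda>z. Drho \<epsilon> (z - X t))"
    by (auto intro!: continuous_on_compose2[OF rho_continuous[of UNIV]] continuous_on_compose2[OF Drho_continuous[of UNIV]] continuous_intros)
  show "integrable lborel (\<lambda>z. rho \<epsilon> (z - X t))" "integrable lborel (\<lambda>z. norm (Drho \<epsilon> (z - X t)))"
    "continuous_on UNIV f \<Longrightarrow> integrable lborel (\<lambda>z. f z * rho \<epsilon> (z - X t))"
    "continuous_on UNIV g \<Longrightarrow> integrable lborel (\<lambda>z. g z \<bullet> Drho \<epsilon> (z - X t))"
    by (auto intro!: integrable_continuous_compact_support[where r = "\<epsilon> + norm (X t)"] continuous_intros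
        simp: far \<epsilon> rho_outside Drho_outside)
  have "rho \<epsilon> \<in> borel_measurable (borel :: 'a measure)" "(\<lambda>z. norm (Drho \<epsilon> z)) \<in> borel_measurable (borel :: 'a measure)"
    by (auto intro!: borel_measurable_continuous_onI continuous_intros rho_continuous Drho_continuous)
  from integral_translation_lborel[OF this(1), of "- X t"] integral_translation_lborel[OF this(2), of "- X t"]
  show "(LINT z|lborel. rho \<epsilon> (z - X t)) = (LINT z|lborel. rho \<epsilon> (z::'a))"
    "(LINT z|lborel. norm (Drho \<epsilon> (z - X t))) = (LINT z|lborel. norm (Drho \<epsilon> (z::'a)))"
    by simp_all
qed

text \<open>Since \<open>Drho\<close> has mean zero, \<open>b\<close> may be replaced by its deviation from \<open>- X'\<close>.\<close>

lemma slice_drift_bound: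
  assumes f: "continuous_on UNIV f" and F: "\<And>z. norm (z - X t) \<le> \<epsilon> \<Longrightarrow> \<bar>f z\<bar> \<le> F" and F0: "0 \<le> F"
  shows "\<bar>LINT z|lborel. (f z *\<^sub>R (X' t + b t z)) \<bullet> Drho \<epsilon> (z - X t)\<bar>
    \<le> F * ((norm (X' t + b t (X t)) + H * \<epsilon> powr \<alpha>) * (LINT z|lborel. norm (Drho \<epsilon> (z::'a))))"
proof -
  let ?E = "norm (X' t + b t (X t)) + H * \<epsilon> powr \<alpha>"
  have i: "integrable lborel (\<lambda>z. (f z *\<^sub>R (X' t + b t z)) \<bullet> Drho \<epsilon> (z - X t))"
    by (intro slice_integrables continuous_intros f b_continuous)
  have "\<bar>LINT z|lborel. (f z *\<^sub>R (X' t + b t z)) \<bullet> Drho \<epsilon> (z - X t)\<bar>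
      \<le> (LINT z|lborel. \<bar>(f z *\<^sub>R (X' t + b t z)) \<bullet> Drho \<epsilon> (z - X t)\<bar>)"
    by (rule integral_abs_bound)
  also have "\<dots> \<le> (LINT z|lborel. F * ?E * norm (Drho \<epsilon> (z - X t)))"
  proof (rule integral_mono)
    show "integrable lborel (\<lambda>z. \<bar>(f z *\<^sub>R (X' t + b t z)) \<bullet> Drho \<epsilon> (z - X t)\<bar>)" using i by (rule integrable_abs)
    show "integrable lborel (\<lambda>z. F * ?E * norm (Drho \<epsilon> (z - X t)))" by (intro integrable_mult_right slice_integrables)
    fix z
    show "\<bar>(f z *\<^sub>R (X' t + b t z)) \<bullet> Drho \<epsilon> (z - X t)\<bar> \<le> F * ?E * norm (Drho \<epsilon> (z - X t))"
    proof (cases "norm (z - X t) \<le> \<epsilon>")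
      case True
      have "norm (b t z - b t (X t)) \<le> H * \<epsilon> powr \<alpha>"
        by (rule order_trans[OF b_holder]) (use True \<alpha>_pos H_nonneg in \<open>auto intro!: mult_left_mono powr_mono2\<close>)
      then have "norm (X' t + b t z) \<le> ?E"
        using norm_triangle_ineq[of "X' t + b t (X t)" "b t z - b t (X t)"] by simp
      then have "norm (f z *\<^sub>R (X' t + b t z)) \<le> F * ?E"
        using F[OF True] F0 by (auto intro!: mult_mono)
      then have "norm (f z *\<^sub>R (X' t + b t z)) * norm (Drho \<epsilon> (z - X t)) \<le> F * ?E * norm (Drho \<epsilon> (z - X t))"
        by (rule mult_right_mono) simp
      then show ?thesis using Cauchy_Schwarz_ineq2 order_trans by blast
    qed (simp add: \<epsilon> Drho_outside)
  qed
  finally show ?thesis using slice_integrables(6) by simp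
qed

text \<open>The commutator estimate: testing the equation with the moving bump controls the variation of \<open>u\<close>
  along \<open>X\<close> up to the defect \<open>X' + b\<close> and terms vanishing with \<open>\<epsilon>\<close>.\<close>

lemma commutator_estimate:
  fixes V N :: real
  defines "V \<equiv> (LINT z|lborel. rho \<epsilon> (z::'a))" and "N \<equiv> (LINT z|lborel. norm (Drho \<epsilon> (z::'a)))"
  shows "V * \<bar>LINT t|lborel. u t (X t) * \<eta>' t\<bar> \<le> (B + 1) * \<epsilon> powr \<beta> *
    (2 * V * (LINT t|lborel. \<bar>\<eta>' t\<bar>) + 2 * N * ((LINT t|lborel. \<eta> t * norm (X' t + b t (X t))) + H * \<epsilon> powr \<alpha> * (LINT t|lborel. \<eta> t))
     + 2 * DIM('a) * V * (LINT t|lborel. \<eta> t * C1 t))"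
proof -
  \<comment> \<open>Bound for |u - q| within distance \<epsilon> of the curve: B \<epsilon>^\<beta>
    from the Hoelder condition in space and one more \<epsilon>^\<beta> from approximating u(t, X t)
    by \<open>q\<close>.\<close>
  define G where "G = (B + 1) * \<epsilon> powr \<beta>"
  have G: "0 \<le> G" using B_nonneg by (simp add: G_def)
  have V: "0 \<le> V" unfolding V_def by (intro Bochner_Integration.integral_nonneg rho_nonneg)
  have N: "0 \<le> N" unfolding N_def by (intro Bochner_Integration.integral_nonneg) simp
  define e where "e t = norm (X' t + b t (X t)) + H * \<epsilon> powr \<alpha>" for t
  obtain L where L: "\<And>t. t \<in> {a..c} \<Longrightarrow> norm (X t) \<le> L"
    using compact_continuous_norm_bound[OF continuous_on_subset[OF path_continuous subset_UNIV] compact_Icc] by metis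
  define r where "r = L + \<epsilon>"
  have r: "\<And>t. t \<in> {a..c} \<Longrightarrow> norm (X t) + \<epsilon> \<le> r" using L by (simp add: r_def)
  have contu: "continuous_on UNIV (\<lambda>z. u (f z) (g z))" if "continuous_on UNIV f" "continuous_on UNIV g" for f :: "'c::topological_space \<Rightarrow> real" and g
  proof -
    have "continuous_on UNIV (\<lambda>z. (f z, g z))" using that by (intro continuous_intros)
    from continuous_on_compose2[OF u_continuous this] show ?thesis by simp
  qed
  have contuX: "continuous_on UNIV (\<lambda>t. u t (X t))" by (intro contu path_continuous continuous_on_id)
  \<comment> \<open>The function u(t, X t) is only continuous in time, and multiplying the bump by
    it would leave the class of test functions. A polynomial within \<epsilon>^\<beta> of it does
    the same service.\<close>
  obtain q where q: "real_polynomial_function q" and qu: "\<And>t. t \<in> {a..c} \<Longrightarrow> \<bar>u t (X t) - q t\<bar> < \<epsilon> powr \<beta>"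
    using Stone_Weierstrass_real_polynomial_function[of "{a..c}" "\<lambda>t. u t (X t)" "\<epsilon> powr \<beta>"]
      continuous_on_subset[OF contuX subset_UNIV, of "{a..c}"] \<epsilon> by auto
  obtain q' where q': "real_polynomial_function q'" "\<And>t. (q has_real_derivative q' t) (at t)"
    using has_real_derivative_polynomial_function[OF q] by metis
  have contq: "continuous_on UNIV q" "continuous_on UNIV q'"
    using continuously_differentiable_polynomial[of _ 0] q q' by auto
  have cont\<eta>: "continuous_on UNIV \<eta>" using \<eta>(1)[of 0] by simp
  define \<phi> where "\<phi> z = \<eta> (fst z) * rho \<epsilon> (snd z - X (fst z))" for z
  define pt where "pt z = \<eta>' (fst z) * rho \<epsilon> (snd z - X (fst z)) - \<eta> (fst z) * (X' (fst z) \<bullet> Drho \<epsilon> (snd z - X (fst z)))" for z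
  define px where "px z = \<eta> (fst z) *\<^sub>R Drho \<epsilon> (snd z - X (fst z))" for z
  have \<phi>: "smooth_supported a c r \<phi> pt px"
    unfolding \<phi>_def pt_def px_def by (rule moving_bump_smooth[OF X contX' \<eta> cont\<eta>' supp r \<epsilon>])
  \<comment> \<open>As \<open>q\<close> depends on time alone, \<open>q\<close> times the bump is
    again a moving bump, with a cutoff of no particular sign, and the divergence formula applies to
    it.\<close>
  have q\<phi>: "smooth_supported a c r (\<lambda>z. (q (fst z) * \<eta> (fst z)) * rho \<epsilon> (snd z - X (fst z)))
     (\<lambda>z. (q (fst z) * \<eta>' (fst z) + q' (fst z) * \<eta> (fst z)) * rho \<epsilon> (snd z - X (fst z)) - (q (fst z) * \<eta> (fst z)) * (X' (fst z) \<bullet> Drho \<epsilon> (snd z - X (fst z))))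
     (\<lambda>z. (q (fst z) * \<eta> (fst z)) *\<^sub>R Drho \<epsilon> (snd z - X (fst z)))"
  proof (rule moving_bump_smooth[OF X contX' _ _ _ _ r \<epsilon>])
    show "continuously_differentiable k (\<lambda>t. q t * \<eta> t)" for k
      by (intro continuously_differentiable_mult \<eta> continuously_differentiable_polynomial q)
    show "((\<lambda>t. q t * \<eta> t) has_real_derivative q t * \<eta>' t + q' t * \<eta> t) (at t)" for t
      using DERIV_mult[OF q'(2) \<eta>(2), of t] by (simp add: algebra_simps)
    show "continuous_on UNIV (\<lambda>t. q t * \<eta>' t + q' t * \<eta> t)" by (intro continuous_intros contq cont\<eta> cont\<eta>')
  qed (simp add: supp)
  \<comment> \<open>The tube of radius \<epsilon> around the curve. The bound \<open>G\<close> on u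
    - q holds on this tube, whereas the box carrying the support of \<open>\<phi>\<close> is
    larger.\<close>
  define K where "K = (\<lambda>p. (fst p, X (fst p) + snd p)) ` ({a..c} \<times> cball (0::'a) \<epsilon>)"
  have K: "compact K"
    unfolding K_def
    by (intro compact_continuous_image compact_Times compact_Icc compact_cball continuous_intros
        continuous_on_compose2[OF path_continuous]) auto
  have K1: "z \<in> K \<longleftrightarrow> fst z \<in> {a..c} \<and> norm (snd z - X (fst z)) \<le> \<epsilon>" for z
    unfolding K_def by (cases z) (force simp: image_iff intro!: bexI[of _ "(fst z, snd z - X (fst z))"])
  have KT: "K \<subseteq> {0<..<T} \<times> UNIV"
    using ac by (auto simp: K_def)
  have \<phi>0: "\<phi> z = 0" if "z \<notin> K" for z
    using that \<epsilon> supp[of "fst z"] unfolding K1 \<phi>_def by (auto simp: rho_outside)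
  have \<phi>nn: "0 \<le> \<phi> z" for z by (simp add: \<phi>_def nn rho_nonneg)
  define g where "g z = u (fst z) (snd z) - q (fst z)" for z
  have contg: "continuous_on UNIV g"
    unfolding g_def by (intro continuous_intros u_continuous continuous_on_compose2[OF contq(1)]) auto
  have gG: "\<bar>u t x - q t\<bar> \<le> G" if "t \<in> {a..c}" "norm (x - X t) \<le> \<epsilon>" for t x
  proof -
    have "\<bar>u t x - u t (X t)\<bar> \<le> B * norm (x - X t) powr \<beta>" using that ac by (intro u_holder) auto
    also have "\<dots> \<le> B * \<epsilon> powr \<beta>" using that B_nonneg \<beta>_pos by (intro mult_left_mono powr_mono2) auto
    finally show ?thesis using qu[OF that(1)] by (simp add: G_def distrib_right)
  qed
  define \<Lambda> where "\<Lambda> = div_b (\<lambda>z. g z * \<phi> z)"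
  define J where "J = (LINT t|lborel. \<eta> t * norm (X' t + b t (X t))) + H * \<epsilon> powr \<alpha> * (LINT t|lborel. \<eta> t)"
  have int_e: "integrable lborel (\<lambda>t. \<eta> t * e t)" and J: "(LINT t|lborel. \<eta> t * e t) = J"
    using cutoff_integrables(1,3)[OF contuX] by (auto simp: e_def distrib_left J_def)
  \<comment> \<open>Estimating \<open>\<Lambda>\<close> by positivity produces
    \<open>div_b \<phi>\<close> itself. As \<open>Drho\<close> has mean zero, X' can be added to b
    under the integral, which leaves only the defect and the oscillation of b.\<close>
  have div\<phi>: "div_b \<phi> \<le> N * J"
  proof -
    have i: "integrable lborel (\<lambda>z. b (fst z) (snd z) \<bullet> px z)"
      using integrable_b_px[OF \<phi> ac, of "\<lambda>_. 1" 1] by simp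
    have "div_b \<phi> = (LINT t|lborel. - (LINT x|lborel. b t x \<bullet> px (t, x)))"
      unfolding div_b_eq[OF \<phi> ac] using integral_lborel_pair(1)[OF i] by simp
    also have "\<dots> \<le> (LINT t|lborel. N * (\<eta> t * e t))"
    proof (rule integral_mono)
      show "integrable lborel (\<lambda>t. - (LINT x|lborel. b t x \<bullet> px (t, x)))"
        using integral_lborel_pair(2)[OF i] by simp
      show "integrable lborel (\<lambda>t. N * (\<eta> t * e t))" using int_e by simp
      fix t
      have "(LINT x|lborel. ((\<lambda>_. \<eta> t) x *\<^sub>R (X' t + b t x)) \<bullet> Drho \<epsilon> (x - X t))
        = (LINT x|lborel. (\<eta> t *\<^sub>R X' t) \<bullet> Drho \<epsilon> (x - X t) + (\<eta> t *\<^sub>R b t x) \<bullet> Drho \<epsilon> (x - X t))"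
        by (simp add: algebra_simps inner_add_left)
      also have "\<dots> = (LINT x|lborel. (\<eta> t *\<^sub>R X' t) \<bullet> Drho \<epsilon> (x - X t)) + (LINT x|lborel. (\<eta> t *\<^sub>R b t x) \<bullet> Drho \<epsilon> (x - X t))"
        by (intro Bochner_Integration.integral_add slice_integrables continuous_intros b_continuous)
      also have "\<dots> = (LINT x|lborel. b t x \<bullet> px (t, x))"
        using integral_inner_Drho[OF \<epsilon>, of "\<eta> t *\<^sub>R X' t" "X t"] by (simp add: px_def)
      finally have "\<bar>LINT x|lborel. b t x \<bullet> px (t, x)\<bar> \<le> \<eta> t * (e t * N)"
        using slice_drift_bound[of "\<lambda>_. \<eta> t" t "\<eta> t"] nn[of t] by (simp add: e_def N_def)
      then show "- (LINT x|lborel. b t x \<bullet> px (t, x)) \<le> N * (\<eta> t * e t)" by (simp add: mult_ac)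
    qed
    also have "\<dots> = N * J" by (simp add: J)
    finally show ?thesis .
  qed
  have C1\<phi>: "(LINT z|lborel. C1 (fst z) * \<phi> z) = V * (LINT t|lborel. \<eta> t * C1 t)"
  proof -
    have "(LINT z|lborel. C1 (fst z) * \<phi> z) = (LINT t|lborel. LINT x|lborel. (C1 t * \<eta> t) * rho \<epsilon> (x - X t))"
      using integral_lborel_pair(1)[OF integrable_C1[OF \<phi> ac]] by (simp add: \<phi>_def mult_ac)
    also have "\<dots> = (LINT t|lborel. V * (\<eta> t * C1 t))"
      using slice_integrables(5) by (simp add: V_def mult_ac)
    finally show ?thesis by simp
  qed
  have \<Lambda>: "\<bar>\<Lambda>\<bar> \<le> G * (N * J) + 2 * DIM('a) * G * (V * (LINT t|lborel. \<eta> t * C1 t))"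
  proof -
    have "\<bar>\<Lambda>\<bar> \<le> G * div_b \<phi> + 2 * DIM('a) * G * (LINT z|lborel. C1 (fst z) * \<phi> z)"
      unfolding \<Lambda>_def using gG by (intro div_b_bound[OF \<phi> ac \<phi>nn K KT \<phi>0 contg]) (auto simp: K1 g_def)
    also have "\<dots> \<le> G * (N * J) + 2 * DIM('a) * G * (LINT z|lborel. C1 (fst z) * \<phi> z)"
      using div\<phi> G by (intro add_right_mono mult_left_mono)
    finally show ?thesis by (simp add: C1\<phi>)
  qed
  \<comment> \<open>The integrand of the equation tested with \<open>\<phi>\<close>, minus that of
    the divergence formula tested with \<open>q \<phi>\<close>. The terms with \<open>div_b\<close>
    then combine into \<open>\<Lambda>\<close>, which sees only u - q.\<close>
  define F where "F z = u (fst z) (snd z) * pt z - g z * (b (fst z) (snd z) \<bullet> px z)" for z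
  have cont\<phi>: "continuous_on UNIV \<phi>" by (rule smooth_supported_continuous[OF \<phi>])
  obtain Lu where Lu: "\<And>z. z \<in> {a..c} \<times> cball 0 r \<Longrightarrow> norm (u (fst z) (snd z)) \<le> Lu"
    using compact_continuous_norm_bound[OF continuous_on_subset[OF u_continuous subset_UNIV] compact_Times[OF compact_Icc compact_cball]] by metis
  obtain Lg where Lg: "\<And>z. z \<in> {a..c} \<times> cball 0 r \<Longrightarrow> norm (g z) \<le> Lg"
    using compact_continuous_norm_bound[OF continuous_on_subset[OF contg subset_UNIV] compact_Times[OF compact_Icc compact_cball]] by metis
  obtain Lq where Lq: "\<And>t. t \<in> {a..c} \<Longrightarrow> norm (q t) \<le> Lq"
    using compact_continuous_norm_bound[OF continuous_on_subset[OF contq(1) subset_UNIV] compact_Icc] by metis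
  obtain Lp where Lp: "0 \<le> Lp" "\<And>z. norm (pt z) \<le> Lp"
    using gradient_bound[OF \<phi> ac] by metis
  have upt: "integrable lborel (\<lambda>z. u (fst z) (snd z) * pt z)"
  proof (rule integrable_supported[OF \<phi> ac])
    show "(\<lambda>z. u (fst z) (snd z) * pt z) \<in> borel_measurable borel"
      using u_continuous smooth_supportedD(3)[OF \<phi>] by (intro borel_measurable_continuous_onI continuous_intros)
    show "integrable lborel (\<lambda>t. Lu * Lp * indicator {a..c} t)"
      by (intro integrable_mult_right integrable_real_indicator) (auto simp: emeasure_lborel_Icc_eq)
    show "\<bar>u (fst (t, x)) (snd (t, x)) * pt (t, x)\<bar> \<le> Lu * Lp * indicator {a..c} t" if "t \<in> {a..c}" "norm x \<le> r" for t x
      using mult_mono[OF Lu[of "(t, x)"] Lp(2)[of "(t, x)"]] Lu[of "(t, x)"] that by (auto simp: abs_mult)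
  qed simp
  have ibu: "integrable lborel (\<lambda>z. u (fst z) (snd z) * (b (fst z) (snd z) \<bullet> px z))"
    using Lu by (intro integrable_b_px[OF \<phi> ac, where G = Lu] borel_measurable_continuous_onI u_continuous) auto
  have ibq: "integrable lborel (\<lambda>z. q (fst z) * (b (fst z) (snd z) \<bullet> px z))"
    using Lq by (intro integrable_b_px[OF \<phi> ac, where G = Lq] borel_measurable_continuous_onI continuous_on_compose2[OF contq(1)] continuous_intros) auto
  have F: "integrable lborel F" "(LINT z|lborel. F z) = \<Lambda>"
  proof -
    have Feq: "F = (\<lambda>z. (u (fst z) (snd z) * pt z - u (fst z) (snd z) * (b (fst z) (snd z) \<bullet> px z)) + q (fst z) * (b (fst z) (snd z) \<bullet> px z))"
      by (auto simp: F_def g_def algebra_simps)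
    show "integrable lborel F" unfolding Feq using upt ibu ibq by auto
    have "\<Lambda> = div_b (\<lambda>z. u (fst z) (snd z) * \<phi> z) - div_b (\<lambda>z. q (fst z) * \<phi> z)"
    proof -
      have im: "integrable \<mu> (\<lambda>z. f z * \<phi> z)" "integrable \<nu> (\<lambda>z. f z * \<phi> z)" if "continuous_on UNIV f" for f
        by (rule integrable_measure[OF K KT], intro continuous_intros that cont\<phi>, use \<phi>0 in simp)+
      have "continuous_on UNIV (\<lambda>z::real \<times> 'a. q (fst z))" by (intro continuous_on_compose2[OF contq(1)] continuous_intros) auto
      from im[OF this] im[OF u_continuous] show ?thesis
        unfolding \<Lambda>_def div_b_def g_def by (simp add: left_diff_distrib)
    qed
    also have "div_b (\<lambda>z. q (fst z) * \<phi> z) = - (LINT z|lborel. q (fst z) * (b (fst z) (snd z) \<bullet> px z))"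
      using div_b_eq[OF q\<phi> ac] by (simp add: \<phi>_def px_def mult.assoc)
    also have "div_b (\<lambda>z. u (fst z) (snd z) * \<phi> z)
       = (LINT z|lborel. u (fst z) (snd z) * pt z) - (LINT z|lborel. u (fst z) (snd z) * (b (fst z) (snd z) \<bullet> px z))"
      using equation_lborel[OF \<phi> ac] by simp
    finally show "(LINT z|lborel. F z) = \<Lambda>" unfolding Feq using upt ibu ibq by simp
  qed
  define I where "I t = (LINT x|lborel. F (t, x))" for t
  have I: "integrable lborel I" "(LINT t|lborel. I t) = \<Lambda>"
    using integral_lborel_pair[OF F(1)] F(2) unfolding I_def[abs_def] by auto
  have slice: "\<bar>I t - V * (q t * \<eta>' t)\<bar> \<le> G * V * \<bar>\<eta>' t\<bar> + G * N * (\<eta> t * e t)" for t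
  proof (cases "t \<in> {a..c}")
    case False
    then have "F (t, x) = 0" for x
      using supp[of t] cutoff_deriv_zero[of t] by (simp add: F_def pt_def px_def)
    then show ?thesis using False supp[of t] cutoff_deriv_zero[of t] by (simp add: I_def)
  next
    case True
    let ?g = "\<lambda>x. u t x - q t"
    have contg': "continuous_on UNIV ?g" by (intro continuous_intros contu)
    \<comment> \<open>Here u is split as q + g, and b, where it is multiplied by g, is paired with
      X'. The first term yields the main contribution V q \<eta>', the next two are of order
      \<open>G\<close>, and the last one has zero integral.\<close>
    have Fx: "F (t, x) = q t * \<eta>' t * rho \<epsilon> (x - X t) + (?g x * \<eta>' t) * rho \<epsilon> (x - X t)
       - ((?g x * \<eta> t) *\<^sub>R (X' t + b t x)) \<bullet> Drho \<epsilon> (x - X t) - ((q t * \<eta> t) *\<^sub>R X' t) \<bullet> Drho \<epsilon> (x - X t)" for x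
      by (simp add: F_def pt_def px_def g_def inner_add_left algebra_simps)
    define I1 where "I1 = (LINT x|lborel. (?g x * \<eta>' t) * rho \<epsilon> (x - X t))"
    define I2 where "I2 = (LINT x|lborel. ((?g x * \<eta> t) *\<^sub>R (X' t + b t x)) \<bullet> Drho \<epsilon> (x - X t))"
    have i1: "integrable lborel (\<lambda>x. (?g x * \<eta>' t) * rho \<epsilon> (x - X t))"
      by (intro slice_integrables continuous_intros contg')
    have i2: "integrable lborel (\<lambda>x. ((?g x * \<eta> t) *\<^sub>R (X' t + b t x)) \<bullet> Drho \<epsilon> (x - X t))"
      by (intro slice_integrables continuous_intros contg' b_continuous)
    have i3: "integrable lborel (\<lambda>x. ((q t * \<eta> t) *\<^sub>R X' t) \<bullet> Drho \<epsilon> (x - X t))"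
      by (intro slice_integrables continuous_intros)
    have i0: "integrable lborel (\<lambda>x. q t * \<eta>' t * rho \<epsilon> (x - X t))"
      by (intro integrable_mult_right slice_integrables)
    have "I t = (LINT x|lborel. q t * \<eta>' t * rho \<epsilon> (x - X t)) + I1 - I2 - (LINT x|lborel. ((q t * \<eta> t) *\<^sub>R X' t) \<bullet> Drho \<epsilon> (x - X t))"
      unfolding I_def Fx I1_def I2_def
      by (subst Bochner_Integration.integral_diff Bochner_Integration.integral_add; (intro Bochner_Integration.integrable_diff Bochner_Integration.integrable_add i0 i1 i2 i3)?)+ simp
    also have "(LINT x|lborel. ((q t * \<eta> t) *\<^sub>R X' t) \<bullet> Drho \<epsilon> (x - X t)) = 0"
      by (rule integral_inner_Drho[OF \<epsilon>])
    also have "(LINT x|lborel. q t * \<eta>' t * rho \<epsilon> (x - X t)) = V * (q t * \<eta>' t)"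
      using slice_integrables(5) by (simp add: V_def)
    finally have "I t - V * (q t * \<eta>' t) = I1 - I2" by simp
    moreover have "\<bar>I1\<bar> \<le> G * V * \<bar>\<eta>' t\<bar>"
    proof -
      have "\<bar>I1\<bar> \<le> (LINT x|lborel. \<bar>(?g x * \<eta>' t) * rho \<epsilon> (x - X t)\<bar>)" unfolding I1_def by (rule integral_abs_bound)
      also have "\<dots> \<le> (LINT x|lborel. G * \<bar>\<eta>' t\<bar> * rho \<epsilon> (x - X t))"
      proof (rule integral_mono[OF integrable_abs[OF i1]])
        show "integrable lborel (\<lambda>x. G * \<bar>\<eta>' t\<bar> * rho \<epsilon> (x - X t))" by (intro integrable_mult_right slice_integrables)
        show "\<bar>(?g x * \<eta>' t) * rho \<epsilon> (x - X t)\<bar> \<le> G * \<bar>\<eta>' t\<bar> * rho \<epsilon> (x - X t)" for x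
        proof (cases "norm (x - X t) \<le> \<epsilon>")
          case near: True
          then show ?thesis using gG[OF True near] rho_nonneg[of \<epsilon> "x - X t"] by (auto simp: abs_mult intro!: mult_right_mono)
        qed (simp add: \<epsilon> rho_outside)
      qed
      also have "\<dots> = G * V * \<bar>\<eta>' t\<bar>" using slice_integrables(5) by (simp add: V_def)
      finally show ?thesis .
    qed
    moreover have "\<bar>I2\<bar> \<le> G * N * (\<eta> t * e t)"
    proof -
      have "\<bar>I2\<bar> \<le> G * \<eta> t * (e t * N)"
        unfolding I2_def e_def N_def
      proof (rule slice_drift_bound)
        show "continuous_on UNIV (\<lambda>x. ?g x * \<eta> t)" by (intro continuous_intros contg')
        show "\<bar>?g z * \<eta> t\<bar> \<le> G * \<eta> t" if "norm (z - X t) \<le> \<epsilon>" for z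
          using gG[OF True that] nn[of t] by (auto simp: abs_mult intro!: mult_right_mono)
      qed (use G nn in simp)
      then show ?thesis by (simp add: mult_ac)
    qed
    ultimately show ?thesis by linarith
  qed
  have iq: "integrable lborel (\<lambda>t. q t * \<eta>' t)" and i\<eta>': "integrable lborel (\<lambda>t. \<bar>\<eta>' t\<bar>)"
    and iu: "integrable lborel (\<lambda>t. u t (X t) * \<eta>' t)"
    using cutoff_integrables(4,5) contq(1) contuX by auto
  have "V * \<bar>LINT t|lborel. q t * \<eta>' t\<bar> \<le> \<bar>\<Lambda>\<bar> + (G * V * (LINT t|lborel. \<bar>\<eta>' t\<bar>) + G * N * J)"
  proof -
    have "V * (LINT t|lborel. q t * \<eta>' t) = \<Lambda> - (LINT t|lborel. I t - V * (q t * \<eta>' t))"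
      using I iq by simp
    moreover have "\<bar>LINT t|lborel. I t - V * (q t * \<eta>' t)\<bar> \<le> G * V * (LINT t|lborel. \<bar>\<eta>' t\<bar>) + G * N * J"
    proof -
      have "\<bar>LINT t|lborel. I t - V * (q t * \<eta>' t)\<bar> \<le> (LINT t|lborel. \<bar>I t - V * (q t * \<eta>' t)\<bar>)"
        by (rule integral_abs_bound)
      also have "\<dots> \<le> (LINT t|lborel. G * V * \<bar>\<eta>' t\<bar> + G * N * (\<eta> t * e t))"
        by (intro integral_mono slice) (use I iq i\<eta>' int_e in auto)
      also have "\<dots> = G * V * (LINT t|lborel. \<bar>\<eta>' t\<bar>) + G * N * J" using i\<eta>' int_e J by simp
      finally show ?thesis .
    qed
    moreover have "V * \<bar>LINT t|lborel. q t * \<eta>' t\<bar> = \<bar>V * (LINT t|lborel. q t * \<eta>' t)\<bar>" using V by (simp add: abs_mult)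
    ultimately show ?thesis by linarith
  qed
  moreover have "V * \<bar>(LINT t|lborel. u t (X t) * \<eta>' t) - (LINT t|lborel. q t * \<eta>' t)\<bar> \<le> V * (G * (LINT t|lborel. \<bar>\<eta>' t\<bar>))"
  proof (rule mult_left_mono[OF _ V])
    have "\<bar>(LINT t|lborel. u t (X t) * \<eta>' t) - (LINT t|lborel. q t * \<eta>' t)\<bar> = \<bar>LINT t|lborel. u t (X t) * \<eta>' t - q t * \<eta>' t\<bar>"
      using iu iq by simp
    also have "\<dots> \<le> (LINT t|lborel. \<bar>u t (X t) * \<eta>' t - q t * \<eta>' t\<bar>)" by (rule integral_abs_bound)
    also have "\<dots> \<le> (LINT t|lborel. G * \<bar>\<eta>' t\<bar>)"
    proof (rule integral_mono)
      show "\<bar>u t (X t) * \<eta>' t - q t * \<eta>' t\<bar> \<le> G * \<bar>\<eta>' t\<bar>" for t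
      proof (cases "t \<in> {a..c}")
        case True
        have "\<bar>u t (X t) - q t\<bar> * \<bar>\<eta>' t\<bar> \<le> G * \<bar>\<eta>' t\<bar>" using gG[OF True, of "X t"] \<epsilon> by (intro mult_right_mono) auto
        then show ?thesis by (simp flip: left_diff_distrib add: abs_mult)
      qed (simp add: cutoff_deriv_zero)
    qed (use iu iq i\<eta>' in auto)
    finally show "\<bar>(LINT t|lborel. u t (X t) * \<eta>' t) - (LINT t|lborel. q t * \<eta>' t)\<bar> \<le> G * (LINT t|lborel. \<bar>\<eta>' t\<bar>)" by simp
  qed
  moreover have "V * \<bar>LINT t|lborel. u t (X t) * \<eta>' t\<bar> \<le> V * \<bar>LINT t|lborel. q t * \<eta>' t\<bar> + V * \<bar>(LINT t|lborel. u t (X t) * \<eta>' t) - (LINT t|lborel. q t * \<eta>' t)\<bar>"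
    unfolding distrib_left[symmetric] by (intro mult_left_mono V) linarith
  ultimately have "V * \<bar>LINT t|lborel. u t (X t) * \<eta>' t\<bar> \<le> G * (N * J) + 2 * DIM('a) * G * (V * (LINT t|lborel. \<eta> t * C1 t))
      + (G * V * (LINT t|lborel. \<bar>\<eta>' t\<bar>) + G * N * J) + V * (G * (LINT t|lborel. \<bar>\<eta>' t\<bar>))"
    using \<Lambda> by linarith
  \<comment> \<open>The factors 2 of the first two terms are double occurrences: G N J stems from
    \<open>\<Lambda>\<close> and from the slices, the integral of |\<eta>'| from the slices and from
    the return from \<open>q\<close> to u.\<close>
  also have "\<dots> = G * (2 * V * (LINT t|lborel. \<bar>\<eta>' t\<bar>) + 2 * N * J + 2 * DIM('a) * V * (LINT t|lborel. \<eta> t * C1 t))"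
    by (simp add: algebra_simps)
  finally show ?thesis by (simp add: G_def J_def)
qed

end

end

section \<open>Integrals over time intervals\<close>

lemma absolutely_integrable_borel_bound:
  fixes f :: "real \<Rightarrow> 'a::euclidean_space"
  assumes f: "f \<in> borel_measurable borel" and g: "integrable lborel g" and le: "\<And>t. t \<in> {a..c} \<Longrightarrow> norm (f t) \<le> g t"
  shows "f absolutely_integrable_on {a..c}"
    and "(LINT t|lborel. indicator {a..c} t *\<^sub>R f t) = integral {a..c} f"
    and "integrable lborel (\<lambda>t. indicator {a..c} t *\<^sub>R f t)"
proof -
  have m: "(\<lambda>t. indicator {a..c} t *\<^sub>R f t) \<in> borel_measurable borel"
    using f by measurable
  show i: "integrable lborel (\<lambda>t. indicator {a..c} t *\<^sub>R f t)"
  proof (rule Bochner_Integration.integrable_bound[OF g])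
    show "AE t in lborel. norm (indicator {a..c} t *\<^sub>R f t) \<le> norm (g t)"
      using le by (intro AE_I2) (auto simp: indicator_def intro: order_trans[OF _ abs_ge_self])
  qed (use m in auto)
  then have s: "set_integrable lborel {a..c} f" by (simp add: set_integrable_def)
  show "(LINT t|lborel. indicator {a..c} t *\<^sub>R f t) = integral {a..c} f"
    using set_borel_integral_eq_integral(2)[OF s] by (simp add: set_lebesgue_integral_def)
  show "f absolutely_integrable_on {a..c}"
    unfolding set_integrable_def using i m by (subst integrable_completion) auto
qed

lemma absolutely_integrable_lborel:
  fixes g :: "real \<Rightarrow> real"
  assumes "integrable lborel g" "\<And>t. 0 \<le> g t"
  shows "g absolutely_integrable_on {a..c}" "integral {a..c} g \<le> (LINT t|lborel. g t)"
proof -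
  have g: "g \<in> borel_measurable borel" using assms by auto
  note * = absolutely_integrable_borel_bound[OF g assms(1), of a c]
  show "g absolutely_integrable_on {a..c}" using *(1) assms by simp
  have "integral {a..c} g = (LINT t|lborel. indicator {a..c} t *\<^sub>R g t)" using *(2) assms by simp
  also have "\<dots> \<le> (LINT t|lborel. g t)"
    by (rule integral_mono) (use *(3) assms in \<open>auto simp: indicator_def\<close>)
  finally show "integral {a..c} g \<le> (LINT t|lborel. g t)" .
qed

text \<open>Absolute continuity of the integral, obtained from the uniform continuity of the
  primitive on a compact interval.\<close>

lemma integral_uniformly_small:
  fixes g :: "real \<Rightarrow> real"
  assumes g: "integrable lborel g" "\<And>t. 0 \<le> g t" and "0 < \<omega>"
  obtains h where "0 < h" "\<And>s t. a \<le> s \<Longrightarrow> s \<le> t \<Longrightarrow> t \<le> c \<Longrightarrow> t - s \<le> h \<Longrightarrow> integral {s..t} g \<le> \<omega>"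
proof -
  have gi: "g integrable_on {s..t}" for s t
    using absolutely_integrable_lborel(1)[OF g] absolutely_integrable_on_def by blast
  have "uniformly_continuous_on {a..c} (\<lambda>t. integral {a..t} g)"
    by (intro compact_uniformly_continuous indefinite_integral_continuous_1 gi compact_Icc)
  then obtain d where d: "d > 0" "\<And>s t. s \<in> {a..c} \<Longrightarrow> t \<in> {a..c} \<Longrightarrow> dist t s < d \<Longrightarrow> dist (integral {a..t} g) (integral {a..s} g) < \<omega>"
    unfolding uniformly_continuous_on_def using \<open>0 < \<omega>\<close> by metis
  show ?thesis
  proof (rule that[of "d / 2"])
    fix s t assume st: "a \<le> s" "s \<le> t" "t \<le> c" "t - s \<le> d / 2"
    have "integral {a..s} g + integral {s..t} g = integral {a..t} g"
      by (rule Henstock_Kurzweil_Integration.integral_combine) (use st gi in auto)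
    with d(2)[of s t] d(1) st show "integral {s..t} g \<le> \<omega>" by (auto simp: dist_real_def)
  qed (use d in simp)
qed

lemma powr_small:
  fixes H \<alpha> \<zeta> :: real
  assumes "0 \<le> H" "0 < \<alpha>" "0 < \<zeta>"
  obtains \<delta> where "0 < \<delta>" "\<And>x. 0 \<le> x \<Longrightarrow> x \<le> \<delta> \<Longrightarrow> H * x powr \<alpha> \<le> \<zeta>"
\<comment> \<open>Dividing by \<open>H + 1\<close> instead of \<open>H\<close> covers the case H =
  0.\<close>
proof (rule that[of "(\<zeta> / (H + 1)) powr (1 / \<alpha>)"])
  fix x assume x: "0 \<le> x" "x \<le> (\<zeta> / (H + 1)) powr (1 / \<alpha>)"
  have "x powr \<alpha> \<le> ((\<zeta> / (H + 1)) powr (1 / \<alpha>)) powr \<alpha>" using x assms by (intro powr_mono2) auto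
  also have "\<dots> = \<zeta> / (H + 1)" using assms by (simp add: powr_powr)
  finally have "H * x powr \<alpha> \<le> H * (\<zeta> / (H + 1))" using assms by (intro mult_left_mono)
  also have "\<dots> \<le> \<zeta>" using assms by (simp add: field_simps)
  finally show "H * x powr \<alpha> \<le> \<zeta>" .
qed (use assms in auto)

subsection \<open>Polynomial approximation in \<open>L\<^sup>1\<close>\<close>

text \<open>Truncation at height \<open>k\<close> changes \<open>f\<close> little in L^1.
  Measurability provides continuous functions converging to \<open>f\<close> almost everywhere;
  after the same truncation they are uniformly bounded, and dominated convergence applies.\<close>

lemma L1_approximation_continuous:
  fixes f :: "real \<Rightarrow> real"
  assumes f: "f absolutely_integrable_on {a..c}" and \<zeta>: "0 < \<zeta>"
  obtains g where "continuous_on UNIV g" "integral {a..c} (\<lambda>t. \<bar>f t - g t\<bar>) \<le> \<zeta>"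
proof -
  define cl where "cl k x = max (- real k) (min (real k) x)" for k :: nat and x :: real
  have fn: "(\<lambda>t. \<bar>f t\<bar>) integrable_on {a..c}"
    using f by (auto simp: absolutely_integrable_on_def)
  have clf: "(\<lambda>t. cl k (f t)) absolutely_integrable_on {a..c}" for k
    unfolding cl_def by (intro absolutely_integrable_max_1 absolutely_integrable_min_1 f absolutely_integrable_on_const) auto
  have lim1: "(\<lambda>k. integral {a..c} (\<lambda>t. \<bar>f t - cl k (f t)\<bar>)) \<longlonglongrightarrow> integral {a..c} (\<lambda>t. 0)"
  proof (rule dominated_convergence(2)[where h = "\<lambda>t. 2 * \<bar>f t\<bar>"])
    show "(\<lambda>t. \<bar>f t - cl k (f t)\<bar>) integrable_on {a..c}" for k
      using set_integral_diff(1)[OF f clf] by (auto dest!: set_integrable_abs simp: absolutely_integrable_on_def)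
    show "(\<lambda>t. 2 * \<bar>f t\<bar>) integrable_on {a..c}" using fn by (intro integrable_on_mult_right)
    show "norm \<bar>f t - cl k (f t)\<bar> \<le> 2 * \<bar>f t\<bar>" for k t
      by (auto simp: cl_def)
    show "(\<lambda>k. \<bar>f t - cl k (f t)\<bar>) \<longlonglongrightarrow> 0" for t
    proof (rule tendsto_eventually, rule eventually_sequentiallyI)
      fix k assume "nat \<lceil>\<bar>f t\<bar>\<rceil> \<le> k"
      then have "\<bar>f t\<bar> \<le> real k" by linarith
      then show "\<bar>f t - cl k (f t)\<bar> = 0" by (auto simp: cl_def)
    qed
  qed
  then have "\<forall>\<^sub>F k in sequentially. integral {a..c} (\<lambda>t. \<bar>f t - cl k (f t)\<bar>) < \<zeta> / 2"
    using \<zeta> by (intro order_tendstoD(2)[of _ "integral {a..c} (\<lambda>t. 0)"]) auto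
  then obtain k where k: "integral {a..c} (\<lambda>t. \<bar>f t - cl k (f t)\<bar>) < \<zeta> / 2"
    by (auto simp: eventually_sequentially)
  have "f measurable_on {a..c}"
    using absolutely_integrable_imp_borel_measurable[OF f] by (subst measurable_on_iff_borel_measurable) auto
  then obtain N g where N: "negligible N" and g: "\<And>n. continuous_on UNIV (g n)"
    and gl: "\<And>x. x \<notin> N \<Longrightarrow> (\<lambda>n. g n x) \<longlonglongrightarrow> (if x \<in> {a..c} then f x else 0)"
    unfolding measurable_on_def by metis
  have contcl: "continuous_on UNIV (\<lambda>t. cl k (g n t))" for n
    unfolding cl_def by (intro continuous_intros g)
  have clg: "(\<lambda>t. cl k (g n t)) absolutely_integrable_on {a..c}" for n
    by (rule absolutely_integrable_continuous_real[OF continuous_on_subset[OF contcl subset_UNIV]])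
  have lim2: "(\<lambda>n. integral ({a..c} - N) (\<lambda>t. \<bar>cl k (f t) - cl k (g n t)\<bar>)) \<longlonglongrightarrow> integral ({a..c} - N) (\<lambda>t. 0)"
  proof (rule dominated_convergence(2)[where h = "\<lambda>t. 2 * real k"])
    have sp: "h integrable_on ({a..c} - N) \<longleftrightarrow> h integrable_on {a..c}" for h :: "real \<Rightarrow> real"
      by (rule integrable_spike_set_eq) (auto intro: negligible_subset[OF N])
    show "(\<lambda>t. \<bar>cl k (f t) - cl k (g n t)\<bar>) integrable_on ({a..c} - N)" for n
      unfolding sp using set_integral_diff(1)[OF clf clg] by (auto dest!: set_integrable_abs simp: absolutely_integrable_on_def)
    show "(\<lambda>t. 2 * real k) integrable_on ({a..c} - N)" unfolding sp by (rule integrable_const_ivl)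
    show "norm \<bar>cl k (f t) - cl k (g n t)\<bar> \<le> 2 * real k" for n t
      by (auto simp: cl_def)
    show "(\<lambda>n. \<bar>cl k (f t) - cl k (g n t)\<bar>) \<longlonglongrightarrow> 0" if "t \<in> {a..c} - N" for t
    proof -
      have "(\<lambda>n. g n t) \<longlonglongrightarrow> f t" using gl[of t] that by auto
      then have "(\<lambda>n. \<bar>cl k (f t) - cl k (g n t)\<bar>) \<longlonglongrightarrow> \<bar>cl k (f t) - cl k (f t)\<bar>"
        unfolding cl_def by (intro tendsto_intros)
      then show ?thesis by simp
    qed
  qed
  have sp: "integral ({a..c} - N) h = integral {a..c} h" for h :: "real \<Rightarrow> real"
    by (rule integral_spike_set) (auto intro: negligible_subset[OF N])
  have "\<forall>\<^sub>F n in sequentially. integral {a..c} (\<lambda>t. \<bar>cl k (f t) - cl k (g n t)\<bar>) < \<zeta> / 2"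
    using \<zeta> lim2 unfolding sp by (intro order_tendstoD(2)[of _ "integral {a..c} (\<lambda>t. 0)"]) auto
  then obtain n where n: "integral {a..c} (\<lambda>t. \<bar>cl k (f t) - cl k (g n t)\<bar>) < \<zeta> / 2"
    by (auto simp: eventually_sequentially)
  have i: "(\<lambda>t. \<bar>f t - cl k (f t)\<bar>) integrable_on {a..c}" "(\<lambda>t. \<bar>cl k (f t) - cl k (g n t)\<bar>) integrable_on {a..c}"
     "(\<lambda>t. \<bar>f t - cl k (g n t)\<bar>) integrable_on {a..c}"
    using set_integral_diff(1)[OF clf clg] set_integral_diff(1)[OF f clf] set_integral_diff(1)[OF f clg]
    by (auto dest!: set_integrable_abs simp: absolutely_integrable_on_def)
  show ?thesis
  proof (rule that[OF contcl[of n]])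
    have "integral {a..c} (\<lambda>t. \<bar>f t - cl k (g n t)\<bar>) \<le> integral {a..c} (\<lambda>t. \<bar>f t - cl k (f t)\<bar> + \<bar>cl k (f t) - cl k (g n t)\<bar>)"
      by (intro integral_le i integrable_add) auto
    also have "\<dots> = integral {a..c} (\<lambda>t. \<bar>f t - cl k (f t)\<bar>) + integral {a..c} (\<lambda>t. \<bar>cl k (f t) - cl k (g n t)\<bar>)"
      by (intro Henstock_Kurzweil_Integration.integral_add i)
    finally show "integral {a..c} (\<lambda>t. \<bar>f t - cl k (g n t)\<bar>) \<le> \<zeta>" using k n by linarith
  qed
qed

lemma L1_approximation_polynomial_real:
  fixes f :: "real \<Rightarrow> real"
  assumes f: "f absolutely_integrable_on {a..c}" and \<zeta>: "0 < \<zeta>"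
  obtains p where "real_polynomial_function p" "integral {a..c} (\<lambda>t. \<bar>f t - p t\<bar>) \<le> \<zeta>"
proof -
  obtain g where g: "continuous_on UNIV g" "integral {a..c} (\<lambda>t. \<bar>f t - g t\<bar>) \<le> \<zeta> / 2"
    using L1_approximation_continuous[OF f, of "\<zeta> / 2"] \<zeta> by auto
  define L where "L = \<bar>c - a\<bar> + 1"
  have L: "0 < L" by (simp add: L_def)
  obtain p where p: "real_polynomial_function p" "\<And>t. t \<in> {a..c} \<Longrightarrow> \<bar>g t - p t\<bar> < \<zeta> / 2 / L"
    using Stone_Weierstrass_real_polynomial_function[of "{a..c}" g "\<zeta> / 2 / L"] continuous_on_subset[OF g(1) subset_UNIV] \<zeta> L by auto
  have contp: "continuous_on UNIV p" using continuously_differentiable_polynomial[OF p(1), of 0] by simp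
  have ga: "g absolutely_integrable_on {a..c}" and pa: "p absolutely_integrable_on {a..c}"
    by (rule absolutely_integrable_continuous_real[OF continuous_on_subset[OF _ subset_UNIV]], fact)+
  have i: "(\<lambda>t. \<bar>f t - g t\<bar>) integrable_on {a..c}" "(\<lambda>t. \<bar>f t - p t\<bar>) integrable_on {a..c}"
    using set_integral_diff(1)[OF f ga] set_integral_diff(1)[OF f pa]
    by (auto dest!: set_integrable_abs simp: absolutely_integrable_on_def)
  show ?thesis
  proof (rule that[OF p(1)])
    have "integral {a..c} (\<lambda>t. \<bar>f t - p t\<bar>) \<le> integral {a..c} (\<lambda>t. \<bar>f t - g t\<bar> + \<zeta> / 2 / L)"
      by (intro integral_le i integrable_add integrable_const_ivl) (use p(2) in fastforce)
    also have "\<dots> = integral {a..c} (\<lambda>t. \<bar>f t - g t\<bar>) + integral {a..c} (\<lambda>t. \<zeta> / 2 / L)"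
      by (intro Henstock_Kurzweil_Integration.integral_add i integrable_const_ivl)
    also have "integral {a..c} (\<lambda>t. \<zeta> / 2 / L) \<le> L * (\<zeta> / 2 / L)"
      using \<zeta> L by (cases "a \<le> c") (auto simp: L_def intro!: mult_right_mono divide_right_mono)
    finally show "integral {a..c} (\<lambda>t. \<bar>f t - p t\<bar>) \<le> \<zeta>" using g(2) L by simp
  qed
qed

lemma real_polynomial_antiderivative:
  assumes "real_polynomial_function p"
  obtains P where "real_polynomial_function P" "\<And>t::real. (P has_real_derivative p t) (at t)"
proof -
  obtain a n where p: "p = (\<lambda>x. \<Sum>i\<le>n. a i * x ^ i)" using assms real_polynomial_function_iff_sum by auto
  show ?thesis
  proof (rule that[of "\<lambda>x. \<Sum>i\<le>n. (a i / real (Suc i)) * x ^ Suc i"])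
    show "real_polynomial_function (\<lambda>x. \<Sum>i\<le>n. (a i / real (Suc i)) * x ^ Suc i)"
      by (intro real_polynomial_function_sum real_polynomial_function.intros(2,4) real_polynomial_function_power
          real_polynomial_function.intros(1) bounded_linear_ident) auto
    show "((\<lambda>x. \<Sum>i\<le>n. (a i / real (Suc i)) * x ^ Suc i) has_real_derivative p t) (at t)" for t
      unfolding p by (rule DERIV_sum) (rule derivative_eq_intros refl | simp)+
  qed
qed

text \<open>The velocity is approximated component by component, each with error \<zeta> / d. The
  antiderivative is delivered too, since it becomes the polynomial curve.\<close>

lemma L1_approximation_polynomial:
  fixes f :: "real \<Rightarrow> 'a::euclidean_space"
  assumes f: "f absolutely_integrable_on {a..c}" and \<zeta>: "0 < \<zeta>"
  obtains P p where "polynomial_function P" "\<And>t. (P has_vector_derivative p t) (at t)" "continuous_on UNIV p"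
    "integral {a..c} (\<lambda>t. norm (f t - p t)) \<le> \<zeta>"
proof -
  define d where "d = real DIM('a)"
  have d: "0 < d" by (simp add: d_def)
  have comp: "(\<lambda>t. f t \<bullet> i) absolutely_integrable_on {a..c}" for i
    by (rule absolutely_integrable_component[OF f])
  have "\<exists>P p. real_polynomial_function P \<and> real_polynomial_function p \<and> (\<forall>t::real. (P has_real_derivative p t) (at t)) \<and>
      integral {a..c} (\<lambda>t. \<bar>f t \<bullet> i - p t\<bar>) \<le> \<zeta> / d" for i
    using L1_approximation_polynomial_real[OF comp, of "\<zeta> / d"] real_polynomial_antiderivative \<zeta> d by (metis divide_pos_pos)
  then obtain P p where Pp: "\<And>i. real_polynomial_function (P i)" "\<And>i. real_polynomial_function (p i)"
    "\<And>i t::real. (P i has_real_derivative p i t) (at t)" "\<And>i. integral {a..c} (\<lambda>t. \<bar>f t \<bullet> i - p i t\<bar>) \<le> \<zeta> / d"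
    by metis
  have contp: "continuous_on UNIV (p i)" for i using continuously_differentiable_polynomial[OF Pp(2), of 0] by simp
  let ?P = "\<lambda>t. \<Sum>i\<in>Basis. P i t *\<^sub>R (i::'a)" and ?p = "\<lambda>t. \<Sum>i\<in>Basis. p i t *\<^sub>R (i::'a)"
  have contp': "continuous_on UNIV ?p" by (intro continuous_intros contp)
  show ?thesis
  proof (rule that[of ?P ?p])
    show "polynomial_function ?P"
      using Pp(1) by (auto simp: polynomial_function_iff_Basis_inner)
    show "(?P has_vector_derivative ?p t) (at t)" for t
      by (intro has_vector_derivative_sum has_vector_derivative_scaleR[where g' = 0, simplified] Pp(3)
          has_real_derivative_iff_has_vector_derivative[THEN iffD1] | rule derivative_eq_intros Pp(3) | simp)+
    show "continuous_on UNIV ?p" by (rule contp')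
    have i1: "(\<lambda>t. \<bar>f t \<bullet> i - p i t\<bar>) integrable_on {a..c}" for i
      using set_integral_diff(1)[OF comp absolutely_integrable_continuous_real[OF continuous_on_subset[OF contp subset_UNIV]]]
      by (auto dest!: set_integrable_abs simp: absolutely_integrable_on_def)
    have i2: "(\<lambda>t. norm (f t - ?p t)) integrable_on {a..c}"
      using set_integral_diff(1)[OF f absolutely_integrable_continuous_real[OF continuous_on_subset[OF contp' subset_UNIV]]]
      by (auto dest!: set_integrable_norm simp: absolutely_integrable_on_def)
    have "integral {a..c} (\<lambda>t. norm (f t - ?p t)) \<le> integral {a..c} (\<lambda>t. \<Sum>i\<in>Basis. \<bar>f t \<bullet> i - p i t\<bar>)"
    proof (rule integral_le[OF i2])
      show "(\<lambda>t. \<Sum>i\<in>Basis. \<bar>f t \<bullet> i - p i t\<bar>) integrable_on {a..c}" by (intro integrable_sum i1) auto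
      show "norm (f t - ?p t) \<le> (\<Sum>i\<in>Basis. \<bar>f t \<bullet> i - p i t\<bar>)" for t
        by (rule order_trans[OF norm_le_l1]) (simp add: inner_diff_left)
    qed
    also have "\<dots> = (\<Sum>i\<in>(Basis::'a set). integral {a..c} (\<lambda>t. \<bar>f t \<bullet> i - p i t\<bar>))"
      by (intro integral_sum i1) auto
    also have "\<dots> \<le> (\<Sum>i\<in>(Basis::'a set). \<zeta> / d)" by (intro sum_mono Pp(4))
    also have "\<dots> = \<zeta>" using d by (simp add: d_def)
    finally show "integral {a..c} (\<lambda>t. norm (f t - ?p t)) \<le> \<zeta>" .
  qed
qed

subsection \<open>Approximate characteristics\<close>

context transport_field
begin

lemma C0_integrable_on: "C0 integrable_on {s..t}"
  using absolutely_integrable_lborel(1)[OF C0_integrable C0_nonneg] absolutely_integrable_on_def by blast+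

lemma C0_integral_nonneg: "0 \<le> integral {s..t} C0"
  by (rule Henstock_Kurzweil_Integration.integral_nonneg[OF C0_integrable_on C0_nonneg])

lemma C0_integral_mono: "s \<le> s' \<Longrightarrow> t' \<le> t \<Longrightarrow> integral {s'..t'} C0 \<le> integral {s..t} C0"
  by (rule integral_subset_le) (auto intro: C0_integrable_on C0_nonneg)

lemma C0_integral_combine: "s \<le> r \<Longrightarrow> r \<le> t \<Longrightarrow> integral {s..r} C0 + integral {r..t} C0 = integral {s..t} C0"
  by (rule Henstock_Kurzweil_Integration.integral_combine[OF _ _ C0_integrable_on])

lemma b_path_absolutely_integrable:
  assumes "continuous_on {s..t} X"
  shows "(\<lambda>\<tau>. b \<tau> (X \<tau>)) absolutely_integrable_on {s..t}"
proof -
  define Y where "Y = (\<lambda>\<tau>. if \<tau> \<in> {s..t} then X \<tau> else 0)"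
  have Y: "Y \<in> borel_measurable borel"
    unfolding Y_def by (rule borel_measurable_continuous_on_if) (use assms in auto)
  have m: "(\<lambda>\<tau>. b \<tau> (Y \<tau>)) \<in> borel_measurable borel"
    by (rule b_compose_borel[OF _ Y]) simp
  obtain L where L: "\<And>\<tau>. \<tau> \<in> {s..t} \<Longrightarrow> norm (X \<tau>) \<le> L"
    using compact_continuous_norm_bound[OF assms compact_Icc] by metis
  have "(\<lambda>\<tau>. b \<tau> (Y \<tau>)) absolutely_integrable_on {s..t}"
  proof (rule absolutely_integrable_borel_bound(1)[OF m, of "\<lambda>\<tau>. C0 \<tau> * (1 + L)"])
    show "integrable lborel (\<lambda>\<tau>. C0 \<tau> * (1 + L))" using C0_integrable by simp
    show "norm (b \<tau> (Y \<tau>)) \<le> C0 \<tau> * (1 + L)" if "\<tau> \<in> {s..t}" for \<tau>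
      by (rule order_trans[OF b_growth]) (use L[OF that] that C0_nonneg in \<open>auto simp: Y_def intro!: mult_left_mono\<close>)
  qed
  then show ?thesis
    by (rule set_integrable_cong[THEN iffD1, rotated 3]) (auto simp: Y_def)
qed

lemma b_absolutely_integrable: "(\<lambda>\<tau>. b \<tau> y) absolutely_integrable_on {s..t}"
  by (rule b_path_absolutely_integrable) (rule continuous_on_const)

lemma b_uminus_absolutely_integrable: "(\<lambda>\<tau>. - b \<tau> y) absolutely_integrable_on {s..t}"
  using set_integral_diff(1)[OF absolutely_integrable_zero b_absolutely_integrable[where y = y]] by simp

text \<open>Explicit Euler steps in which only the space variable is frozen, the field being merely
  measurable in time. The step length is chosen so that the displacement during one step, at most (1
  + |x|) times the integral of \<open>C0\<close>, keeps the Hoelder oscillation of \<open>b\<close>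
  below \<zeta>. The growth bound is a discrete Gronwall estimate based on 1 + r \<le> exp
  r.\<close>

lemma euler_scheme:
  assumes sT: "s \<le> T" and \<zeta>: "0 < \<zeta>"
  obtains g where "g absolutely_integrable_on {s..T}"
    "\<And>\<tau>. \<tau> \<in> {s..T} \<Longrightarrow> norm (g \<tau> + b \<tau> (y + integral {s..\<tau>} g)) \<le> \<zeta>"
    "\<And>\<tau>. \<tau> \<in> {s..T} \<Longrightarrow> 1 + norm (y + integral {s..\<tau>} g) \<le> (1 + norm y) * exp (integral {s..\<tau>} C0)"
proof -
  \<comment> \<open>A bound for 1 + |x| along the whole scheme, known beforehand from the growth
    estimate; it allows one step length for all steps.\<close>
  define R where "R = (1 + norm y) * exp (integral {s..T} C0)"
  have R: "0 < R" by (simp add: R_def add_pos_nonneg)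
  obtain \<delta> where \<delta>: "0 < \<delta>" "\<And>x. 0 \<le> x \<Longrightarrow> x \<le> \<delta> \<Longrightarrow> H * x powr \<alpha> \<le> \<zeta>"
    using powr_small[OF H_nonneg \<alpha>_pos \<zeta>] by metis
  obtain h where h: "0 < h" "\<And>s' t. s \<le> s' \<Longrightarrow> s' \<le> t \<Longrightarrow> t \<le> T \<Longrightarrow> t - s' \<le> h \<Longrightarrow> integral {s'..t} C0 \<le> \<delta> / R"
    using integral_uniformly_small[OF C0_integrable C0_nonneg, of "\<delta> / R" s T] \<delta>(1) R by (metis divide_pos_pos)
  define t where "t k = min T (s + real k * h)" for k :: nat
  have t: "s \<le> t k" "t k \<le> T" "t k \<le> t (Suc k)" "t (Suc k) - t k \<le> h" for k
    using sT h(1) by (auto simp: t_def distrib_right)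
  \<comment> \<open>At every stage the velocity is defined on the whole interval but controlled only
    up to \<open>t k\<close>; the next stage alters it beyond \<open>t k\<close> only.\<close>
  have "\<exists>g. g absolutely_integrable_on {s..T} \<and> (\<forall>\<tau>\<in>{s..t k}. norm (g \<tau> + b \<tau> (y + integral {s..\<tau>} g)) \<le> \<zeta> \<and>
     1 + norm (y + integral {s..\<tau>} g) \<le> (1 + norm y) * exp (integral {s..\<tau>} C0))" for k
  proof (induction k)
    case 0
    have "\<tau> = s" if "\<tau> \<in> {s..t 0}" for \<tau> using that by (simp add: t_def)
    then have "\<forall>\<tau>\<in>{s..t 0}. norm (- b \<tau> y + b \<tau> (y + integral {s..\<tau>} (\<lambda>\<tau>. - b \<tau> y))) \<le> \<zeta> \<and>
        1 + norm (y + integral {s..\<tau>} (\<lambda>\<tau>. - b \<tau> y)) \<le> (1 + norm y) * exp (integral {s..\<tau>} C0)"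
      using \<zeta> by fastforce
    then show ?case using b_uminus_absolutely_integrable by blast
  next
    case (Suc k)
    then obtain g where g: "g absolutely_integrable_on {s..T}"
      and g1: "\<And>\<tau>. \<tau> \<in> {s..t k} \<Longrightarrow> norm (g \<tau> + b \<tau> (y + integral {s..\<tau>} g)) \<le> \<zeta>"
      and g2: "\<And>\<tau>. \<tau> \<in> {s..t k} \<Longrightarrow> 1 + norm (y + integral {s..\<tau>} g) \<le> (1 + norm y) * exp (integral {s..\<tau>} C0)"
      by blast
    define x where "x = y + integral {s..t k} g"
    have x: "1 + norm x \<le> (1 + norm y) * exp (integral {s..t k} C0)"
      unfolding x_def by (rule g2) (use t in auto)
    have xR: "1 + norm x \<le> R"
      using x C0_integral_mono[of s s "t k" T] t unfolding R_def
      by (smt (verit, best) exp_le_cancel_iff mult_left_mono norm_ge_zero)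
    define g' where "g' \<tau> = (if \<tau> \<le> t k then g \<tau> else - b \<tau> x)" for \<tau>
    have g'1: "g' absolutely_integrable_on {s..t k}"
      by (rule set_integrable_cong[THEN iffD1, OF refl refl _ absolutely_integrable_on_subinterval[OF g]])
         (use t in \<open>auto simp: g'_def\<close>)
    have bneg: "(\<lambda>\<tau>. - b \<tau> x) absolutely_integrable_on {t k..r}" for r
      by (rule b_uminus_absolutely_integrable)
    have g'2: "g' absolutely_integrable_on {t k..r}" for r
      by (rule absolutely_integrable_spike[OF bneg, of "{t k}"]) (auto simp: g'_def)
    have g'i: "g' absolutely_integrable_on {s..T}"
      by (rule absolutely_integrable_on_combine[OF g'1 g'2]) (use t in auto)
    have int1: "integral {s..\<tau>} g' = integral {s..\<tau>} g" if "\<tau> \<le> t k" for \<tau>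
      by (rule Henstock_Kurzweil_Integration.integral_cong) (use that in \<open>auto simp: g'_def\<close>)
    have int2: "y + integral {s..\<tau>} g' = x + integral {t k..\<tau>} (\<lambda>r. - b r x)" if "t k \<le> \<tau>" "\<tau> \<le> T" for \<tau>
    proof -
      have "integral {s..t k} g' + integral {t k..\<tau>} g' = integral {s..\<tau>} g'"
        by (rule Henstock_Kurzweil_Integration.integral_combine)
           (use that t absolutely_integrable_on_subinterval[OF g'i, of s \<tau>] in \<open>auto simp: absolutely_integrable_on_def\<close>)
      moreover have "integral {t k..\<tau>} g' = integral {t k..\<tau>} (\<lambda>r. - b r x)"
        by (rule integral_spike[of "{t k}"]) (auto simp: g'_def)
      ultimately show ?thesis using int1[of "t k"] by (simp add: x_def add.assoc)
    qed
    have step: "norm (integral {t k..\<tau>} (\<lambda>r. - b r x)) \<le> (1 + norm x) * integral {t k..\<tau>} C0" if "t k \<le> \<tau>" for \<tau>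
    proof -
      have "norm (integral {t k..\<tau>} (\<lambda>r. - b r x)) \<le> integral {t k..\<tau>} (\<lambda>r. (1 + norm x) * C0 r)"
      proof (rule integral_norm_bound_integral[OF _ integrable_on_mult_right[OF C0_integrable_on]])
        show "(\<lambda>r. - b r x) integrable_on {t k..\<tau>}"
          using bneg[of \<tau>] by (simp add: absolutely_integrable_on_def)
        show "norm (- b r x) \<le> (1 + norm x) * C0 r" for r
          using b_growth[of r x] by (simp add: mult.commute)
      qed
      then show ?thesis by simp
    qed
    have "norm (g' \<tau> + b \<tau> (y + integral {s..\<tau>} g')) \<le> \<zeta> \<and>
       1 + norm (y + integral {s..\<tau>} g') \<le> (1 + norm y) * exp (integral {s..\<tau>} C0)" if \<tau>: "\<tau> \<in> {s..t (Suc k)}" for \<tau>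
    proof (cases "\<tau> \<le> t k")
      case True
      then show ?thesis using g1[of \<tau>] g2[of \<tau>] \<tau> by (simp add: int1) (simp add: g'_def)
    next
      case False
      define z where "z = x + integral {t k..\<tau>} (\<lambda>r. - b r x)"
      have \<tau>2: "t k \<le> \<tau>" "\<tau> \<le> T" "\<tau> - t k \<le> h" using False \<tau> t(2,4)[of "Suc k"] t(4)[of k] t(2)[of "Suc k"] by auto
      have z: "y + integral {s..\<tau>} g' = z" unfolding z_def using int2 \<tau>2 by simp
      have zx: "norm (z - x) \<le> (1 + norm x) * integral {t k..\<tau>} C0" using step \<tau>2 by (simp add: z_def)
      also have "\<dots> \<le> R * (\<delta> / R)"
        using xR h(2)[of "t k" \<tau>] \<tau>2 t C0_integral_nonneg R by (intro mult_mono) auto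
      finally have "norm (z - x) \<le> \<delta>" using R by simp
      then have "norm (b \<tau> z - b \<tau> x) \<le> \<zeta>" using \<delta>(2) b_holder order_trans norm_ge_zero by blast
      then have 1: "norm (g' \<tau> + b \<tau> z) \<le> \<zeta>" using False by (simp add: g'_def)
      have "1 + norm z \<le> (1 + norm x) * (1 + integral {t k..\<tau>} C0)"
        using zx norm_triangle_ineq2[of z x] by (simp add: algebra_simps)
      also have "\<dots> \<le> (1 + norm x) * exp (integral {t k..\<tau>} C0)"
        by (intro mult_left_mono exp_ge_add_one_self) (simp add: add_nonneg_nonneg)
      also have "\<dots> \<le> (1 + norm y) * exp (integral {s..t k} C0) * exp (integral {t k..\<tau>} C0)"
        by (intro mult_right_mono x) simp
      also have "\<dots> = (1 + norm y) * exp (integral {s..\<tau>} C0)"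
        using C0_integral_combine[of s "t k" \<tau>] \<tau>2 t by (simp add: mult.assoc flip: exp_add)
      finally show ?thesis using 1 z by simp
    qed
    then show ?case using g'i by blast
  qed
  moreover obtain k :: nat where "(T - s) / h \<le> real k" using real_arch_simple by blast
  then have "t k = T" using h(1) by (simp add: t_def field_simps min_def)
  ultimately show ?thesis using that by metis
qed

text \<open>Polynomial curves almost solving \<open>X' = - b(t, X)\<close>. No limit is taken: such curves are smooth enough to carry
  test functions.\<close>

lemma approximate_characteristic:
  assumes sT: "s \<le> T" and \<zeta>: "0 < \<zeta>"
  obtains X X' where "polynomial_function X" "\<And>t. (X has_vector_derivative X' t) (at t)" "continuous_on UNIV X'" "X s = y"
    "integral {s..T} (\<lambda>t. norm (X' t + b t (X t))) \<le> \<zeta>"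
    "\<And>t. t \<in> {s..T} \<Longrightarrow> 1 + norm (X t) \<le> (1 + norm y) * exp (integral {s..t} C0) + \<zeta>"
proof -
  \<comment> \<open>The errors to be paid are \<zeta> / L for the L^1 approximation of the velocity
    and 2 \<zeta> / L per unit of time for the Euler scheme and the displacement; 1 + 2 (T - s) is
    at most \<open>L\<close>.\<close>
  define L where "L = 3 * (T - s + 1)"
  have L: "3 \<le> L" using sT by (simp add: L_def)
  have \<zeta>L: "0 < \<zeta> / L" using \<zeta> L by simp
  obtain \<delta> where \<delta>: "0 < \<delta>" "\<And>x. 0 \<le> x \<Longrightarrow> x \<le> \<delta> \<Longrightarrow> H * x powr \<alpha> \<le> \<zeta> / L"
    using powr_small[OF H_nonneg \<alpha>_pos \<zeta>L] by metis
  define \<xi> where "\<xi> = min \<delta> (\<zeta> / L)"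
  have \<xi>: "0 < \<xi>" "\<xi> \<le> \<delta>" "\<xi> \<le> \<zeta> / L" using \<delta>(1) \<zeta>L by (auto simp: \<xi>_def)
  obtain g where g: "g absolutely_integrable_on {s..T}"
    and g1: "\<And>\<tau>. \<tau> \<in> {s..T} \<Longrightarrow> norm (g \<tau> + b \<tau> (y + integral {s..\<tau>} g)) \<le> \<zeta> / L"
    and g2: "\<And>\<tau>. \<tau> \<in> {s..T} \<Longrightarrow> 1 + norm (y + integral {s..\<tau>} g) \<le> (1 + norm y) * exp (integral {s..\<tau>} C0)"
    using euler_scheme[OF sT \<zeta>L, of y] by metis
  obtain P p where P: "polynomial_function P" "\<And>t. (P has_vector_derivative p t) (at t)" "continuous_on UNIV p"
    and gp: "integral {s..T} (\<lambda>t. norm (g t - p t)) \<le> \<xi>"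
    using L1_approximation_polynomial[OF g \<xi>(1)] by metis
  \<comment> \<open>The shift restores the initial value. The curve then stays within \<xi> of the
    Euler curve, because the velocities differ by at most \<xi> in L^1.\<close>
  define X where "X t = P t + (y - P s)" for t
  have pi: "p absolutely_integrable_on {c..d}" for c d
    by (rule absolutely_integrable_continuous_real[OF continuous_on_subset[OF P(3) subset_UNIV]])
  have X: "polynomial_function X" "\<And>t. (X has_vector_derivative p t) (at t)" "X s = y"
    unfolding X_def using P(1,2) by (auto intro!: derivative_eq_intros)
  have contX: "continuous_on S X" for S
    using X(2) by (meson continuous_at_imp_continuous_on has_vector_derivative_continuous)
  have gpi: "(\<lambda>t. g t - p t) absolutely_integrable_on {s..t}" if "t \<le> T" for t
    using set_integral_diff(1)[OF absolutely_integrable_on_subinterval[OF g] pi] that by auto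
  have near: "norm (X t - (y + integral {s..t} g)) \<le> \<xi>" if t: "t \<in> {s..T}" for t
  proof -
    have "integral {s..t} p = P t - P s"
      by (intro integral_unique fundamental_theorem_of_calculus) (use t P(2) in \<open>auto intro: has_vector_derivative_at_within\<close>)
    then have "X t - (y + integral {s..t} g) = - (integral {s..t} g - integral {s..t} p)"
      by (simp add: X_def)
    also have "integral {s..t} g - integral {s..t} p = integral {s..t} (\<lambda>t. g t - p t)"
      by (rule Henstock_Kurzweil_Integration.integral_diff[symmetric])
         (use absolutely_integrable_on_subinterval[OF g, of s t] pi t in \<open>auto simp: absolutely_integrable_on_def\<close>)
    finally have "norm (X t - (y + integral {s..t} g)) = norm (integral {s..t} (\<lambda>t. g t - p t))" by simp
    also have "\<dots> \<le> integral {s..t} (\<lambda>t. norm (g t - p t))"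
      by (rule integral_norm_bound_integral) (use gpi[of t] t in \<open>auto simp: absolutely_integrable_on_def\<close>)
    also have "\<dots> \<le> integral {s..T} (\<lambda>t. norm (g t - p t))"
      by (rule integral_subset_le) (use gpi t in \<open>auto simp: absolutely_integrable_on_def\<close>)
    finally show ?thesis using gp by linarith
  qed
  show ?thesis
  proof (rule that[OF X(1,2) P(3) X(3)])
    have bi: "(\<lambda>t. norm (p t + b t (X t))) integrable_on {s..T}"
      using set_integral_add(1)[OF pi b_path_absolutely_integrable[OF contX]] by (auto simp: absolutely_integrable_on_def)
    have "integral {s..T} (\<lambda>t. norm (p t + b t (X t))) \<le> integral {s..T} (\<lambda>t. norm (g t - p t) + 2 * (\<zeta> / L))"
    proof (rule integral_le[OF bi])
      show "(\<lambda>t. norm (g t - p t) + 2 * (\<zeta> / L)) integrable_on {s..T}"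
        using gpi[of T] by (intro integrable_add integrable_const_ivl) (auto simp: absolutely_integrable_on_def)
      fix t assume t: "t \<in> {s..T}"
      have "norm (b t (X t) - b t (y + integral {s..t} g)) \<le> \<zeta> / L"
        by (rule order_trans[OF b_holder]) (intro \<delta>(2), use near[OF t] \<xi> in auto)
      moreover have "p t + b t (X t) = (g t + b t (y + integral {s..t} g)) + (b t (X t) - b t (y + integral {s..t} g)) - (g t - p t)"
        by simp
      moreover have "norm (u + v - w) \<le> norm u + norm v + norm w" for u v w :: 'a
        using norm_triangle_ineq4[of "u + v" w] norm_triangle_ineq[of u v] by linarith
      ultimately have "norm (p t + b t (X t)) \<le> norm (g t + b t (y + integral {s..t} g)) + norm (b t (X t) - b t (y + integral {s..t} g)) + norm (g t - p t)"
        and "norm (b t (X t) - b t (y + integral {s..t} g)) \<le> \<zeta> / L"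
        by metis+
      then show "norm (p t + b t (X t)) \<le> norm (g t - p t) + 2 * (\<zeta> / L)"
        using g1[OF t] by linarith
    qed
    also have "\<dots> = integral {s..T} (\<lambda>t. norm (g t - p t)) + integral {s..T} (\<lambda>t. 2 * (\<zeta> / L))"
      using gpi[of T] by (intro Henstock_Kurzweil_Integration.integral_add integrable_const_ivl) (auto simp: absolutely_integrable_on_def)
    also have "integral {s..T} (\<lambda>t. 2 * (\<zeta> / L)) = (T - s) * (2 * (\<zeta> / L))" using sT by simp
    also have "integral {s..T} (\<lambda>t. norm (g t - p t)) + (T - s) * (2 * (\<zeta> / L)) \<le> \<zeta> / L + (T - s) * (2 * (\<zeta> / L))"
      using gp \<xi>(3) by linarith
    also have "\<dots> \<le> L * (\<zeta> / L)"
    proof -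
      have "(1 + 2 * (T - s)) * (\<zeta> / L) \<le> L * (\<zeta> / L)" using \<zeta>L sT by (intro mult_right_mono) (auto simp: L_def)
      then show ?thesis by (simp only: distrib_right mult_1_left) (simp only: mult.assoc mult.left_commute)
    qed
    also have "\<dots> = \<zeta>" using L by simp
    finally show "integral {s..T} (\<lambda>t. norm (p t + b t (X t))) \<le> \<zeta>" .
    fix t assume t: "t \<in> {s..T}"
    have "\<zeta> / L \<le> \<zeta>" using L \<zeta> by (simp add: field_simps)
    then show "1 + norm (X t) \<le> (1 + norm y) * exp (integral {s..t} C0) + \<zeta>"
      using near[OF t] g2[OF t] \<xi>(3) norm_triangle_ineq2[of "X t" "y + integral {s..t} g"] by linarith
  qed
qed

end

section \<open>Time cutoffs as approximate identities\<close>

lemma smooth_step_derivative: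
  "(smooth_step has_real_derivative deriv smooth_step x) (at x)" "continuous_on UNIV (deriv smooth_step)"
  "continuously_differentiable k (deriv smooth_step)"
proof -
  obtain f' where f': "\<And>x. (smooth_step has_real_derivative f' x) (at x)" "continuous_on UNIV f'"
    "\<And>k. continuously_differentiable k f'"
    using obtain_smooth_real_derivative[OF smooth_step_smooth] by metis
  then have "deriv smooth_step = f'" by (auto simp: DERIV_imp_deriv)
  with f' show "(smooth_step has_real_derivative deriv smooth_step x) (at x)" "continuous_on UNIV (deriv smooth_step)"
    "continuously_differentiable k (deriv smooth_step)"
    by auto
qed

lemma smooth_step_derivative_outside: "x < 0 \<or> 1 < x \<Longrightarrow> deriv smooth_step x = 0"
proof (rule DERIV_imp_deriv)
  assume "x < 0 \<or> 1 < x"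
  then show "(smooth_step has_real_derivative 0) (at x)"
  proof
    assume "x < 0"
    have "\<forall>\<^sub>F y in nhds x. smooth_step y = 0"
      by (rule eventually_mono[OF eventually_nhds_in_open[of "{..<0}" x]]) (use \<open>x < 0\<close> in \<open>auto simp: smooth_step_0\<close>)
    from DERIV_cong_ev[OF refl this refl, of 0] show ?thesis by simp
  next
    assume "1 < x"
    have "\<forall>\<^sub>F y in nhds x. smooth_step y = 1"
      by (rule eventually_mono[OF eventually_nhds_in_open[of "{1<..}" x]]) (use \<open>1 < x\<close> in \<open>auto simp: smooth_step_1\<close>)
    from DERIV_cong_ev[OF refl this refl, of 0] show ?thesis by simp
  qed
qed

text \<open>The derivative of a smooth step of width h started at \<tau> is an approximate identity
  living on [\<tau>, \<tau> + h]. What enters is its integral 1 and an L^1 bound \<open>m\<close>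
  that is the same for all h and \<tau>.\<close>

lemma smooth_step_kernel:
  obtains m where "0 \<le> m"
    "\<And>h \<tau>. 0 < h \<Longrightarrow> (LINT t|lborel. \<bar>deriv smooth_step ((t - \<tau>) / h) / h\<bar>) \<le> m"
    "\<And>h \<tau> F d. 0 < h \<Longrightarrow> continuous_on UNIV F \<Longrightarrow> (\<And>t. t \<in> {\<tau>..\<tau> + h} \<Longrightarrow> \<bar>F t - F \<tau>\<bar> \<le> d) \<Longrightarrow>
       \<bar>(LINT t|lborel. F t * (deriv smooth_step ((t - \<tau>) / h) / h)) - F \<tau>\<bar> \<le> m * d"
    "\<And>h \<tau> F. 0 < h \<Longrightarrow> continuous_on UNIV F \<Longrightarrow> integrable lborel (\<lambda>t. F t * (deriv smooth_step ((t - \<tau>) / h) / h))"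
proof -
  obtain m where m: "0 \<le> m" "\<And>x. x \<in> {0..1} \<Longrightarrow> norm (deriv smooth_step x) \<le> m"
    using compact_continuous_norm_bound[OF continuous_on_subset[OF smooth_step_derivative(2) subset_UNIV] compact_Icc] by metis
  define k where "k h \<tau> t = deriv smooth_step ((t - \<tau>) / h) / h" for h \<tau> t :: real
  have contk: "continuous_on UNIV (k h \<tau>)" if "0 < h" for h \<tau>
    unfolding k_def using that
    by (intro continuous_intros continuous_on_compose2[OF smooth_step_derivative(2)]) auto
  have k0: "k h \<tau> t = 0" if "0 < h" "t \<notin> {\<tau>..\<tau> + h}" for h \<tau> t
    unfolding k_def using that by (subst smooth_step_derivative_outside) (auto simp: field_simps)
  have km: "\<bar>k h \<tau> t\<bar> \<le> m / h * indicator {\<tau>..\<tau> + h} t" if "0 < h" for h \<tau> t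
  proof (cases "t \<in> {\<tau>..\<tau> + h}")
    case True
    then have "\<bar>deriv smooth_step ((t - \<tau>) / h)\<bar> \<le> m" using m(2)[of "(t - \<tau>) / h"] that by (simp add: field_simps)
    then show ?thesis using True that by (simp add: k_def divide_right_mono)
  qed (simp add: k0 that)
  have ii: "integrable lborel (\<lambda>t. c * indicator {\<tau>..\<tau> + h} t)" for c \<tau> h :: real
    by (intro integrable_mult_right integrable_real_indicator) (auto simp: emeasure_lborel_Icc_eq)
  have int: "integrable lborel (\<lambda>t. F t * k h \<tau> t)" if "0 < h" "continuous_on UNIV F" for F h \<tau>
    by (rule integrable_continuous_compact_support[where r = "\<bar>\<tau>\<bar> + h"])
       (use that in \<open>auto intro!: continuous_intros contk k0\<close>)
  have k1: "(LINT t|lborel. k h \<tau> t) = 1" if h: "0 < h" for h \<tau>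
  proof -
    have "(LINT t|lborel. k h \<tau> t) = (LINT t|lborel. indicator {\<tau>..\<tau> + h} t *\<^sub>R k h \<tau> t)"
      by (rule Bochner_Integration.integral_cong) (use k0[OF h] in \<open>auto simp: indicator_def\<close>)
    also have "\<dots> = integral {\<tau>..\<tau> + h} (k h \<tau>)"
    proof (rule absolutely_integrable_borel_bound(2))
      show "k h \<tau> \<in> borel_measurable borel" by (rule borel_measurable_continuous_onI[OF contk[OF h]])
      show "norm (k h \<tau> t) \<le> m / h * indicator {\<tau>..\<tau> + h} t" for t using km[OF h] by simp
    qed (rule ii)
    also have "\<dots> = smooth_step ((\<tau> + h - \<tau>) / h) - smooth_step ((\<tau> - \<tau>) / h)"
    proof (intro integral_unique fundamental_theorem_of_calculus)
      show "((\<lambda>t. smooth_step ((t - \<tau>) / h)) has_vector_derivative k h \<tau> t) (at t within {\<tau>..\<tau> + h})" for t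
      proof -
        have "((\<lambda>t. smooth_step ((t - \<tau>) / h)) has_real_derivative deriv smooth_step ((t - \<tau>) / h) * (1 / h)) (at t)"
          using h by (intro DERIV_chain2[OF smooth_step_derivative(1)]) (auto intro!: derivative_eq_intros)
        then show ?thesis
          by (simp add: k_def has_real_derivative_iff_has_vector_derivative has_vector_derivative_at_within)
      qed
    qed (use h in simp)
    also have "\<dots> = 1" using h by (simp add: smooth_step_0 smooth_step_1)
    finally show ?thesis .
  qed
  show ?thesis
  proof (rule that[of m])
    show "0 \<le> m" by fact
    fix h \<tau> :: real assume h: "0 < h"
    have "(LINT t|lborel. \<bar>k h \<tau> t\<bar>) \<le> (LINT t|lborel. m / h * indicator {\<tau>..\<tau> + h} t)"
      using int[OF h continuous_on_const, of 1] by (intro integral_mono km h ii) auto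
    also have "\<dots> = m" using h by simp
    finally show "(LINT t|lborel. \<bar>deriv smooth_step ((t - \<tau>) / h) / h\<bar>) \<le> m" by (simp add: k_def)
    fix F :: "real \<Rightarrow> real" assume F: "continuous_on UNIV F"
    show "integrable lborel (\<lambda>t. F t * (deriv smooth_step ((t - \<tau>) / h) / h))" using int[OF h F] by (simp add: k_def)
    fix d assume d: "\<And>t. t \<in> {\<tau>..\<tau> + h} \<Longrightarrow> \<bar>F t - F \<tau>\<bar> \<le> d"
    have "0 \<le> d" using d[of \<tau>] h by simp
    have "(LINT t|lborel. F t * k h \<tau> t) - F \<tau> = (LINT t|lborel. F t * k h \<tau> t) - F \<tau> * (LINT t|lborel. k h \<tau> t)"
      by (simp add: k1 h)
    also have "\<dots> = (LINT t|lborel. (F t - F \<tau>) * k h \<tau> t)"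
      using int[OF h F] int[OF h continuous_on_const, of 1] by (simp add: left_diff_distrib)
    finally have "\<bar>(LINT t|lborel. F t * k h \<tau> t) - F \<tau>\<bar> \<le> (LINT t|lborel. \<bar>(F t - F \<tau>) * k h \<tau> t\<bar>)"
      using integral_abs_bound by metis
    also have "\<dots> \<le> (LINT t|lborel. d * (m / h) * indicator {\<tau>..\<tau> + h} t)"
    proof (rule integral_mono)
      show "integrable lborel (\<lambda>t. \<bar>(F t - F \<tau>) * k h \<tau> t\<bar>)"
        by (intro integrable_abs int h continuous_intros F)
      show "integrable lborel (\<lambda>t. d * (m / h) * indicator {\<tau>..\<tau> + h} t)" by (rule ii)
      show "\<bar>(F t - F \<tau>) * k h \<tau> t\<bar> \<le> d * (m / h) * indicator {\<tau>..\<tau> + h} t" for t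
      proof (cases "t \<in> {\<tau>..\<tau> + h}")
        case True
        then show ?thesis using mult_mono[OF d[OF True] km[OF h, of \<tau> t]] \<open>0 \<le> d\<close> by (simp add: abs_mult)
      qed (simp add: k0 h)
    qed
    also have "\<dots> = m * d" using h by simp
    finally show "\<bar>(LINT t|lborel. F t * (deriv smooth_step ((t - \<tau>) / h) / h)) - F \<tau>\<bar> \<le> m * d" by (simp add: k_def)
  qed
qed

context transport_field
begin

lemma defect_integral:
  assumes X: "continuous_on UNIV X" "continuous_on UNIV X'"
  shows "integrable lborel (\<lambda>t. indicator {s..T} t * norm (X' t + b t (X t)))"
    and "(LINT t|lborel. indicator {s..T} t * norm (X' t + b t (X t))) = integral {s..T} (\<lambda>t. norm (X' t + b t (X t)))"
proof -
  have bX: "(\<lambda>t. b t (X t)) \<in> borel_measurable borel"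
    using X by (intro b_compose_borel borel_measurable_continuous_onI) auto
  have m: "(\<lambda>t. norm (X' t + b t (X t))) \<in> borel_measurable borel"
    using measurable_compose[OF borel_measurable_add[OF borel_measurable_continuous_onI[OF X(2)] bX] borel_measurable_norm] .
  obtain L1 where L1: "0 \<le> L1" "\<And>t. t \<in> {s..T} \<Longrightarrow> norm (X t) \<le> L1"
    using compact_continuous_norm_bound[OF continuous_on_subset[OF X(1) subset_UNIV] compact_Icc] by metis
  obtain L2 where L2: "0 \<le> L2" "\<And>t. t \<in> {s..T} \<Longrightarrow> norm (X' t) \<le> L2"
    using compact_continuous_norm_bound[OF continuous_on_subset[OF X(2) subset_UNIV] compact_Icc] by metis
  have g: "integrable lborel (\<lambda>t. L2 * indicator {s..T} t + C0 t * (1 + L1))"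
    using C0_integrable by (intro Bochner_Integration.integrable_add integrable_mult_right integrable_mult_left integrable_real_indicator)
      (auto simp: emeasure_lborel_Icc_eq)
  have le: "norm (norm (X' t + b t (X t))) \<le> L2 * indicator {s..T} t + C0 t * (1 + L1)" if "t \<in> {s..T}" for t
  proof -
    have "norm (b t (X t)) \<le> C0 t * (1 + L1)"
      by (rule order_trans[OF b_growth]) (use L1(2)[OF that] C0_nonneg in \<open>auto intro!: mult_left_mono\<close>)
    then show ?thesis using L2(2)[OF that] norm_triangle_ineq[of "X' t" "b t (X t)"] that by simp
  qed
  from absolutely_integrable_borel_bound[OF m g le]
  show "integrable lborel (\<lambda>t. indicator {s..T} t * norm (X' t + b t (X t)))"
    "(LINT t|lborel. indicator {s..T} t * norm (X' t + b t (X t))) = integral {s..T} (\<lambda>t. norm (X' t + b t (X t)))"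
    by auto
qed

end

section \<open>Variation of \<open>u\<close> along a polynomial curve\<close>

context distributional_transport
begin

lemma u_path_continuous:
  "continuous_on UNIV f \<Longrightarrow> continuous_on UNIV g \<Longrightarrow> continuous_on UNIV (\<lambda>z. u (f z) (g z))"
proof -
  assume "continuous_on UNIV f" "continuous_on UNIV g"
  then have "continuous_on UNIV (\<lambda>z. (f z, g z))" by (intro continuous_intros)
  from continuous_on_compose2[OF u_continuous this] show "continuous_on UNIV (\<lambda>z. u (f z) (g z))" by simp
qed

text \<open>The cutoff is the difference of two smooth steps of width h at t1 and t2. Pairing u(t, X
  t) with its derivative gives u(t1, X t1) - u(t2, X t2) in the limit h to 0, and the commutator
  estimate is uniform in h. The times stay strictly between 0 and T because test functions vanish
  near both.\<close>

lemma path_variation: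
  obtains K1 K2 where "0 \<le> K1" "0 \<le> K2"
   "\<And>X X' s t1 t2 \<epsilon>. polynomial_function X \<Longrightarrow> (\<And>t. (X has_vector_derivative X' t) (at t)) \<Longrightarrow> continuous_on UNIV X' \<Longrightarrow>
      s \<le> t1 \<Longrightarrow> 0 < t1 \<Longrightarrow> t1 < t2 \<Longrightarrow> t2 < T \<Longrightarrow> 0 < \<epsilon> \<Longrightarrow>
      \<bar>u t1 (X t1) - u t2 (X t2)\<bar> \<le> \<epsilon> powr \<beta> * (K1 + K2 / \<epsilon> * (integral {s..T} (\<lambda>t. norm (X' t + b t (X t))) + H * \<epsilon> powr \<alpha> * T))"
proof -
  obtain m where m: "0 \<le> m"
    and ker1: "\<And>h \<tau>. 0 < h \<Longrightarrow> (LINT t|lborel. \<bar>deriv smooth_step ((t - \<tau>) / h) / h\<bar>) \<le> m"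
    and ker2: "\<And>h \<tau> F d. 0 < h \<Longrightarrow> continuous_on UNIV F \<Longrightarrow> (\<And>t. t \<in> {\<tau>..\<tau> + h} \<Longrightarrow> \<bar>F t - F \<tau>\<bar> \<le> d) \<Longrightarrow>
       \<bar>(LINT t|lborel. F t * (deriv smooth_step ((t - \<tau>) / h) / h)) - F \<tau>\<bar> \<le> m * d"
    and ker3: "\<And>h \<tau> F. 0 < h \<Longrightarrow> continuous_on UNIV F \<Longrightarrow> integrable lborel (\<lambda>t. F t * (deriv smooth_step ((t - \<tau>) / h) / h))"
    by (rule smooth_step_kernel) (rule that; blast)
  obtain Cb where Cb: "0 \<le> Cb" "\<And>\<epsilon>. 0 < \<epsilon> \<Longrightarrow> (LINT w|lborel. norm (Drho \<epsilon> (w::'a))) \<le> Cb / \<epsilon> * (LINT w|lborel. rho \<epsilon> (w::'a))"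
    "\<And>\<epsilon>. 0 < \<epsilon> \<Longrightarrow> 0 < (LINT w|lborel. rho \<epsilon> (w::'a))"
    using rho_integral_bounds by metis
  define c1 where "c1 = (LINT t|lborel. C1 t)"
  have c1: "0 \<le> c1" unfolding c1_def by (intro Bochner_Integration.integral_nonneg C1_nonneg)
  \<comment> \<open>The integral of |\<eta>'| is at most 2 m and enters with a factor 2;
    \<open>Cb\<close> compares the integral of |\<open>Drho\<close>| with the mass of the bump.
    Neither constant depends on the curve, the times or \<epsilon>.\<close>
  define K1 where "K1 = (B + 1) * (4 * m + 2 * DIM('a) * c1)"
  define K2 where "K2 = (B + 1) * (2 * Cb)"
  show ?thesis
  proof (rule that[of K1 K2])
    show "0 \<le> K1" "0 \<le> K2" using B_nonneg m c1 Cb(1) by (auto simp: K1_def K2_def intro!: mult_nonneg_nonneg add_nonneg_nonneg)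
    fix X X' :: "real \<Rightarrow> 'a" and s t1 t2 \<epsilon> :: real
    assume X: "polynomial_function X" "\<And>t. (X has_vector_derivative X' t) (at t)" and contX': "continuous_on UNIV X'"
      and t: "s \<le> t1" "0 < t1" "t1 < t2" "t2 < T" and \<epsilon>: "0 < \<epsilon>"
    define E where "E = integral {s..T} (\<lambda>t. norm (X' t + b t (X t)))"
    have contX: "continuous_on UNIV X"
      using X(2) by (auto simp: continuous_on_eq_continuous_at intro: has_vector_derivative_continuous)
    define F where "F t = u t (X t)" for t
    have contF: "continuous_on UNIV F" unfolding F_def by (intro u_path_continuous continuous_on_id contX)
    define V where "V = (LINT z|lborel. rho \<epsilon> (z::'a))"
    define N where "N = (LINT z|lborel. norm (Drho \<epsilon> (z::'a)))"
    have V: "0 < V" and NV: "N \<le> Cb / \<epsilon> * V" and N: "0 \<le> N"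
      using Cb(2,3)[OF \<epsilon>] by (auto simp: V_def N_def intro!: Bochner_Integration.integral_nonneg)
    have approx: "\<bar>F t1 - F t2\<bar> \<le> \<epsilon> powr \<beta> * (K1 + K2 / \<epsilon> * (E + H * \<epsilon> powr \<alpha> * T)) + 2 * m * d" if d: "0 < d" for d
    proof -
      have "isCont F t1" "isCont F t2" using contF by (auto simp: continuous_on_eq_continuous_at)
      then obtain h1 h2 where h1: "0 < h1" "\<And>t. dist t t1 < h1 \<Longrightarrow> dist (F t) (F t1) < d"
        and h2: "0 < h2" "\<And>t. dist t t2 < h2 \<Longrightarrow> dist (F t) (F t2) < d"
        unfolding continuous_at_eps_delta using d by metis
      \<comment> \<open>Small enough for the continuity of \<open>F\<close> at both times, for the
        first ramp to end before the second begins, and for the second to end before T.\<close>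
      define h where "h = min (min (h1 / 2) (h2 / 2)) (min (t2 - t1) ((T - t2) / 2))"
      have h: "0 < h" "h < h1" "h < h2" "t1 + h \<le> t2" "t2 + h < T"
        using h1(1) h2(1) t by (auto simp: h_def min_def field_simps)
      define \<eta> where "\<eta> t = smooth_step ((t - t1) / h) - smooth_step ((t - t2) / h)" for t
      define \<eta>' where "\<eta>' t = deriv smooth_step ((t - t1) / h) / h - deriv smooth_step ((t - t2) / h) / h" for t
      have \<eta>1: "continuously_differentiable k \<eta>" for k
        unfolding \<eta>_def diff_divide_distrib divide_inverse[of _ h]
        by (intro continuously_differentiable_diff continuously_differentiable_compose[OF smooth_step_smooth]
            continuously_differentiable_const continuously_differentiable_linear bounded_linear_mult_left)
      have \<eta>2: "(\<eta> has_real_derivative \<eta>' t) (at t)" for t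
      proof -
        have "((\<lambda>t. smooth_step ((t - \<tau>) / h)) has_real_derivative deriv smooth_step ((t - \<tau>) / h) * (1 / h)) (at t)" for \<tau>
          using h(1) by (intro DERIV_chain2[OF smooth_step_derivative(1)]) (auto intro!: derivative_eq_intros)
        from DERIV_diff[OF this[of t1] this[of t2]] show ?thesis by (simp add: \<eta>_def[abs_def] \<eta>'_def)
      qed
      have \<eta>3: "continuous_on UNIV \<eta>'"
        unfolding \<eta>'_def using h(1) by (intro continuous_intros continuous_on_compose2[OF smooth_step_derivative(2)]) auto
      have supp: "\<eta> t = 0" if "t \<notin> {t1..t2 + h}" for t
      proof (cases "t < t1")
        case True
        then show ?thesis using h(1) t by (simp add: \<eta>_def smooth_step_0 divide_nonpos_pos)
      next
        case False
        then have "t2 + h < t" using that by auto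
        then show ?thesis using h(1,4) t by (simp add: \<eta>_def smooth_step_1 field_simps)
      qed
      have nn: "0 \<le> \<eta> t" for t
      proof (cases "t \<le> t2")
        case True
        then show ?thesis using h(1) by (simp add: \<eta>_def smooth_step_0 divide_nonpos_pos smooth_step_bounds)
      next
        case False
        then show ?thesis using h(1,4) by (simp add: \<eta>_def smooth_step_1 field_simps smooth_step_bounds)
      qed
      have le1: "\<eta> t \<le> indicator {t1..t2 + h} t" for t
        using supp[of t] smooth_step_bounds(1)[of "(t - t2) / h"] smooth_step_bounds(2)[of "(t - t1) / h"]
        by (cases "t \<in> {t1..t2 + h}") (auto simp: \<eta>_def)
      note ctx = X contX' \<eta>1 \<eta>2 \<eta>3 supp nn t(2) h(5) \<epsilon>
      have C: "V * \<bar>LINT t|lborel. F t * \<eta>' t\<bar> \<le> (B + 1) * \<epsilon> powr \<beta> *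
         (2 * V * (LINT t|lborel. \<bar>\<eta>' t\<bar>) + 2 * N * ((LINT t|lborel. \<eta> t * norm (X' t + b t (X t))) + H * \<epsilon> powr \<alpha> * (LINT t|lborel. \<eta> t))
         + 2 * DIM('a) * V * (LINT t|lborel. \<eta> t * C1 t))"
        unfolding F_def V_def N_def by (rule commutator_estimate[OF ctx])
      have i1: "integrable lborel (\<lambda>t. \<eta> t)"
        by (rule cutoff_integrables(1)[OF ctx]; (assumption | rule continuous_on_const))
      have i2: "integrable lborel (\<lambda>t. \<eta> t * C1 t)"
        by (rule cutoff_integrables(2)[OF ctx]; (assumption | rule continuous_on_const))
      have i3: "integrable lborel (\<lambda>t. \<eta> t * norm (X' t + b t (X t)))"
        by (rule cutoff_integrables(3)[OF ctx]; (assumption | rule continuous_on_const))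
      have i4: "integrable lborel (\<lambda>t. \<eta>' t)"
        by (rule cutoff_integrables(4)[OF ctx]; (assumption | rule continuous_on_const))
      have b1: "(LINT t|lborel. \<bar>\<eta>' t\<bar>) \<le> 2 * m"
      proof -
        have i: "integrable lborel (\<lambda>t. \<bar>deriv smooth_step ((t - \<tau>) / h) / h\<bar>)" for \<tau>
          using ker3[OF h(1) continuous_on_const, of 1 \<tau>] by (intro integrable_abs) simp
        have "(LINT t|lborel. \<bar>\<eta>' t\<bar>) \<le> (LINT t|lborel. \<bar>deriv smooth_step ((t - t1) / h) / h\<bar> + \<bar>deriv smooth_step ((t - t2) / h) / h\<bar>)"
          by (intro integral_mono integrable_abs[OF i4] Bochner_Integration.integrable_add i) (unfold \<eta>'_def, rule abs_triangle_ineq4)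
        also have "\<dots> = (LINT t|lborel. \<bar>deriv smooth_step ((t - t1) / h) / h\<bar>) + (LINT t|lborel. \<bar>deriv smooth_step ((t - t2) / h) / h\<bar>)"
          by (intro Bochner_Integration.integral_add i)
        also have "\<dots> \<le> m + m" by (intro add_mono ker1 h(1))
        finally show ?thesis by simp
      qed
      have b2: "(LINT t|lborel. \<eta> t * norm (X' t + b t (X t))) \<le> E"
      proof -
        have "(LINT t|lborel. \<eta> t * norm (X' t + b t (X t))) \<le> (LINT t|lborel. indicator {s..T} t * norm (X' t + b t (X t)))"
        proof (rule integral_mono[OF i3 defect_integral(1)[OF contX contX']])
          show "\<eta> \<tau> * norm (X' \<tau> + b \<tau> (X \<tau>)) \<le> indicator {s..T} \<tau> * norm (X' \<tau> + b \<tau> (X \<tau>))" for \<tau>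
            by (rule mult_right_mono[OF order_trans[OF le1]]) (use t(1) h(5) in \<open>auto simp: indicator_def\<close>)
        qed
        then show ?thesis unfolding defect_integral(2)[OF contX contX'] E_def .
      qed
      have b3: "(LINT t|lborel. \<eta> t) \<le> T"
      proof -
        have "(LINT t|lborel. \<eta> t) \<le> (LINT t|lborel. indicator {t1..t2 + h} t)"
          by (intro integral_mono i1 le1 integrable_real_indicator) (auto simp: emeasure_lborel_Icc_eq)
        also have "\<dots> = t2 + h - t1" using t h by simp
        finally show ?thesis using t h by linarith
      qed
      have b4: "(LINT t|lborel. \<eta> t * C1 t) \<le> c1"
        unfolding c1_def
      proof (intro integral_mono i2 C1_integrable)
        show "\<eta> t * C1 t \<le> C1 t" for t
          using mult_right_mono[OF order_trans[OF le1 indicator_le_1], of "C1 t"] C1_nonneg[of t] by simp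
      qed
      have Nb: "2 * N * ((LINT t|lborel. \<eta> t * norm (X' t + b t (X t))) + H * \<epsilon> powr \<alpha> * (LINT t|lborel. \<eta> t)) \<le> 2 * (Cb / \<epsilon> * V) * (E + H * \<epsilon> powr \<alpha> * T)"
        using NV N b2 b3 H_nonneg nn \<epsilon> Cb(1) V
        by (intro mult_mono add_mono add_nonneg_nonneg mult_nonneg_nonneg Bochner_Integration.integral_nonneg) auto
      have s1: "2 * V * (LINT t|lborel. \<bar>\<eta>' t\<bar>) \<le> 2 * V * (2 * m)" using b1 V by (intro mult_left_mono) auto
      have s2: "2 * DIM('a) * V * (LINT t|lborel. \<eta> t * C1 t) \<le> 2 * DIM('a) * V * c1"
        using b4 V by (intro mult_left_mono) auto
      have "V * \<bar>LINT t|lborel. F t * \<eta>' t\<bar> \<le> (B + 1) * \<epsilon> powr \<beta> *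
         (2 * V * (2 * m) + 2 * (Cb / \<epsilon> * V) * (E + H * \<epsilon> powr \<alpha> * T) + 2 * DIM('a) * V * c1)"
        by (rule order_trans[OF C mult_left_mono[OF add_mono[OF add_mono[OF s1 Nb] s2]]]) (use B_nonneg in simp)
      also have "\<dots> = V * (\<epsilon> powr \<beta> * (K1 + K2 / \<epsilon> * (E + H * \<epsilon> powr \<alpha> * T)))"
        by (simp add: K1_def K2_def algebra_simps)
      finally have main: "\<bar>LINT t|lborel. F t * \<eta>' t\<bar> \<le> \<epsilon> powr \<beta> * (K1 + K2 / \<epsilon> * (E + H * \<epsilon> powr \<alpha> * T))"
        using V by simp
      have split: "(LINT t|lborel. F t * \<eta>' t) = (LINT t|lborel. F t * (deriv smooth_step ((t - t1) / h) / h)) - (LINT t|lborel. F t * (deriv smooth_step ((t - t2) / h) / h))"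
        using ker3[OF h(1) contF] by (simp add: \<eta>'_def right_diff_distrib)
      have "\<bar>(LINT t|lborel. F t * (deriv smooth_step ((t - t1) / h) / h)) - F t1\<bar> \<le> m * d"
      proof (rule ker2[OF h(1) contF])
        fix t assume "t \<in> {t1..t1 + h}"
        then have "dist (F t) (F t1) < d" using h(2) by (intro h1(2)) (auto simp: dist_real_def)
        then show "\<bar>F t - F t1\<bar> \<le> d" by (simp add: dist_real_def)
      qed
      moreover have "\<bar>(LINT t|lborel. F t * (deriv smooth_step ((t - t2) / h) / h)) - F t2\<bar> \<le> m * d"
      proof (rule ker2[OF h(1) contF])
        fix t assume "t \<in> {t2..t2 + h}"
        then have "dist (F t) (F t2) < d" using h(3) by (intro h2(2)) (auto simp: dist_real_def)
        then show "\<bar>F t - F t2\<bar> \<le> d" by (simp add: dist_real_def)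
      qed
      ultimately show ?thesis using main unfolding split by linarith
    qed
    have "\<bar>F t1 - F t2\<bar> \<le> \<epsilon> powr \<beta> * (K1 + K2 / \<epsilon> * (E + H * \<epsilon> powr \<alpha> * T))"
    proof (rule field_le_epsilon)
      fix e :: real assume e: "0 < e"
      have "2 * m * (e / (2 * m + 1)) \<le> e" using m e by (simp add: field_simps)
      with approx[of "e / (2 * m + 1)"] e m
      show "\<bar>F t1 - F t2\<bar> \<le> \<epsilon> powr \<beta> * (K1 + K2 / \<epsilon> * (E + H * \<epsilon> powr \<alpha> * T)) + e"
        by (simp add: add_nonneg_pos)
    qed
    then show "\<bar>u t1 (X t1) - u t2 (X t2)\<bar> \<le> \<epsilon> powr \<beta> * (K1 + K2 / \<epsilon> * (integral {s..T} (\<lambda>t. norm (X' t + b t (X t))) + H * \<epsilon> powr \<alpha> * T))"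
      by (simp add: F_def E_def)
  qed
qed

end

lemma (in transport_field) approximate_characteristic_ex:
  assumes "s \<le> T" "0 < \<zeta>"
  shows "\<exists>X X'. polynomial_function X \<and> (\<forall>t. (X has_vector_derivative X' t) (at t)) \<and> continuous_on UNIV X' \<and> X s = y \<and>
    integral {s..T} (\<lambda>t. norm (X' t + b t (X t))) \<le> \<zeta> \<and>
    (\<forall>t\<in>{s..T}. 1 + norm (X t) \<le> (1 + norm y) * exp (integral {s..t} C0) + \<zeta>)"
proof (rule approximate_characteristic[OF assms, of y])
  fix X X' assume "polynomial_function X" "\<And>t. (X has_vector_derivative X' t) (at t)" "continuous_on UNIV X'" "X s = y"
    "integral {s..T} (\<lambda>t. norm (X' t + b t (X t))) \<le> \<zeta>"
    "\<And>t. t \<in> {s..T} \<Longrightarrow> 1 + norm (X t) \<le> (1 + norm y) * exp (integral {s..t} C0) + \<zeta>"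
  then show ?thesis by blast
qed

section \<open>Constancy along characteristics\<close>

locale regular_transport = distributional_transport +
  assumes exponent: "1 < \<alpha> + \<beta>"
begin

text \<open>The radius \<epsilon> is fixed so that K1 \<epsilon>^\<beta> and K2 H T
  \<epsilon>^(\<alpha> + \<beta> - 1) are small, the second being possible because the exponent is
  positive. The admissible defect \<delta> is chosen afterwards, to beat the factor K2
  \<epsilon>^(\<beta> - 1). The end points of the time interval are reached by continuity.\<close>

lemma u_almost_constant:
  assumes \<zeta>: "0 < \<zeta>"
  obtains \<delta> where "0 < \<delta>"
   "\<And>X X' s t. polynomial_function X \<Longrightarrow> (\<And>t. (X has_vector_derivative X' t) (at t)) \<Longrightarrow> continuous_on UNIV X' \<Longrightarrow>
      0 \<le> s \<Longrightarrow> integral {s..T} (\<lambda>t. norm (X' t + b t (X t))) \<le> \<delta> \<Longrightarrow> t \<in> {s..T} \<Longrightarrow> \<bar>u s (X s) - u t (X t)\<bar> \<le> \<zeta>"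
proof -
  obtain K1 K2 where K: "0 \<le> K1" "0 \<le> K2"
   and var: "\<And>X X' s t1 t2 \<epsilon>. polynomial_function X \<Longrightarrow> (\<And>t. (X has_vector_derivative X' t) (at t)) \<Longrightarrow> continuous_on UNIV X' \<Longrightarrow>
      s \<le> t1 \<Longrightarrow> 0 < t1 \<Longrightarrow> t1 < t2 \<Longrightarrow> t2 < T \<Longrightarrow> 0 < \<epsilon> \<Longrightarrow>
      \<bar>u t1 (X t1) - u t2 (X t2)\<bar> \<le> \<epsilon> powr \<beta> * (K1 + K2 / \<epsilon> * (integral {s..T} (\<lambda>t. norm (X' t + b t (X t))) + H * \<epsilon> powr \<alpha> * T))"
    by (rule path_variation) (rule that; blast)
  have \<zeta>3: "0 < \<zeta> / 3" using \<zeta> by simp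
  obtain \<epsilon>1 where \<epsilon>1: "0 < \<epsilon>1" "\<And>x. 0 \<le> x \<Longrightarrow> x \<le> \<epsilon>1 \<Longrightarrow> K1 * x powr \<beta> \<le> \<zeta> / 3"
    using powr_small[OF K(1) \<beta>_pos \<zeta>3] by metis
  have "0 \<le> K2 * H * T" using K H_nonneg T_pos by simp
  then obtain \<epsilon>2 where \<epsilon>2: "0 < \<epsilon>2" "\<And>x. 0 \<le> x \<Longrightarrow> x \<le> \<epsilon>2 \<Longrightarrow> K2 * H * T * x powr (\<alpha> + \<beta> - 1) \<le> \<zeta> / 3"
    using powr_small[of "K2 * H * T" "\<alpha> + \<beta> - 1" "\<zeta> / 3"] exponent \<zeta>3 by (metis diff_gt_0_iff_gt)
  define \<epsilon> where "\<epsilon> = min \<epsilon>1 \<epsilon>2"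
  have \<epsilon>: "0 < \<epsilon>" "\<epsilon> \<le> \<epsilon>1" "\<epsilon> \<le> \<epsilon>2" using \<epsilon>1 \<epsilon>2 by (auto simp: \<epsilon>_def)
  define Q where "Q = \<epsilon> powr \<beta> * (K2 / \<epsilon>)"
  have Q: "0 \<le> Q" using K \<epsilon> by (simp add: Q_def)
  define \<delta> where "\<delta> = \<zeta> / 3 / (Q + 1)"
  have \<delta>: "0 < \<delta>" "Q * \<delta> \<le> \<zeta> / 3" using \<zeta> Q by (auto simp: \<delta>_def field_simps)
  show ?thesis
  proof (rule that[OF \<delta>(1)])
    fix X X' :: "real \<Rightarrow> 'a" and s t
    assume X: "polynomial_function X" "\<And>t. (X has_vector_derivative X' t) (at t)" "continuous_on UNIV X'"
      and s: "0 \<le> s" and E: "integral {s..T} (\<lambda>t. norm (X' t + b t (X t))) \<le> \<delta>" and t: "t \<in> {s..T}"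
    have contX: "continuous_on UNIV X"
      using X(2) by (auto simp: continuous_on_eq_continuous_at intro: has_vector_derivative_continuous)
    define F where "F t = u t (X t)" for t
    have contF: "continuous_on UNIV F" unfolding F_def by (intro u_path_continuous continuous_on_id contX)
    have inner: "\<bar>F t1 - F t2\<bar> \<le> \<zeta>" if "s < t1" "t1 < t2" "t2 < T" for t1 t2
    proof -
      have "\<bar>F t1 - F t2\<bar> \<le> \<epsilon> powr \<beta> * (K1 + K2 / \<epsilon> * (integral {s..T} (\<lambda>t. norm (X' t + b t (X t))) + H * \<epsilon> powr \<alpha> * T))"
        unfolding F_def using s that by (intro var[OF X _ _ _ _ \<epsilon>(1)]) auto
      also have "\<dots> \<le> \<epsilon> powr \<beta> * (K1 + K2 / \<epsilon> * (\<delta> + H * \<epsilon> powr \<alpha> * T))"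
        using E K \<epsilon> H_nonneg by (intro mult_left_mono add_mono) auto
      also have "\<dots> = K1 * \<epsilon> powr \<beta> + Q * \<delta> + K2 * H * T * (\<epsilon> powr \<beta> * \<epsilon> powr \<alpha> / \<epsilon>)"
        by (simp add: Q_def algebra_simps)
      also have "\<epsilon> powr \<beta> * \<epsilon> powr \<alpha> / \<epsilon> = \<epsilon> powr (\<alpha> + \<beta> - 1)"
        using \<epsilon>(1) by (simp add: powr_add powr_diff)
      also have "K1 * \<epsilon> powr \<beta> + Q * \<delta> + K2 * H * T * \<epsilon> powr (\<alpha> + \<beta> - 1) \<le> \<zeta> / 3 + \<zeta> / 3 + \<zeta> / 3"
        using \<epsilon>1(2)[of \<epsilon>] \<epsilon>2(2)[of \<epsilon>] \<epsilon> \<delta>(2) by (intro add_mono) auto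
      finally show ?thesis by simp
    qed
    show "\<bar>u s (X s) - u t (X t)\<bar> \<le> \<zeta>"
    proof (cases "s = t")
      case False
      then have st: "s < t" "t \<le> T" using t by auto
      \<comment> \<open>The summand 2 makes the factor less than 1/2, so that s + \<open>d n\<close>
        stays before t - \<open>d n\<close> for every n.\<close>
      define d where "d n = (t - s) * inverse (real (Suc n) + 2)" for n
      have d0: "d \<longlonglongrightarrow> 0"
      proof -
        have "(\<lambda>n. inverse (real n)) \<longlonglongrightarrow> 0" by (rule LIMSEQ_inverse_real_of_nat[THEN LIMSEQ_imp_Suc])
        then have "(\<lambda>n. inverse (real (n + 3))) \<longlonglongrightarrow> 0" by (rule LIMSEQ_ignore_initial_segment)
        from tendsto_mult_left[OF this, of "t - s"] show ?thesis unfolding d_def by (simp add: add.commute)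
      qed
      have d: "0 < d n" "d n < (t - s) / 2" for n
      proof -
        show "0 < d n" using st by (simp add: d_def)
        have "(t - s) * inverse (real (Suc n) + 2) < (t - s) * (1 / 2)"
          using st by (intro mult_strict_left_mono) (auto simp: field_simps)
        then show "d n < (t - s) / 2" by (simp add: d_def)
      qed
      have "isCont F s" "isCont F t" using contF by (auto simp: continuous_on_eq_continuous_at)
      moreover have "(\<lambda>n. s + d n) \<longlonglongrightarrow> s" "(\<lambda>n. t - d n) \<longlonglongrightarrow> t"
        using tendsto_add[OF tendsto_const d0, of s] tendsto_diff[OF tendsto_const d0, of t] by auto
      ultimately have "(\<lambda>n. F (s + d n)) \<longlonglongrightarrow> F s" "(\<lambda>n. F (t - d n)) \<longlonglongrightarrow> F t"
        using isCont_tendsto_compose by blast+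
      then have "(\<lambda>n. \<bar>F (s + d n) - F (t - d n)\<bar>) \<longlonglongrightarrow> \<bar>F s - F t\<bar>" by (intro tendsto_intros)
      moreover have "\<bar>F (s + d n) - F (t - d n)\<bar> \<le> \<zeta>" for n
        using d[of n] st by (intro inner) (auto simp: field_simps)
      ultimately have "\<bar>F s - F t\<bar> \<le> \<zeta>" using LIMSEQ_le_const2 by blast
      then show ?thesis by (simp add: F_def)
    qed (use \<zeta> in simp)
  qed
qed

text \<open>The point \<open>x\<close> is where the flow of \<open>- b\<close> carries \<open>y\<close> from time \<open>s\<close> to time \<open>s'\<close>.\<close>

lemma characteristic_step:
  fixes y :: 'a
  assumes s: "0 \<le> s" "s \<le> s'" "s' \<le> T"
  defines "m \<equiv> (1 + norm y) * exp (integral {0..T} C0) * integral {s..s'} C0"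
  shows "\<exists>x. u s' x = u s y \<and> norm (x - y) \<le> m \<and> norm (x - y + integral {s..s'} (\<lambda>t. b t y)) \<le> (s' - s) * (H * m powr \<alpha>)"
proof -
  define C where "C = (1 + norm y) * exp (integral {0..T} C0)"
  define I where "I = integral {s..s'} C0"
  have C: "0 \<le> C" by (simp add: C_def add_nonneg_nonneg)
  have I: "0 \<le> I" unfolding I_def by (rule C0_integral_nonneg)
  have m: "m = C * I" by (simp add: m_def C_def I_def)
  define ze where "ze n = inverse (real (Suc n))" for n
  have ze: "0 < ze n" "ze n \<le> 1" for n by (auto simp: ze_def field_simps)
  have ze0: "ze \<longlonglongrightarrow> 0" unfolding ze_def by (rule LIMSEQ_inverse_real_of_nat)
  define mm where "mm n = ze n + (C + ze n) * I" for n
  have mm: "0 \<le> mm n" "mm n \<le> 1 + (C + 1) * I" for n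
    using ze[of n] C I by (auto simp: mm_def intro!: add_mono mult_right_mono)
  have "\<exists>x. \<bar>u s y - u s' x\<bar> \<le> ze n \<and> norm (x - y) \<le> mm n \<and>
      norm (x - y + integral {s..s'} (\<lambda>t. b t y)) \<le> ze n + (s' - s) * (H * mm n powr \<alpha>)" for n
  proof -
    obtain \<delta> where \<delta>: "0 < \<delta>"
      and const: "\<And>X X' s t. polynomial_function X \<Longrightarrow> (\<And>t. (X has_vector_derivative X' t) (at t)) \<Longrightarrow> continuous_on UNIV X' \<Longrightarrow>
        0 \<le> s \<Longrightarrow> integral {s..T} (\<lambda>t. norm (X' t + b t (X t))) \<le> \<delta> \<Longrightarrow> t \<in> {s..T} \<Longrightarrow> \<bar>u s (X s) - u t (X t)\<bar> \<le> ze n"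
      by (rule u_almost_constant[OF ze(1)[of n]]) (rule that; blast)
    have mpos: "0 < min \<delta> (ze n)" using \<delta> ze by simp
    have sT: "s \<le> T" using s by simp
    obtain X X' where X: "polynomial_function X" "\<And>t. (X has_vector_derivative X' t) (at t)" "continuous_on UNIV X'" "X s = y"
      and E: "integral {s..T} (\<lambda>t. norm (X' t + b t (X t))) \<le> min \<delta> (ze n)"
      and Xb: "\<And>t. t \<in> {s..T} \<Longrightarrow> 1 + norm (X t) \<le> (1 + norm y) * exp (integral {s..t} C0) + min \<delta> (ze n)"
      using approximate_characteristic_ex[OF sT mpos, of y] by blast
    have contX: "continuous_on S X" for S
      using X(2) by (meson continuous_at_imp_continuous_on has_vector_derivative_continuous)
    have XC: "1 + norm (X t) \<le> C + ze n" if "t \<in> {s..T}" for t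
    proof -
      have "(1 + norm y) * exp (integral {s..t} C0) \<le> C"
        unfolding C_def using C0_integral_mono[of 0 s t T] s that by (intro mult_left_mono) auto
      then show ?thesis using Xb[OF that] by linarith
    qed
    have X'i: "X' absolutely_integrable_on {c..d}" for c d
      by (rule absolutely_integrable_continuous_real[OF continuous_on_subset[OF X(3) subset_UNIV]])
    have defi: "(\<lambda>t. norm (X' t + b t (X t))) integrable_on {c..d}" for c d
      using set_integral_add(1)[OF X'i b_path_absolutely_integrable[OF contX]] by (auto simp: absolutely_integrable_on_def)
    have def_le: "integral {s..t} (\<lambda>t. norm (X' t + b t (X t))) \<le> ze n" if "t \<le> T" for t
    proof -
      have "integral {s..t} (\<lambda>t. norm (X' t + b t (X t))) \<le> integral {s..T} (\<lambda>t. norm (X' t + b t (X t)))"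
        by (rule integral_subset_le) (use that defi in auto)
      then show ?thesis using E by linarith
    qed
    have ftc: "integral {s..t} X' = X t - y" if "s \<le> t" for t
      unfolding X(4)[symmetric]
      by (intro integral_unique fundamental_theorem_of_calculus that has_vector_derivative_at_within[OF X(2)])
    have near: "norm (X t - y) \<le> mm n" if t: "t \<in> {s..s'}" for t
    proof -
      have i: "(\<lambda>r. norm (X' r + b r (X r)) + (C + ze n) * C0 r) integrable_on {s..t}"
        by (intro integrable_add defi integrable_on_mult_right C0_integrable_on)
      have "norm (integral {s..t} X') \<le> integral {s..t} (\<lambda>r. norm (X' r + b r (X r)) + (C + ze n) * C0 r)"
      proof (rule integral_norm_bound_integral[OF _ i])
        show "X' integrable_on {s..t}" using X'i by (simp add: absolutely_integrable_on_def)
        fix r assume r: "r \<in> {s..t}"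
        have "norm (b r (X r)) \<le> C0 r * (C + ze n)"
          by (rule order_trans[OF b_growth]) (use XC[of r] r t s C0_nonneg in \<open>auto intro!: mult_left_mono\<close>)
        then show "norm (X' r) \<le> norm (X' r + b r (X r)) + (C + ze n) * C0 r"
          using norm_triangle_ineq4[of "X' r + b r (X r)" "b r (X r)"] by (simp add: mult.commute)
      qed
      also have "\<dots> = integral {s..t} (\<lambda>r. norm (X' r + b r (X r))) + (C + ze n) * integral {s..t} C0"
        by (subst Henstock_Kurzweil_Integration.integral_add) (auto intro: defi integrable_on_mult_right C0_integrable_on)
      also have "\<dots> \<le> ze n + (C + ze n) * I"
        unfolding I_def using def_le[of t] C0_integral_mono[of s s t s'] t s C ze[of n]
        by (intro add_mono mult_left_mono) auto
      finally show ?thesis using ftc[of t] t by (simp add: mm_def)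
    qed
    have "norm (X s' - y + integral {s..s'} (\<lambda>t. b t y)) = norm (integral {s..s'} (\<lambda>t. X' t + b t y))"
      using ftc[OF s(2)] X'i b_absolutely_integrable
      by (subst Henstock_Kurzweil_Integration.integral_add) (auto simp: absolutely_integrable_on_def)
    also have "\<dots> \<le> integral {s..s'} (\<lambda>t. norm (X' t + b t (X t)) + H * mm n powr \<alpha>)"
    proof (rule integral_norm_bound_integral)
      show "(\<lambda>t. X' t + b t y) integrable_on {s..s'}"
        using set_integral_add(1)[OF X'i b_absolutely_integrable] by (auto simp: absolutely_integrable_on_def)
      show "(\<lambda>t. norm (X' t + b t (X t)) + H * mm n powr \<alpha>) integrable_on {s..s'}"
        by (intro integrable_add defi integrable_const_ivl)
      fix t assume t: "t \<in> {s..s'}"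
      have "norm (b t y - b t (X t)) \<le> H * mm n powr \<alpha>"
        by (rule order_trans[OF b_holder]) (use near[OF t] H_nonneg \<alpha>_pos in \<open>auto simp: norm_minus_commute intro!: mult_left_mono powr_mono2\<close>)
      then show "norm (X' t + b t y) \<le> norm (X' t + b t (X t)) + H * mm n powr \<alpha>"
        using norm_triangle_ineq[of "X' t + b t (X t)" "b t y - b t (X t)"] by simp
    qed
    also have "\<dots> = integral {s..s'} (\<lambda>t. norm (X' t + b t (X t))) + (s' - s) * (H * mm n powr \<alpha>)"
      using s by (subst Henstock_Kurzweil_Integration.integral_add) (auto intro: defi)
    also have "\<dots> \<le> ze n + (s' - s) * (H * mm n powr \<alpha>)" using def_le[OF s(3)] by simp
    finally have "norm (X s' - y + integral {s..s'} (\<lambda>t. b t y)) \<le> ze n + (s' - s) * (H * mm n powr \<alpha>)" .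
    moreover have "\<bar>u s y - u s' (X s')\<bar> \<le> ze n"
      using const[OF X(1-3) s(1), of s'] E s X(4) by simp
    ultimately show ?thesis using near[of s'] s by (intro exI[of _ "X s'"]) auto
  qed
  then obtain x where x: "\<And>n. \<bar>u s y - u s' (x n)\<bar> \<le> ze n" "\<And>n. norm (x n - y) \<le> mm n"
      "\<And>n. norm (x n - y + integral {s..s'} (\<lambda>t. b t y)) \<le> ze n + (s' - s) * (H * mm n powr \<alpha>)"
    by metis
  \<comment> \<open>The approximate characteristics themselves need not converge: only their
    positions at time s' enter, and these lie in a fixed ball of R^d.\<close>
  have "x n \<in> cball y (1 + (C + 1) * I)" for n
    using order_trans[OF x(2)[of n] mm(2)[of n]] by (simp add: dist_norm norm_minus_commute)
  then obtain l r where r: "strict_mono r" "(x \<circ> r) \<longlonglongrightarrow> l"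
    using compact_cball[of y "1 + (C + 1) * I"] unfolding compact_def by metis
  have xr: "(\<lambda>n. x (r n)) \<longlonglongrightarrow> l" using r(2) by (simp add: o_def)
  have zr: "(\<lambda>n. ze (r n)) \<longlonglongrightarrow> 0" using LIMSEQ_subseq_LIMSEQ[OF ze0 r(1)] by (simp add: o_def)
  have "(\<lambda>n. ze (r n) + (C + ze (r n)) * I) \<longlonglongrightarrow> 0 + (C + 0) * I" by (intro tendsto_intros zr)
  then have mr: "(\<lambda>n. mm (r n)) \<longlonglongrightarrow> m" by (simp add: mm_def m)
  have mra: "(\<lambda>n. mm (r n) powr \<alpha>) \<longlonglongrightarrow> m powr \<alpha>"
    by (rule tendsto_powr2[OF mr tendsto_const]) (use mm(1) \<alpha>_pos in \<open>auto intro: always_eventually\<close>)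
  have contu: "isCont (u s') l"
    using u_path_continuous[OF continuous_on_const continuous_on_id, of s'] by (simp add: continuous_on_eq_continuous_at)
  show ?thesis
  proof (intro exI conjI)
    have "(\<lambda>n. \<bar>u s y - u s' (x (r n))\<bar>) \<longlonglongrightarrow> \<bar>u s y - u s' l\<bar>"
      by (intro tendsto_intros isCont_tendsto_compose[OF contu] xr)
    then have "\<bar>u s y - u s' l\<bar> \<le> 0" by (rule LIMSEQ_le[OF _ zr]) (use x(1) in blast)
    then show "u s' l = u s y" by simp
    have "(\<lambda>n. norm (x (r n) - y)) \<longlonglongrightarrow> norm (l - y)" by (intro tendsto_intros xr)
    then show "norm (l - y) \<le> m" by (rule LIMSEQ_le[OF _ mr]) (use x(2) in blast)
    have "(\<lambda>n. norm (x (r n) - y + integral {s..s'} (\<lambda>t. b t y))) \<longlonglongrightarrow> norm (l - y + integral {s..s'} (\<lambda>t. b t y))"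
      by (intro tendsto_intros xr)
    moreover have "(\<lambda>n. ze (r n) + (s' - s) * (H * mm (r n) powr \<alpha>)) \<longlonglongrightarrow> 0 + (s' - s) * (H * m powr \<alpha>)"
      by (intro tendsto_intros zr mra)
    ultimately have "norm (l - y + integral {s..s'} (\<lambda>t. b t y)) \<le> 0 + (s' - s) * (H * m powr \<alpha>)"
      by (rule LIMSEQ_le) (use x(3) in blast)
    then show "norm (l - y + integral {s..s'} (\<lambda>t. b t y)) \<le> (s' - s) * (H * m powr \<alpha>)" by simp
  qed
qed

end

subsection \<open>Averages over short time intervals\<close>

text \<open>Only averages near the two ends survive a shift. For a continuous function they tend,
  after division by \<delta>, to its values at t1 and t2.\<close>

lemma integral_shift_difference:
  fixes \<Phi> :: "real \<Rightarrow> real"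
  assumes \<Phi>: "continuous_on {t1..t2 + \<delta>} \<Phi>" and t: "t1 \<le> t2" "0 \<le> \<delta>"
  shows "integral {t1..t2} (\<lambda>s. \<Phi> s - \<Phi> (s + \<delta>)) = integral {t1..t1 + \<delta>} \<Phi> - integral {t2..t2 + \<delta>} \<Phi>"
proof -
  have i: "\<Phi> integrable_on {s..t}" if "t1 \<le> s" "t \<le> t2 + \<delta>" for s t
    by (rule integrable_continuous_interval[OF continuous_on_subset[OF \<Phi>]]) (use that in auto)
  have cs: "continuous_on {t1..t2} (\<lambda>s. \<Phi> (s + \<delta>))"
    by (rule continuous_on_compose2[OF \<Phi>]) (use t in \<open>auto intro!: continuous_intros\<close>)
  have "integral {t1..t2} (\<lambda>s. \<Phi> s - \<Phi> (s + \<delta>)) = integral {t1..t2} \<Phi> - integral {t1..t2} (\<lambda>s. \<Phi> (s + \<delta>))"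
    by (rule Henstock_Kurzweil_Integration.integral_diff[OF i integrable_continuous_interval[OF cs]]) (use t in auto)
  also have "integral {t1..t2} (\<lambda>s. \<Phi> (s + \<delta>)) = integral {t1 + \<delta>..t2 + \<delta>} \<Phi>"
    using integral_shift_Icc_real[of t1 t2 \<Phi> \<delta>] by (simp add: o_def add.commute)
  also have "integral {t1..t2} \<Phi> - integral {t1 + \<delta>..t2 + \<delta>} \<Phi> = integral {t1..t1 + \<delta>} \<Phi> - integral {t2..t2 + \<delta>} \<Phi>"
    using Henstock_Kurzweil_Integration.integral_combine[of t1 "t1 + \<delta>" "t2 + \<delta>" \<Phi>] Henstock_Kurzweil_Integration.integral_combine[of t1 t2 "t2 + \<delta>" \<Phi>]
      i[of t1 "t2 + \<delta>"] t by auto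
  finally show ?thesis .
qed

lemma short_integral_continuous:
  fixes f :: "real \<Rightarrow> 'a::euclidean_space"
  assumes f: "f integrable_on {a..c}" and t: "a \<le> t1" "t2 + \<delta> \<le> c" "0 \<le> \<delta>"
  shows "continuous_on {t1..t2} (\<lambda>s. integral {s..s + \<delta>} f)"
proof -
  have cont: "continuous_on {a..c} (\<lambda>s. integral {a..s} f)" by (rule indefinite_integral_continuous_1[OF f])
  have "integral {s..s + \<delta>} f = integral {a..s + \<delta>} f - integral {a..s} f" if "s \<in> {t1..t2}" for s
    using Henstock_Kurzweil_Integration.integral_combine[of a s "s + \<delta>" f] integrable_on_subinterval[OF f, of a "s + \<delta>"] that t
    by (auto simp: algebra_simps)
  moreover have "continuous_on {t1..t2} (\<lambda>s. integral {a..s + \<delta>} f - integral {a..s} f)"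
    by (intro continuous_on_diff continuous_on_compose2[OF cont] continuous_intros) (use t in auto)
  ultimately show ?thesis
    by (subst continuous_on_cong[OF refl, where g = "\<lambda>s. integral {a..s + \<delta>} f - integral {a..s} f"]) auto
qed

text \<open>Each time belongs to the windows [s, s + \<delta>] for a set of s of length at most
  \<delta>. In place of Fubini, the shift identity is applied to the primitive of \<open>h\<close>,
  which lies between 0 and the total integral.\<close>

lemma integral_short_integral_le:
  fixes h :: "real \<Rightarrow> real"
  assumes h: "h integrable_on {a..c}" "\<And>s. s \<in> {a..c} \<Longrightarrow> 0 \<le> h s" and t: "a \<le> t1" "t1 \<le> t2" "t2 + \<delta> \<le> c" "0 \<le> \<delta>"
  shows "integral {t1..t2} (\<lambda>s. integral {s..s + \<delta>} h) \<le> \<delta> * integral {a..c} h"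
proof -
  define \<Phi> where "\<Phi> s = integral {a..s} h" for s
  have hi: "h integrable_on {s..t}" if "a \<le> s" "t \<le> c" for s t
    by (rule integrable_on_subinterval[OF h(1)]) (use that in auto)
  have cont: "continuous_on {a..c} \<Phi>" unfolding \<Phi>_def by (rule indefinite_integral_continuous_1[OF h(1)])
  have \<Phi>nn: "0 \<le> \<Phi> s" "\<Phi> s \<le> integral {a..c} h" if "s \<in> {a..c}" for s
    unfolding \<Phi>_def using that h
    by (auto intro!: Henstock_Kurzweil_Integration.integral_nonneg integral_subset_le hi)
  have "integral {t1..t2} (\<lambda>s. integral {s..s + \<delta>} h) = integral {t1..t2} (\<lambda>s. - (\<Phi> s - \<Phi> (s + \<delta>)))"
  proof (rule Henstock_Kurzweil_Integration.integral_cong)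
    fix s assume "s \<in> {t1..t2}"
    then show "integral {s..s + \<delta>} h = - (\<Phi> s - \<Phi> (s + \<delta>))"
      using Henstock_Kurzweil_Integration.integral_combine[of a s "s + \<delta>" h] hi[of a "s + \<delta>"] t by (auto simp: \<Phi>_def)
  qed
  also have "\<dots> = - integral {t1..t2} (\<lambda>s. \<Phi> s - \<Phi> (s + \<delta>))" by (rule Henstock_Kurzweil_Integration.integral_neg)
  also have "\<dots> = integral {t2..t2 + \<delta>} \<Phi> - integral {t1..t1 + \<delta>} \<Phi>"
    using integral_shift_difference[OF continuous_on_subset[OF cont], of t1 t2 \<delta>] t by auto
  also have "\<dots> \<le> integral {t2..t2 + \<delta>} (\<lambda>_. integral {a..c} h) - 0"
    by (intro diff_mono integral_le Henstock_Kurzweil_Integration.integral_nonneg integrable_continuous_interval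
        continuous_on_subset[OF cont] \<Phi>nn) (use t in auto)
  finally show ?thesis using t by simp
qed

text \<open>Lebesgue differentiation in the L^1 sense. It is clear for continuous functions;
  replacing \<open>f\<close> by such a function \<open>p\<close> costs the L^1 distance twice, once
  inside the averages and once for the values of \<open>f\<close>.\<close>

lemma short_average_L1:
  fixes f :: "real \<Rightarrow> 'a::euclidean_space"
  assumes f: "f absolutely_integrable_on {a..c}" and t: "a \<le> t1" "t1 \<le> t2" "t2 < c" and e: "0 < e"
  shows "\<exists>\<delta>0>0. \<forall>\<delta>. 0 < \<delta> \<longrightarrow> \<delta> < \<delta>0 \<longrightarrow> t2 + \<delta> \<le> c \<and>
    (\<lambda>s. norm (integral {s..s + \<delta>} f - \<delta> *\<^sub>R f s)) integrable_on {t1..t2} \<and>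
    integral {t1..t2} (\<lambda>s. norm (integral {s..s + \<delta>} f - \<delta> *\<^sub>R f s)) \<le> e * \<delta>"
proof -
  have e3: "0 < e / 3" using e by simp
  obtain P p where p: "continuous_on UNIV (p::real \<Rightarrow> 'a)" and fp: "integral {a..c} (\<lambda>t. norm (f t - p t)) \<le> e / 3"
    using L1_approximation_polynomial[OF f e3] by metis
  define w where "w = e / 3 / (t2 - t1 + 1)"
  have w: "0 < w" "(t2 - t1) * w \<le> e / 3" using e t by (auto simp: w_def field_simps)
  have "uniformly_continuous_on {a..c} p"
    by (intro compact_uniformly_continuous continuous_on_subset[OF p] compact_Icc subset_UNIV)
  then obtain d where d: "0 < d" "\<And>s r. s \<in> {a..c} \<Longrightarrow> r \<in> {a..c} \<Longrightarrow> dist r s < d \<Longrightarrow> dist (p r) (p s) < w"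
    unfolding uniformly_continuous_on_def using w(1) by metis
  have pi: "p absolutely_integrable_on {s..r}" for s r
    by (rule absolutely_integrable_continuous_real[OF continuous_on_subset[OF p subset_UNIV]])
  have fs: "f absolutely_integrable_on {s..r}" if "a \<le> s" "r \<le> c" for s r
    by (rule absolutely_integrable_on_subinterval[OF f]) (use that in auto)
  define h where "h s = norm (f s - p s)" for s
  have hi: "h integrable_on {s..r}" if "a \<le> s" "r \<le> c" for s r
    unfolding h_def using set_integral_diff(1)[OF fs[OF that] pi] by (auto simp: absolutely_integrable_on_def)
  show ?thesis
  proof (intro exI[of _ "min d (c - t2)"] conjI allI impI)
    show "0 < min d (c - t2)" using d t by simp
    fix \<delta> :: real assume \<delta>: "0 < \<delta>" "\<delta> < min d (c - t2)"
    then show \<delta>c: "t2 + \<delta> \<le> c" by simp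
    have c1: "continuous_on {t1..t2} (\<lambda>s. integral {s..s + \<delta>} f)"
      by (rule short_integral_continuous[of f a c]) (use f t \<delta> in \<open>auto simp: absolutely_integrable_on_def\<close>)
    have "(\<lambda>s. \<delta> *\<^sub>R f s) absolutely_integrable_on {t1..t2}"
      using absolutely_integrable_scaleR_left[OF fs[of t1 t2], of \<delta>] t by auto
    from set_integral_diff(1)[OF absolutely_integrable_continuous_real[OF c1] this]
    show int: "(\<lambda>s. norm (integral {s..s + \<delta>} f - \<delta> *\<^sub>R f s)) integrable_on {t1..t2}"
      by (simp add: absolutely_integrable_on_def)
    have c2: "(\<lambda>s. integral {s..s + \<delta>} h) integrable_on {t1..t2}"
      by (rule integrable_continuous_interval[OF short_integral_continuous[of h a c]]) (use hi t \<delta> in auto)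
    have "integral {t1..t2} (\<lambda>s. norm (integral {s..s + \<delta>} f - \<delta> *\<^sub>R f s))
       \<le> integral {t1..t2} (\<lambda>s. integral {s..s + \<delta>} h + \<delta> * w + \<delta> * h s)"
    proof (rule integral_le[OF int])
      show "(\<lambda>s. integral {s..s + \<delta>} h + \<delta> * w + \<delta> * h s) integrable_on {t1..t2}"
        by (intro integrable_add c2 integrable_const_ivl integrable_on_mult_right hi) (use t in auto)
      fix s assume s: "s \<in> {t1..t2}"
      have sc: "a \<le> s" "s + \<delta> \<le> c" using s t \<delta> by auto
      have fi: "f integrable_on {s..s + \<delta>}" and pii: "p integrable_on {s..s + \<delta>}"
        using fs[OF sc] pi by (auto simp: absolutely_integrable_on_def)
      have "norm (integral {s..s + \<delta>} (\<lambda>r. f r - p r)) \<le> integral {s..s + \<delta>} h"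
        by (rule integral_norm_bound_integral) (use fi pii hi[OF sc] in \<open>auto simp: h_def intro: integrable_diff\<close>)
      then have 1: "norm (integral {s..s + \<delta>} f - integral {s..s + \<delta>} p) \<le> integral {s..s + \<delta>} h"
        by (simp add: Henstock_Kurzweil_Integration.integral_diff[OF fi pii])
      have "norm (integral {s..s + \<delta>} (\<lambda>r. p r - p s)) \<le> integral {s..s + \<delta>} (\<lambda>_. w)"
      proof (rule integral_norm_bound_integral)
        show "(\<lambda>r. p r - p s) integrable_on {s..s + \<delta>}" by (intro integrable_diff pii integrable_const_ivl)
        show "norm (p r - p s) \<le> w" if "r \<in> {s..s + \<delta>}" for r
          using d(2)[of s r] that sc \<delta> by (auto simp: dist_norm)
      qed (rule integrable_const_ivl)
      then have 2: "norm (integral {s..s + \<delta>} p - \<delta> *\<^sub>R p s) \<le> \<delta> * w"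
        using \<delta> by (simp add: Henstock_Kurzweil_Integration.integral_diff[OF pii integrable_const_ivl])
      have 3: "norm (\<delta> *\<^sub>R p s - \<delta> *\<^sub>R f s) = \<delta> * h s"
        using \<delta> by (simp add: h_def norm_minus_commute flip: scaleR_diff_right)
      have tri: "norm (u - z) \<le> norm (u - v) + norm (v - y) + norm (y - z)" for u v y z :: 'a
        using norm_triangle_ineq[of "u - v" "v - z"] norm_triangle_ineq[of "v - y" "y - z"] by simp
      show "norm (integral {s..s + \<delta>} f - \<delta> *\<^sub>R f s) \<le> integral {s..s + \<delta>} h + \<delta> * w + \<delta> * h s"
        using tri[of "integral {s..s + \<delta>} f" "\<delta> *\<^sub>R f s" "integral {s..s + \<delta>} p" "\<delta> *\<^sub>R p s"] 1 2 3 by linarith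
    qed
    also have "\<dots> = integral {t1..t2} (\<lambda>s. integral {s..s + \<delta>} h) + (t2 - t1) * (\<delta> * w) + \<delta> * integral {t1..t2} h"
    proof -
      have "integral {t1..t2} (\<lambda>s. integral {s..s + \<delta>} h + \<delta> * w + \<delta> * h s)
        = integral {t1..t2} (\<lambda>s. integral {s..s + \<delta>} h + \<delta> * w) + integral {t1..t2} (\<lambda>s. \<delta> * h s)"
        by (intro Henstock_Kurzweil_Integration.integral_add integrable_add c2 integrable_const_ivl integrable_on_mult_right hi) (use t in auto)
      also have "integral {t1..t2} (\<lambda>s. integral {s..s + \<delta>} h + \<delta> * w) = integral {t1..t2} (\<lambda>s. integral {s..s + \<delta>} h) + integral {t1..t2} (\<lambda>s. \<delta> * w)"
        by (intro Henstock_Kurzweil_Integration.integral_add c2 integrable_const_ivl)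
      finally show ?thesis using t by simp
    qed
    also have "\<dots> \<le> \<delta> * (e / 3) + \<delta> * (e / 3) + \<delta> * (e / 3)"
    proof (intro add_mono)
      have "integral {t1..t2} (\<lambda>s. integral {s..s + \<delta>} h) \<le> \<delta> * integral {a..c} h"
        by (rule integral_short_integral_le) (use hi t \<delta> in \<open>auto simp: h_def\<close>)
      also have "\<dots> \<le> \<delta> * (e / 3)" using fp \<delta> by (simp add: h_def[abs_def])
      finally show "integral {t1..t2} (\<lambda>s. integral {s..s + \<delta>} h) \<le> \<delta> * (e / 3)" .
      show "(t2 - t1) * (\<delta> * w) \<le> \<delta> * (e / 3)" using mult_left_mono[OF w(2), of \<delta>] \<delta> by (simp add: mult_ac)
      have "integral {t1..t2} h \<le> integral {a..c} h" by (rule integral_subset_le) (use t hi in \<open>auto simp: h_def\<close>)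
      then show "\<delta> * integral {t1..t2} h \<le> \<delta> * (e / 3)" using fp \<delta> by (auto simp: h_def[abs_def])
    qed
    also have "\<dots> = e * \<delta>" by simp
    finally show "integral {t1..t2} (\<lambda>s. norm (integral {s..s + \<delta>} f - \<delta> *\<^sub>R f s)) \<le> e * \<delta>" .
  qed
qed

subsection \<open>Measurability of minima\<close>

text \<open>By continuity in x, the inequality \<open>m t < c\<close> is already witnessed at a
  point of a countable dense subset of \<open>S\<close>, so the sublevel sets of \<open>m\<close>
  are countable unions of measurable sets.\<close>

lemma measurable_minimum_compact:
  fixes h :: "'t \<Rightarrow> 'a::euclidean_space \<Rightarrow> real"
  assumes cont: "\<And>t. t \<in> space M \<Longrightarrow> continuous_on S (h t)" and meas: "\<And>x. x \<in> S \<Longrightarrow> (\<lambda>t. h t x) \<in> borel_measurable M"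
    and m: "\<And>t. t \<in> space M \<Longrightarrow> (\<exists>x\<in>S. m t = h t x) \<and> (\<forall>x\<in>S. m t \<le> h t x)"
  shows "m \<in> borel_measurable M"
proof -
  obtain D where D: "countable D" "D \<subseteq> S" "S \<subseteq> closure D" using separable[of S] by metis
  have eq: "{t \<in> space M. m t < c} = (\<Union>x\<in>D. {t \<in> space M. h t x < c})" for c
  proof (intro equalityI subsetI)
    fix t assume "t \<in> {t \<in> space M. m t < c}"
    then have t: "t \<in> space M" "m t < c" by auto
    then obtain x where x: "x \<in> S" "h t x < c" using m by metis
    have "\<exists>d>0. \<forall>y\<in>S. dist y x < d \<longrightarrow> dist (h t y) (h t x) < c - h t x"
      using cont[OF t(1)] x unfolding continuous_on_iff by auto
    then obtain d where d: "d > 0" "\<And>y. y \<in> S \<Longrightarrow> dist y x < d \<Longrightarrow> dist (h t y) (h t x) < c - h t x" by blast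
    obtain y where "y \<in> D" "dist y x < d"
      using D(3) x(1) d(1) closure_approachable[of x D] by blast
    then have "h t y < c" using d(2)[of y] D(2) by (auto simp: dist_real_def)
    then show "t \<in> (\<Union>x\<in>D. {t \<in> space M. h t x < c})" using \<open>y \<in> D\<close> t by auto
  next
    fix t assume "t \<in> (\<Union>x\<in>D. {t \<in> space M. h t x < c})"
    then show "t \<in> {t \<in> space M. m t < c}" using m D(2) by force
  qed
  have "{t \<in> space M. m t < c} \<in> sets M" for c
    unfolding eq
  proof (rule sets.countable_UN''[OF D(1)])
    fix x assume "x \<in> D"
    then have [measurable]: "(\<lambda>t. h t x) \<in> borel_measurable M" using meas D(2) by auto
    show "{t \<in> space M. h t x < c} \<in> sets M" by measurable
  qed
  then show ?thesis by (simp add: borel_measurable_iff_less)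
qed

text \<open>The minimum of \<open>g\<close> over the maximizers of \<open>f\<close> is the limit of the penalized minima of \<open>g + n (max f - f)\<close>.\<close>

lemma measurable_minimum_over_argmax:
  fixes f g :: "'t \<Rightarrow> 'a::euclidean_space \<Rightarrow> real"
  assumes S: "compact S" "S \<noteq> {}"
    and cont: "\<And>t. t \<in> space M \<Longrightarrow> continuous_on S (f t)" "\<And>t. t \<in> space M \<Longrightarrow> continuous_on S (g t)"
    and meas: "\<And>x. x \<in> S \<Longrightarrow> (\<lambda>t. f t x) \<in> borel_measurable M" "\<And>x. x \<in> S \<Longrightarrow> (\<lambda>t. g t x) \<in> borel_measurable M"
    and G1: "\<And>t. t \<in> space M \<Longrightarrow> \<exists>y\<in>S. (\<forall>x\<in>S. f t x \<le> f t y) \<and> G t = g t y"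
    and G2: "\<And>t y. t \<in> space M \<Longrightarrow> y \<in> S \<Longrightarrow> (\<forall>x\<in>S. f t x \<le> f t y) \<Longrightarrow> G t \<le> g t y"
  shows "G \<in> borel_measurable M"
proof -
  have "\<exists>m. \<forall>t\<in>space M. (\<exists>x\<in>S. m t = f t x) \<and> (\<forall>x\<in>S. f t x \<le> m t)"
    by (rule bchoice) (use continuous_attains_sup[OF S cont(1)] in blast)
  then obtain m where m: "\<And>t. t \<in> space M \<Longrightarrow> (\<exists>x\<in>S. m t = f t x) \<and> (\<forall>x\<in>S. f t x \<le> m t)" by blast
  have "(\<lambda>t. - m t) \<in> borel_measurable M"
    by (rule measurable_minimum_compact[where h = "\<lambda>t x. - f t x" and S = S])
       (use m cont meas in \<open>auto intro!: continuous_intros\<close>)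
  then have mm: "m \<in> borel_measurable M" by (simp add: borel_measurable_uminus_eq)
  define h where "h n t x = g t x + real n * (m t - f t x)" for n t x
  have conth: "continuous_on S (h n t)" if "t \<in> space M" for n t
    unfolding h_def by (intro continuous_intros cont that)
  have "\<exists>p. \<forall>t\<in>space M. p t \<in> S \<and> (\<forall>x\<in>S. h n t (p t) \<le> h n t x)" for n
    by (rule bchoice) (use continuous_attains_inf[OF S conth] in blast)
  then obtain p where p: "\<And>n t. t \<in> space M \<Longrightarrow> p n t \<in> S \<and> (\<forall>x\<in>S. h n t (p n t) \<le> h n t x)" by metis
  have Gn: "(\<lambda>t. h n t (p n t)) \<in> borel_measurable M" for n
  proof (rule measurable_minimum_compact[where h = "h n" and S = S])
    show "(\<lambda>t. h n t x) \<in> borel_measurable M" if "x \<in> S" for x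
      unfolding h_def using meas[OF that] mm by measurable
  qed (use p conth in auto)
  show ?thesis
  proof (rule borel_measurable_LIMSEQ_real[OF _ Gn])
    fix t assume t: "t \<in> space M"
    let ?a = "\<lambda>n. h n t (p n t)"
    obtain y where y: "y \<in> S" "\<forall>x\<in>S. f t x \<le> f t y" "G t = g t y" using G1[OF t] by blast
    have my: "m t = f t y" using m[OF t] y by (metis order_antisym)
    have fm: "f t x \<le> m t" if "x \<in> S" for x using m[OF t] that by blast
    have aG: "?a n \<le> G t" for n using p[OF t, of n] y(1) by (auto simp: h_def my y(3))
    have ga: "g t (p n t) \<le> ?a n" for n using fm p[OF t] by (simp add: h_def)
    have mono: "incseq ?a"
    proof (rule incseq_SucI)
      fix n
      have "?a n \<le> h n t (p (Suc n) t)" using p[OF t] by blast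
      also have "\<dots> \<le> ?a (Suc n)" using fm[of "p (Suc n) t"] p[OF t] by (auto simp: h_def intro!: mult_right_mono)
      finally show "?a n \<le> ?a (Suc n)" .
    qed
    then obtain L where L: "?a \<longlonglongrightarrow> L" "\<forall>n. ?a n \<le> L"
      using incseq_convergent[of ?a "G t"] aG by blast
    have "L \<le> G t" using L(1) aG LIMSEQ_le_const2 by blast
    obtain g0 where g0: "\<And>x. x \<in> S \<Longrightarrow> norm (g t x) \<le> g0"
      using compact_continuous_norm_bound[OF cont(2)[OF t] S(1)] by metis
    \<comment> \<open>The penalized minimum never exceeds \<open>G t\<close> while \<open>g\<close>
      is bounded below, so n times the gap stays bounded; limit points of the penalized minimizers
      are therefore maximizers of \<open>f\<close>.\<close>
    have gap: "m t - f t (p n t) \<le> (G t + g0) * inverse (real n)" if "0 < n" for n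
    proof -
      have "real n * (m t - f t (p n t)) \<le> G t + g0"
        using aG[of n] g0[of "p n t"] p[OF t, of n] by (auto simp: h_def)
      then show ?thesis using that by (simp add: field_simps)
    qed
    obtain l r where l: "l \<in> S" "strict_mono r" "((\<lambda>n. p n t) \<circ> r) \<longlonglongrightarrow> l"
      using S(1) p[OF t] unfolding compact_def by metis
    have pl: "(\<lambda>n. p (r n) t) \<longlonglongrightarrow> l" using l(3) by (simp add: o_def)
    have fl: "(\<lambda>n. f t (p (r n) t)) \<longlonglongrightarrow> f t l" and gl: "(\<lambda>n. g t (p (r n) t)) \<longlonglongrightarrow> g t l"
      using continuous_on_tendsto_compose[OF cont(1)[OF t] pl l(1)] continuous_on_tendsto_compose[OF cont(2)[OF t] pl l(1)] p[OF t] by auto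
    have inv: "(\<lambda>n. inverse (real (r n))) \<longlonglongrightarrow> 0"
      using LIMSEQ_subseq_LIMSEQ[OF LIMSEQ_inverse_real_of_nat[THEN LIMSEQ_imp_Suc] l(2)] by (simp add: o_def)
    have "(\<lambda>n. m t - f t (p (r n) t)) \<longlonglongrightarrow> m t - f t l" by (intro tendsto_intros fl)
    moreover have "(\<lambda>n. (G t + g0) * inverse (real (r n))) \<longlonglongrightarrow> (G t + g0) * 0" by (intro tendsto_intros inv)
    moreover have "\<exists>N. \<forall>n\<ge>N. m t - f t (p (r n) t) \<le> (G t + g0) * inverse (real (r n))"
      using gap seq_suble[OF l(2)] by (intro exI[of _ 1]) (metis less_le_trans less_one not_less)
    ultimately have "m t - f t l \<le> (G t + g0) * 0" by (rule LIMSEQ_le)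
    then have "\<forall>x\<in>S. f t x \<le> f t l" using fm by fastforce
    then have "G t \<le> g t l" by (rule G2[OF t l(1)])
    moreover have "g t l \<le> L"
    proof (rule LIMSEQ_le_const2[OF gl], intro exI[of _ 0] allI impI)
      show "g t (p (r n) t) \<le> L" for n using ga[of "r n"] L(2) order_trans by blast
    qed
    ultimately have "L = G t" using \<open>L \<le> G t\<close> by simp
    then show "?a \<longlonglongrightarrow> G t" using L(1) by simp
  qed
qed

subsection \<open>The subsolution inequality\<close>

lemma continuous_imp_usc_on: "continuous_on S f \<Longrightarrow> usc_on S f"
  unfolding usc_on_def continuous_on_def by (auto intro: order_tendstoD)

text \<open>The Hoelder bound makes \<open>b t\<close> continuous in space, so its envelope is its
  value.\<close>

lemma (in transport_field) lower_b_eq: "lower_b b t x p = ereal (b t x \<bullet> p)"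
proof -
  have "isCont (b t) x" using b_continuous by (simp add: continuous_on_eq_continuous_at)
  then have "(b t \<longlongrightarrow> b t x) (nhds x)" by (simp add: continuous_within tendsto_at_iff_tendsto_nhds)
  then have "((\<lambda>z. ereal (b t z \<bullet> p)) \<longlongrightarrow> ereal (b t x \<bullet> p)) (nhds x)"
    by (intro tendsto_intros)
  then show ?thesis
    unfolding lower_b_def by (rule lim_imp_Liminf[rotated]) simp
qed

lemma cINF_ereal_attained:
  assumes "y \<in> A" "\<And>z. z \<in> A \<Longrightarrow> (g::'a \<Rightarrow> real) y \<le> g z"
  shows "(INF z\<in>A. ereal (g z)) = ereal (g y)"
  using assms by (intro antisym INF_lower2[of y] INF_greatest) auto

section \<open>The maximum of \<open>w - \<psi>\<close> as a function of time\<close>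

context transport_field
begin

context
  fixes T :: real and w \<psi> \<psi>t :: "real \<Rightarrow> 'a \<Rightarrow> real" and D\<psi> :: "real \<Rightarrow> 'a \<Rightarrow> 'a"
  assumes T: "0 < T" and w_continuous: "continuous_on ({0..T} \<times> UNIV) (\<lambda>(t, x). w t x)"
    and C12: "C12 T \<psi> \<psi>t D\<psi>" and coercive: "tends_to_minus_infinity T (\<lambda>t x. w t x - \<psi> t x)"
begin

definition gap :: "real \<Rightarrow> 'a \<Rightarrow> real" where "gap t x = w t x - \<psi> t x"
definition drift :: "real \<Rightarrow> 'a \<Rightarrow> real" where "drift t x = \<psi>t t x - b t x \<bullet> D\<psi> t x"
text \<open>The function M of the subsolution inequality; \<open>rhs\<close> below is the
  corresponding R.\<close>

definition top_value :: "real \<Rightarrow> real" where "top_value t = (SUP x. gap t x)"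

lemma top_value_unfold: "top_value t = (SUP x. w t x - \<psi> t x)"
  by (simp add: top_value_def gap_def)

lemma test_derivatives:
  "t \<in> {0..T} \<Longrightarrow> ((\<lambda>s. \<psi> s x) has_real_derivative \<psi>t t x) (at t within {0..T})"
  "t \<in> {0..T} \<Longrightarrow> GDERIV (\<psi> t) x :> D\<psi> t x"
  "continuous_on ({0..T} \<times> UNIV) (\<lambda>(t, x). \<psi> t x)" "continuous_on ({0..T} \<times> UNIV) (\<lambda>(t, x). \<psi>t t x)"
  "continuous_on ({0..T} \<times> UNIV) (\<lambda>(t, x). D\<psi> t x)"
  using C12 by (auto simp: C12_def)

lemma slice_continuous:
  fixes h :: "real \<Rightarrow> 'a \<Rightarrow> 'b::topological_space"
  assumes "continuous_on ({0..T} \<times> UNIV) (\<lambda>(t, x). h t x)"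
  shows "t \<in> {0..T} \<Longrightarrow> continuous_on S (h t)" "continuous_on {0..T} (\<lambda>t. h t x)"
proof -
  have "continuous_on S (\<lambda>x. (t, x))" by (intro continuous_intros)
  moreover have "t \<in> {0..T} \<Longrightarrow> (\<lambda>x. (t, x)) ` S \<subseteq> {0..T} \<times> UNIV" by auto
  ultimately show "t \<in> {0..T} \<Longrightarrow> continuous_on S (h t)"
    using continuous_on_compose2[OF assms, of S "\<lambda>x. (t, x)"] by simp
  have "continuous_on {0..T} (\<lambda>t. (t, x))" by (intro continuous_intros)
  moreover have "(\<lambda>t. (t, x)) ` {0..T} \<subseteq> {0..T} \<times> UNIV" by auto
  ultimately show "continuous_on {0..T} (\<lambda>t. h t x)"
    using continuous_on_compose2[OF assms, of "{0..T}" "\<lambda>t. (t, x)"] by simp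
qed

lemma gap_continuous: "continuous_on ({0..T} \<times> UNIV) (\<lambda>(t, x). gap t x)"
  using continuous_on_diff[OF w_continuous test_derivatives(3)] by (simp add: gap_def case_prod_unfold)

lemma drift_continuous: "t \<in> {0..T} \<Longrightarrow> continuous_on S (drift t)"
  unfolding drift_def
  by (intro continuous_intros slice_continuous(1) test_derivatives continuous_on_subset[OF b_continuous]) auto

text \<open>The values at the origin are bounded over the compact time interval, so coercivity,
  which is uniform in time, provides one radius for all times.\<close>

lemma coercive_radius:
  obtains R where "0 \<le> R" "\<And>t x. t \<in> {0..T} \<Longrightarrow> R < norm x \<Longrightarrow> gap t x < gap t 0"
proof -
  obtain c where c: "\<And>t. t \<in> {0..T} \<Longrightarrow> norm (gap t 0) \<le> c"
    using compact_continuous_norm_bound[OF slice_continuous(2)[OF gap_continuous] compact_Icc] by metis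
  obtain R where R: "\<And>x. R \<le> norm x \<Longrightarrow> \<forall>t\<in>{0..T}. w t x - \<psi> t x \<le> - c - 1"
    using coercive unfolding tends_to_minus_infinity_def eventually_at_infinity by blast
  show ?thesis
  proof (rule that[of "max R 0"])
    fix t and x :: 'a assume "t \<in> {0..T}" "max R 0 < norm x"
    then have "gap t x \<le> - c - 1" using R[of x] by (auto simp: gap_def)
    then show "gap t x < gap t 0" using c[OF \<open>t \<in> {0..T}\<close>] by auto
  qed simp
qed

context
  fixes R :: real
  assumes R: "0 \<le> R" "\<And>t x. t \<in> {0..T} \<Longrightarrow> R < norm x \<Longrightarrow> gap t x < gap t 0"
begin

lemma maximum_attained:
  assumes t: "t \<in> {0..T}"
  obtains y where "norm y \<le> R" "\<And>x. gap t x \<le> gap t y"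
proof -
  obtain y where y: "y \<in> cball 0 R" "\<forall>x\<in>cball 0 R. gap t x \<le> gap t y"
    using continuous_attains_sup[OF compact_cball _ slice_continuous(1)[OF gap_continuous t]] R(1) by (metis cball_eq_empty not_le)
  have "gap t x \<le> gap t y" for x
  proof (cases "norm x \<le> R")
    case False
    then have "gap t x < gap t 0" using R(2)[OF t] by auto
    also have "\<dots> \<le> gap t y" using y(2) R(1) by auto
    finally show ?thesis by simp
  qed (use y in auto)
  with y show ?thesis using that[of y] by auto
qed

lemma maximizer_bound: "t \<in> {0..T} \<Longrightarrow> (\<And>x. gap t x \<le> gap t y) \<Longrightarrow> norm y \<le> R"
  using R(2)[of t y] by (metis leI not_le)

lemma top_value_eq: "(\<And>x. gap t x \<le> gap t y) \<Longrightarrow> top_value t = gap t y"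
  unfolding top_value_def by (intro cSup_eq_maximum) auto

lemma gap_le_top: "t \<in> {0..T} \<Longrightarrow> gap t x \<le> top_value t"
  using maximum_attained[of t] top_value_eq[of t] by metis

lemma uniformly_close:
  fixes h :: "real \<Rightarrow> 'a \<Rightarrow> 'b::metric_space"
  assumes "continuous_on ({0..T} \<times> UNIV) (\<lambda>(t, x). h t x)" "0 < e"
  obtains d where "0 < d" "\<And>t s x y. t \<in> {0..T} \<Longrightarrow> s \<in> {0..T} \<Longrightarrow> norm x \<le> r \<Longrightarrow> norm y \<le> r \<Longrightarrow> \<bar>t - s\<bar> < d \<Longrightarrow> norm (x - y) < d \<Longrightarrow> dist (h t x) (h s y) < e"
proof -
  have "uniformly_continuous_on ({0..T} \<times> cball 0 r) (\<lambda>(t, x). h t x)"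
    by (intro compact_uniformly_continuous continuous_on_subset[OF assms(1)] compact_Times compact_Icc compact_cball) auto
  then obtain d where d: "0 < d" "\<And>p q. p \<in> {0..T} \<times> cball 0 r \<Longrightarrow> q \<in> {0..T} \<times> cball 0 r \<Longrightarrow> dist q p < d \<Longrightarrow>
      dist (case q of (t, x) \<Rightarrow> h t x) (case p of (t, x) \<Rightarrow> h t x) < e"
    unfolding uniformly_continuous_on_def using assms(2) by metis
  show ?thesis
  proof (rule that[of "d / 2"])
    fix t s and x y :: 'a assume a: "t \<in> {0..T}" "s \<in> {0..T}" "norm x \<le> r" "norm y \<le> r" "\<bar>t - s\<bar> < d / 2" "norm (x - y) < d / 2"
    have "dist (t, x) (s, y) \<le> \<bar>t - s\<bar> + norm (x - y)"
      unfolding dist_Pair_Pair using sqrt_sum_squares_le_sum_abs[of "dist t s" "dist x y"] by (simp add: dist_norm)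
    then show "dist (h t x) (h s y) < e" using d(2)[of "(s, y)" "(t, x)"] a by auto
  qed (use d in simp)
qed

text \<open>All maximizers lie in one ball, on which \<open>gap\<close> is uniformly continuous;
  moving a maximizer from one time to a nearby one loses little.\<close>

lemma top_value_continuous: "continuous_on {0..T} top_value"
  unfolding continuous_on_iff
proof (intro ballI allI impI)
  fix t e :: real assume t: "t \<in> {0..T}" and e: "0 < e"
  obtain d where d: "0 < d" "\<And>t s x y. t \<in> {0..T} \<Longrightarrow> s \<in> {0..T} \<Longrightarrow> norm x \<le> R \<Longrightarrow> norm y \<le> R \<Longrightarrow> \<bar>t - s\<bar> < d \<Longrightarrow> norm (x - y) < d \<Longrightarrow> dist (gap t x) (gap s y) < e"
    by (rule uniformly_close[OF gap_continuous e, of R]) (rule that; blast)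
  have half: "top_value r < top_value s + e" if rs: "r \<in> {0..T}" "s \<in> {0..T}" "\<bar>r - s\<bar> < d" for r s
  proof -
    obtain y where y: "norm y \<le> R" "\<And>x. gap r x \<le> gap r y" using maximum_attained[OF rs(1)] by metis
    have "dist (gap r y) (gap s y) < e" using d(2)[OF rs(1,2) y(1) y(1) rs(3)] d(1) by simp
    then show ?thesis using gap_le_top[OF rs(2), of y] top_value_eq[OF y(2)] by (auto simp: dist_real_def)
  qed
  have "dist (top_value s) (top_value t) < e" if "s \<in> {0..T}" "dist s t < d" for s
  proof -
    have "\<bar>t - s\<bar> < d" "\<bar>s - t\<bar> < d" using that(2) by (auto simp: dist_real_def)
    then show ?thesis using half[OF t that(1)] half[OF that(1) t] by (auto simp: dist_real_def)
  qed
  then show "\<exists>d>0. \<forall>s\<in>{0..T}. dist s t < d \<longrightarrow> dist (top_value s) (top_value t) < e"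
    using d(1) by blast
qed

lemma least_drift:
  assumes t: "t \<in> {0..T}"
  obtains y where "\<And>x. gap t x \<le> gap t y" "\<And>z. (\<And>x. gap t x \<le> gap t z) \<Longrightarrow> drift t y \<le> drift t z"
proof -
  define K where "K = {y. \<forall>x. gap t x \<le> gap t y}"
  have "K = (\<Inter>x. {y. gap t x \<le> gap t y})" by (auto simp: K_def)
  also have "closed \<dots>"
    by (intro closed_INT ballI closed_Collect_le continuous_on_const slice_continuous(1)[OF gap_continuous t])
  finally have "closed K" .
  moreover have "K \<subseteq> cball 0 R" using maximizer_bound[OF t] by (auto simp: K_def)
  ultimately have "compact K" by (metis compact_Int_closed compact_cball inf.absorb_iff2)
  moreover have "K \<noteq> {}" using maximum_attained[OF t] by (auto simp: K_def)
  ultimately obtain y where "y \<in> K" "\<forall>z\<in>K. drift t y \<le> drift t z"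
    using continuous_attains_inf[OF _ _ drift_continuous[OF t]] by metis
  then show ?thesis using that[of y] by (auto simp: K_def)
qed

text \<open>The maximizers form a compact set on which the continuous \<open>drift\<close> attains
  its least value. Hence the infimum in \<open>sub_rhs\<close> is a real number, and
  \<open>rhs\<close> is its real-valued form.\<close>

definition rhs :: "real \<Rightarrow> real" where
  "rhs t = drift t (SOME y. (\<forall>x. gap t x \<le> gap t y) \<and> (\<forall>z. (\<forall>x. gap t x \<le> gap t z) \<longrightarrow> drift t y \<le> drift t z))"

lemma
  assumes t: "t \<in> {0..T}"
  shows rhs_attained: "\<exists>y. (\<forall>x. gap t x \<le> gap t y) \<and> rhs t = drift t y"
    and rhs_le: "(\<And>x. gap t x \<le> gap t z) \<Longrightarrow> rhs t \<le> drift t z"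
proof -
  have "\<exists>y. (\<forall>x. gap t x \<le> gap t y) \<and> (\<forall>z. (\<forall>x. gap t x \<le> gap t z) \<longrightarrow> drift t y \<le> drift t z)"
    by (rule least_drift[OF t]) blast
  from someI_ex[OF this]
  show "\<exists>y. (\<forall>x. gap t x \<le> gap t y) \<and> rhs t = drift t y" "(\<And>x. gap t x \<le> gap t z) \<Longrightarrow> rhs t \<le> drift t z"
    unfolding rhs_def by blast+
qed

lemma sub_rhs_eq: "t \<in> {0..T} \<Longrightarrow> sub_rhs b w \<psi> \<psi>t D\<psi> t = ereal (rhs t)"
proof -
  assume t: "t \<in> {0..T}"
  obtain y where y: "\<And>x. gap t x \<le> gap t y" "rhs t = drift t y"
    using rhs_attained[OF t] by blast
  have "{y. is_arg_max (\<lambda>x. w t x - \<psi> t x) (\<lambda>_. True) y} = {y. \<forall>x. gap t x \<le> gap t y}"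
    by (auto simp: is_arg_max_linorder gap_def)
  moreover have "ereal (\<psi>t t y) - lower_b b t y (D\<psi> t y) = ereal (drift t y)" for y
    by (simp add: lower_b_eq drift_def)
  ultimately have "sub_rhs b w \<psi> \<psi>t D\<psi> t = (INF y\<in>{y. \<forall>x. gap t x \<le> gap t y}. ereal (drift t y))"
    by (simp add: sub_rhs_def)
  also have "\<dots> = ereal (drift t y)"
  proof (rule cINF_ereal_attained)
    show "drift t y \<le> drift t z" if "z \<in> {y. \<forall>x. gap t x \<le> gap t y}" for z
      using rhs_le[OF t, of z] that y(2) by simp
  qed (use y in simp)
  finally show ?thesis using y(2) by simp
qed

lemma test_bound:
  obtains L where "0 \<le> L" "\<And>t x. t \<in> {0..T} \<Longrightarrow> norm x \<le> R \<Longrightarrow> norm (\<psi>t t x) \<le> L" "\<And>t x. t \<in> {0..T} \<Longrightarrow> norm x \<le> R \<Longrightarrow> norm (D\<psi> t x) \<le> L"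
proof -
  have K: "compact ({0..T} \<times> cball (0::'a) R)" by (intro compact_Times compact_Icc compact_cball)
  obtain L1 where L1: "0 \<le> L1" "\<And>z. z \<in> {0..T} \<times> cball 0 R \<Longrightarrow> norm (case z of (t, x) \<Rightarrow> \<psi>t t x) \<le> L1"
    using compact_continuous_norm_bound[OF continuous_on_subset[OF test_derivatives(4)] K] by (metis Sigma_mono order_refl subset_UNIV)
  obtain L2 where L2: "0 \<le> L2" "\<And>z. z \<in> {0..T} \<times> cball 0 R \<Longrightarrow> norm (case z of (t, x) \<Rightarrow> D\<psi> t x) \<le> L2"
    using compact_continuous_norm_bound[OF continuous_on_subset[OF test_derivatives(5)] K] by (metis Sigma_mono order_refl subset_UNIV)
  show ?thesis
  proof (rule that[of "L1 + L2"])
    fix t x assume "t \<in> {0..T}" "norm (x::'a) \<le> R"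
    then show "norm (\<psi>t t x) \<le> L1 + L2" "norm (D\<psi> t x) \<le> L1 + L2"
      using L1(2)[of "(t, x)"] L2(2)[of "(t, x)"] L1(1) L2(1) by auto
  qed (use L1 L2 in simp)
qed

lemma rhs_absolutely_integrable: "rhs absolutely_integrable_on {0..T}"
proof -
  have meas: "(\<lambda>t. h t x) \<in> borel_measurable (lebesgue_on {0..T})"
    if "continuous_on ({0..T} \<times> UNIV) (\<lambda>(t, x). h t x)" for h :: "real \<Rightarrow> 'a \<Rightarrow> 'b::euclidean_space" and x
    by (rule continuous_imp_measurable_on_sets_lebesgue[OF slice_continuous(2)[OF that]]) simp
  have bm: "(\<lambda>t. b t x) \<in> borel_measurable (lebesgue_on {0..T})" for x
    by (rule absolutely_integrable_imp_borel_measurable[OF b_absolutely_integrable]) simp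
  have m: "rhs \<in> borel_measurable (lebesgue_on {0..T})"
  proof (rule measurable_minimum_over_argmax[where S = "cball 0 R" and f = gap and g = drift])
    show "(\<lambda>t. gap t x) \<in> borel_measurable (lebesgue_on {0..T})" for x by (rule meas[OF gap_continuous])
    show "(\<lambda>t. drift t x) \<in> borel_measurable (lebesgue_on {0..T})" for x
      unfolding drift_def
      by (intro borel_measurable_diff borel_measurable_inner meas test_derivatives bm)
    show "\<exists>y\<in>cball 0 R. (\<forall>x\<in>cball 0 R. gap t x \<le> gap t y) \<and> rhs t = drift t y" if "t \<in> space (lebesgue_on {0..T})" for t
    proof -
      have t: "t \<in> {0..T}" using that by simp
      obtain y where y: "\<And>x. gap t x \<le> gap t y" "rhs t = drift t y" using rhs_attained[OF t] by blast
      then show ?thesis using maximizer_bound[OF t, of y] by (intro bexI[of _ y]) auto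
    qed
    \<comment> \<open>A maximizer over the ball is a global one, since some global maximizer lies in
      the ball.\<close>
    show "rhs t \<le> drift t y" if "t \<in> space (lebesgue_on {0..T})" "y \<in> cball 0 R" and y: "\<forall>x\<in>cball 0 R. gap t x \<le> gap t y" for t y
    proof -
      have t: "t \<in> {0..T}" using that by simp
      have "gap t x \<le> gap t y" for x
      proof -
        obtain z where z: "norm z \<le> R" "\<And>x. gap t x \<le> gap t z" using maximum_attained[OF t] by metis
        have "gap t z \<le> gap t y" using y z(1) by auto
        then show ?thesis using z(2)[of x] by linarith
      qed
      then show ?thesis by (rule rhs_le[OF t])
    qed
  qed (use R(1) slice_continuous(1)[OF gap_continuous] drift_continuous in auto)
  obtain L where L: "0 \<le> L" "\<And>t x. t \<in> {0..T} \<Longrightarrow> norm x \<le> R \<Longrightarrow> norm (\<psi>t t x) \<le> L" "\<And>t x. t \<in> {0..T} \<Longrightarrow> norm x \<le> R \<Longrightarrow> norm (D\<psi> t x) \<le> L"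
    by (rule test_bound) (rule that; blast)
  show ?thesis
  proof (rule measurable_bounded_by_integrable_imp_absolutely_integrable[OF m])
    show "(\<lambda>t. L + C0 t * ((1 + R) * L)) integrable_on {0..T}"
      by (intro integrable_add integrable_const_ivl integrable_on_mult_left C0_integrable_on)
    fix t assume t: "t \<in> {0..T}"
    obtain y where y: "\<And>x. gap t x \<le> gap t y" "rhs t = drift t y" using rhs_attained[OF t] by blast
    have yR: "norm y \<le> R" by (rule maximizer_bound[OF t y(1)])
    have "norm (b t y) \<le> C0 t * (1 + R)"
      by (rule order_trans[OF b_growth]) (use yR C0_nonneg in \<open>auto intro!: mult_left_mono\<close>)
    then have "norm (b t y) * norm (D\<psi> t y) \<le> C0 t * (1 + R) * L"
      using L(1,3) t yR R(1) C0_nonneg by (intro mult_mono) auto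
    then have "\<bar>b t y \<bullet> D\<psi> t y\<bar> \<le> C0 t * ((1 + R) * L)"
      using Cauchy_Schwarz_ineq2[of "b t y" "D\<psi> t y"] by (simp add: mult.assoc)
    then show "norm (rhs t) \<le> L + C0 t * ((1 + R) * L)"
      using L(2)[OF t yR] y(2) by (simp add: drift_def)
  qed simp
qed

context
  assumes step: "\<And>s s' y. 0 \<le> s \<Longrightarrow> s \<le> s' \<Longrightarrow> s' \<le> T \<Longrightarrow> \<exists>x. w s' x = w s y \<and>
      norm (x - y) \<le> (1 + norm y) * exp (integral {0..T} C0) * integral {s..s'} C0 \<and>
      norm (x - y + integral {s..s'} (\<lambda>t. b t y)) \<le> (s' - s) * (H * ((1 + norm y) * exp (integral {0..T} C0) * integral {s..s'} C0) powr \<alpha>)"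
begin

text \<open>The assumption \<open>step\<close> provides a point \<open>x\<close> at time s +
  \<delta> with the same value of \<open>w\<close> as the maximizer \<open>y\<close> at time s, and
  \<psi> is expanded to first order between them. The displacement is minus the time integral of b
  at y, but y varies with s, so y is replaced by a point of the finite net \<open>N\<close>: the
  remaining sum compares averages of b with its values at fixed points only. Of the three terms L e,
  one comes from the error in the displacement and two from passing from y to the net and
  back.\<close>

lemma top_value_short_time:
  assumes e: "0 < e" and t2: "t2 < T"
    and N: "\<And>y. norm y \<le> R \<Longrightarrow> \<exists>i\<in>N. H * norm (y - i) powr \<alpha> \<le> e" "finite N"
    and L: "0 \<le> L" "\<And>t x. t \<in> {0..T} \<Longrightarrow> norm x \<le> R \<Longrightarrow> norm (D\<psi> t x) \<le> L"
  obtains \<delta>0 where "0 < \<delta>0" "\<And>\<delta> s. 0 < \<delta> \<Longrightarrow> \<delta> < \<delta>0 \<Longrightarrow> 0 \<le> s \<Longrightarrow> s \<le> t2 \<Longrightarrow>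
    top_value s - top_value (s + \<delta>) \<le> \<delta> * rhs s + \<delta> * (e + 3 * L * e) + e * ((1 + R) * exp (integral {0..T} C0)) * integral {s..s + \<delta>} C0
      + L * (\<Sum>i\<in>N. norm (integral {s..s + \<delta>} (\<lambda>t. b t i) - \<delta> *\<^sub>R b s i))"
proof -
  define Q where "Q = (1 + R) * exp (integral {0..T} C0)"
  have Q: "0 < Q" using R(1) by (simp add: Q_def add_pos_nonneg)
  obtain d1 where d1: "0 < d1" "\<And>t s x y. t \<in> {0..T} \<Longrightarrow> s \<in> {0..T} \<Longrightarrow> norm x \<le> R + 1 \<Longrightarrow> norm y \<le> R + 1 \<Longrightarrow> \<bar>t - s\<bar> < d1 \<Longrightarrow> norm (x - y) < d1 \<Longrightarrow> dist (\<psi>t t x) (\<psi>t s y) < e"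
    by (rule uniformly_close[OF test_derivatives(4) e, of "R + 1"]) (rule that; blast)
  obtain d2 where d2: "0 < d2" "\<And>t s x y. t \<in> {0..T} \<Longrightarrow> s \<in> {0..T} \<Longrightarrow> norm x \<le> R + 1 \<Longrightarrow> norm y \<le> R + 1 \<Longrightarrow> \<bar>t - s\<bar> < d2 \<Longrightarrow> norm (x - y) < d2 \<Longrightarrow> dist (D\<psi> t x) (D\<psi> s y) < e"
    by (rule uniformly_close[OF test_derivatives(5) e, of "R + 1"]) (rule that; blast)
  obtain d3 where d3: "0 < d3" "\<And>x. 0 \<le> x \<Longrightarrow> x \<le> d3 \<Longrightarrow> H * x powr \<alpha> \<le> e"
    using powr_small[OF H_nonneg \<alpha>_pos e] by metis
  \<comment> \<open>Keeping the integral of \<open>C0\<close> over the short window below d / Q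
    makes the displacement at most \<open>d\<close>. This respects the three moduli, and d \<le> 1
    keeps \<open>x\<close> in the ball of radius R + 1 on which they were taken.\<close>
  define d where "d = min (min d1 d2) (min d3 1) / 2"
  have d: "0 < d" "d < d1" "d < d2" "d \<le> d3" "d \<le> 1" using d1(1) d2(1) d3(1) by (auto simp: d_def)
  have dQ: "0 < d / Q" using d Q by simp
  obtain h where h: "0 < h" "\<And>s t. 0 \<le> s \<Longrightarrow> s \<le> t \<Longrightarrow> t \<le> T \<Longrightarrow> t - s \<le> h \<Longrightarrow> integral {s..t} C0 \<le> d / Q"
    by (rule integral_uniformly_small[OF C0_integrable C0_nonneg dQ, of 0 T]) (rule that; blast)
  show ?thesis
  proof (rule that[of "min (min h d1) (T - t2)"])
    show "0 < min (min h d1) (T - t2)" using h(1) d1(1) t2 by simp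
    fix \<delta> s assume \<delta>: "0 < \<delta>" "\<delta> < min (min h d1) (T - t2)" and s: "0 \<le> s" "s \<le> t2"
    have sT: "s \<in> {0..T}" "s + \<delta> \<in> {0..T}" using s t2 \<delta> by auto
    define I where "I = integral {s..s + \<delta>} C0"
    have I: "0 \<le> I" "I \<le> d / Q" unfolding I_def using h(2)[of s "s + \<delta>"] C0_integral_nonneg \<delta> sT s by auto
    obtain y where y: "\<And>x. gap s x \<le> gap s y" "rhs s = drift s y" using rhs_attained[OF sT(1)] by blast
    have yR: "norm y \<le> R" by (rule maximizer_bound[OF sT(1) y(1)])
    define m where "m = (1 + norm y) * exp (integral {0..T} C0) * I"
    have m0: "0 \<le> m" using I by (simp add: m_def add_nonneg_nonneg)
    have mQ: "m \<le> Q * I" unfolding m_def Q_def using yR I by (intro mult_right_mono) auto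
    also have "Q * I \<le> d" using I(2) Q by (simp add: field_simps)
    finally have md: "m \<le> d" .
    obtain x where x: "w (s + \<delta>) x = w s y" "norm (x - y) \<le> m"
        "norm (x - y + integral {s..s + \<delta>} (\<lambda>t. b t y)) \<le> \<delta> * (H * m powr \<alpha>)"
      using step[of s "s + \<delta>" y] \<delta>(1) sT unfolding m_def I_def by auto
    have xR: "norm x \<le> R + 1" using x(2) md d(5) yR norm_triangle_ineq2[of x y] by linarith
    have Hm: "H * m powr \<alpha> \<le> e" using d3(2)[of m] m0 md d(4) by linarith
    \<comment> \<open>The values of \<open>w\<close> at the two points cancel; from here on only
      \<psi> and the displacement x - y matter.\<close>
    have 0: "top_value s - top_value (s + \<delta>) \<le> \<psi> (s + \<delta>) x - \<psi> s y"
      using gap_le_top[OF sT(2), of x] top_value_eq[OF y(1)] x(1) by (simp add: gap_def)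
    have 1: "\<psi> (s + \<delta>) x - \<psi> s x \<le> \<delta> * (\<psi>t s y + e)"
    proof -
      have "\<exists>r\<in>{s<..<s + \<delta>}. \<psi> (s + \<delta>) x - \<psi> s x = \<psi>t r x * (s + \<delta> - s)"
      proof (rule mvt_simple)
        fix r assume "s \<le> r" "r \<le> s + \<delta>"
        then have "((\<lambda>s. \<psi> s x) has_real_derivative \<psi>t r x) (at r within {s..s + \<delta>})"
          using sT by (intro has_field_derivative_subset[OF test_derivatives(1)]) auto
        then show "((\<lambda>s. \<psi> s x) has_derivative (*) (\<psi>t r x)) (at r within {s..s + \<delta>})"
          by (simp add: has_field_derivative_def)
      qed (use \<delta> in simp)
      then obtain r where r: "r \<in> {s<..<s + \<delta>}" "\<psi> (s + \<delta>) x - \<psi> s x = \<delta> * \<psi>t r x" by (auto simp: mult.commute)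
      have "dist (\<psi>t r x) (\<psi>t s y) < e"
        using r(1) sT \<delta> xR yR x(2) md d(2) by (intro d1(2)) auto
      then show ?thesis using r(2) \<delta>(1) by (auto simp: dist_real_def intro!: mult_left_mono)
    qed
    \<comment> \<open>A first order expansion obtained as a Lipschitz estimate for \<psi> minus its
      linear part at \<open>y\<close>, whose gradient is at most e on the ball of radius
      \<open>m\<close>.\<close>
    have 2: "\<psi> s x - \<psi> s y \<le> D\<psi> s y \<bullet> (x - y) + e * norm (x - y)"
    proof -
      have "\<bar>(\<psi> s x - x \<bullet> D\<psi> s y) - (\<psi> s y - y \<bullet> D\<psi> s y)\<bar> \<le> e * norm (x - y)"
      proof (rule GDERIV_lipschitz[where S = "cball y m"])
        show "GDERIV (\<lambda>z. \<psi> s z - z \<bullet> D\<psi> s y) z :> D\<psi> s z - D\<psi> s y" for z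
        proof (rule GDERIV_diff[OF test_derivatives(2)[OF sT(1)]])
          show "GDERIV (\<lambda>z. z \<bullet> D\<psi> s y) z :> D\<psi> s y"
            by (auto simp: gderiv_def intro!: derivative_eq_intros)
        qed
        show "norm (D\<psi> s z - D\<psi> s y) \<le> e" if "z \<in> cball y m" for z
        proof -
          have zy: "norm (z - y) \<le> m" using that by (simp add: dist_norm norm_minus_commute)
          then have "norm z \<le> R + 1" using md d(5) yR norm_triangle_ineq2[of z y] by linarith
          then have "dist (D\<psi> s z) (D\<psi> s y) < e" using zy md d(3) yR sT d2(1) by (intro d2(2)) auto
          then show ?thesis by (simp add: dist_norm)
        qed
      qed (use x(2) m0 in \<open>auto simp: dist_norm norm_minus_commute\<close>)
      then show ?thesis by (simp add: inner_diff_right inner_commute)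
    qed
    have DL: "norm (D\<psi> s y) \<le> L" by (rule L(2)[OF sT(1) yR])
    have in_le: "\<bar>D\<psi> s y \<bullet> v\<bar> \<le> L * c" if "norm v \<le> c" for v c
    proof -
      have "\<bar>D\<psi> s y \<bullet> v\<bar> \<le> norm (D\<psi> s y) * norm v" by (rule Cauchy_Schwarz_ineq2)
      also have "\<dots> \<le> L * c" using DL L(1) that by (intro mult_mono) auto
      finally show ?thesis .
    qed
    define J where "J = integral {s..s + \<delta>} (\<lambda>t. b t y)"
    have 3: "D\<psi> s y \<bullet> (x - y + J) \<le> L * (\<delta> * e)"
    proof -
      have "norm (x - y + J) \<le> \<delta> * e"
        unfolding J_def by (rule order_trans[OF x(3) mult_left_mono[OF Hm]]) (use \<delta>(1) in simp)
      from in_le[OF this] show ?thesis by linarith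
    qed
    obtain i where i: "i \<in> N" "H * norm (y - i) powr \<alpha> \<le> e" using N(1)[OF yR] by blast
    define Si where "Si = (\<Sum>i\<in>N. norm (integral {s..s + \<delta>} (\<lambda>t. b t i) - \<delta> *\<^sub>R b s i))"
    \<comment> \<open>The point y is exchanged for the net point i under the time integral and back
      again at time s, with an error \<delta> e each; in between stands the averaging error at a
      fixed point.\<close>
    have "norm (J - \<delta> *\<^sub>R b s y) \<le> Si + \<delta> * e + \<delta> * e"
    proof -
      have bi: "(\<lambda>t. b t z) integrable_on {s..s + \<delta>}" for z
        using b_absolutely_integrable by (auto simp: absolutely_integrable_on_def)
      have "norm (integral {s..s + \<delta>} (\<lambda>t. b t y - b t i)) \<le> integral {s..s + \<delta>} (\<lambda>t. e)"
        by (rule integral_norm_bound_integral) (use i(2) b_holder[of _ y i] bi in \<open>auto intro!: integrable_diff intro: order_trans\<close>)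
      then have a: "norm (J - integral {s..s + \<delta>} (\<lambda>t. b t i)) \<le> \<delta> * e"
        using \<delta>(1) by (simp add: J_def Henstock_Kurzweil_Integration.integral_diff[OF bi bi])
      have "norm (b s i - b s y) \<le> e" using b_holder[of s y i] i(2) by (simp add: norm_minus_commute)
      then have c: "norm (\<delta> *\<^sub>R b s i - \<delta> *\<^sub>R b s y) \<le> \<delta> * e"
        using \<delta>(1) by (simp flip: scaleR_diff_right)
      have bSi: "norm (integral {s..s + \<delta>} (\<lambda>t. b t i) - \<delta> *\<^sub>R b s i) \<le> Si"
        unfolding Si_def by (rule member_le_sum[OF i(1) _ N(2)]) simp
      have tri: "norm (u - z) \<le> norm (u - v) + norm (v - y) + norm (y - z)" for u v y z :: 'a
        using norm_triangle_ineq[of "u - v" "v - z"] norm_triangle_ineq[of "v - y" "y - z"] by simp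
      show ?thesis
        using tri[of J "\<delta> *\<^sub>R b s y" "integral {s..s + \<delta>} (\<lambda>t. b t i)" "\<delta> *\<^sub>R b s i"] a c bSi by linarith
    qed
    from in_le[OF this] have 4: "- (D\<psi> s y \<bullet> J) \<le> - (\<delta> * (D\<psi> s y \<bullet> b s y)) + L * (Si + \<delta> * e + \<delta> * e)"
      by (simp add: inner_diff_right)
    have "e * norm (x - y) \<le> e * (Q * I)" using x(2) mQ e by (intro mult_left_mono) auto
    moreover have "D\<psi> s y \<bullet> (x - y) = D\<psi> s y \<bullet> (x - y + J) - D\<psi> s y \<bullet> J" by (simp add: inner_add_right)
    moreover have "\<delta> * rhs s = \<delta> * \<psi>t s y - \<delta> * (D\<psi> s y \<bullet> b s y)" using y(2) by (simp add: drift_def inner_commute right_diff_distrib)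
    ultimately have "top_value s - top_value (s + \<delta>) \<le> \<delta> * rhs s + \<delta> * (e + 3 * L * e) + e * (Q * I) + L * Si"
      using 0 1 2 3 4 by (simp add: algebra_simps)
    then show "top_value s - top_value (s + \<delta>) \<le> \<delta> * rhs s + \<delta> * (e + 3 * L * e) + e * ((1 + R) * exp (integral {0..T} C0)) * integral {s..s + \<delta>} C0
      + L * (\<Sum>i\<in>N. norm (integral {s..s + \<delta>} (\<lambda>t. b t i) - \<delta> *\<^sub>R b s i))"
      by (simp add: Q_def I_def Si_def mult.assoc)
  qed
qed

text \<open>The short time estimate is integrated over s from t1 to t2 and divided by \<delta>. The
  left side telescopes to averages of \<open>top_value\<close> near the two ends. The time t2 stays
  below T so that s + \<delta> does not exceed T.\<close>

lemma top_value_inequality_interior: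
  assumes t: "0 \<le> t1" "t1 < t2" "t2 < T"
  shows "top_value t1 - top_value t2 \<le> integral {t1..t2} rhs"
proof -
  obtain L where L: "0 \<le> L" "\<And>t x. t \<in> {0..T} \<Longrightarrow> norm x \<le> R \<Longrightarrow> norm (\<psi>t t x) \<le> L" "\<And>t x. t \<in> {0..T} \<Longrightarrow> norm x \<le> R \<Longrightarrow> norm (D\<psi> t x) \<le> L"
    by (rule test_bound) (rule that; blast)
  define Q where "Q = (1 + R) * exp (integral {0..T} C0)"
  have Q: "0 \<le> Q" using R(1) by (simp add: Q_def)
  define I0 where "I0 = integral {0..T} C0"
  have I0: "0 \<le> I0" unfolding I0_def by (rule C0_integral_nonneg)
  \<comment> \<open>The total coefficient of e after division by \<delta>: \<open>Q * I0\<close>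
    comes from the displacement, \<open>L\<close> from the averages at the net points, and 2 from
    replacing the averages of \<open>top_value\<close> near t1 and t2 by its values.\<close>
  define A where "A = (1 + 3 * L) * (t2 - t1) + Q * I0 + L + 2"
  have A: "0 < A" using L(1) Q I0 t by (auto simp: A_def intro!: add_nonneg_pos add_nonneg_nonneg)
  have rhsi: "rhs integrable_on {t1..t2}"
    using absolutely_integrable_on_subinterval[OF rhs_absolutely_integrable, of t1 t2] t by (auto simp: absolutely_integrable_on_def)
  have approx: "top_value t1 - top_value t2 \<le> integral {t1..t2} rhs + e * A" if e: "0 < e" for e
  proof -
    obtain \<rho> where \<rho>: "0 < \<rho>" "\<And>x. 0 \<le> x \<Longrightarrow> x \<le> \<rho> \<Longrightarrow> H * x powr \<alpha> \<le> e"
      using powr_small[OF H_nonneg \<alpha>_pos e] by metis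
    obtain N where N: "finite N" "cball (0::'a) R \<subseteq> (\<Union>x\<in>N. ball x \<rho>)"
      using compact_cball[of "0::'a" R] \<rho>(1) unfolding compact_eq_totally_bounded by blast
    have near: "\<exists>i\<in>N. H * norm (y - i) powr \<alpha> \<le> e" if "norm y \<le> R" for y
    proof -
      have "y \<in> (\<Union>x\<in>N. ball x \<rho>)" using N(2) that by (meson mem_cball_0 subsetD)
      then obtain i where "i \<in> N" "dist i y < \<rho>" by auto
      then show ?thesis using \<rho>(2)[of "norm (y - i)"] by (auto simp: dist_norm norm_minus_commute)
    qed
    obtain \<delta>0 where \<delta>0: "0 < \<delta>0" and short: "\<And>\<delta> s. 0 < \<delta> \<Longrightarrow> \<delta> < \<delta>0 \<Longrightarrow> 0 \<le> s \<Longrightarrow> s \<le> t2 \<Longrightarrow>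
      top_value s - top_value (s + \<delta>) \<le> \<delta> * rhs s + \<delta> * (e + 3 * L * e) + e * ((1 + R) * exp (integral {0..T} C0)) * integral {s..s + \<delta>} C0
        + L * (\<Sum>i\<in>N. norm (integral {s..s + \<delta>} (\<lambda>t. b t i) - \<delta> *\<^sub>R b s i))"
      by (rule top_value_short_time[OF e t(3) near N(1) L(1,3)]) (assumption | rule that; blast)+
    \<comment> \<open>The tolerance for each single net point; summed over the net it stays below e.
      The added 1 covers an empty net.\<close>
    define e' where "e' = e / (real (card N) + 1)"
    have e': "0 < e'" "real (card N) * e' \<le> e" using e by (auto simp: e'_def field_simps)
    have "\<exists>\<delta>1>0. \<forall>\<delta>. 0 < \<delta> \<longrightarrow> \<delta> < \<delta>1 \<longrightarrow> t2 + \<delta> \<le> T \<and>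
      (\<lambda>s. norm (integral {s..s + \<delta>} (\<lambda>t. b t i) - \<delta> *\<^sub>R b s i)) integrable_on {t1..t2} \<and>
      integral {t1..t2} (\<lambda>s. norm (integral {s..s + \<delta>} (\<lambda>t. b t i) - \<delta> *\<^sub>R b s i)) \<le> e' * \<delta>" for i
      by (rule short_average_L1[OF b_absolutely_integrable[where y = i and s = 0 and t = T] t(1) _ t(3) e'(1)]) (use t in simp)
    from choice[OF allI[OF this]] obtain \<delta>1 where avg0: "\<forall>i. 0 < \<delta>1 i \<and> (\<forall>\<delta>. 0 < \<delta> \<longrightarrow> \<delta> < \<delta>1 i \<longrightarrow> t2 + \<delta> \<le> T \<and>
      (\<lambda>s. norm (integral {s..s + \<delta>} (\<lambda>t. b t i) - \<delta> *\<^sub>R b s i)) integrable_on {t1..t2} \<and>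
      integral {t1..t2} (\<lambda>s. norm (integral {s..s + \<delta>} (\<lambda>t. b t i) - \<delta> *\<^sub>R b s i)) \<le> e' * \<delta>)" ..
    then have \<delta>1: "\<And>i. 0 < \<delta>1 i" and avg: "\<And>i \<delta>. 0 < \<delta> \<Longrightarrow> \<delta> < \<delta>1 i \<Longrightarrow>
      (\<lambda>s. norm (integral {s..s + \<delta>} (\<lambda>t. b t i) - \<delta> *\<^sub>R b s i)) integrable_on {t1..t2} \<and>
      integral {t1..t2} (\<lambda>s. norm (integral {s..s + \<delta>} (\<lambda>t. b t i) - \<delta> *\<^sub>R b s i)) \<le> e' * \<delta>"
      by blast+
    define \<delta>2 where "\<delta>2 = Min (insert 1 (\<delta>1 ` N))"
    have \<delta>2: "0 < \<delta>2" "\<And>i. i \<in> N \<Longrightarrow> \<delta>2 \<le> \<delta>1 i" using N(1) \<delta>1 by (auto simp: \<delta>2_def)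
    have "uniformly_continuous_on {0..T} top_value"
      by (intro compact_uniformly_continuous top_value_continuous compact_Icc)
    then obtain \<delta>3 where \<delta>3: "0 < \<delta>3" "\<And>s r. s \<in> {0..T} \<Longrightarrow> r \<in> {0..T} \<Longrightarrow> dist r s < \<delta>3 \<Longrightarrow> dist (top_value r) (top_value s) < e"
      unfolding uniformly_continuous_on_def using e by metis
    define \<delta> where "\<delta> = min (min \<delta>0 \<delta>2) (min \<delta>3 (T - t2)) / 2"
    have \<delta>: "0 < \<delta>" "\<delta> < \<delta>0" "\<delta> < \<delta>2" "\<delta> < \<delta>3" "t2 + \<delta> \<le> T"
      using \<delta>0 \<delta>2(1) \<delta>3(1) t by (auto simp: \<delta>_def min_def field_simps)
    define S where "S i s = norm (integral {s..s + \<delta>} (\<lambda>t. b t i) - \<delta> *\<^sub>R b s i)" for i s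
    have S: "S i integrable_on {t1..t2}" "integral {t1..t2} (S i) \<le> e' * \<delta>" if "i \<in> N" for i
      using avg[OF \<delta>(1), of i] \<delta>2(2)[OF that] \<delta>(3) by (auto simp: S_def[abs_def])
    have ti: "top_value integrable_on {s..r}" if "0 \<le> s" "r \<le> T" for s r
      by (rule integrable_continuous_interval[OF continuous_on_subset[OF top_value_continuous]]) (use that in auto)
    have "\<delta> * (top_value t1 - e) = integral {t1..t1 + \<delta>} (\<lambda>_. top_value t1 - e)" using \<delta>(1) by simp
    also have "\<dots> \<le> integral {t1..t1 + \<delta>} top_value"
    proof (rule integral_le[OF integrable_const_ivl ti])
      show "top_value t1 - e \<le> top_value s" if "s \<in> {t1..t1 + \<delta>}" for s
        using \<delta>3(2)[of t1 s] that t \<delta> by (auto simp: dist_real_def)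
    qed (use t \<delta> in auto)
    finally have lo: "\<delta> * (top_value t1 - e) \<le> integral {t1..t1 + \<delta>} top_value" .
    have "integral {t2..t2 + \<delta>} top_value \<le> integral {t2..t2 + \<delta>} (\<lambda>_. top_value t2 + e)"
    proof (rule integral_le[OF ti integrable_const_ivl])
      show "top_value s \<le> top_value t2 + e" if "s \<in> {t2..t2 + \<delta>}" for s
        using \<delta>3(2)[of t2 s] that t \<delta> by (auto simp: dist_real_def)
    qed (use t \<delta> in auto)
    also have "\<dots> = \<delta> * (top_value t2 + e)" using \<delta>(1) by simp
    finally have hi: "integral {t2..t2 + \<delta>} top_value \<le> \<delta> * (top_value t2 + e)" .
    have c1: "continuous_on {t1..t2} (\<lambda>s. top_value s - top_value (s + \<delta>))"
      by (intro continuous_on_diff continuous_on_compose2[OF top_value_continuous] continuous_intros) (use t \<delta> in auto)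
    have c2: "(\<lambda>s. integral {s..s + \<delta>} C0) integrable_on {t1..t2}"
      by (rule integrable_continuous_interval[OF short_integral_continuous[OF C0_integrable_on[of 0 T]]]) (use t \<delta> in auto)
    have i1: "(\<lambda>s. \<delta> * rhs s) integrable_on {t1..t2}" "(\<lambda>s. \<delta> * (e + 3 * L * e)) integrable_on {t1..t2}"
      "(\<lambda>s. e * Q * integral {s..s + \<delta>} C0) integrable_on {t1..t2}" "(\<lambda>s. L * (\<Sum>i\<in>N. S i s)) integrable_on {t1..t2}"
      by (intro integrable_on_mult_right rhsi integrable_const_ivl c2 integrable_sum N(1) S(1); assumption)+
    have "integral {t1..t1 + \<delta>} top_value - integral {t2..t2 + \<delta>} top_value = integral {t1..t2} (\<lambda>s. top_value s - top_value (s + \<delta>))"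
      using integral_shift_difference[OF continuous_on_subset[OF top_value_continuous], of t1 t2 \<delta>] t \<delta> by auto
    also have "\<dots> \<le> integral {t1..t2} (\<lambda>s. \<delta> * rhs s + \<delta> * (e + 3 * L * e) + e * Q * integral {s..s + \<delta>} C0 + L * (\<Sum>i\<in>N. S i s))"
    proof (rule integral_le[OF integrable_continuous_interval[OF c1]])
      show "(\<lambda>s. \<delta> * rhs s + \<delta> * (e + 3 * L * e) + e * Q * integral {s..s + \<delta>} C0 + L * (\<Sum>i\<in>N. S i s)) integrable_on {t1..t2}"
        by (intro integrable_add i1)
      show "top_value s - top_value (s + \<delta>) \<le> \<delta> * rhs s + \<delta> * (e + 3 * L * e) + e * Q * integral {s..s + \<delta>} C0 + L * (\<Sum>i\<in>N. S i s)"
        if "s \<in> {t1..t2}" for s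
        using short[OF \<delta>(1,2), of s] that t by (simp add: Q_def S_def)
    qed
    also have "\<dots> = \<delta> * integral {t1..t2} rhs + (t2 - t1) * (\<delta> * (e + 3 * L * e)) + e * Q * integral {t1..t2} (\<lambda>s. integral {s..s + \<delta>} C0)
        + L * (\<Sum>i\<in>N. integral {t1..t2} (S i))"
      using t integral_sum[OF N(1) S(1)]
      by (simp add: Henstock_Kurzweil_Integration.integral_add integrable_add i1)
    also have "\<dots> \<le> \<delta> * integral {t1..t2} rhs + (t2 - t1) * (\<delta> * (e + 3 * L * e)) + e * Q * (\<delta> * I0) + L * (\<delta> * e)"
    proof (intro add_mono mult_left_mono order_refl)
      show "integral {t1..t2} (\<lambda>s. integral {s..s + \<delta>} C0) \<le> \<delta> * I0"
        unfolding I0_def by (rule integral_short_integral_le[OF C0_integrable_on C0_nonneg]) (use t \<delta> in auto)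
      have "(\<Sum>i\<in>N. integral {t1..t2} (S i)) \<le> (\<Sum>i\<in>N. e' * \<delta>)" by (rule sum_mono[OF S(2)])
      also have "\<dots> = (real (card N) * e') * \<delta>" by simp
      also have "\<dots> \<le> e * \<delta>" using e'(2) \<delta>(1) by (intro mult_right_mono) auto
      finally show "(\<Sum>i\<in>N. integral {t1..t2} (S i)) \<le> \<delta> * e" by (simp add: mult.commute)
    qed (use e Q L(1) \<delta>(1) t in auto)
    finally have "\<delta> * (top_value t1 - e) - \<delta> * (top_value t2 + e) \<le>
        \<delta> * integral {t1..t2} rhs + (t2 - t1) * (\<delta> * (e + 3 * L * e)) + e * Q * (\<delta> * I0) + L * (\<delta> * e)"
      using lo hi by linarith
    then have "\<delta> * (top_value t1 - top_value t2) \<le> \<delta> * (integral {t1..t2} rhs + e * A)"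
      by (simp add: A_def algebra_simps)
    then show ?thesis using \<delta>(1) by simp
  qed
  show ?thesis
  proof (rule field_le_epsilon)
    fix e :: real assume "0 < e"
    then show "top_value t1 - top_value t2 \<le> integral {t1..t2} rhs + e"
      using approx[of "e / A"] A by simp
  qed
qed

text \<open>Both sides are continuous in t2, so the case t2 = T follows by letting the final time
  increase to T.\<close>

lemma top_value_inequality:
  assumes t: "0 \<le> t1" "t1 < t2" "t2 \<le> T"
  shows "top_value t1 - top_value t2 \<le> integral {t1..t2} rhs"
proof (cases "t2 = T")
  case True
  have rhsi: "rhs integrable_on {t1..T}"
    using absolutely_integrable_on_subinterval[OF rhs_absolutely_integrable, of t1 T] t by (auto simp: absolutely_integrable_on_def)
  define F where "F r = integral {t1..r} rhs - (top_value t1 - top_value r)" for r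
  have cF: "continuous_on {t1..T} F"
    unfolding F_def
    by (intro continuous_intros indefinite_integral_continuous_1 rhsi continuous_on_subset[OF top_value_continuous]) (use t in auto)
  define d where "d n = (T - t1) * inverse (real (Suc n))" for n
  have d0: "d \<longlonglongrightarrow> 0"
    using tendsto_mult_left[OF LIMSEQ_inverse_real_of_nat, of "T - t1"] by (simp add: d_def[abs_def])
  have d: "0 < d n" "d n \<le> T - t1" for n
  proof -
    show "0 < d n" using t True by (simp add: d_def)
    have "(T - t1) * inverse (real (Suc n)) \<le> (T - t1) * 1" using t True by (intro mult_left_mono) (auto simp: field_simps)
    then show "d n \<le> T - t1" by (simp add: d_def)
  qed
  have dT: "t1 \<le> T - d n" "T - d n \<le> T" for n using d[of n] by auto
  have "(\<lambda>n. T - d n) \<longlonglongrightarrow> T" using tendsto_diff[OF tendsto_const d0, of T] by simp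
  then have "(\<lambda>n. F (T - d n)) \<longlonglongrightarrow> F T"
    by (rule continuous_on_tendsto_compose[OF cF]) (use t True dT in auto)
  moreover have "0 \<le> F (T - d n)" for n
  proof (cases "T - d n = t1")
    case False
    then have "t1 < T - d n" using d(2)[of n] by linarith
    then show ?thesis using top_value_inequality_interior[of t1 "T - d n"] t d(1)[of n] by (simp add: F_def)
  qed (simp add: F_def)
  ultimately have "0 \<le> F T" using LIMSEQ_le_const by blast
  then show ?thesis by (simp add: F_def True)
qed (use t top_value_inequality_interior in auto)

end

end

end

text \<open>The hypothesis on \<open>w\<close> only asks for equal values at two points and is
  therefore unchanged under passing to the negative. It thus serves for u and for - u alike, and
  with duality for both halves of the solution property.\<close>

lemma viscosity_subsolutionI:
  assumes T: "0 < T" and w: "continuous_on ({0..T} \<times> UNIV) (\<lambda>(t, x). w t x)"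
    and step: "\<And>s s' y. 0 \<le> s \<Longrightarrow> s \<le> s' \<Longrightarrow> s' \<le> T \<Longrightarrow> \<exists>x. w s' x = w s y \<and>
      norm (x - y) \<le> (1 + norm y) * exp (integral {0..T} C0) * integral {s..s'} C0 \<and>
      norm (x - y + integral {s..s'} (\<lambda>t. b t y)) \<le> (s' - s) * (H * ((1 + norm y) * exp (integral {0..T} C0) * integral {s..s'} C0) powr \<alpha>)"
  shows "viscosity_subsolution T b w"
  unfolding viscosity_subsolution_def
proof (intro conjI allI impI)
  show "usc_on ({0..T} \<times> UNIV) (\<lambda>(t, x). w t x)" by (rule continuous_imp_usc_on[OF w])
  fix \<psi> \<psi>t D\<psi>
  assume "C12 T \<psi> \<psi>t D\<psi> \<and> tends_to_minus_infinity T (\<lambda>t x. w t x - \<psi> t x)"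
  then have C: "C12 T \<psi> \<psi>t D\<psi>" "tends_to_minus_infinity T (\<lambda>t x. w t x - \<psi> t x)" by auto
  note ctx = T w C
  obtain R where R: "0 \<le> R" "\<And>t x. t \<in> {0..T} \<Longrightarrow> R < norm x \<Longrightarrow> gap w \<psi> t x < gap w \<psi> t 0"
    by (rule coercive_radius[OF ctx]) (rule that; blast)
  have eq: "sub_rhs b w \<psi> \<psi>t D\<psi> t = ereal (rhs w \<psi> \<psi>t D\<psi> t)" if "t \<in> {0..T}" for t
    by (rule sub_rhs_eq[OF ctx R that])
  have int: "rhs w \<psi> \<psi>t D\<psi> absolutely_integrable_on {0..T}"
    by (rule rhs_absolutely_integrable[OF ctx R])
  have "(\<lambda>t. real_of_ereal (sub_rhs b w \<psi> \<psi>t D\<psi> t)) absolutely_integrable_on {0..T}"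
    by (rule set_integrable_cong[THEN iffD1, OF refl refl _ int]) (simp add: eq)
  then show "ereal_integrable_on (sub_rhs b w \<psi> \<psi>t D\<psi>) {0..T}"
    unfolding ereal_integrable_on_def by (auto intro!: AE_I2 simp: eq)
  fix t1 t2 assume "0 \<le> t1 \<and> t1 < t2 \<and> t2 \<le> T"
  then have t: "0 \<le> t1" "t1 < t2" "t2 \<le> T" by auto
  have "(LINT t:{t1..t2}|lebesgue. real_of_ereal (sub_rhs b w \<psi> \<psi>t D\<psi> t)) = (LINT t:{t1..t2}|lebesgue. rhs w \<psi> \<psi>t D\<psi> t)"
    by (rule set_lebesgue_integral_cong) (use t eq in auto)
  also have "\<dots> = integral {t1..t2} (rhs w \<psi> \<psi>t D\<psi>)"
    by (rule set_lebesgue_integral_eq_integral(2)[OF absolutely_integrable_on_subinterval[OF int]]) (use t in auto)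
  finally show "(SUP x. w t1 x - \<psi> t1 x) - (SUP x. w t2 x - \<psi> t2 x) \<le> (LINT t:{t1..t2}|lebesgue. real_of_ereal (sub_rhs b w \<psi> \<psi>t D\<psi> t))"
    using top_value_inequality[OF ctx R step t] by (simp add: top_value_unfold[OF ctx])
qed

end

subsection \<open>Duality between sub- and supersolutions\<close>

lemma C12_uminus:
  fixes \<psi> :: "real \<Rightarrow> 'a::euclidean_space \<Rightarrow> real"
  assumes "C12 T \<psi> \<psi>t D\<psi>"
  shows "C12 T (\<lambda>t x. - \<psi> t x) (\<lambda>t x. - \<psi>t t x) (\<lambda>t x. - D\<psi> t x)"
proof -
  obtain D2 :: "real \<Rightarrow> 'a \<Rightarrow> 'a \<Rightarrow>\<^sub>L 'a" where D2:
    "\<And>t x. t \<in> {0..T} \<Longrightarrow> ((\<lambda>s. \<psi> s x) has_real_derivative \<psi>t t x) (at t within {0..T})"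
    "\<And>t x. t \<in> {0..T} \<Longrightarrow> GDERIV (\<psi> t) x :> D\<psi> t x"
    "\<And>t x. t \<in> {0..T} \<Longrightarrow> (D\<psi> t has_derivative blinfun_apply (D2 t x)) (at x)"
    and c: "continuous_on ({0..T} \<times> UNIV) (\<lambda>(t, x). \<psi> t x)" "continuous_on ({0..T} \<times> UNIV) (\<lambda>(t, x). \<psi>t t x)"
    "continuous_on ({0..T} \<times> UNIV) (\<lambda>(t, x). D\<psi> t x)" "continuous_on ({0..T} \<times> UNIV) (\<lambda>(t, x). D2 t x)"
    using assms unfolding C12_def by blast
  show ?thesis
    unfolding C12_def
  proof (intro exI[of _ "\<lambda>t x. - D2 t x"] conjI ballI allI)
    fix t x assume t: "t \<in> {0..T}"
    show "((\<lambda>s. - \<psi> s x) has_real_derivative - \<psi>t t x) (at t within {0..T})" by (rule DERIV_minus[OF D2(1)[OF t]])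
    show "GDERIV (\<lambda>x. - \<psi> t x) x :> - D\<psi> t x" by (rule GDERIV_minus[OF D2(2)[OF t]])
    have "blinfun_apply (- D2 t x) = (\<lambda>h. - blinfun_apply (D2 t x) h)" by (simp add: fun_eq_iff uminus_blinfun.rep_eq)
    then show "((\<lambda>x. - D\<psi> t x) has_derivative blinfun_apply (- D2 t x)) (at x)"
      using has_derivative_minus[OF D2(3)[OF t]] by simp
  qed (use c[THEN continuous_on_minus] in \<open>simp_all add: case_prod_unfold\<close>)
qed

lemma super_rhs_eq_uminus_sub_rhs:
  "super_rhs b v \<psi> \<psi>t D\<psi> t = - sub_rhs b (\<lambda>t x. - v t x) (\<lambda>t x. - \<psi> t x) (\<lambda>t x. - \<psi>t t x) (\<lambda>t x. - D\<psi> t x) t"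
proof -
  have l: "lower_b b t y (- p) = - upper_b b t y p" for y p
    unfolding lower_b_def upper_b_def using ereal_Liminf_uminus[of "nhds y" "\<lambda>z. ereal (b t z \<bullet> p)"] by simp
  \<comment> \<open>As \<open>r\<close> is a real number, the identity holds for infinite
    \<open>U\<close> as well and no indeterminate difference occurs.\<close>
  have e: "ereal (- r) - - U = - (ereal r - U)" for r U
    by (cases U) auto
  have s: "{y. is_arg_max (\<lambda>x. - v t x - - \<psi> t x) (\<lambda>_. True) y} = {y. is_arg_min (\<lambda>x. v t x - \<psi> t x) (\<lambda>_. True) y}"
  proof -
    have "(- v t x - - \<psi> t x \<le> - v t y - - \<psi> t y) = (v t y - \<psi> t y \<le> v t x - \<psi> t x)" for x y by auto
    then show ?thesis by (simp only: is_arg_max_linorder is_arg_min_linorder)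
  qed
  show ?thesis
    unfolding sub_rhs_def super_rhs_def s l e
    by (simp only: ereal_INF_uminus_eq ereal_uminus_uminus)
qed

lemma real_INF_eq: "(INF x. g x) = - (SUP x. - g x :: real)"
  by (simp add: Inf_real_def image_image)

lemma tends_to_infinity_uminus:
  "tends_to_minus_infinity T (\<lambda>t x. - w t x) \<longleftrightarrow> tends_to_plus_infinity T w"
proof -
  have "tends_to_minus_infinity T (\<lambda>t x. - w t x) \<longleftrightarrow> (\<forall>K. \<forall>\<^sub>F x in at_infinity. \<forall>t\<in>{0..T}. - K \<le> w t x)"
    by (simp add: tends_to_minus_infinity_def minus_le_iff)
  also have "\<dots> \<longleftrightarrow> tends_to_plus_infinity T w"
    unfolding tends_to_plus_infinity_def
  proof (intro iffI allI)
    fix K assume "\<forall>K. \<forall>\<^sub>F x in at_infinity. \<forall>t\<in>{0..T}. - K \<le> w t x"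
    from spec[OF this, of "- K"] show "\<forall>\<^sub>F x in at_infinity. \<forall>t\<in>{0..T}. K \<le> w t x" by simp
  qed blast
  finally show ?thesis .
qed

lemma usc_on_uminus: "usc_on S (\<lambda>z. - f z) \<longleftrightarrow> lsc_on S f"
proof -
  have "usc_on S (\<lambda>z. - f z) \<longleftrightarrow> (\<forall>z\<in>S. \<forall>c. - c < f z \<longrightarrow> (\<forall>\<^sub>F w in at z within S. - c < f w))"
    by (simp add: usc_on_def minus_less_iff)
  also have "\<dots> \<longleftrightarrow> lsc_on S f"
    unfolding lsc_on_def
  proof (intro iffI ballI allI)
    fix z c assume "\<forall>z\<in>S. \<forall>c. - c < f z \<longrightarrow> (\<forall>\<^sub>F w in at z within S. - c < f w)" "z \<in> S"
    then have "- (- c) < f z \<longrightarrow> (\<forall>\<^sub>F w in at z within S. - (- c) < f w)" by blast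
    then show "c < f z \<longrightarrow> (\<forall>\<^sub>F w in at z within S. c < f w)" by simp
  qed blast
  finally show ?thesis .
qed

lemma ereal_integrable_on_uminus: "ereal_integrable_on (\<lambda>t. - R t) S \<longleftrightarrow> ereal_integrable_on R S"
proof -
  have "(\<lambda>t. - real_of_ereal (R t)) absolutely_integrable_on S \<longleftrightarrow> (\<lambda>t. real_of_ereal (R t)) absolutely_integrable_on S"
    using set_integral_diff(1)[OF absolutely_integrable_zero, of S "\<lambda>t. real_of_ereal (R t)"]
      set_integral_diff(1)[OF absolutely_integrable_zero, of S "\<lambda>t. - real_of_ereal (R t)"] by auto
  then show ?thesis by (simp add: ereal_integrable_on_def)
qed

text \<open>Negation exchanges maxima with minima and the lower with the upper envelope, and the
  negative of an admissible test function is admissible. Only subsolutions remain to be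
  studied.\<close>

lemma viscosity_supersolution_iff_uminus:
  "viscosity_supersolution T b v \<longleftrightarrow> viscosity_subsolution T b (\<lambda>t x. - v t x)"
proof -
  have semi: "lsc_on ({0..T} \<times> UNIV) (\<lambda>(t, x). v t x) \<longleftrightarrow> usc_on ({0..T} \<times> UNIV) (\<lambda>(t, x). - v t x)"
    using usc_on_uminus[of _ "\<lambda>(t, x). v t x"] by (simp add: case_prod_unfold)
  define sup where "sup \<psi> \<psi>t D\<psi> \<longleftrightarrow> ereal_integrable_on (super_rhs b v \<psi> \<psi>t D\<psi>) {0..T} \<and>
        (\<forall>t1 t2. 0 \<le> t1 \<and> t1 < t2 \<and> t2 \<le> T \<longrightarrow>
           (INF x. v t1 x - \<psi> t1 x) - (INF x. v t2 x - \<psi> t2 x)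
           \<ge> (LINT t:{t1..t2}|lebesgue. real_of_ereal (super_rhs b v \<psi> \<psi>t D\<psi> t)))" for \<psi> \<psi>t D\<psi>
  define sub where "sub \<psi> \<psi>t D\<psi> \<longleftrightarrow> ereal_integrable_on (sub_rhs b (\<lambda>t x. - v t x) \<psi> \<psi>t D\<psi>) {0..T} \<and>
        (\<forall>t1 t2. 0 \<le> t1 \<and> t1 < t2 \<and> t2 \<le> T \<longrightarrow>
           (SUP x. - v t1 x - \<psi> t1 x) - (SUP x. - v t2 x - \<psi> t2 x)
           \<le> (LINT t:{t1..t2}|lebesgue. real_of_ereal (sub_rhs b (\<lambda>t x. - v t x) \<psi> \<psi>t D\<psi> t)))" for \<psi> \<psi>t D\<psi>
  have iff: "sup \<psi> \<psi>t D\<psi> \<longleftrightarrow> sub (\<lambda>t x. - \<psi> t x) (\<lambda>t x. - \<psi>t t x) (\<lambda>t x. - D\<psi> t x)" for \<psi> \<psi>t D\<psi>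
  proof -
    have r: "super_rhs b v \<psi> \<psi>t D\<psi> = (\<lambda>t. - sub_rhs b (\<lambda>t x. - v t x) (\<lambda>t x. - \<psi> t x) (\<lambda>t x. - \<psi>t t x) (\<lambda>t x. - D\<psi> t x) t)"
      by (rule ext) (rule super_rhs_eq_uminus_sub_rhs)
    have m: "(INF x. v t x - \<psi> t x) = - (SUP x. - v t x - - \<psi> t x)" for t
      unfolding real_INF_eq by simp
    have l: "(LINT t:{t1..t2}|lebesgue. real_of_ereal (- R t)) = - (LINT t:{t1..t2}|lebesgue. real_of_ereal (R t))" for R t1 t2
      by (simp add: set_lebesgue_integral_def)
    show ?thesis
      unfolding sup_def sub_def r ereal_integrable_on_uminus m l
      by (rule conj_cong[OF refl]) (rule all_cong1, rule all_cong1, auto)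
  qed
  have eq1: "viscosity_supersolution T b v \<longleftrightarrow> lsc_on ({0..T} \<times> UNIV) (\<lambda>(t, x). v t x) \<and>
      (\<forall>\<psi> \<psi>t D\<psi>. C12 T \<psi> \<psi>t D\<psi> \<and> tends_to_plus_infinity T (\<lambda>t x. v t x - \<psi> t x) \<longrightarrow> sup \<psi> \<psi>t D\<psi>)"
    unfolding viscosity_supersolution_def sup_def by simp
  have eq2: "viscosity_subsolution T b (\<lambda>t x. - v t x) \<longleftrightarrow> usc_on ({0..T} \<times> UNIV) (\<lambda>(t, x). - v t x) \<and>
      (\<forall>\<psi> \<psi>t D\<psi>. C12 T \<psi> \<psi>t D\<psi> \<and> tends_to_minus_infinity T (\<lambda>t x. - v t x - \<psi> t x) \<longrightarrow> sub \<psi> \<psi>t D\<psi>)"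
    unfolding viscosity_subsolution_def sub_def by simp
  show ?thesis
    unfolding eq1 eq2 semi
  proof (intro conj_cong[OF refl] iffI allI impI)
    fix \<psi> \<psi>t D\<psi>
    assume a: "\<forall>\<psi> \<psi>t D\<psi>. C12 T \<psi> \<psi>t D\<psi> \<and> tends_to_plus_infinity T (\<lambda>t x. v t x - \<psi> t x) \<longrightarrow> sup \<psi> \<psi>t D\<psi>"
      and h: "C12 T \<psi> \<psi>t D\<psi> \<and> tends_to_minus_infinity T (\<lambda>t x. - v t x - \<psi> t x)"
    have "tends_to_plus_infinity T (\<lambda>t x. v t x - - \<psi> t x)"
      using h tends_to_infinity_uminus[of T "\<lambda>t x. v t x - - \<psi> t x"] by simp
    with a h have "sup (\<lambda>t x. - \<psi> t x) (\<lambda>t x. - \<psi>t t x) (\<lambda>t x. - D\<psi> t x)" using C12_uminus by blast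
    then show "sub \<psi> \<psi>t D\<psi>" unfolding iff by simp
  next
    fix \<psi> \<psi>t D\<psi>
    assume a: "\<forall>\<psi> \<psi>t D\<psi>. C12 T \<psi> \<psi>t D\<psi> \<and> tends_to_minus_infinity T (\<lambda>t x. - v t x - \<psi> t x) \<longrightarrow> sub \<psi> \<psi>t D\<psi>"
      and h: "C12 T \<psi> \<psi>t D\<psi> \<and> tends_to_plus_infinity T (\<lambda>t x. v t x - \<psi> t x)"
    have "tends_to_minus_infinity T (\<lambda>t x. - v t x - - \<psi> t x)"
      using h tends_to_infinity_uminus[of T "\<lambda>t x. v t x - \<psi> t x"] by simp
    with a h have "sub (\<lambda>t x. - \<psi> t x) (\<lambda>t x. - \<psi>t t x) (\<lambda>t x. - D\<psi> t x)" using C12_uminus by blast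
    then show "sup \<psi> \<psi>t D\<psi>" unfolding iff .
  qed
qed

subsection \<open>Comparison along approximate characteristics\<close>

text \<open>Up to \<eta> the Hoelder term is at most its value at \<eta>; beyond \<eta> the exponent
  \<beta> - 2 \<le> 0 lets the quadratic term with coefficient \<open>l\<close> absorb it.\<close>

lemma holder_quadratic_bound:
  fixes B \<beta> l \<eta> r :: real
  assumes "0 \<le> B" "\<beta> \<le> 2" "0 \<le> \<beta>" "0 < \<eta>" "B * \<eta> powr (\<beta> - 2) \<le> l" "0 \<le> r"
  shows "B * r powr \<beta> - l * r\<^sup>2 \<le> B * \<eta> powr \<beta>"
proof (cases "r \<le> \<eta>")
  case True
  have "0 \<le> l" using assms(1,5) by (meson mult_nonneg_nonneg order_trans powr_ge_zero)
  moreover have "B * r powr \<beta> \<le> B * \<eta> powr \<beta>" using True assms by (intro mult_left_mono powr_mono2) auto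
  ultimately show ?thesis by (smt (verit) zero_le_mult_iff zero_le_power2)
next
  case False
  then have r: "0 < r" using assms by simp
  have "r powr \<beta> = r powr (\<beta> - 2) * r\<^sup>2"
    using r by (simp flip: powr_numeral powr_add)
  also have "\<dots> \<le> \<eta> powr (\<beta> - 2) * r\<^sup>2"
    using False assms by (intro mult_right_mono powr_mono2') auto
  finally have "B * r powr \<beta> \<le> B * \<eta> powr (\<beta> - 2) * r\<^sup>2" using assms(1) mult_left_mono by (fastforce simp: mult.assoc)
  also have "\<dots> \<le> l * r\<^sup>2" by (intro mult_right_mono assms) simp
  finally show ?thesis using assms by (smt (verit) mult_nonneg_nonneg powr_ge_zero)
qed

lemma moving_quadratic_C12:
  fixes X :: "real \<Rightarrow> 'a::euclidean_space" and f :: "real \<Rightarrow> real"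
  assumes X: "\<And>t. (X has_vector_derivative X' t) (at t)" "continuous_on UNIV X'"
    and f: "\<And>t. (f has_real_derivative f' t) (at t)" "continuous_on UNIV f'"
  shows "C12 T (\<lambda>t z. f t * ((z - X t) \<bullet> (z - X t)))
     (\<lambda>t z. f' t * ((z - X t) \<bullet> (z - X t)) - 2 * f t * (X' t \<bullet> (z - X t))) (\<lambda>t z. (2 * f t) *\<^sub>R (z - X t))"
proof -
  have contX: "continuous_on UNIV X"
    using X(1) by (auto simp: continuous_on_eq_continuous_at intro: has_vector_derivative_continuous)
  have contf: "continuous_on UNIV f"
    using f(1) by (auto simp: continuous_on_eq_continuous_at intro: DERIV_isCont)
  have [continuous_intros]: "continuous_on S (\<lambda>z. g (fst z))" if "continuous_on UNIV g" for g :: "real \<Rightarrow> 'b::topological_space" and S :: "(real \<times> 'a) set"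
    by (rule continuous_on_compose2[OF that]) (auto intro!: continuous_intros)
  show ?thesis
    unfolding C12_def
  proof (intro exI[of _ "\<lambda>t x. (2 * f t) *\<^sub>R id_blinfun"] conjI ballI allI)
    fix t :: real and x :: 'a
    have dX: "((\<lambda>s. x - X s) has_derivative (\<lambda>h. - (h *\<^sub>R X' t))) (at t)"
      using X(1)[of t] unfolding has_vector_derivative_def by (auto intro!: derivative_eq_intros)
    have "((\<lambda>s. (x - X s) \<bullet> (x - X s)) has_derivative (\<lambda>h. h * (- 2 * (X' t \<bullet> (x - X t))))) (at t)"
      by (rule has_derivative_eq_rhs[OF has_derivative_inner[OF dX dX]]) (auto simp: fun_eq_iff inner_commute)
    then have "((\<lambda>s. (x - X s) \<bullet> (x - X s)) has_real_derivative (- 2 * (X' t \<bullet> (x - X t)))) (at t)"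
      unfolding has_field_derivative_def by (rule has_derivative_eq_rhs) (auto simp: fun_eq_iff)
    from DERIV_mult[OF f(1)[of t] this]
    have "((\<lambda>s. f s * ((x - X s) \<bullet> (x - X s))) has_real_derivative f' t * ((x - X t) \<bullet> (x - X t)) - 2 * f t * (X' t \<bullet> (x - X t))) (at t)"
      by (rule DERIV_cong) (simp add: algebra_simps)
    then show "((\<lambda>s. f s * ((x - X s) \<bullet> (x - X s))) has_real_derivative f' t * ((x - X t) \<bullet> (x - X t)) - 2 * f t * (X' t \<bullet> (x - X t))) (at t within {0..T})"
      by (rule has_field_derivative_at_within)
    have "((\<lambda>z. f t * ((z - X t) \<bullet> (z - X t))) has_derivative (\<lambda>h. f t * ((x - X t) \<bullet> h + h \<bullet> (x - X t)))) (at x)"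
      by (intro has_derivative_mult_right has_derivative_inner) (auto intro!: derivative_eq_intros)
    then show "GDERIV (\<lambda>z. f t * ((z - X t) \<bullet> (z - X t))) x :> (2 * f t) *\<^sub>R (x - X t)"
      unfolding gderiv_def by (rule has_derivative_eq_rhs) (auto simp: fun_eq_iff inner_commute)
    show "((\<lambda>z. (2 * f t) *\<^sub>R (z - X t)) has_derivative blinfun_apply ((2 * f t) *\<^sub>R id_blinfun)) (at x)"
      by (auto intro!: derivative_eq_intros simp: fun_eq_iff blinfun.scaleR_left)
  qed (auto simp: case_prod_unfold intro!: continuous_intros contX contf X(2) f(2))
qed

context transport_field
begin

text \<open>The test function vanishes at \<open>y\<close> at time s, and at time T it is steep
  enough for the Hoelder bound on the terminal value to limit the maximum near v(T, X T). In
  between, the right-hand side is controlled by the defect and by the error in approximating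
  \<open>C1\<close>. The curve enters only through its bound \<rho> and its defect, so one \<delta>
  serves all curves.\<close>

lemma subsolution_upper_bound:
  assumes T: "0 < T" and sub: "viscosity_subsolution T b v"
    and linear: "\<forall>t\<in>{0..T}. \<forall>x. \<bar>v t x\<bar> \<le> C * (1 + norm x)" and C: "0 \<le> C"
    and terminal: "\<And>x y. \<bar>v T x - v T y\<bar> \<le> B * norm (x - y) powr \<beta>" and B: "0 \<le> B" "0 < \<beta>" "\<beta> \<le> 2"
    and s: "0 \<le> s" "s < T" and e: "0 < e"
  shows "\<exists>\<delta>>0. \<forall>X X'. (\<forall>t. (X has_vector_derivative X' t) (at t)) \<and> continuous_on UNIV X' \<and> X s = y \<and>
       (\<forall>t\<in>{s..T}. norm (X t) \<le> \<rho>) \<and> integral {s..T} (\<lambda>t. norm (X' t + b t (X t))) \<le> \<delta> \<longrightarrow> v s y \<le> v T (X T) + e"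
proof -
  have growth: "\<bar>v t x\<bar> \<le> C * (1 + norm x)" if "t \<in> {0..T}" for t x using linear that by blast
  have C1a: "C1 absolutely_integrable_on {a..c}" for a c
    by (rule absolutely_integrable_lborel(1)[OF C1_integrable C1_nonneg])
  define c1 where "c1 = integral {0..T} C1"
  have C1i: "C1 integrable_on {a..c}" for a c using C1a by (auto simp: absolutely_integrable_on_def)
  have c1: "0 \<le> c1" unfolding c1_def by (rule Henstock_Kurzweil_Integration.integral_nonneg[OF C1i C1_nonneg])
  \<comment> \<open>Bounds for the exponential weight: the primitive \<open>P\<close> of the
    polynomial approximating \<open>C1\<close> satisfies |P| \<le> c1 + 1, the 1 being room for the
    L^1 error.\<close>
  define fmin where "fmin = exp (- 2 * (c1 + 1))"
  define fmax where "fmax = exp (2 * (c1 + 1))"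
  have f0: "0 < fmin" "0 < fmax" by (auto simp: fmin_def fmax_def)
  have e2: "0 < e / 2" using e by simp
  obtain \<eta> where \<eta>: "0 < \<eta>" "B * \<eta> powr \<beta> \<le> e / 2"
    using powr_small[OF B(1,2) e2] by (metis less_imp_le order_refl)
  \<comment> \<open>Large enough for the quadratic, even with the smallest weight, to absorb the
    Hoelder variation of the terminal value beyond distance \<eta>.\<close>
  define l where "l = (B * \<eta> powr (\<beta> - 2) + 1) / fmin"
  have l: "0 < l" "B * \<eta> powr (\<beta> - 2) \<le> l * fmin"
    using B(1) f0 by (auto simp: l_def intro!: divide_pos_pos add_nonneg_pos)
  \<comment> \<open>A bound for the distance of a maximizer from X t: the maximality inequality
    makes a quadratic in this distance at most linear, with constants from the growth of
    \<open>v\<close> and the bound \<rho>. The summand 1 settles short distances.\<close>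
  define Rk where "Rk = 1 + C * (3 + 2 * \<bar>\<rho>\<bar>) / (l * fmin)"
  have Rk: "1 \<le> Rk" using C l f0 by (simp add: Rk_def)
  define W where "W = l * fmax * (2 * Rk\<^sup>2 + 2 * Rk)"
  have W: "0 < W" using l f0 Rk by (auto simp: W_def intro!: mult_pos_pos add_pos_pos)
  define \<delta> where "\<delta> = min 1 (e / 2 / W)"
  have \<delta>: "0 < \<delta>" "\<delta> \<le> 1" "W * \<delta> \<le> e / 2"
    using e W by (auto simp: \<delta>_def min_def field_simps)
  obtain p where p: "real_polynomial_function p" "integral {0..T} (\<lambda>t. \<bar>C1 t - p t\<bar>) \<le> \<delta>"
    using L1_approximation_polynomial_real[OF C1a \<delta>(1)] by metis
  obtain P0 where P0: "\<And>t::real. (P0 has_real_derivative p t) (at t)"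
    using real_polynomial_antiderivative[OF p(1)] by metis
  define P where "P t = P0 t - P0 0" for t
  have P: "(P has_real_derivative p t) (at t)" for t unfolding P_def using DERIV_diff[OF P0 DERIV_const] by simp
  have contp: "continuous_on S p" for S
    using continuously_differentiable_polynomial[OF p(1), of 0] continuous_on_subset by auto
  have pa: "p absolutely_integrable_on {a..c}" for a c by (rule absolutely_integrable_continuous_real[OF contp])
  have Cp: "(\<lambda>t. \<bar>C1 t - p t\<bar>) integrable_on {a..c}" for a c
    using set_integral_diff(1)[OF C1a pa] by (auto dest!: set_integrable_abs simp: absolutely_integrable_on_def)
  have Pb: "\<bar>P t\<bar> \<le> c1 + 1" if t: "t \<in> {0..T}" for t
  proof -
    have "integral {0..t} p = P t - P 0"
      using t P by (intro integral_unique fundamental_theorem_of_calculus)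
        (auto simp: has_real_derivative_iff_has_vector_derivative[symmetric] intro: has_field_derivative_at_within)
    then have "\<bar>P t\<bar> = norm (integral {0..t} p)" by (simp add: P_def)
    also have "\<dots> \<le> integral {0..t} (\<lambda>t. C1 t + \<bar>C1 t - p t\<bar>)"
    proof (rule integral_norm_bound_integral)
      show "norm (p x) \<le> C1 x + \<bar>C1 x - p x\<bar>" for x using C1_nonneg[of x] by auto
    qed (use pa C1i Cp in \<open>auto simp: absolutely_integrable_on_def intro!: integrable_add\<close>)
    also have "\<dots> \<le> integral {0..T} (\<lambda>t. C1 t + \<bar>C1 t - p t\<bar>)"
      by (rule integral_subset_le) (use t C1i Cp C1_nonneg in \<open>auto intro!: integrable_add add_nonneg_nonneg\<close>)
    also have "\<dots> = c1 + integral {0..T} (\<lambda>t. \<bar>C1 t - p t\<bar>)"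
      unfolding c1_def by (rule Henstock_Kurzweil_Integration.integral_add[OF C1i Cp])
    finally show ?thesis using p(2) \<delta>(2) by linarith
  qed
  \<comment> \<open>A smooth weight with f' = - 2 p f, where \<open>p\<close> stands for
    \<open>C1\<close>. Its decay offsets the growth permitted by the one-sided condition, up to the
    difference C1 - p.\<close>
  define f where "f t = l * exp (- 2 * P t)" for t
  have f: "(f has_real_derivative - 2 * p t * f t) (at t)" for t
    unfolding f_def by (auto intro!: derivative_eq_intros P)
  have contf: "continuous_on UNIV f"
    using f by (auto simp: continuous_on_eq_continuous_at intro: DERIV_isCont)
  have fb: "l * fmin \<le> f t" "f t \<le> l * fmax" if "t \<in> {0..T}" for t
    using Pb[OF that] l(1) by (auto simp: f_def fmin_def fmax_def)
  show ?thesis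
  proof (intro exI[of _ \<delta>] conjI allI impI \<delta>(1))
    fix X X' :: "real \<Rightarrow> 'a"
    assume "(\<forall>t. (X has_vector_derivative X' t) (at t)) \<and> continuous_on UNIV X' \<and> X s = y \<and>
       (\<forall>t\<in>{s..T}. norm (X t) \<le> \<rho>) \<and> integral {s..T} (\<lambda>t. norm (X' t + b t (X t))) \<le> \<delta>"
    then have X: "\<And>t. (X has_vector_derivative X' t) (at t)" and contX': "continuous_on UNIV X'" and Xs: "X s = y"
      and X\<rho>: "\<And>t. t \<in> {s..T} \<Longrightarrow> norm (X t) \<le> \<rho>" and defect: "integral {s..T} (\<lambda>t. norm (X' t + b t (X t))) \<le> \<delta>"
      by auto
    have contX: "continuous_on S X" for S
      using X by (meson continuous_at_imp_continuous_on has_vector_derivative_continuous)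
    define \<psi> where "\<psi> t z = f t * ((z - X t) \<bullet> (z - X t))" for t z
    define \<psi>t where "\<psi>t t z = (- 2 * p t * f t) * ((z - X t) \<bullet> (z - X t)) - 2 * f t * (X' t \<bullet> (z - X t))" for t z
    define D\<psi> where "D\<psi> t z = (2 * f t) *\<^sub>R (z - X t)" for t z
    have C12: "C12 T \<psi> \<psi>t D\<psi>"
      unfolding \<psi>_def \<psi>t_def D\<psi>_def
      by (rule moving_quadratic_C12[OF X contX' f]) (intro continuous_intros contp contf)
    have \<psi>_ge: "l * fmin * (norm (z - X t))\<^sup>2 \<le> \<psi> t z" if "t \<in> {0..T}" for t z
      unfolding \<psi>_def power2_norm_eq_inner[symmetric] by (intro mult_right_mono fb that) simp
    obtain \<rho>0 where \<rho>0: "0 \<le> \<rho>0" "\<And>t. t \<in> {0..T} \<Longrightarrow> norm (X t) \<le> \<rho>0"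
      using compact_continuous_norm_bound[OF contX compact_Icc] by metis
    define a where "a = l * fmin"
    have a: "0 < a" using l f0 by (simp add: a_def)
    have far: "v t z - \<psi> t z \<le> - K" if K: "0 \<le> K" and t: "t \<in> {0..T}" and z: "1 + 2 * \<rho>0 + 4 * (2 * C + K) / a \<le> norm z" for K t z
    proof -
      have q: "0 \<le> 4 * (2 * C + K) / a" using K C a by simp
      have z1: "1 \<le> norm z" "2 * \<rho>0 \<le> norm z" "4 * (2 * C + K) / a \<le> norm z" using z q \<rho>0(1) by auto
      have "norm z / 2 \<le> norm (z - X t)" using z1(2) \<rho>0(2)[OF t] norm_triangle_ineq2[of z "X t"] by linarith
      then have "(norm z / 2)\<^sup>2 \<le> (norm (z - X t))\<^sup>2" by (intro power_mono) auto
      then have "a * (norm z / 2)\<^sup>2 \<le> a * (norm (z - X t))\<^sup>2" using a by (intro mult_left_mono) auto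
      then have "a * (norm z / 2)\<^sup>2 \<le> \<psi> t z" using \<psi>_ge[OF t, of z] by (simp add: a_def)
      moreover have "v t z \<le> 2 * C * norm z"
      proof -
        have "C * (1 + norm z) \<le> C * (2 * norm z)" using z1(1) C by (intro mult_left_mono) auto
        then show ?thesis using growth[OF t, of z] by simp
      qed
      moreover have "2 * C * norm z - a * (norm z / 2)\<^sup>2 \<le> - K"
      proof -
        have "2 * C + K \<le> a * norm z / 4" using z1(3) a by (simp add: field_simps)
        then have "(2 * C + K) * norm z \<le> (a * norm z / 4) * norm z" by (rule mult_right_mono) simp
        moreover have "K * 1 \<le> K * norm z" using z1(1) K by (rule mult_left_mono)
        ultimately show ?thesis by (simp add: power2_eq_square algebra_simps)
      qed
      ultimately show ?thesis by linarith
    qed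
    have coercive: "tends_to_minus_infinity T (\<lambda>t x. v t x - \<psi> t x)"
      unfolding tends_to_minus_infinity_def eventually_at_infinity
    proof (intro allI exI ballI impI)
      fix K :: real and x :: 'a and t assume "1 + 2 * \<rho>0 + 4 * (2 * C + \<bar>K\<bar>) / a \<le> norm x" "t \<in> {0..T}"
      then show "v t x - \<psi> t x \<le> K" using far[of "\<bar>K\<bar>" t x] by auto
    qed
    let ?R = "sub_rhs b v \<psi> \<psi>t D\<psi>"
    define bound where "bound t = l * fmax * (2 * Rk\<^sup>2 * \<bar>C1 t - p t\<bar> + 2 * Rk * norm (X' t + b t (X t)))" for t
    have bound0: "0 \<le> bound t" for t using l f0 Rk by (auto simp: bound_def)
    have R_le: "real_of_ereal (?R t) \<le> bound t" if t: "t \<in> {s..T}" for t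
    proof (cases "\<exists>z. is_arg_max (\<lambda>x. v t x - \<psi> t x) (\<lambda>_. True) z")
      \<comment> \<open>Without a maximizer the infimum over the empty set is infinite, and its
        conversion to a real number is 0 by convention, which still obeys the bound.\<close>
      case False
      then have "?R t = \<infinity>" by (simp add: sub_rhs_def top_ereal_def)
      then show ?thesis using bound0 by simp
    next
      case True
      have t0: "t \<in> {0..T}" using t s by auto
      obtain z where z: "is_arg_max (\<lambda>x. v t x - \<psi> t x) (\<lambda>_. True) z" using True by blast
      define D where "D = z - X t"
      have "v t (X t) - \<psi> t (X t) \<le> v t z - \<psi> t z" using z by (auto simp: is_arg_max_linorder)
      then have "a * (norm D)\<^sup>2 \<le> v t z - v t (X t)" using \<psi>_ge[OF t0, of z] by (simp add: \<psi>_def a_def D_def)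
      also have "\<dots> \<le> C * (1 + norm z) + C * (1 + norm (X t))" using growth[OF t0, of z] growth[OF t0, of "X t"] by linarith
      also have "\<dots> \<le> C * (2 + 2 * \<bar>\<rho>\<bar> + norm D)"
      proof -
        have "norm z \<le> norm D + norm (X t)" unfolding D_def using norm_triangle_ineq[of "z - X t" "X t"] by simp
        then have "C * ((1 + norm z) + (1 + norm (X t))) \<le> C * (2 + 2 * \<bar>\<rho>\<bar> + norm D)" using X\<rho>[OF t] C by (intro mult_left_mono) auto
        then show ?thesis by (simp add: distrib_left)
      qed
      finally have aD: "a * (norm D)\<^sup>2 \<le> C * (2 + 2 * \<bar>\<rho>\<bar> + norm D)" .
      have DR: "norm D \<le> Rk"
      proof (cases "norm D \<le> 1")
        case False
        have "2 + 2 * \<bar>\<rho>\<bar> + norm D \<le> (3 + 2 * \<bar>\<rho>\<bar>) * norm D"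
          using False mult_left_mono[of 1 "norm D" "2 + 2 * \<bar>\<rho>\<bar>"] by (simp add: algebra_simps)
        from mult_left_mono[OF this C] aD have "a * norm D * norm D \<le> C * (3 + 2 * \<bar>\<rho>\<bar>) * norm D"
          by (simp add: power2_eq_square mult.assoc)
        then have "a * norm D \<le> C * (3 + 2 * \<bar>\<rho>\<bar>)" by (rule mult_right_le_imp_le) (use False in linarith)
        then have "norm D \<le> C * (3 + 2 * \<bar>\<rho>\<bar>) / a" using a by (simp add: pos_le_divide_eq mult.commute)
        then show ?thesis by (simp add: Rk_def a_def)
      qed (use Rk in linarith)
      have val: "\<psi>t t z - b t z \<bullet> D\<psi> t z \<le> bound t"
      proof -
        have os: "- C1 t * (norm D)\<^sup>2 \<le> (b t z - b t (X t)) \<bullet> D" unfolding D_def by (rule b_one_sided)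
        have cs: "\<bar>(X' t + b t (X t)) \<bullet> D\<bar> \<le> norm (X' t + b t (X t)) * Rk"
          by (rule order_trans[OF Cauchy_Schwarz_ineq2 mult_left_mono[OF DR]]) simp
        have d2: "(norm D)\<^sup>2 \<le> Rk\<^sup>2" using DR by (intro power_mono) auto
        have cp: "(C1 t - p t) * (norm D)\<^sup>2 \<le> \<bar>C1 t - p t\<bar> * Rk\<^sup>2"
          by (rule order_trans[OF mult_right_mono[OF abs_ge_self] mult_left_mono[OF d2]]) auto
        \<comment> \<open>With D = z - X t, the decay of the weight supplies - p |D|^2, the defect
          enters through its product with D, and the one-sided condition bounds the last term by C1
          |D|^2. What remains is (C1 - p) |D|^2 plus the defect term.\<close>
        have "\<psi>t t z - b t z \<bullet> D\<psi> t z = 2 * f t * (- p t * (norm D)\<^sup>2 - (X' t + b t (X t)) \<bullet> D - (b t z - b t (X t)) \<bullet> D)"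
          by (simp add: \<psi>t_def D\<psi>_def D_def[symmetric] power2_norm_eq_inner inner_add_left inner_diff_left algebra_simps)
        also have "\<dots> \<le> 2 * f t * (\<bar>C1 t - p t\<bar> * Rk\<^sup>2 + norm (X' t + b t (X t)) * Rk)"
        proof (rule mult_left_mono)
          show "- p t * (norm D)\<^sup>2 - (X' t + b t (X t)) \<bullet> D - (b t z - b t (X t)) \<bullet> D \<le> \<bar>C1 t - p t\<bar> * Rk\<^sup>2 + norm (X' t + b t (X t)) * Rk"
            using os cs cp by (simp add: left_diff_distrib)
        qed (use fb[OF t0] a in \<open>simp add: a_def\<close>)
        also have "\<dots> \<le> 2 * (l * fmax) * (\<bar>C1 t - p t\<bar> * Rk\<^sup>2 + norm (X' t + b t (X t)) * Rk)"
          using fb(2)[OF t0] Rk by (intro mult_right_mono) auto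
        also have "\<dots> = bound t" by (simp add: bound_def algebra_simps)
        finally show ?thesis .
      qed
      have "?R t \<le> ereal (\<psi>t t z) - lower_b b t z (D\<psi> t z)"
        unfolding sub_rhs_def by (rule INF_lower) (use z in simp)
      also have "\<dots> \<le> ereal (bound t)" using val by (simp add: lower_b_eq)
      finally have "?R t \<le> ereal (bound t)" .
      then show ?thesis using bound0[of t] by (cases "?R t") auto
    qed
    have bi: "(\<lambda>t. norm (X' t + b t (X t))) integrable_on {s..T}"
      using set_integral_add(1)[OF absolutely_integrable_continuous_real[OF continuous_on_subset[OF contX' subset_UNIV]] b_path_absolutely_integrable[OF contX]]
      by (auto simp: absolutely_integrable_on_def)
    have boundi: "bound integrable_on {s..T}"
      unfolding bound_def by (intro integrable_on_mult_right integrable_add Cp bi)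
    have bound_le: "integral {s..T} bound \<le> e / 2"
    proof -
      have "integral {s..T} bound = l * fmax * (2 * Rk\<^sup>2 * integral {s..T} (\<lambda>t. \<bar>C1 t - p t\<bar>) + 2 * Rk * integral {s..T} (\<lambda>t. norm (X' t + b t (X t))))"
        unfolding bound_def by (simp add: Henstock_Kurzweil_Integration.integral_add integrable_on_mult_right Cp bi)
      also have "\<dots> \<le> l * fmax * (2 * Rk\<^sup>2 * \<delta> + 2 * Rk * \<delta>)"
      proof (intro mult_left_mono add_mono defect)
        have "integral {s..T} (\<lambda>t. \<bar>C1 t - p t\<bar>) \<le> integral {0..T} (\<lambda>t. \<bar>C1 t - p t\<bar>)"
          by (rule integral_subset_le) (use s Cp in auto)
        then show "integral {s..T} (\<lambda>t. \<bar>C1 t - p t\<bar>) \<le> \<delta>" using p(2) by linarith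
      qed (use Rk l f0 in auto)
      also have "\<dots> = W * \<delta>" by (simp add: W_def algebra_simps)
      finally show ?thesis using \<delta>(3) by linarith
    qed
    have visc: "ereal_integrable_on ?R {0..T}"
      "(SUP x. v s x - \<psi> s x) - (SUP x. v T x - \<psi> T x) \<le> (LINT t:{s..T}|lebesgue. real_of_ereal (?R t))"
      using sub C12 coercive s unfolding viscosity_subsolution_def by auto
    have Ri: "(\<lambda>t. real_of_ereal (?R t)) absolutely_integrable_on {s..T}"
      by (rule absolutely_integrable_on_subinterval[where S = "{0..T}"]) (use visc(1) s in \<open>auto simp: ereal_integrable_on_def\<close>)
    have "(LINT t:{s..T}|lebesgue. real_of_ereal (?R t)) = integral {s..T} (\<lambda>t. real_of_ereal (?R t))"
      by (rule set_lebesgue_integral_eq_integral(2)[OF Ri])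
    also have "\<dots> \<le> integral {s..T} bound"
      by (rule integral_le[OF _ boundi R_le]) (use Ri in \<open>simp_all add: absolutely_integrable_on_def\<close>)
    finally have gain: "(SUP x. v s x - \<psi> s x) - (SUP x. v T x - \<psi> T x) \<le> e / 2" using visc(2) bound_le by linarith
    have s0: "s \<in> {0..T}" using s by simp
    have T0: "T \<in> {0..T}" using T by simp
    have "v s y = v s y - \<psi> s y" by (simp add: \<psi>_def Xs)
    also have "\<dots> \<le> (SUP x. v s x - \<psi> s x)"
    proof (rule cSUP_upper)
      define r0 where "r0 = 1 + 2 * \<rho>0 + 4 * (2 * C + 0) / a"
      show "bdd_above (range (\<lambda>x. v s x - \<psi> s x))"
      proof (rule bdd_aboveI2)
        fix x
        show "v s x - \<psi> s x \<le> C * (1 + \<bar>r0\<bar>)"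
        proof (cases "r0 \<le> norm x")
          case True
          then have "v s x - \<psi> s x \<le> - 0" unfolding r0_def by (intro far s0) simp
          moreover have "0 \<le> C * (1 + \<bar>r0\<bar>)" using C by simp
          ultimately show ?thesis by linarith
        next
          case False
          then have "C * (1 + norm x) \<le> C * (1 + \<bar>r0\<bar>)" using C by (intro mult_left_mono) auto
          moreover have "0 \<le> \<psi> s x" using \<psi>_ge[OF s0, of x] a by (smt (verit) a_def mult_nonneg_nonneg zero_le_power2)
          ultimately show ?thesis using growth[OF s0, of x] by linarith
        qed
      qed
    qed simp
    also have "\<dots> \<le> (SUP x. v T x - \<psi> T x) + e / 2" using gain by linarith
    also have "(SUP x. v T x - \<psi> T x) \<le> v T (X T) + e / 2"
    proof (rule cSUP_least)
      fix z
      have "v T z - v T (X T) \<le> B * norm (z - X T) powr \<beta>" using terminal[of z "X T"] by linarith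
      moreover have "B * norm (z - X T) powr \<beta> - (l * fmin) * (norm (z - X T))\<^sup>2 \<le> B * \<eta> powr \<beta>"
        by (rule holder_quadratic_bound) (use B \<eta> l in auto)
      ultimately show "v T z - \<psi> T z \<le> v T (X T) + e / 2" using \<psi>_ge[OF T0, of z] \<eta>(2) by linarith
    qed simp
    finally show "v s y \<le> v T (X T) + e" by simp
  qed
qed

end

subsection \<open>Borel modifications\<close>

lemma AE_lborel_null_set:
  assumes "AE x in lborel. P x"
  obtains N where "N \<in> null_sets lborel" "\<And>x. x \<notin> N \<Longrightarrow> P x"
proof -
  obtain N where N: "{x \<in> space lborel. \<not> P x} \<subseteq> N" "N \<in> null_sets lborel"
    using assms unfolding eventually_ae_filter by blast
  show ?thesis by (rule that[OF N(2)]) (use N(1) in auto)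
qed

lemma borel_modification_real:
  fixes C :: "real \<Rightarrow> real"
  assumes "C \<in> borel_measurable (lebesgue_on {0..T})"
  obtains N where "N \<in> null_sets lborel" "(\<lambda>t. if t \<in> {0..T} - N then C t else 0) \<in> borel_measurable borel"
proof -
  have "(\<lambda>t. if t \<in> {0..T} then C t else 0) \<in> borel_measurable (completion lborel)"
    by (rule borel_measurable_if_I[OF assms]) simp
  then obtain g where g: "g \<in> borel_measurable lborel" "AE t in lborel. (if t \<in> {0..T} then C t else 0) = g t"
    using completion_ex_borel_measurable_real by blast
  obtain N where N: "N \<in> null_sets lborel" "\<And>t. t \<notin> N \<Longrightarrow> (if t \<in> {0..T} then C t else 0) = g t"
    using AE_lborel_null_set[OF g(2)] by metis
  have [measurable]: "g \<in> borel_measurable borel" "N \<in> sets borel" using g(1) N(1) by auto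
  have "(\<lambda>t. if t \<in> {0..T} - N then C t else 0) = (\<lambda>t. if t \<in> {0..T} - N then g t else 0)"
  proof
    fix t show "(if t \<in> {0..T} - N then C t else 0) = (if t \<in> {0..T} - N then g t else 0)"
      using N(2)[of t] by auto
  qed
  also have "\<dots> \<in> borel_measurable borel" by measurable
  finally show ?thesis by (rule that[OF N(1)])
qed

text \<open>The point x is replaced by the first member of a dense sequence within distance 1/(n +
  1) of it. This index depends measurably on x and takes countably many values, so the approximants
  are measurable; continuity in x gives convergence.\<close>

lemma borel_measurable_caratheodory:
  fixes f :: "real \<Rightarrow> 'a::euclidean_space \<Rightarrow> 'b::euclidean_space"
  assumes cont: "\<And>t. continuous_on UNIV (f t)" and D: "countable D" "closure D = UNIV"
    and meas: "\<And>q. q \<in> D \<Longrightarrow> (\<lambda>t. f t q) \<in> borel_measurable borel"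
  shows "(\<lambda>z. f (fst z) (snd z)) \<in> borel_measurable borel"
proof -
  have "D \<noteq> {}" using D(2) by auto
  define d where "d = from_nat_into D"
  have d: "d k \<in> D" for k unfolding d_def by (rule from_nat_into[OF \<open>D \<noteq> {}\<close>])
  have dense: "\<exists>k. dist (d k) x < e" if e: "0 < e" for x e
  proof -
    obtain q where "q \<in> D" "dist q x < e" using D(2) e closure_approachable[of x D] by auto
    then show ?thesis unfolding d_def using from_nat_into_surj[OF D(1)] by metis
  qed
  define k where "k n x = (LEAST k. dist (d k) x < inverse (real (Suc n)))" for n x
  have kd: "dist (d (k n x)) x < inverse (real (Suc n))" for n x
    unfolding k_def by (rule LeastI_ex) (rule dense, simp)
  have mk: "k n \<in> measurable borel (count_space UNIV)" for n
    unfolding k_def by measurable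
  show ?thesis
  proof (rule borel_measurable_LIMSEQ_metric)
    show "(\<lambda>z. f (fst z) (d (k n (snd z)))) \<in> borel_measurable borel" for n
    proof (rule measurable_compose_countable[where f = "\<lambda>i z. f (fst z) (d i)" and g = "\<lambda>z. k n (snd z)"])
      have fst: "fst \<in> borel_measurable (borel :: (real \<times> 'a) measure)" and snd: "snd \<in> borel_measurable (borel :: (real \<times> 'a) measure)"
        by (auto intro!: borel_measurable_continuous_onI continuous_intros)
      show "(\<lambda>z::real \<times> 'a. f (fst z) (d i)) \<in> borel_measurable borel" for i
        by (rule measurable_compose[OF fst meas[OF d]])
      show "(\<lambda>z::real \<times> 'a. k n (snd z)) \<in> measurable borel (count_space UNIV)"
        by (rule measurable_compose[OF snd mk])
    qed
    fix z :: "real \<times> 'a"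
    have "(\<lambda>n. dist (d (k n (snd z))) (snd z)) \<longlonglongrightarrow> 0"
      by (rule tendsto_sandwich[OF _ _ tendsto_const LIMSEQ_inverse_real_of_nat])
         (simp_all add: less_imp_le[OF kd] del: of_nat_Suc)
    then have "(\<lambda>n. d (k n (snd z))) \<longlonglongrightarrow> snd z" by (rule tendsto_dist_iff[THEN iffD2])
    moreover have "isCont (f (fst z)) (snd z)" using cont by (simp add: continuous_on_eq_continuous_at)
    ultimately show "(\<lambda>n. f (fst z) (d (k n (snd z)))) \<longlonglongrightarrow> f (fst z) (snd z)"
      by (rule isCont_tendsto_compose[rotated])
  qed
qed

text \<open>Almost every x has the property that b(., x) agrees with a Borel function at almost
  every time. Countably many such x are dense, their exceptional times form one null set, and
  continuity in x carries measurability to the whole field. The claim covers every larger null set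
  so that further exceptional times can be removed later.\<close>

lemma borel_modification_field:
  fixes b :: "real \<Rightarrow> 'a::euclidean_space \<Rightarrow> 'a"
  assumes meas: "(\<lambda>(t, x). b t x) \<in> borel_measurable (lebesgue_on ({0..T} \<times> UNIV))"
    and cont: "\<And>t. t \<in> {0..T} \<Longrightarrow> continuous_on UNIV (b t)"
  obtains N where "N \<in> null_sets lborel"
    "\<And>N'. N \<subseteq> N' \<Longrightarrow> N' \<in> null_sets lborel \<Longrightarrow> (\<lambda>z. if fst z \<in> {0..T} - N' then b (fst z) (snd z) else 0) \<in> borel_measurable borel"
proof -
  have S: "{0..T} \<times> (UNIV :: 'a set) \<in> sets lebesgue"
    by (intro sets_completionI_sets) (auto intro!: borel_closed closed_Times)
  define F where "F z = (if z \<in> {0..T} \<times> UNIV then b (fst z) (snd z) else 0)" for z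
  have F: "F \<in> borel_measurable lebesgue"
    using borel_measurable_if_I[OF meas S, unfolded case_prod_unfold] by (simp only: F_def[abs_def])
  have "\<exists>g. g \<in> borel_measurable lborel \<and> (AE z in lborel. F z \<bullet> i = g z)" for i
  proof -
    have "(\<lambda>z. F z \<bullet> i) \<in> borel_measurable (completion lborel)"
      using F by (intro borel_measurable_inner) auto
    then show ?thesis using completion_ex_borel_measurable_real by blast
  qed
  then obtain g where g: "\<And>i. g i \<in> borel_measurable lborel" "\<And>i. AE z in lborel. F z \<bullet> i = g i z" by metis
  \<comment> \<open>The order matters: x is fixed before the times are discarded, which is why the
    two almost everywhere quantifiers are exchanged.\<close>
  have "AE x in lborel. AE t in lborel. F (t, x) \<bullet> i = g i (t, x)" for i
  proof -
    obtain N where N: "N \<in> null_sets lborel" "\<And>z. z \<notin> N \<Longrightarrow> F z \<bullet> i = g i z"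
      using AE_lborel_null_set[OF g(2)[of i]] by metis
    have sN: "N \<in> sets (lborel \<Otimes>\<^sub>M lborel)" unfolding lborel_prod using N(1) by auto
    have "AE z in lborel \<Otimes>\<^sub>M lborel. z \<notin> N"
      unfolding lborel_prod by (rule AE_not_in[OF N(1)])
    then have "AE t in lborel. AE x in lborel. (t, x) \<notin> N" by (rule lborel_pair.AE_pair)
    moreover have "{x \<in> space (lborel \<Otimes>\<^sub>M lborel). (fst x, snd x) \<notin> N} \<in> sets (lborel \<Otimes>\<^sub>M lborel)"
    proof -
      have "{x \<in> space (lborel \<Otimes>\<^sub>M lborel). (fst x, snd x) \<notin> N} = space (lborel \<Otimes>\<^sub>M lborel) - N" by auto
      also have "\<dots> \<in> sets (lborel \<Otimes>\<^sub>M lborel)" by (rule sets.compl_sets[OF sN])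
      finally show ?thesis .
    qed
    ultimately have "AE x in lborel. AE t in lborel. (t, x) \<notin> N"
      by (subst (asm) lborel_pair.AE_commute)
    then show ?thesis
    proof eventually_elim
      case (elim x)
      then show ?case by eventually_elim (use N(2) in auto)
    qed
  qed
  then have "AE x in lborel. \<forall>i\<in>Basis. AE t in lborel. F (t, x) \<bullet> i = g i (t, x)"
    by (intro AE_finite_allI) auto
  then obtain E where E: "E \<in> null_sets lborel" "\<And>x. x \<notin> E \<Longrightarrow> \<forall>i\<in>Basis. AE t in lborel. F (t, x) \<bullet> i = g i (t, x)"
    by (rule AE_lborel_null_set) (rule that)
  \<comment> \<open>A null set contains no nonempty open set, so the good points x are
    dense.\<close>
  have "closure (- E) = UNIV"
  proof -
    have "negligible E" using E(1) by (simp add: negligible_iff_null_sets null_sets_completionI)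
    then have "interior E = {}" using open_not_negligible[of "interior E"] negligible_subset[OF _ interior_subset] by auto
    then show ?thesis by (simp add: closure_complement)
  qed
  moreover obtain D where D: "countable D" "D \<subseteq> - E" "- E \<subseteq> closure D" using separable[of "- E"] by metis
  ultimately have Dd: "closure D = UNIV" by (metis closure_closure closure_mono top.extremum_uniqueI)
  have "\<exists>N. N \<in> null_sets lborel \<and> (\<forall>t. t \<notin> N \<longrightarrow> (\<forall>i\<in>Basis. F (t, q) \<bullet> i = g i (t, q)))" if "q \<in> D" for q
  proof -
    have "\<forall>i\<in>Basis. AE t in lborel. F (t, q) \<bullet> i = g i (t, q)" using E(2) D(2) that by blast
    then have "AE t in lborel. \<forall>i\<in>Basis. F (t, q) \<bullet> i = g i (t, q)" by (intro AE_finite_allI) auto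
    from AE_lborel_null_set[OF this] show ?thesis by metis
  qed
  then obtain Nq where Nq: "\<And>q. q \<in> D \<Longrightarrow> Nq q \<in> null_sets lborel"
      "\<And>q t i. q \<in> D \<Longrightarrow> t \<notin> Nq q \<Longrightarrow> i \<in> Basis \<Longrightarrow> F (t, q) \<bullet> i = g i (t, q)" by metis
  show ?thesis
  proof (rule that[of "\<Union>q\<in>D. Nq q"])
    show "(\<Union>q\<in>D. Nq q) \<in> null_sets lborel" by (rule null_sets_UN'[OF D(1) Nq(1)])
    fix N' assume N': "(\<Union>q\<in>D. Nq q) \<subseteq> N'" "N' \<in> null_sets lborel"
    have [measurable]: "N' \<in> sets borel" using N'(2) by auto
    show "(\<lambda>z. if fst z \<in> {0..T} - N' then b (fst z) (snd z) else 0) \<in> borel_measurable borel"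
    proof (rule borel_measurable_caratheodory[where f = "\<lambda>t x. if t \<in> {0..T} - N' then b t x else 0", OF _ D(1) Dd])
      show "continuous_on UNIV (\<lambda>x. if t \<in> {0..T} - N' then b t x else 0)" for t
        using cont[of t] by (cases "t \<in> {0..T} - N'") auto
      fix q assume q: "q \<in> D"
      show "(\<lambda>t. if t \<in> {0..T} - N' then b t q else 0) \<in> borel_measurable borel"
      proof (rule borel_measurable_euclidean_space[THEN iffD2], intro ballI)
        fix i :: 'a assume i: "i \<in> Basis"
        have "(if t \<in> {0..T} - N' then b t q else 0) \<bullet> i = (if t \<in> {0..T} - N' then g i (t, q) else 0)" for t
        proof -
          have "t \<notin> N' \<Longrightarrow> t \<notin> Nq q" using N'(1) q by blast
          then show ?thesis using Nq(2)[OF q _ i, of t] by (auto simp: F_def)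
        qed
        moreover have "(\<lambda>t. g i (t, q)) \<in> borel_measurable borel"
        proof (rule measurable_compose[of "\<lambda>t. (t, q)" borel borel])
          show "(\<lambda>t. (t, q)) \<in> borel_measurable borel" by (intro borel_measurable_continuous_onI continuous_intros)
        qed (use g(1) in simp)
        then have "(\<lambda>t. if t \<in> {0..T} - N' then g i (t, q) else 0) \<in> borel_measurable borel" by measurable
        ultimately show "(\<lambda>t. (if t \<in> {0..T} - N' then b t q else 0) \<bullet> i) \<in> borel_measurable borel" by simp
      qed
    qed
  qed
qed

lemma integrable_borel_modification:
  fixes C :: "real \<Rightarrow> real"
  assumes C: "C absolutely_integrable_on {0..T}" and N: "N \<in> null_sets lborel"
    and m: "(\<lambda>t. if t \<in> {0..T} - N then C t else 0) \<in> borel_measurable borel"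
  shows "integrable lborel (\<lambda>t. if t \<in> {0..T} - N then C t else 0)"
proof -
  have neg: "negligible N" using N by (simp add: negligible_iff_null_sets null_sets_completionI)
  have "(\<lambda>t. if t \<in> {0..T} - N then C t else 0) absolutely_integrable_on {0..T}"
    by (rule absolutely_integrable_spike[OF C neg]) auto
  then have "integrable lebesgue (\<lambda>t. indicator {0..T} t *\<^sub>R (if t \<in> {0..T} - N then C t else 0))"
    by (simp add: set_integrable_def)
  also have "(\<lambda>t. indicator {0..T} t *\<^sub>R (if t \<in> {0..T} - N then C t else 0)) = (\<lambda>t. if t \<in> {0..T} - N then C t else 0)"
    by (auto simp: fun_eq_iff)
  finally show ?thesis using m by (subst (asm) integrable_completion) auto
qed

lemma test_function_GDERIV:
  fixes \<phi> :: "real \<times> 'a::euclidean_space \<Rightarrow> real"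
  assumes "test_function T \<phi>"
  shows "continuous_on UNIV \<phi>" "continuous_on UNIV (\<lambda>z. fst (grad \<phi> z))" "continuous_on UNIV (\<lambda>z. snd (grad \<phi> z))"
proof -
  have cd: "continuously_differentiable k \<phi>" for k using assms by (simp add: test_function_def)
  define D where "D z = (\<Sum>i\<in>Basis. frechet_derivative \<phi> (at z) i *\<^sub>R i)" for z
  have "GDERIV \<phi> z :> D z" for z
    unfolding gderiv_def
  proof (rule has_derivative_eq_rhs[OF continuously_differentiable_SucE(1)[OF cd[of "Suc 0"]]])
    have lin: "linear (frechet_derivative \<phi> (at z))"
      using continuously_differentiable_SucE(1)[OF cd[of "Suc 0"]] has_derivative_linear by blast
    show "frechet_derivative \<phi> (at z) = (\<lambda>h. h \<bullet> D z)"
    proof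
      fix h
      have "frechet_derivative \<phi> (at z) h = frechet_derivative \<phi> (at z) (\<Sum>i\<in>Basis. (h \<bullet> i) *\<^sub>R i)"
        by (simp only: euclidean_representation)
      also have "\<dots> = (\<Sum>i\<in>Basis. (h \<bullet> i) * frechet_derivative \<phi> (at z) i)"
        using lin by (simp only: linear_sum linear_cmul real_scaleR_def)
      also have "\<dots> = h \<bullet> D z" unfolding D_def by (simp only: inner_sum_right inner_scaleR_right mult.commute)
      finally show "frechet_derivative \<phi> (at z) h = h \<bullet> D z" .
    qed
  qed
  then have g: "grad \<phi> = D" using grad_eqI by blast
  have "continuous_on UNIV (\<lambda>z. frechet_derivative \<phi> (at z) i)" if "i \<in> Basis" for i
    using continuously_differentiable_SucE(2)[OF cd[of "Suc 0"] that] by simp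
  then have "continuous_on UNIV D" unfolding D_def by (intro continuous_intros)
  then show "continuous_on UNIV (\<lambda>z. fst (grad \<phi> z))" "continuous_on UNIV (\<lambda>z. snd (grad \<phi> z))"
    unfolding g by (intro continuous_intros; assumption)+
  show "continuous_on UNIV \<phi>" using cd[of 0] by simp
qed

lemma null_set_times_UNIV:
  assumes "N \<in> null_sets lborel"
  shows "AE z in (lborel :: (real \<times> 'a::euclidean_space) measure). fst z \<notin> N"
proof -
  have "N \<times> UNIV \<in> null_sets (lborel \<Otimes>\<^sub>M (lborel :: 'a measure))"
  proof (rule null_setsI)
    have N: "N \<in> sets lborel" "emeasure lborel N = 0" using assms by auto
    then show "N \<times> UNIV \<in> sets (lborel \<Otimes>\<^sub>M (lborel :: 'a measure))" by auto
    show "emeasure (lborel \<Otimes>\<^sub>M (lborel :: 'a measure)) (N \<times> UNIV) = 0"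
      using N by (subst lborel.emeasure_pair_measure_Times) auto
  qed
  then have "AE z in (lborel \<Otimes>\<^sub>M (lborel :: 'a measure)). z \<notin> N \<times> UNIV" by (rule AE_not_in)
  then have "AE z in (lborel :: (real \<times> 'a) measure). z \<notin> N \<times> UNIV" by (simp only: lborel_prod)
  then show ?thesis by eventually_elim auto
qed

lemma integral_modified_field:
  fixes b b' :: "real \<Rightarrow> 'a::euclidean_space \<Rightarrow> 'a"
  assumes b: "(\<lambda>(t, x). b t x) \<in> borel_measurable (lebesgue_on ({0..T} \<times> UNIV))"
    and b': "(\<lambda>z. b' (fst z) (snd z)) \<in> borel_measurable borel"
    and N: "N \<in> null_sets lborel" and eq: "\<And>t. t \<in> {0..T} - N \<Longrightarrow> b' t = b t"
    and k: "k \<in> borel_measurable borel" and w: "w \<in> borel_measurable borel"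
  shows "(LINT z:{0<..<T} \<times> UNIV|lebesgue. k z * (b (fst z) (snd z) \<bullet> w z)) = (LINT z:{0<..<T} \<times> UNIV|lebesgue. k z * (b' (fst z) (snd z) \<bullet> w z))"
proof -
  have S: "{0..T} \<times> (UNIV :: 'a set) \<in> sets lebesgue" by (intro sets_completionI_sets) (auto intro!: borel_closed closed_Times)
  have S': "{0<..<T} \<times> (UNIV :: 'a set) \<in> sets lebesgue" by (intro sets_completionI_sets) (auto intro!: borel_open open_Times)
  define F where "F z = (if z \<in> {0..T} \<times> UNIV then b (fst z) (snd z) else 0)" for z
  have F: "F \<in> borel_measurable lebesgue"
    using borel_measurable_if_I[OF b S, unfolded case_prod_unfold] by (simp only: F_def[abs_def])
  have km: "k \<in> borel_measurable lebesgue" "w \<in> borel_measurable lebesgue" "(\<lambda>z. b' (fst z) (snd z)) \<in> borel_measurable lebesgue"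
    using k w b' by (auto intro: measurable_completion)
  have "(LINT z:{0<..<T} \<times> UNIV|lebesgue. k z * (b (fst z) (snd z) \<bullet> w z)) = (LINT z:{0<..<T} \<times> UNIV|lebesgue. k z * (F z \<bullet> w z))"
    by (rule set_lebesgue_integral_cong[OF S']) (auto simp: F_def)
  also have "\<dots> = (LINT z:{0<..<T} \<times> UNIV|lebesgue. k z * (b' (fst z) (snd z) \<bullet> w z))"
  proof (rule set_lebesgue_integral_cong_AE[OF S'])
    show "(\<lambda>z. k z * (F z \<bullet> w z)) \<in> borel_measurable lebesgue" using km F by (intro borel_measurable_times borel_measurable_inner)
    show "(\<lambda>z. k z * (b' (fst z) (snd z) \<bullet> w z)) \<in> borel_measurable lebesgue" using km by (intro borel_measurable_times borel_measurable_inner)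
    have "AE z in lebesgue. fst z \<notin> N" using null_set_times_UNIV[OF N] by (rule AE_completion)
    then show "AE z\<in>{0<..<T} \<times> UNIV in lebesgue. k z * (F z \<bullet> w z) = k z * (b' (fst z) (snd z) \<bullet> w z)"
      by eventually_elim (use eq in \<open>auto simp: F_def\<close>)
  qed
  finally show ?thesis .
qed

section \<open>Insensitivity to null sets of times\<close>

lemma usc_on_cong: "(\<And>z. z \<in> S \<Longrightarrow> f z = g z) \<Longrightarrow> usc_on S f \<longleftrightarrow> usc_on S g"
proof -
  assume eq: "\<And>z. z \<in> S \<Longrightarrow> f z = g z"
  have "(\<forall>\<^sub>F w in at z within S. f w < c) \<longleftrightarrow> (\<forall>\<^sub>F w in at z within S. g w < c)" for z c
    by (rule eventually_subst) (simp add: eventually_at_filter eq)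
  then show "usc_on S f \<longleftrightarrow> usc_on S g" by (simp add: usc_on_def eq)
qed

text \<open>The right-hand side at time t depends on the field and the function at that time only.
  Changing the field at a null set of times therefore leaves all the integrals unchanged.\<close>

lemma viscosity_subsolution_cong:
  fixes v w :: "real \<Rightarrow> 'a::euclidean_space \<Rightarrow> real"
  assumes sub: "viscosity_subsolution T b v" and N: "N \<in> null_sets lborel"
    and b: "\<And>t. t \<in> {0..T} - N \<Longrightarrow> b' t = b t" and w: "\<And>t. t \<in> {0..T} \<Longrightarrow> w t = v t"
  shows "viscosity_subsolution T b' w"
  unfolding viscosity_subsolution_def
proof (intro conjI allI impI)
  have neg: "negligible N" using N by (simp add: negligible_iff_null_sets null_sets_completionI)
  show "usc_on ({0..T} \<times> UNIV) (\<lambda>(t, x). w t x)"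
    using sub usc_on_cong[of "{0..T} \<times> UNIV" "\<lambda>(t, x). w t x" "\<lambda>(t, x). v t x"] w
    by (auto simp: viscosity_subsolution_def)
  fix \<psi> \<psi>t D\<psi>
  assume C: "C12 T \<psi> \<psi>t D\<psi> \<and> tends_to_minus_infinity T (\<lambda>t x. w t x - \<psi> t x)"
  have "tends_to_minus_infinity T (\<lambda>t x. v t x - \<psi> t x)"
    using C w unfolding tends_to_minus_infinity_def by simp
  then have v: "ereal_integrable_on (sub_rhs b v \<psi> \<psi>t D\<psi>) {0..T}"
    "\<And>t1 t2. 0 \<le> t1 \<and> t1 < t2 \<and> t2 \<le> T \<Longrightarrow> (SUP x. v t1 x - \<psi> t1 x) - (SUP x. v t2 x - \<psi> t2 x)
           \<le> (LINT t:{t1..t2}|lebesgue. real_of_ereal (sub_rhs b v \<psi> \<psi>t D\<psi> t))"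
    using sub C unfolding viscosity_subsolution_def by blast+
  have eq: "sub_rhs b' w \<psi> \<psi>t D\<psi> t = sub_rhs b v \<psi> \<psi>t D\<psi> t" if "t \<in> {0..T} - N" for t
    using b[OF that] w[of t] that by (simp add: sub_rhs_def lower_b_def)
  have int: "(\<lambda>t. real_of_ereal (sub_rhs b v \<psi> \<psi>t D\<psi> t)) absolutely_integrable_on {0..T}"
    using v(1) by (simp add: ereal_integrable_on_def)
  have int': "(\<lambda>t. real_of_ereal (sub_rhs b' w \<psi> \<psi>t D\<psi> t)) absolutely_integrable_on {0..T}"
    by (rule absolutely_integrable_spike[OF int neg]) (simp add: eq)
  have "AE t in lebesgue_on {0..T}. \<bar>sub_rhs b' w \<psi> \<psi>t D\<psi> t\<bar> \<noteq> \<infinity>"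
  proof -
    have "AE t in lebesgue. t \<notin> N" by (rule AE_completion[OF AE_not_in[OF N]])
    then have "AE t in lebesgue_on {0..T}. t \<notin> N" by (subst AE_restrict_space_iff) auto
    moreover have "AE t in lebesgue_on {0..T}. \<bar>sub_rhs b v \<psi> \<psi>t D\<psi> t\<bar> \<noteq> \<infinity>" using v(1) by (simp add: ereal_integrable_on_def)
    moreover have "AE t in lebesgue_on {0..T}. t \<in> {0..T}" by (rule AE_I2) simp
    ultimately show ?thesis by eventually_elim (simp add: eq)
  qed
  with int' show "ereal_integrable_on (sub_rhs b' w \<psi> \<psi>t D\<psi>) {0..T}" by (simp add: ereal_integrable_on_def)
  fix t1 t2 assume t: "0 \<le> t1 \<and> t1 < t2 \<and> t2 \<le> T"
  have sub2: "{t1..t2} \<subseteq> {0..T}" using t by auto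
  have "(LINT t:{t1..t2}|lebesgue. real_of_ereal (sub_rhs b' w \<psi> \<psi>t D\<psi> t)) = integral {t1..t2} (\<lambda>t. real_of_ereal (sub_rhs b' w \<psi> \<psi>t D\<psi> t))"
    by (rule set_lebesgue_integral_eq_integral(2)[OF absolutely_integrable_on_subinterval[OF int' sub2]])
  also have "\<dots> = integral {t1..t2} (\<lambda>t. real_of_ereal (sub_rhs b v \<psi> \<psi>t D\<psi> t))"
    by (rule integral_spike[OF neg]) (use sub2 eq in auto)
  also have "\<dots> = (LINT t:{t1..t2}|lebesgue. real_of_ereal (sub_rhs b v \<psi> \<psi>t D\<psi> t))"
    by (rule set_lebesgue_integral_eq_integral(2)[OF absolutely_integrable_on_subinterval[OF int sub2], symmetric])
  finally show "(SUP x. w t1 x - \<psi> t1 x) - (SUP x. w t2 x - \<psi> t2 x) \<le> (LINT t:{t1..t2}|lebesgue. real_of_ereal (sub_rhs b' w \<psi> \<psi>t D\<psi> t))"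
    using v(2)[OF t] w[of t1] w[of t2] t by simp
qed

lemma holder_seminorm_bound:
  fixes f :: "real \<Rightarrow> 'a::real_normed_vector \<Rightarrow> 'b::real_normed_vector"
  assumes "(SUP t\<in>{0..T}. holder_seminorm \<gamma> (f t)) < \<infinity>"
  obtains H where "0 \<le> H" "\<And>t x y. t \<in> {0..T} \<Longrightarrow> norm (f t x - f t y) \<le> H * norm (x - y) powr \<gamma>"
proof -
  define S where "S = (SUP t\<in>{0..T}. holder_seminorm \<gamma> (f t))"
  show ?thesis
  proof (rule that[of "max 0 (real_of_ereal S)"])
    fix t x y assume t: "t \<in> {0..T}"
    show "norm (f t x - f t y) \<le> max 0 (real_of_ereal S) * norm (x - y) powr \<gamma>"
    proof (cases "x = y")
      case False
      have "ereal (norm (f t x - f t y) / norm (x - y) powr \<gamma>) \<le> holder_seminorm \<gamma> (f t)"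
        unfolding holder_seminorm_def by (rule SUP_upper2[of "(x, y)"]) (use False in auto)
      also have "\<dots> \<le> S" unfolding S_def by (rule SUP_upper[OF t])
      finally have "norm (f t x - f t y) / norm (x - y) powr \<gamma> \<le> real_of_ereal S"
        using assms unfolding S_def[symmetric] by (cases S) auto
      then have "norm (f t x - f t y) / norm (x - y) powr \<gamma> \<le> max 0 (real_of_ereal S)" by simp
      then show ?thesis using False by (simp add: pos_divide_le_eq)
    qed simp
  qed simp
qed

section \<open>Solution property and uniqueness for Borel data\<close>

context regular_transport
begin

lemma viscosity_subsolutions: "viscosity_subsolution T b u" "viscosity_subsolution T b (\<lambda>t x. - u t x)"
proof -
  have c: "continuous_on ({0..T} \<times> UNIV) (\<lambda>(t, x). u t x)" "continuous_on ({0..T} \<times> UNIV) (\<lambda>(t, x). - u t x)"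
    using continuous_on_subset[OF u_continuous] by (auto simp: case_prod_unfold intro!: continuous_intros)
  show "viscosity_subsolution T b u" by (rule viscosity_subsolutionI[OF T_pos c(1) characteristic_step])
  show "viscosity_subsolution T b (\<lambda>t x. - u t x)"
    by (rule viscosity_subsolutionI[OF T_pos c(2)]) (use characteristic_step in simp)
qed

text \<open>The upper bounds for \<open>v\<close> and for its negative show that v(s, y) is close to
  v(T, X T) along an approximate characteristic from (s, y). There u(s, y) is close to u(T, X T),
  directly by near constancy, and the terminal values agree.\<close>

lemma viscosity_solution_unique:
  assumes v: "viscosity_subsolution T b v" "viscosity_subsolution T b (\<lambda>t x. - v t x)"
    and growth: "\<forall>t\<in>{0..T}. \<forall>x. \<bar>v t x\<bar> \<le> C * (1 + norm x)" and C: "0 \<le> C" and \<beta>: "\<beta> \<le> 2"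
    and terminal: "\<And>x. v T x = u T x" and s: "s \<in> {0..T}"
  shows "v s y = u s y"
proof (cases "s = T")
  case False
  then have s0: "0 \<le> s" "s < T" "s \<le> T" using s by auto
  have holder: "\<bar>v T x - v T z\<bar> \<le> B * norm (x - z) powr \<beta>" "\<bar>- v T x - - v T z\<bar> \<le> B * norm (x - z) powr \<beta>" for x z
    using u_holder[of T x z] T_pos by (auto simp: terminal)
  have growth': "\<forall>t\<in>{0..T}. \<forall>x. \<bar>- v t x\<bar> \<le> C * (1 + norm x)" using growth by simp
  have "\<bar>v s y - u s y\<bar> \<le> 0 + e" if e: "0 < e" for e
  proof -
    define \<rho> where "\<rho> = (1 + norm y) * exp (integral {0..T} C0) + 1"
    have e2: "0 < e / 2" using e by simp
    obtain \<delta>1 where \<delta>1: "0 < \<delta>1" "\<And>X X'. (\<forall>t. (X has_vector_derivative X' t) (at t)) \<and> continuous_on UNIV X' \<and> X s = y \<and>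
       (\<forall>t\<in>{s..T}. norm (X t) \<le> \<rho>) \<and> integral {s..T} (\<lambda>t. norm (X' t + b t (X t))) \<le> \<delta>1 \<Longrightarrow> v s y \<le> v T (X T) + e / 2"
      using subsolution_upper_bound[OF T_pos v(1) growth C holder(1) B_nonneg \<beta>_pos \<beta> s0(1,2) e2, of y \<rho>] by blast
    obtain \<delta>2 where \<delta>2: "0 < \<delta>2" "\<And>X X'. (\<forall>t. (X has_vector_derivative X' t) (at t)) \<and> continuous_on UNIV X' \<and> X s = y \<and>
       (\<forall>t\<in>{s..T}. norm (X t) \<le> \<rho>) \<and> integral {s..T} (\<lambda>t. norm (X' t + b t (X t))) \<le> \<delta>2 \<Longrightarrow> - v s y \<le> - v T (X T) + e / 2"
      using subsolution_upper_bound[OF T_pos v(2) growth' C holder(2) B_nonneg \<beta>_pos \<beta> s0(1,2) e2, of y \<rho>] by blast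
    obtain \<delta>3 where \<delta>3: "0 < \<delta>3" "\<And>X X' s t. polynomial_function X \<Longrightarrow> (\<And>t. (X has_vector_derivative X' t) (at t)) \<Longrightarrow> continuous_on UNIV X' \<Longrightarrow>
        0 \<le> s \<Longrightarrow> integral {s..T} (\<lambda>t. norm (X' t + b t (X t))) \<le> \<delta>3 \<Longrightarrow> t \<in> {s..T} \<Longrightarrow> \<bar>u s (X s) - u t (X t)\<bar> \<le> e / 2"
      by (rule u_almost_constant[OF e2]) (rule that; blast)
    \<comment> \<open>One defect bound admissible for all three estimates, so that a single curve
      can be used; \<delta> \<le> 1 keeps this curve within the radius \<rho> fixed
      beforehand.\<close>
    define \<delta> where "\<delta> = min (min \<delta>1 \<delta>2) (min \<delta>3 1)"
    have \<delta>: "0 < \<delta>" "\<delta> \<le> \<delta>1" "\<delta> \<le> \<delta>2" "\<delta> \<le> \<delta>3" "\<delta> \<le> 1" using \<delta>1(1) \<delta>2(1) \<delta>3(1) by (auto simp: \<delta>_def)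
    obtain X X' where X: "polynomial_function X" "\<And>t. (X has_vector_derivative X' t) (at t)" "continuous_on UNIV X'" "X s = y"
      and E: "integral {s..T} (\<lambda>t. norm (X' t + b t (X t))) \<le> \<delta>"
      and Xb: "\<And>t. t \<in> {s..T} \<Longrightarrow> 1 + norm (X t) \<le> (1 + norm y) * exp (integral {s..t} C0) + \<delta>"
      using approximate_characteristic_ex[OF s0(3) \<delta>(1), of y] by blast
    have X\<rho>: "norm (X t) \<le> \<rho>" if "t \<in> {s..T}" for t
    proof -
      have "(1 + norm y) * exp (integral {s..t} C0) \<le> (1 + norm y) * exp (integral {0..T} C0)"
        using C0_integral_mono[of 0 s t T] s0 that by (intro mult_left_mono) auto
      then show ?thesis using Xb[OF that] \<delta>(5) by (simp add: \<rho>_def)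
    qed
    have "v s y \<le> v T (X T) + e / 2" by (rule \<delta>1(2)[of X X']) (use X X\<rho> E \<delta> in auto)
    moreover have "- v s y \<le> - v T (X T) + e / 2" by (rule \<delta>2(2)[of X X']) (use X X\<rho> E \<delta> in auto)
    moreover have "\<bar>u s (X s) - u T (X T)\<bar> \<le> e / 2" by (rule \<delta>3(2)[OF X(1-3) s0(1)]) (use E \<delta> s0 in auto)
    moreover have "u s (X s) = u s y" "v T (X T) = u T (X T)" by (simp_all add: X(4) terminal)
    ultimately show ?thesis by linarith
  qed
  then have "\<bar>v s y - u s y\<bar> \<le> 0" by (rule field_le_epsilon)
  then show ?thesis by simp
qed (simp add: terminal)

end

section \<open>Passage between the given data and Borel data\<close>

theorem theorem3p7:
  fixes T \<alpha> \<beta> :: real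
    and b :: "real \<Rightarrow> 'a::euclidean_space \<Rightarrow> 'a"
    and C0 C1 :: "real \<Rightarrow> real"
    and u :: "real \<Rightarrow> 'a \<Rightarrow> real"
    and uT :: "'a \<Rightarrow> real"
  assumes "T > 0"
    and "(\<lambda>(t, x). b t x) \<in> borel_measurable (lebesgue_on ({0..T} \<times> UNIV))"
    and "C0 absolutely_integrable_on {0..T}" and "\<And>t. t \<in> {0..T} \<Longrightarrow> 0 \<le> C0 t"
    and "C1 absolutely_integrable_on {0..T}" and "\<And>t. t \<in> {0..T} \<Longrightarrow> 0 \<le> C1 t"
    and "\<And>t x. t \<in> {0..T} \<Longrightarrow> norm (b t x) \<le> C0 t * (1 + norm x)"
    and "\<And>t x y. t \<in> {0..T} \<Longrightarrow> (b t x - b t y) \<bullet> (x - y) \<ge> - C1 t * (norm (x - y))\<^sup>2"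
    and "\<alpha> \<in> {0<..1}" and "\<beta> \<in> {0<..1}" and "\<alpha> + \<beta> > 1"
    and "(SUP t\<in>{0..T}. holder_seminorm \<alpha> (b t)) < \<infinity>"
    and "distributional_solution T b u"
    and "\<And>x. u T x = uT x"
    and "(SUP t\<in>{0..T}. holder_seminorm \<beta> (u t)) < \<infinity>"
  shows "viscosity_solution T b u \<and> linear_growth T u \<and>
    (\<forall>v. viscosity_solution T b v \<and> linear_growth T v \<and> (\<forall>x. v T x = uT x) \<longrightarrow>
       (\<forall>t\<in>{0..T}. \<forall>x. v t x = u t x))"
proof -
  obtain H where H: "0 \<le> H" "\<And>t x y. t \<in> {0..T} \<Longrightarrow> norm (b t x - b t y) \<le> H * norm (x - y) powr \<alpha>"
    using holder_seminorm_bound[OF assms(12)] by blast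
  obtain B where B: "0 \<le> B" "\<And>t x y. t \<in> {0..T} \<Longrightarrow> norm (u t x - u t y) \<le> B * norm (x - y) powr \<beta>"
    using holder_seminorm_bound[OF assms(15)] by blast
  have contb: "continuous_on UNIV (b t)" if t: "t \<in> {0..T}" for t
    unfolding continuous_on_iff
  proof (intro ballI allI impI)
    fix x e assume e: "0 < (e::real)"
    have \<alpha>: "0 < \<alpha>" and e2: "0 < e / 2" using assms(9) e by auto
    obtain d where d: "0 < d" "\<And>r. 0 \<le> r \<Longrightarrow> r \<le> d \<Longrightarrow> H * r powr \<alpha> \<le> e / 2"
      using powr_small[OF H(1) \<alpha> e2] by metis
    have "dist (b t y) (b t x) < e" if "dist y x < d" for y
      using H(2)[OF t, of y x] d(2)[of "norm (y - x)"] that e by (simp add: dist_norm)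
    then show "\<exists>d>0. \<forall>y\<in>UNIV. dist y x < d \<longrightarrow> dist (b t y) (b t x) < e" using d(1) by blast
  qed
  obtain N1 where N1: "N1 \<in> null_sets lborel"
    "\<And>N'. N1 \<subseteq> N' \<Longrightarrow> N' \<in> null_sets lborel \<Longrightarrow> (\<lambda>z. if fst z \<in> {0..T} - N' then b (fst z) (snd z) else 0) \<in> borel_measurable borel"
    using borel_modification_field[OF assms(2) contb] by blast
  have lm: "C \<in> borel_measurable (lebesgue_on {0..T})" if "C absolutely_integrable_on {0..T}" for C :: "real \<Rightarrow> real"
    by (rule absolutely_integrable_imp_borel_measurable[OF that]) simp
  obtain N2 where N2: "N2 \<in> null_sets lborel" "(\<lambda>t. if t \<in> {0..T} - N2 then C0 t else 0) \<in> borel_measurable borel"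
    using borel_modification_real[OF lm[OF assms(3)]] .
  obtain N3 where N3: "N3 \<in> null_sets lborel" "(\<lambda>t. if t \<in> {0..T} - N3 then C1 t else 0) \<in> borel_measurable borel"
    using borel_modification_real[OF lm[OF assms(5)]] .
  \<comment> \<open>One null set has to serve the field and both majorants at once; the field admits
    any null set containing \<open>N1\<close>, and the lemma \<open>larger\<close> below does the
    same for the majorants.\<close>
  define N where "N = N1 \<union> N2 \<union> N3"
  have N: "N \<in> null_sets lborel" unfolding N_def by (intro null_sets.Un N1 N2 N3)
  have larger: "(\<lambda>t. if t \<in> {0..T} - N then C t else 0) \<in> borel_measurable borel"
    if "M \<subseteq> N" "(\<lambda>t. if t \<in> {0..T} - M then C t else 0) \<in> borel_measurable borel" for M and C :: "real \<Rightarrow> real"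
  proof -
    have [measurable]: "N \<in> sets borel" using N by auto
    note [measurable] = that(2)
    have "(\<lambda>t. if t \<in> {0..T} - N then C t else 0) = (\<lambda>t. if t \<in> N then 0 else (if t \<in> {0..T} - M then C t else 0))"
      using that(1) by (auto simp: fun_eq_iff)
    also have "\<dots> \<in> borel_measurable borel" by measurable
    finally show ?thesis .
  qed
  define b' where "b' t x = (if t \<in> {0..T} - N then b t x else 0)" for t x
  define D0 where "D0 t = (if t \<in> {0..T} - N then C0 t else 0)" for t
  define D1 where "D1 t = (if t \<in> {0..T} - N then C1 t else 0)" for t
  have b'_borel: "(\<lambda>z. b' (fst z) (snd z)) \<in> borel_measurable borel"
    unfolding b'_def by (rule N1(2)[OF _ N]) (auto simp: N_def)
  have D0: "integrable lborel D0"
    unfolding D0_def by (rule integrable_borel_modification[OF assms(3) N larger[OF _ N2(2)]]) (auto simp: N_def)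
  have D1: "integrable lborel D1"
    unfolding D1_def by (rule integrable_borel_modification[OF assms(5) N larger[OF _ N3(2)]]) (auto simp: N_def)
  have eqb: "b' t = b t" "b t = b' t" if "t \<in> {0..T} - N" for t using that by (auto simp: b'_def)
  obtain \<mu> \<nu> where contu: "continuous_on ({0..T} \<times> UNIV) (\<lambda>(t, x). u t x)"
    and div: "has_divergence_measure T b \<mu> \<nu>"
    and eqn: "\<And>\<phi>. test_function T \<phi> \<Longrightarrow>
          (LINT z:{0<..<T} \<times> UNIV|lebesgue. u (fst z) (snd z) * fst (grad \<phi> z))
          - (LINT z:{0<..<T} \<times> UNIV|lebesgue. u (fst z) (snd z) * (b (fst z) (snd z) \<bullet> snd (grad \<phi> z)))
          - ((LINT z:{0<..<T} \<times> UNIV|\<mu>. u (fst z) (snd z) * \<phi> z) - (LINT z:{0<..<T} \<times> UNIV|\<nu>. u (fst z) (snd z) * \<phi> z)) = 0"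
    using assms(13) unfolding distributional_solution_def by blast
  define u' where "u' t x = u (max 0 (min T t)) x" for t x
  have u': "u' t = u t" "u t = u' t" if "t \<in> {0..T}" for t using that by (auto simp: u'_def fun_eq_iff)
  have contu': "continuous_on UNIV (\<lambda>z. u' (fst z) (snd z))"
  proof -
    have c1: "continuous_on UNIV (\<lambda>z::real \<times> 'a. (max 0 (min T (fst z)), snd z))" by (intro continuous_intros)
    have c2: "(\<lambda>z::real \<times> 'a. (max 0 (min T (fst z)), snd z)) ` UNIV \<subseteq> {0..T} \<times> UNIV" using assms(1) by auto
    show ?thesis using continuous_on_compose2[OF contu c1 c2] by (simp add: u'_def)
  qed
  have S: "{0<..<T} \<times> (UNIV :: 'a set) \<in> sets borel" by (intro borel_open open_Times) auto
  have \<mu>\<nu>: "sets \<mu> = sets borel" "sets \<nu> = sets borel" using div unfolding has_divergence_measure_def by blast+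
  have subst_u: "(LINT z:{0<..<T} \<times> UNIV|M. u' (fst z) (snd z) * k z) = (LINT z:{0<..<T} \<times> UNIV|M. u (fst z) (snd z) * k z)"
    if "{0<..<T} \<times> (UNIV :: 'a set) \<in> sets M" for M and k :: "real \<times> 'a \<Rightarrow> real"
    by (rule set_lebesgue_integral_cong[OF that]) (auto simp: u'(1))
  have modify: "(LINT z:{0<..<T} \<times> UNIV|lebesgue. k z * (b (fst z) (snd z) \<bullet> snd (grad \<phi> z)))
      = (LINT z:{0<..<T} \<times> UNIV|lebesgue. k z * (b' (fst z) (snd z) \<bullet> snd (grad \<phi> z)))"
    if "continuous_on UNIV k" "test_function T \<phi>" for k and \<phi> :: "real \<times> 'a \<Rightarrow> real"
    by (rule integral_modified_field[OF assms(2) b'_borel N eqb(1)])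
       (use that test_function_GDERIV(3)[OF that(2)] in \<open>auto intro: borel_measurable_continuous_onI\<close>)
  \<comment> \<open>The divergence measure sees the field only through space-time integrals, to
    which a null set of times contributes nothing; the same pair of measures remains valid.\<close>
  have div': "has_divergence_measure T b' \<mu> \<nu>"
    using div modify[of "\<lambda>_. 1"] unfolding has_divergence_measure_def by simp
  interpret regular_transport b' D0 D1 H \<alpha> T u' \<mu> \<nu> B \<beta>
  proof unfold_locales
    show "(\<lambda>z. b' (fst z) (snd z)) \<in> borel_measurable borel" by (rule b'_borel)
    show "norm (b' t x - b' t y) \<le> H * norm (x - y) powr \<alpha>" for t x y
      using H(2)[of t x y] H(1) by (auto simp: b'_def)
    show "norm (b' t x) \<le> D0 t * (1 + norm x)" for t x using assms(7)[of t x] by (auto simp: b'_def D0_def)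
    show "- D1 t * (norm (x - y))\<^sup>2 \<le> (b' t x - b' t y) \<bullet> (x - y)" for t x y
      using assms(8)[of t x y] by (auto simp: b'_def D1_def)
    show "\<bar>u' t x - u' t y\<bar> \<le> B * norm (x - y) powr \<beta>" if "t \<in> {0..T}" for t x y
      using B(2)[OF that, of x y] by (simp add: u'(1)[OF that])
    fix \<phi> :: "real \<times> 'a \<Rightarrow> real" assume \<phi>: "test_function T \<phi>"
    have SL: "{0<..<T} \<times> (UNIV :: 'a set) \<in> sets lebesgue" using S by (intro sets_completionI_sets) simp
    have "(LINT z:{0<..<T} \<times> UNIV|lebesgue. u (fst z) (snd z) * (b (fst z) (snd z) \<bullet> snd (grad \<phi> z)))
      = (LINT z:{0<..<T} \<times> UNIV|lebesgue. u' (fst z) (snd z) * (b' (fst z) (snd z) \<bullet> snd (grad \<phi> z)))"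
      unfolding modify[OF contu' \<phi>, symmetric] by (rule subst_u[OF SL, symmetric])
    then show "(LINT z:{0<..<T} \<times> UNIV|lebesgue. u' (fst z) (snd z) * fst (grad \<phi> z))
          - (LINT z:{0<..<T} \<times> UNIV|lebesgue. u' (fst z) (snd z) * (b' (fst z) (snd z) \<bullet> snd (grad \<phi> z)))
          - ((LINT z:{0<..<T} \<times> UNIV|\<mu>. u' (fst z) (snd z) * \<phi> z) - (LINT z:{0<..<T} \<times> UNIV|\<nu>. u' (fst z) (snd z) * \<phi> z)) = 0"
      using eqn[OF \<phi>] subst_u[OF SL] subst_u[of \<mu>] subst_u[of \<nu>] S \<mu>\<nu> by simp
  qed (use assms(1,4,6,9,10,11) H(1) B(1) D0 D1 contu' div' in \<open>auto simp: D0_def D1_def\<close>)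
  have sub_u: "viscosity_subsolution T b u"
    by (rule viscosity_subsolution_cong[OF viscosity_subsolutions(1) N eqb(2) u'(2)])
  have sub_minus_u: "viscosity_subsolution T b (\<lambda>t x. - u t x)"
    by (rule viscosity_subsolution_cong[OF viscosity_subsolutions(2) N eqb(2)]) (simp_all add: u'(2))
  have visc: "viscosity_solution T b u"
    using contu sub_u sub_minus_u by (simp add: viscosity_solution_def viscosity_supersolution_iff_uminus)
  have growth: "linear_growth T u"
  proof -
    have "continuous_on {0..T} (\<lambda>t. (t, 0::'a))" by (intro continuous_intros)
    then have "continuous_on {0..T} (\<lambda>t. u t 0)"
      using continuous_on_compose2[OF contu, of "{0..T}" "\<lambda>t. (t, 0)"] by auto
    then obtain c where c: "0 \<le> c" "\<And>t. t \<in> {0..T} \<Longrightarrow> norm (u t 0) \<le> c"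
      using compact_continuous_norm_bound[OF _ compact_Icc] by metis
    have "\<bar>u t x\<bar> \<le> (c + B) * (1 + norm x)" if t: "t \<in> {0..T}" for t x
    proof -
      \<comment> \<open>Since \<beta> \<le> 1, the Hoelder bound from the origin grows at most
        linearly.\<close>
      have "norm x powr \<beta> \<le> (1 + norm x) powr \<beta>" using assms(10) by (intro powr_mono2) auto
      also have "\<dots> \<le> (1 + norm x) powr 1" using assms(10) by (intro powr_mono) auto
      finally have "B * norm x powr \<beta> \<le> B * (1 + norm x)" using B(1) by (intro mult_left_mono) auto
      moreover have "c * 1 \<le> c * (1 + norm x)" using c(1) by (intro mult_left_mono) auto
      ultimately show ?thesis using B(2)[OF t, of x 0] c(2)[OF t] by (simp add: distrib_right)
    qed
    then show ?thesis unfolding linear_growth_def by blast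
  qed
  have unique: "v t x = u t x"
    if v: "viscosity_solution T b v" "linear_growth T v" "\<forall>x. v T x = uT x" and t: "t \<in> {0..T}" for v t x
  proof -
    obtain C where C: "\<forall>t\<in>{0..T}. \<forall>x. \<bar>v t x\<bar> \<le> C * (1 + norm x)" using v(2) unfolding linear_growth_def by blast
    \<comment> \<open>At the origin the growth bound forces its constant to be nonnegative.\<close>
    have "\<bar>v T 0\<bar> \<le> C * (1 + norm (0::'a))" using C[rule_format, of T "0::'a"] assms(1) by simp
    then have C0: "0 \<le> C" by simp
    have sub_v: "viscosity_subsolution T b v" "viscosity_subsolution T b (\<lambda>t x. - v t x)"
      using v(1) by (simp_all add: viscosity_solution_def viscosity_supersolution_iff_uminus)
    have "v t x = u' t x"
    proof (rule viscosity_solution_unique[OF _ _ C C0 _ _ t])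
      show "viscosity_subsolution T b' v" by (rule viscosity_subsolution_cong[OF sub_v(1) N eqb(1) refl])
      show "viscosity_subsolution T b' (\<lambda>t x. - v t x)" by (rule viscosity_subsolution_cong[OF sub_v(2) N eqb(1) refl])
      show "\<beta> \<le> 2" using assms(10) by simp
      show "v T x = u' T x" for x using v(3) assms(1,14) by (simp add: u'(1))
    qed
    then show ?thesis using u'(1)[OF t] by simp
  qed
  show ?thesis using visc growth unique by blast
qed

end
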